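(* Let $X$ be an affine Krull scheme, $K$ an abelian group. A $K$-graded sheaf $\mathcal{R}$ on $X$ is a Cox sheaf if and only if it is the sheaf $\mathcal{R}=\widetilde{R}$ associated to a $K$-graded $\mathcal{O}(X)$-algebra $R$ such that: (i) $R$ is $K$-factorial (in particular, $R$ is a $K$-Krull ring) and $R^{+,*}=R_0^*$; (ii) $R_0=\mathcal{O}(X)$, $Q^+(R)_0=Q(R_0)$ and $\deg_K(Q^+(R)^+)=K$; (iii) the essential $K$-valuations of $R$ restrict bijectively on $Q(R_0)$ to the essential valuations of $R_0$.
   Context: Graded rings. Rings are commutative with $1$. For a $K$-graded ring $R$, $R^+$ is the set of non-zero homogeneous elements, $R^{+,*}$ the group of homogeneous units, $R_0^*$ the units of $R_0$. $R\neq0$ is $K$-integral if it has no homogeneous zero divisors, $K$-simple if all elements of $R^+$ are units, $K$-factorial if it is $K$-integral and the monoid $R^+$ is factorial. $Q^+(R)$ is the localization of a $K$-integral $R$ by $R^+$; $Q(\cdot)$ is the usual fraction field. A graded ideal $\mathfrak{p}\neq R$ is $K$-prime if $fg\in\mathfrak{p}$, $f,g$ homogeneous, implies $f\in\mathfrak{p}$ or $g\in\mathfrak{p}$; $R_{\mathfrak{p}}:=(R^+\setminus\mathfrak{p})^{-1}R$. A discrete $K$-valuation on a $K$-simple ring $S$ is a surjective homomorphism $\nu:S^+\to\mathbb{Z}$ with $\nu(a+b)\ge\min\{\nu(a),\nu(b)\}$ for non-zero $a,b$ of the same degree with $a+b\ne0$; its valuation ring is the subring generated by $\nu^{-1}(\mathbb{Z}_{\geq0})$.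 A $K$-Krull ring is an intersection of discrete $K$-valuation rings of a $K$-simple ring such that each non-zero homogeneous element of the intersection has non-zero value for only finitely many of them. The essential $K$-valuations of a $K$-Krull ring $R$ are the discrete $K$-valuations $\nu_{\mathfrak{p}}$ on $Q^+(R)$ with valuation ring $R_{\mathfrak{p}}$, where $\mathfrak{p}$ runs through the minimal non-zero $K$-prime ideals. The case $K=0$ gives Krull rings and their essential valuations. An affine Krull scheme is the spectrum of a Krull ring. $\mathcal{K}$ is the constant sheaf of rational functions; prime divisors $Y$ are points with one-codimensional closure, with discrete valuations $\nu_Y$ of valuation ring $\mathcal{O}_{X,Y}$; $\mathrm{WDiv}(U)=\bigoplus_{Y\in U}\mathbb{Z}Y$, $\mathrm{div}_U(f)=\sum_{Y\in U}\nu_Y(f)Y$, $\mathrm{Cl}(X)=\mathrm{WDiv}(X)/\mathrm{div}_X(\mathcal{K}(X)^* )$. A $K$-graded sheaf is a sheaf of $K$-graded rings with degree-preserving restrictions. Cox sheaves. $\mathcal{O}_X(\mathrm{WDiv}(X))=\bigoplus_{D\in\mathrm{WDiv}(X)}\mathcal{O}_X(D)\chi^D$, where $\mathcal{O}_X(D)(U)=\{f\in\mathcal{K}(U);f=0\text{ or }\mathrm{div}_U(f)+D_{|U}\ge0\}$. A Cox sheaf on $X$ is a $\mathrm{Cl}(X)$-graded sheaf of rings $\mathcal{R}$ admitting a morphism of graded sheaves of rings $\pi:\mathcal{O}_X(\mathrm{WDiv}(X))\to\mathcal{R}$, accompanied by the canonical map $\mathrm{WDiv}(X)\to\mathrm{Cl}(X)$,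 which restricts to isomorphisms $\mathcal{O}_X(D)\chi^D\to\mathcal{R}_{[D]}$ for all $D\in\mathrm{WDiv}(X)$. Here a $K$-graded sheaf is called a Cox sheaf if it is isomorphic to one as a graded sheaf of rings, with an accompanying isomorphism $K\cong\mathrm{Cl}(X)$. *)

theory Defs
  imports "HOL-Algebra.Divisibility" "HOL-Algebra.Free_Abelian_Groups" "HOL-Algebra.Generated_Rings"
    "HOL-Analysis.Abstract_Topology" "HOL-Library.Extended_Nat"
begin

text \<open>
  Grading groups are abelian groups in the sense of HOL-Algebra and hence written multiplicatively.
  A \<open>K\<close>-grading of a ring \<open>R\<close> is the family \<open>G\<close> of its homogeneous components.
\<close>

section \<open>Graded rings\<close>

definition graded_ring ::
  "('k, 'n) monoid_scheme \<Rightarrow> ('r, 'm) ring_scheme \<Rightarrow> ('k \<Rightarrow> 'r set) \<Rightarrow> bool" where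
  "graded_ring K R G \<longleftrightarrow>
     comm_group K \<and> cring R \<and>
     (\<forall>w\<in>carrier K. additive_subgroup (G w) R) \<and>
     (\<forall>v\<in>carrier K. \<forall>w\<in>carrier K. \<forall>a\<in>G v. \<forall>b\<in>G w. a \<otimes>\<^bsub>R\<^esub> b \<in> G (v \<otimes>\<^bsub>K\<^esub> w)) \<and>
     (\<forall>x\<in>carrier R. \<exists>!c. c \<in> (\<Pi>\<^sub>E w\<in>carrier K. G w) \<and>
        finite {w \<in> carrier K. c w \<noteq> \<zero>\<^bsub>R\<^esub>} \<and>
        x = (\<Oplus>\<^bsub>R\<^esub> w\<in>{w \<in> carrier K. c w \<noteq> \<zero>\<^bsub>R\<^esub>}. c w))"

text \<open>The set of non-zero homogeneous elements.\<close>

definition homog :: "('k, 'n) monoid_scheme \<Rightarrow> ('r, 'm) ring_scheme \<Rightarrow> ('k \<Rightarrow> 'r set) \<Rightarrow> 'r set" where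
  "homog K R G = (\<Union>w\<in>carrier K. G w) - {\<zero>\<^bsub>R\<^esub>}"

definition degrees :: "('k, 'n) monoid_scheme \<Rightarrow> ('r, 'm) ring_scheme \<Rightarrow> ('k \<Rightarrow> 'r set) \<Rightarrow> 'k set" where
  "degrees K R G = {w \<in> carrier K. \<exists>x\<in>homog K R G. x \<in> G w}"

definition homog_units ::
  "('k, 'n) monoid_scheme \<Rightarrow> ('r, 'm) ring_scheme \<Rightarrow> ('k \<Rightarrow> 'r set) \<Rightarrow> 'r set" where
  "homog_units K R G = homog K R G \<inter> Units R"

definition degree_zero_ring ::
  "('k, 'n) monoid_scheme \<Rightarrow> ('r, 'm) ring_scheme \<Rightarrow> ('k \<Rightarrow> 'r set) \<Rightarrow> ('r, 'm) ring_scheme" where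
  "degree_zero_ring K R G = R\<lparr>carrier := G \<one>\<^bsub>K\<^esub>\<rparr>"

definition graded_integral ::
  "('k, 'n) monoid_scheme \<Rightarrow> ('r, 'm) ring_scheme \<Rightarrow> ('k \<Rightarrow> 'r set) \<Rightarrow> bool" where
  "graded_integral K R G \<longleftrightarrow> graded_ring K R G \<and> \<one>\<^bsub>R\<^esub> \<noteq> \<zero>\<^bsub>R\<^esub> \<and>
     (\<forall>a\<in>homog K R G. \<forall>b\<in>carrier R. a \<otimes>\<^bsub>R\<^esub> b = \<zero>\<^bsub>R\<^esub> \<longrightarrow> b = \<zero>\<^bsub>R\<^esub>)"

definition graded_simple ::
  "('k, 'n) monoid_scheme \<Rightarrow> ('r, 'm) ring_scheme \<Rightarrow> ('k \<Rightarrow> 'r set) \<Rightarrow> bool" where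
  "graded_simple K R G \<longleftrightarrow> graded_ring K R G \<and> \<one>\<^bsub>R\<^esub> \<noteq> \<zero>\<^bsub>R\<^esub> \<and> homog K R G \<subseteq> Units R"

definition graded_factorial ::
  "('k, 'n) monoid_scheme \<Rightarrow> ('r, 'm) ring_scheme \<Rightarrow> ('k \<Rightarrow> 'r set) \<Rightarrow> bool" where
  "graded_factorial K R G \<longleftrightarrow>
     graded_integral K R G \<and> factorial_monoid (R\<lparr>carrier := homog K R G\<rparr>)"

text \<open>A graded ideal is an ideal that is generated by homogeneous elements.\<close>

definition graded_prime ::
  "('k, 'n) monoid_scheme \<Rightarrow> ('r, 'm) ring_scheme \<Rightarrow> ('k \<Rightarrow> 'r set) \<Rightarrow> 'r set \<Rightarrow> bool" where
  "graded_prime K R G p \<longleftrightarrow>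
     ideal p R \<and> p = Idl\<^bsub>R\<^esub> (p \<inter> homog K R G) \<and> p \<noteq> carrier R \<and>
     (\<forall>f\<in>homog K R G. \<forall>g\<in>homog K R G. f \<otimes>\<^bsub>R\<^esub> g \<in> p \<longrightarrow> f \<in> p \<or> g \<in> p)"

definition minimal_graded_prime ::
  "('k, 'n) monoid_scheme \<Rightarrow> ('r, 'm) ring_scheme \<Rightarrow> ('k \<Rightarrow> 'r set) \<Rightarrow> 'r set \<Rightarrow> bool" where
  "minimal_graded_prime K R G p \<longleftrightarrow>
     graded_prime K R G p \<and> p \<noteq> {\<zero>\<^bsub>R\<^esub>} \<and>
     (\<forall>q. graded_prime K R G q \<and> q \<noteq> {\<zero>\<^bsub>R\<^esub>} \<and> q \<subseteq> p \<longrightarrow> q = p)"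


section \<open>Localizations\<close>

text \<open>The fraction \<open>a/s\<close>, as an equivalence class of pairs.\<close>

definition fraction :: "('r, 'm) ring_scheme \<Rightarrow> 'r set \<Rightarrow> 'r \<Rightarrow> 'r \<Rightarrow> ('r \<times> 'r) set" where
  "fraction R S a s = {(b, t). b \<in> carrier R \<and> t \<in> S \<and>
     (\<exists>u\<in>S. u \<otimes>\<^bsub>R\<^esub> (a \<otimes>\<^bsub>R\<^esub> t) = u \<otimes>\<^bsub>R\<^esub> (b \<otimes>\<^bsub>R\<^esub> s))}"

definition localization :: "('r, 'm) ring_scheme \<Rightarrow> 'r set \<Rightarrow> ('r \<times> 'r) set ring" where
  "localization R S =
     \<lparr>carrier = {fraction R S a s | a s. a \<in> carrier R \<and> s \<in> S},
      monoid.mult = (\<lambda>x y. \<Union>(a, s)\<in>x. \<Union>(b, t)\<in>y. fraction R S (a \<otimes>\<^bsub>R\<^esub> b) (s \<otimes>\<^bsub>R\<^esub> t)),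
      monoid.one = fraction R S \<one>\<^bsub>R\<^esub> \<one>\<^bsub>R\<^esub>,
      ring.zero = fraction R S \<zero>\<^bsub>R\<^esub> \<one>\<^bsub>R\<^esub>,
      ring.add = (\<lambda>x y. \<Union>(a, s)\<in>x. \<Union>(b, t)\<in>y.
               fraction R S ((a \<otimes>\<^bsub>R\<^esub> t) \<oplus>\<^bsub>R\<^esub> (b \<otimes>\<^bsub>R\<^esub> s)) (s \<otimes>\<^bsub>R\<^esub> t))\<rparr>"

text \<open>The graded fraction ring \<open>Q\<^sup>+(R)\<close> and its homogeneous components.\<close>

definition frac_ring ::
  "('k, 'n) monoid_scheme \<Rightarrow> ('r, 'm) ring_scheme \<Rightarrow> ('k \<Rightarrow> 'r set) \<Rightarrow> ('r \<times> 'r) set ring" where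
  "frac_ring K R G = localization R (homog K R G)"

definition frac_grading ::
  "('k, 'n) monoid_scheme \<Rightarrow> ('r, 'm) ring_scheme \<Rightarrow> ('k \<Rightarrow> 'r set) \<Rightarrow> 'k \<Rightarrow> ('r \<times> 'r) set set" where
  "frac_grading K R G w =
     {fraction R (homog K R G) a s | a s. s \<in> homog K R G \<and>
        (\<exists>u\<in>carrier K. s \<in> G u \<and> a \<in> G (w \<otimes>\<^bsub>K\<^esub> u))}"

text \<open>
  For a graded prime \<open>p\<close> of a graded integral ring, the localization \<open>R\<^sub>p\<close> at the non-zero
  homogeneous elements outside \<open>p\<close>, regarded as a subring of \<open>Q\<^sup>+(R)\<close>.
\<close>

definition graded_local ::
  "('k, 'n) monoid_scheme \<Rightarrow> ('r, 'm) ring_scheme \<Rightarrow> ('k \<Rightarrow> 'r set) \<Rightarrow> 'r set \<Rightarrow> ('r \<times> 'r) set set" where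
  "graded_local K R G p =
     {fraction R (homog K R G) a s | a s. a \<in> carrier R \<and> s \<in> homog K R G - p}"


section \<open>Discrete graded valuations and graded Krull rings\<close>

text \<open>Valuations are extensional functions, so that they are determined by their values on
  non-zero homogeneous elements.\<close>

definition discrete_valuation ::
  "('k, 'n) monoid_scheme \<Rightarrow> ('r, 'm) ring_scheme \<Rightarrow> ('k \<Rightarrow> 'r set) \<Rightarrow> ('r \<Rightarrow> int) \<Rightarrow> bool" where
  "discrete_valuation K S H \<nu> \<longleftrightarrow>
     \<nu> \<in> extensional (homog K S H) \<and>
     \<nu> ` homog K S H = UNIV \<and>
     (\<forall>a\<in>homog K S H. \<forall>b\<in>homog K S H. \<nu> (a \<otimes>\<^bsub>S\<^esub> b) = \<nu> a + \<nu> b) \<and>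
     (\<forall>w\<in>carrier K. \<forall>a\<in>H w - {\<zero>\<^bsub>S\<^esub>}. \<forall>b\<in>H w - {\<zero>\<^bsub>S\<^esub>}.
        a \<oplus>\<^bsub>S\<^esub> b \<noteq> \<zero>\<^bsub>S\<^esub> \<longrightarrow> min (\<nu> a) (\<nu> b) \<le> \<nu> (a \<oplus>\<^bsub>S\<^esub> b))"

definition valuation_ring ::
  "('k, 'n) monoid_scheme \<Rightarrow> ('r, 'm) ring_scheme \<Rightarrow> ('k \<Rightarrow> 'r set) \<Rightarrow> ('r \<Rightarrow> int) \<Rightarrow> 'r set" where
  "valuation_ring K S H \<nu> = generate_ring S {x \<in> homog K S H. 0 \<le> \<nu> x}"

text \<open>
  The ambient graded simple ring \<open>S\<close> lives on the type of fractions of \<open>R\<close>. This is no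
  restriction: given any ambient graded simple ring, restricting the valuations to the copy of
  \<open>Q\<^sup>+(R)\<close> inside it, dropping the trivial ones and rescaling the others, exhibits \<open>R\<close> as an
  intersection of discrete valuation rings of \<open>Q\<^sup>+(R)\<close>.
\<close>

definition graded_Krull ::
  "('k, 'n) monoid_scheme \<Rightarrow> ('r, 'm) ring_scheme \<Rightarrow> ('k \<Rightarrow> 'r set) \<Rightarrow> bool" where
  "graded_Krull K R G \<longleftrightarrow> graded_ring K R G \<and>
     (\<exists>(S :: ('r \<times> 'r) set ring) H V i.
        graded_simple K S H \<and> (\<forall>\<nu>\<in>V. discrete_valuation K S H \<nu>) \<and>
        i \<in> ring_hom R S \<and> inj_on i (carrier R) \<and> (\<forall>w\<in>carrier K. i ` G w \<subseteq> H w) \<and>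
        i ` carrier R = {x \<in> carrier S. \<forall>\<nu>\<in>V. x \<in> valuation_ring K S H \<nu>} \<and>
        (\<forall>x \<in> i ` carrier R \<inter> homog K S H. finite {\<nu> \<in> V. \<nu> x \<noteq> 0}))"

definition valuation_at ::
  "('k, 'n) monoid_scheme \<Rightarrow> ('r, 'm) ring_scheme \<Rightarrow> ('k \<Rightarrow> 'r set) \<Rightarrow> 'r set \<Rightarrow>
     (('r \<times> 'r) set \<Rightarrow> int) \<Rightarrow> bool" where
  "valuation_at K R G p \<nu> \<longleftrightarrow>
     discrete_valuation K (frac_ring K R G) (frac_grading K R G) \<nu> \<and>
     valuation_ring K (frac_ring K R G) (frac_grading K R G) \<nu> = graded_local K R G p"

definition essential_valuations ::
  "('k, 'n) monoid_scheme \<Rightarrow> ('r, 'm) ring_scheme \<Rightarrow> ('k \<Rightarrow> 'r set) \<Rightarrow> (('r \<times> 'r) set \<Rightarrow> int) set" where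
  "essential_valuations K R G = {\<nu>. \<exists>p. minimal_graded_prime K R G p \<and> valuation_at K R G p \<nu>}"

text \<open>Ungraded notions are the graded ones for the trivial grading group.\<close>

abbreviation zero_group :: "unit monoid" where
  "zero_group \<equiv> singleton_group ()"

definition trivial_grading :: "('r, 'm) ring_scheme \<Rightarrow> unit \<Rightarrow> 'r set" where
  "trivial_grading R = (\<lambda>_. carrier R)"

abbreviation Krull_ring :: "('r, 'm) ring_scheme \<Rightarrow> bool" where
  "Krull_ring A \<equiv> graded_Krull zero_group A (trivial_grading A)"

abbreviation fraction_field :: "('r, 'm) ring_scheme \<Rightarrow> ('r \<times> 'r) set ring" where
  "fraction_field A \<equiv> frac_ring zero_group A (trivial_grading A)"

text \<open>The canonical map \<open>Q(R\<^sub>0) \<rightarrow> Q\<^sup>+(R)\<close>, \<open>a/s \<mapsto> a/s\<close>.\<close>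

definition degree_zero_frac ::
  "('k, 'n) monoid_scheme \<Rightarrow> ('r, 'm) ring_scheme \<Rightarrow> ('k \<Rightarrow> 'r set) \<Rightarrow> ('r \<times> 'r) set \<Rightarrow> ('r \<times> 'r) set" where
  "degree_zero_frac K R G x = (\<Union>(a, s)\<in>x. fraction R (homog K R G) a s)"

text \<open>Restriction of a valuation on \<open>Q\<^sup>+(R)\<close> to the non-zero elements of \<open>Q(R\<^sub>0)\<close>.\<close>

definition restrict_valuation ::
  "('k, 'n) monoid_scheme \<Rightarrow> ('r, 'm) ring_scheme \<Rightarrow> ('k \<Rightarrow> 'r set) \<Rightarrow>
     (('r \<times> 'r) set \<Rightarrow> int) \<Rightarrow> ('r \<times> 'r) set \<Rightarrow> int" where
  "restrict_valuation K R G \<nu> =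
     (\<lambda>x \<in> carrier (fraction_field (degree_zero_ring K R G))
             - {\<zero>\<^bsub>fraction_field (degree_zero_ring K R G)\<^esub>}.
        \<nu> (degree_zero_frac K R G x))"


section \<open>Sheaves of graded rings\<close>

record ('p, 's, 'k) graded_presheaf =
  sec :: "'p set \<Rightarrow> 's ring"
  res :: "'p set \<Rightarrow> 'p set \<Rightarrow> 's \<Rightarrow> 's"
  hcomp :: "'p set \<Rightarrow> 'k \<Rightarrow> 's set"

definition graded_sheaf ::
  "('k, 'n) monoid_scheme \<Rightarrow> 'p topology \<Rightarrow> ('p, 's, 'k) graded_presheaf \<Rightarrow> bool" where
  "graded_sheaf K X F \<longleftrightarrow>
     (\<forall>U. openin X U \<longrightarrow> graded_ring K (sec F U) (hcomp F U)) \<and>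
     (\<forall>U V. openin X U \<longrightarrow> openin X V \<longrightarrow> V \<subseteq> U \<longrightarrow>
        res F U V \<in> ring_hom (sec F U) (sec F V) \<and>
        (\<forall>w\<in>carrier K. res F U V ` hcomp F U w \<subseteq> hcomp F V w)) \<and>
     (\<forall>U. openin X U \<longrightarrow> (\<forall>s\<in>carrier (sec F U). res F U U s = s)) \<and>
     (\<forall>U V W. openin X U \<longrightarrow> openin X V \<longrightarrow> openin X W \<longrightarrow> W \<subseteq> V \<longrightarrow> V \<subseteq> U \<longrightarrow>
        (\<forall>s\<in>carrier (sec F U). res F V W (res F U V s) = res F U W s)) \<and>
     (\<forall>\<U> f. (\<forall>U\<in>\<U>. openin X U \<and> f U \<in> carrier (sec F U)) \<longrightarrow>
        (\<forall>U\<in>\<U>. \<forall>V\<in>\<U>. res F U (U \<inter> V) (f U) = res F V (U \<inter> V) (f V)) \<longrightarrow>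
        (\<exists>!s. s \<in> carrier (sec F (\<Union>\<U>)) \<and> (\<forall>U\<in>\<U>. res F (\<Union>\<U>) U s = f U)))"

text \<open>Morphisms of an \<open>L\<close>-graded into a \<open>K\<close>-graded sheaf, accompanied by \<open>\<kappa>\<close> on degrees.\<close>

definition graded_sheaf_hom ::
  "('l, 'n) monoid_scheme \<Rightarrow> ('k, 'n') monoid_scheme \<Rightarrow> 'p topology \<Rightarrow>
   ('p, 's, 'l) graded_presheaf \<Rightarrow> ('p, 't, 'k) graded_presheaf \<Rightarrow>
   ('l \<Rightarrow> 'k) \<Rightarrow> ('p set \<Rightarrow> 's \<Rightarrow> 't) \<Rightarrow> bool" where
  "graded_sheaf_hom L K X F F' \<kappa> \<phi> \<longleftrightarrow>
     \<kappa> \<in> hom L K \<and>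
     (\<forall>U. openin X U \<longrightarrow> \<phi> U \<in> ring_hom (sec F U) (sec F' U) \<and>
        (\<forall>w\<in>carrier L. \<phi> U ` hcomp F U w \<subseteq> hcomp F' U (\<kappa> w))) \<and>
     (\<forall>U V. openin X U \<longrightarrow> openin X V \<longrightarrow> V \<subseteq> U \<longrightarrow>
        (\<forall>s\<in>carrier (sec F U). \<phi> V (res F U V s) = res F' U V (\<phi> U s)))"

definition graded_sheaf_iso ::
  "('l, 'n) monoid_scheme \<Rightarrow> ('k, 'n') monoid_scheme \<Rightarrow> 'p topology \<Rightarrow>
   ('p, 's, 'l) graded_presheaf \<Rightarrow> ('p, 't, 'k) graded_presheaf \<Rightarrow>
   ('l \<Rightarrow> 'k) \<Rightarrow> ('p set \<Rightarrow> 's \<Rightarrow> 't) \<Rightarrow> bool" where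
  "graded_sheaf_iso L K X F F' \<kappa> \<phi> \<longleftrightarrow>
     graded_sheaf_hom L K X F F' \<kappa> \<phi> \<and> \<kappa> \<in> iso L K \<and>
     (\<forall>U. openin X U \<longrightarrow> bij_betw (\<phi> U) (carrier (sec F U)) (carrier (sec F' U)) \<and>
        (\<forall>w\<in>carrier L. \<phi> U ` hcomp F U w = hcomp F' U (\<kappa> w)))"


section \<open>Affine schemes and associated sheaves\<close>

definition Spec :: "('a, 'm) ring_scheme \<Rightarrow> 'a set topology" where
  "Spec A = topology (\<lambda>U. \<exists>S \<subseteq> carrier A. U = {p. primeideal p A \<and> \<not> S \<subseteq> p})"

lemma istopology_Spec:
  "istopology (\<lambda>U. \<exists>S \<subseteq> carrier A. U = {p. primeideal p A \<and> \<not> S \<subseteq> p})"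
  unfolding istopology_def
proof (intro conjI allI impI)
  fix U V
  assume "\<exists>S \<subseteq> carrier A. U = {p. primeideal p A \<and> \<not> S \<subseteq> p}"
    and "\<exists>S \<subseteq> carrier A. V = {p. primeideal p A \<and> \<not> S \<subseteq> p}"
  then obtain S T where S: "S \<subseteq> carrier A" "U = {p. primeideal p A \<and> \<not> S \<subseteq> p}"
    and T: "T \<subseteq> carrier A" "V = {p. primeideal p A \<and> \<not> T \<subseteq> p}"
    by auto
  show "\<exists>S \<subseteq> carrier A. U \<inter> V = {p. primeideal p A \<and> \<not> S \<subseteq> p}"
  proof (cases "cring A")
    case False
    then have "\<not> primeideal p A" for p
      by (meson primeideal.axioms(2))
    then show ?thesis using S by auto
  next
    case True
    interpret cring A by fact
    let ?W = "{s \<otimes>\<^bsub>A\<^esub> t | s t. s \<in> S \<and> t \<in> T}"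
    have "(\<not> S \<subseteq> p \<and> \<not> T \<subseteq> p) \<longleftrightarrow> \<not> ?W \<subseteq> p" if "primeideal p A" for p
    proof -
      interpret p: primeideal p A by fact
      show ?thesis
      proof
        assume "\<not> S \<subseteq> p \<and> \<not> T \<subseteq> p"
        then obtain s t where st: "s \<in> S" "s \<notin> p" "t \<in> T" "t \<notin> p" by auto
        then have "s \<otimes>\<^bsub>A\<^esub> t \<notin> p"
          using p.I_prime S(1) T(1) by blast
        then show "\<not> ?W \<subseteq> p" using st by blast
      next
        assume "\<not> ?W \<subseteq> p"
        then obtain s t where st: "s \<in> S" "t \<in> T" "s \<otimes>\<^bsub>A\<^esub> t \<notin> p" by auto
        then show "\<not> S \<subseteq> p \<and> \<not> T \<subseteq> p"
          using p.I_l_closed p.I_r_closed S(1) T(1) by blast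
      qed
    qed
    then have "U \<inter> V = {p. primeideal p A \<and> \<not> ?W \<subseteq> p}"
      using S(2) T(2) by auto
    moreover have "?W \<subseteq> carrier A"
      using S(1) T(1) by auto
    ultimately show ?thesis by blast
  qed
next
  fix \<U>
  assume "\<forall>U\<in>\<U>. \<exists>S \<subseteq> carrier A. U = {p. primeideal p A \<and> \<not> S \<subseteq> p}"
  then obtain f where f: "\<And>U. U \<in> \<U> \<Longrightarrow> f U \<subseteq> carrier A"
    "\<And>U. U \<in> \<U> \<Longrightarrow> U = {p. primeideal p A \<and> \<not> f U \<subseteq> p}"
    by metis
  have "\<Union>\<U> = {p. primeideal p A \<and> \<not> (\<Union>U\<in>\<U>. f U) \<subseteq> p}"
    using f(2) by blast
  moreover have "(\<Union>U\<in>\<U>. f U) \<subseteq> carrier A"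
    using f(1) by blast
  ultimately show "\<exists>S \<subseteq> carrier A. \<Union>\<U> = {p. primeideal p A \<and> \<not> S \<subseteq> p}"
    by blast
qed

lemma openin_Spec:
  "openin (Spec A) U \<longleftrightarrow> (\<exists>S \<subseteq> carrier A. U = {p. primeideal p A \<and> \<not> S \<subseteq> p})"
  unfolding Spec_def by (subst topology_inverse'[OF istopology_Spec]) simp

lemma topspace_Spec: "topspace (Spec A) = {p. primeideal p A}"
proof
  show "topspace (Spec A) \<subseteq> {p. primeideal p A}"
    by (auto simp: topspace_def openin_Spec)
  have "primeideal p A \<Longrightarrow> \<not> carrier A \<subseteq> p" for p
    by (metis ideal.axioms(1) additive_subgroup.a_subset primeideal.I_notcarr
        primeideal.axioms(1) subset_antisym)
  then have "openin (Spec A) {p. primeideal p A}"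
    unfolding openin_Spec by (intro exI[of _ "carrier A"]) auto
  then show "{p. primeideal p A} \<subseteq> topspace (Spec A)"
    by (rule openin_subset)
qed

text \<open>
  The sheaf associated to a graded \<open>A\<close>-algebra \<open>R\<close> with structure map \<open>\<phi>\<close>: sections over \<open>U\<close> are
  the families of elements of the stalks \<open>R\<^sub>p\<close>, where \<open>p \<in> U\<close>, that locally are fractions \<open>a/f\<close>
  with \<open>a \<in> R\<close> and \<open>f \<in> A\<close>. With \<open>a\<close> ranging over \<open>R\<^sub>w\<close> these are the sections of degree \<open>w\<close>,
  i.e. those of the sheaf associated to the \<open>A\<close>-module \<open>R\<^sub>w\<close>.
\<close>

definition graded_algebra ::
  "('a, 'm) ring_scheme \<Rightarrow> ('k, 'n) monoid_scheme \<Rightarrow> ('r, 'm') ring_scheme \<Rightarrow> ('k \<Rightarrow> 'r set) \<Rightarrow>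
     ('a \<Rightarrow> 'r) \<Rightarrow> bool" where
  "graded_algebra A K R G \<phi> \<longleftrightarrow>
     graded_ring K R G \<and> \<phi> \<in> ring_hom A R \<and> \<phi> ` carrier A \<subseteq> G \<one>\<^bsub>K\<^esub>"

definition stalk_denoms ::
  "('a, 'm) ring_scheme \<Rightarrow> ('a \<Rightarrow> 'r) \<Rightarrow> 'a set \<Rightarrow> 'r set" where
  "stalk_denoms A \<phi> p = \<phi> ` (carrier A - p)"

definition assoc_sections ::
  "('a, 'm) ring_scheme \<Rightarrow> ('r, 'm') ring_scheme \<Rightarrow> ('a \<Rightarrow> 'r) \<Rightarrow> 'r set \<Rightarrow> 'a set set \<Rightarrow>
     ('a set \<Rightarrow> ('r \<times> 'r) set) set" where
  "assoc_sections A R \<phi> M U =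
     {s \<in> (\<Pi>\<^sub>E p\<in>U. carrier (localization R (stalk_denoms A \<phi> p))).
        \<forall>p\<in>U. \<exists>V. openin (Spec A) V \<and> p \<in> V \<and> V \<subseteq> U \<and>
          (\<exists>a\<in>M. \<exists>f\<in>carrier A. \<forall>q\<in>V. f \<notin> q \<and> s q = fraction R (stalk_denoms A \<phi> q) a (\<phi> f))}"

definition assoc_sheaf ::
  "('a, 'm) ring_scheme \<Rightarrow> ('r, 'm') ring_scheme \<Rightarrow> ('k \<Rightarrow> 'r set) \<Rightarrow> ('a \<Rightarrow> 'r) \<Rightarrow>
     ('a set, 'a set \<Rightarrow> ('r \<times> 'r) set, 'k) graded_presheaf" where
  "assoc_sheaf A R G \<phi> =
     \<lparr>sec = (\<lambda>U.
        \<lparr>carrier = assoc_sections A R \<phi> (carrier R) U,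
         monoid.mult = (\<lambda>s t. \<lambda>p\<in>U. s p \<otimes>\<^bsub>localization R (stalk_denoms A \<phi> p)\<^esub> t p),
         monoid.one = (\<lambda>p\<in>U. \<one>\<^bsub>localization R (stalk_denoms A \<phi> p)\<^esub>),
         ring.zero = (\<lambda>p\<in>U. \<zero>\<^bsub>localization R (stalk_denoms A \<phi> p)\<^esub>),
         ring.add = (\<lambda>s t. \<lambda>p\<in>U. s p \<oplus>\<^bsub>localization R (stalk_denoms A \<phi> p)\<^esub> t p)\<rparr>),
      res = (\<lambda>U V s. restrict s V),
      hcomp = (\<lambda>U w. assoc_sections A R \<phi> (G w) U)\<rparr>"


section \<open>Divisors on affine Krull schemes\<close>

definition irreducible_closedin :: "'p topology \<Rightarrow> 'p set \<Rightarrow> bool" where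
  "irreducible_closedin X Z \<longleftrightarrow> closedin X Z \<and> Z \<noteq> {} \<and>
     (\<forall>C D. closedin X C \<longrightarrow> closedin X D \<longrightarrow> Z \<subseteq> C \<union> D \<longrightarrow> Z \<subseteq> C \<or> Z \<subseteq> D)"

definition codim :: "'p topology \<Rightarrow> 'p set \<Rightarrow> enat" where
  "codim X Z = Sup {enat n | n. \<exists>C. C 0 = Z \<and> (\<forall>i\<le>n. irreducible_closedin X (C i)) \<and>
     (\<forall>i<n. C i \<subset> C (Suc i))}"

definition prime_divisors :: "('a, 'm) ring_scheme \<Rightarrow> 'a set set" where
  "prime_divisors A = {Y \<in> topspace (Spec A). codim (Spec A) (Abstract_Topology.closure_of (Spec A) {Y}) = 1}"

text \<open>The discrete valuation on the function field with valuation ring \<open>A\<^sub>Y\<close>, which is the stalk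
  at \<open>Y\<close> of the structure sheaf.\<close>

definition divisor_valuation :: "('a, 'm) ring_scheme \<Rightarrow> 'a set \<Rightarrow> ('a \<times> 'a) set \<Rightarrow> int" where
  "divisor_valuation A Y = (THE \<nu>. valuation_at zero_group A (trivial_grading A) Y \<nu>)"

text \<open>The constant sheaf \<open>\<K>\<close> of rational functions; its sections are the locally constant
  functions with values in the function field.\<close>

definition rational_functions ::
  "('a, 'm) ring_scheme \<Rightarrow> 'a set set \<Rightarrow> ('a set \<Rightarrow> ('a \<times> 'a) set) ring" where
  "rational_functions A U =
     \<lparr>carrier = {f \<in> U \<rightarrow>\<^sub>E carrier (fraction_field A).
        \<forall>p\<in>U. \<exists>V. openin (Spec A) V \<and> p \<in> V \<and> V \<subseteq> U \<and> (\<forall>q\<in>V. f q = f p)},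
      monoid.mult = (\<lambda>f g. \<lambda>p\<in>U. f p \<otimes>\<^bsub>fraction_field A\<^esub> g p),
      monoid.one = (\<lambda>p\<in>U. \<one>\<^bsub>fraction_field A\<^esub>),
      ring.zero = (\<lambda>p\<in>U. \<zero>\<^bsub>fraction_field A\<^esub>),
      ring.add = (\<lambda>f g. \<lambda>p\<in>U. f p \<oplus>\<^bsub>fraction_field A\<^esub> g p)\<rparr>"

type_synonym 'a divisor = "'a set \<Rightarrow>\<^sub>0 int"

definition WDiv :: "('a, 'm) ring_scheme \<Rightarrow> 'a set set \<Rightarrow> 'a divisor monoid" where
  "WDiv A U = free_Abelian_group (prime_divisors A \<inter> U)"

definition restrict_divisor :: "'a divisor \<Rightarrow> 'a set set \<Rightarrow> 'a divisor" where
  "restrict_divisor D U = Abs_poly_mapping (\<lambda>Y. if Y \<in> U then Poly_Mapping.lookup D Y else 0)"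

definition effective :: "'a divisor \<Rightarrow> bool" where
  "effective D \<longleftrightarrow> (\<forall>Y. 0 \<le> Poly_Mapping.lookup D Y)"

text \<open>Meaningful for non-zero \<open>f\<close> only.\<close>

definition divisor_of ::
  "('a, 'm) ring_scheme \<Rightarrow> 'a set set \<Rightarrow> ('a set \<Rightarrow> ('a \<times> 'a) set) \<Rightarrow> 'a divisor" where
  "divisor_of A U f = Abs_poly_mapping
     (\<lambda>Y. if Y \<in> prime_divisors A \<inter> U then divisor_valuation A Y (f Y) else 0)"

definition principal_divisors :: "('a, 'm) ring_scheme \<Rightarrow> 'a divisor set" where
  "principal_divisors A = (let X = topspace (Spec A)
     in divisor_of A X ` Units (rational_functions A X))"

definition Cl :: "('a, 'm) ring_scheme \<Rightarrow> 'a divisor set monoid" where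
  "Cl A = WDiv A (topspace (Spec A)) Mod principal_divisors A"

definition divisor_class :: "('a, 'm) ring_scheme \<Rightarrow> 'a divisor \<Rightarrow> 'a divisor set" where
  "divisor_class A D = principal_divisors A #>\<^bsub>WDiv A (topspace (Spec A))\<^esub> D"


section \<open>Cox sheaves\<close>

text \<open>\<open>\<O>\<^sub>X(D)(U)\<close>\<close>

definition divisor_sections ::
  "('a, 'm) ring_scheme \<Rightarrow> 'a divisor \<Rightarrow> 'a set set \<Rightarrow> ('a set \<Rightarrow> ('a \<times> 'a) set) set" where
  "divisor_sections A D U = {f \<in> carrier (rational_functions A U).
     f = \<zero>\<^bsub>rational_functions A U\<^esub> \<or> effective (divisor_of A U f + restrict_divisor D U)}"

text \<open>
  The sheaf \<open>\<O>\<^sub>X(WDiv(X))\<close>: a section over \<open>U\<close> is a finite sum of terms \<open>s D \<chi>\<^sup>D\<close> with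
  \<open>s D\<close> in \<open>\<O>\<^sub>X(D)(U)\<close>, encoded as the function \<open>s\<close>, and multiplication is convolution.
\<close>

definition divisorial_sheaf ::
  "('a, 'm) ring_scheme \<Rightarrow>
     ('a set, 'a divisor \<Rightarrow> 'a set \<Rightarrow> ('a \<times> 'a) set, 'a divisor) graded_presheaf" where
  "divisorial_sheaf A =
     (let W = carrier (WDiv A (topspace (Spec A)));
          \<K> = rational_functions A;
          \<S> = (\<lambda>U. {s. (\<forall>D\<in>W. s D \<in> divisor_sections A D U) \<and>
                         (\<forall>D. D \<notin> W \<longrightarrow> s D = \<zero>\<^bsub>\<K> U\<^esub>) \<and> finite {D. s D \<noteq> \<zero>\<^bsub>\<K> U\<^esub>}})
      in \<lparr>sec = (\<lambda>U.
            \<lparr>carrier = \<S> U,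
             monoid.mult = (\<lambda>s t D. \<Oplus>\<^bsub>\<K> U\<^esub> E\<in>{E. s E \<noteq> \<zero>\<^bsub>\<K> U\<^esub>}. s E \<otimes>\<^bsub>\<K> U\<^esub> t (D - E)),
             monoid.one = (\<lambda>D. if D = 0 then \<one>\<^bsub>\<K> U\<^esub> else \<zero>\<^bsub>\<K> U\<^esub>),
             ring.zero = (\<lambda>D. \<zero>\<^bsub>\<K> U\<^esub>),
             ring.add = (\<lambda>s t D. s D \<oplus>\<^bsub>\<K> U\<^esub> t D)\<rparr>),
          res = (\<lambda>U V s D. restrict (s D) V),
          hcomp = (\<lambda>U D. {s \<in> \<S> U. \<forall>E. E \<noteq> D \<longrightarrow> s E = \<zero>\<^bsub>\<K> U\<^esub>})\<rparr>)"

definition Cl_graded_Cox_sheaf ::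
  "('a, 'm) ring_scheme \<Rightarrow> ('a set, 's, 'a divisor set) graded_presheaf \<Rightarrow> bool" where
  "Cl_graded_Cox_sheaf A F \<longleftrightarrow>
     graded_sheaf (Cl A) (Spec A) F \<and>
     (\<exists>\<pi>. graded_sheaf_hom (WDiv A (topspace (Spec A))) (Cl A) (Spec A)
             (divisorial_sheaf A) F (divisor_class A) \<pi> \<and>
          (\<forall>D\<in>carrier (WDiv A (topspace (Spec A))). \<forall>U. openin (Spec A) U \<longrightarrow>
             bij_betw (\<pi> U) (hcomp (divisorial_sheaf A) U D) (hcomp F U (divisor_class A D))))"

text \<open>
  A \<open>K\<close>-graded sheaf is a Cox sheaf if it is isomorphic, along an isomorphism of \<open>K\<close> with the
  class group, to a \<open>Cl\<close>-graded one. The latter may be taken to have sections of the same type,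
  since any sheaf isomorphic to \<open>F\<close> can be transported to the rings of sections of \<open>F\<close>.
\<close>

definition Cox_sheaf ::
  "('a, 'm) ring_scheme \<Rightarrow> ('k, 'n) monoid_scheme \<Rightarrow> ('a set, 's, 'k) graded_presheaf \<Rightarrow> bool" where
  "Cox_sheaf A K F \<longleftrightarrow>
     (\<exists>(F' :: ('a set, 's, 'a divisor set) graded_presheaf) \<kappa> \<phi>.
        Cl_graded_Cox_sheaf A F' \<and> graded_sheaf_iso K (Cl A) (Spec A) F F' \<kappa> \<phi>)"

end

theory Submission
  imports Defs
begin

text \<open>
  Over a non-empty open set \<open>U\<close> the sections of \<open>\<O>(D)\<close> are elements of the function field, so a Cox sheaf
  amounts to an epimorphism \<open>\<delta>\<close> from divisors onto \<open>K\<close> with kernel the principal divisors, together with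
  isomorphisms of \<open>\<O>(D)(U)\<close> onto the sections of degree \<open>\<delta>(D)\<close> that respect products and restrictions.

  Given these data, every prime divisor \<open>Y\<close> defines a valuation on the homogeneous elements of the ring
  \<open>R\<close> of global sections: the element coming from \<open>x \<in> \<O>(D)(X)\<close> has value \<open>\<nu>\<^sub>Y(x) + D\<^sub>Y\<close>. Divisibility in
  \<open>R\<^sup>+\<close> is comparison of these values, and the section \<open>1\<close> of \<open>\<O>(Y)\<close> has value \<open>1\<close> at \<open>Y\<close> and \<open>0\<close> elsewhere.
  Hence \<open>R\<close> is factorial with these sections as prime elements.

  Conversely, by (iii) the prime elements of \<open>R\<close> correspond to the prime divisors. Mapping \<open>Y\<close> to its prime
  element defines a homomorphism \<open>h\<close> from divisors to the homogeneous units of \<open>Q\<^sup>+(R)\<close>. Let \<open>\<delta>(D)\<close> be the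
  degree of \<open>h(D)\<close>. A homogeneous fraction all of whose values vanish is a unit of \<open>R\<close>, hence of degree
  \<open>0\<close> by (i); together with (ii) this determines image and kernel of \<open>\<delta>\<close>, and \<open>x \<mapsto> x h(D)\<close> maps \<open>\<O>(D)(U)\<close>
  onto the sections of degree \<open>\<delta>(D)\<close> over \<open>U\<close>.
\<close>

section \<open>Fractions with cancellable denominators\<close>

text \<open>A Krull ring comes with some defining family of valuations on some ambient field,
  whereas prime divisors and (iii) refer to valuations at minimal primes. These have to be
  constructed: a minimal prime is the center of some member of the family, which after division by a
  constant is the order there, and the ring is the intersection of its localizations at minimal
  primes. Valuations are handled through the elementwise comparison \<open>graded_ord\<close>, which
  graded rings and, via the trivial grading, ungraded ones share.

  Sections become elements of one fraction ring because the point 0 lies in every non-empty open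
  set; the empty set is treated apart.

  The obstacle for a given Cox sheaf is that a section has many representations: x for the divisor D
  and y for E may give the same section when D and E are linearly equivalent. If D - E is the
  divisor of h, nothing forces the section of h for E - D to be 1. It is, however, an invertible
  section of degree zero, and such sections have value 0 everywhere, so the values are well
  defined.\<close>

locale fractions = cring R for R (structure) +
  fixes S
  assumes denoms: "S \<subseteq> carrier R"
    and one_denom: "\<one> \<in> S"
    and mult_denom: "\<lbrakk>s \<in> S; t \<in> S\<rbrakk> \<Longrightarrow> s \<otimes> t \<in> S"
    and cancel_denom: "\<lbrakk>s \<in> S; a \<in> carrier R; s \<otimes> a = \<zero>\<rbrakk> \<Longrightarrow> a = \<zero>"
begin

lemma denom_closed [simp, intro]: "s \<in> S \<Longrightarrow> s \<in> carrier R"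
  using denoms by blast

lemma denom_cancel:
  assumes "s \<in> S" "a \<in> carrier R" "b \<in> carrier R"
  shows "s \<otimes> a = s \<otimes> b \<longleftrightarrow> a = b"
proof
  assume "s \<otimes> a = s \<otimes> b"
  then have "s \<otimes> (a \<ominus> b) = \<zero>"
    using assms by (simp add: minus_eq r_distr r_minus r_neg denom_closed)
  then have "a \<ominus> b = \<zero>"
    using assms cancel_denom by (meson minus_closed)
  then show "a = b" using assms by simp
qed simp

text \<open>The auxiliary factor \<open>u\<close> in the definition of \<open>fraction\<close> can
  be cancelled, so equality of fractions becomes plain cross multiplication.\<close>

lemma mem_fraction_iff:
  assumes "a \<in> carrier R" "s \<in> S"
  shows "(b, t) \<in> fraction R S a s \<longleftrightarrow> b \<in> carrier R \<and> t \<in> S \<and> a \<otimes> t = b \<otimes> s"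
proof -
  have "u \<otimes> (a \<otimes> t) = u \<otimes> (b \<otimes> s) \<longleftrightarrow> a \<otimes> t = b \<otimes> s"
    if "u \<in> S" "b \<in> carrier R" "t \<in> S" for u
    using that assms by (intro denom_cancel) auto
  then show ?thesis
    unfolding fraction_def using one_denom by auto
qed

lemma self_mem_fraction: "\<lbrakk>a \<in> carrier R; s \<in> S\<rbrakk> \<Longrightarrow> (a, s) \<in> fraction R S a s"
  by (simp add: mem_fraction_iff)

lemma fraction_eqI:
  assumes "a \<in> carrier R" "s \<in> S" "b \<in> carrier R" "t \<in> S" "a \<otimes> t = b \<otimes> s"
  shows "fraction R S a s = fraction R S b t"
proof -
  have sub: "fraction R S a s \<subseteq> fraction R S b t"
    if h: "a \<in> carrier R" "s \<in> S" "b \<in> carrier R" "t \<in> S" "a \<otimes> t = b \<otimes> s" for a s b t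
  proof
    fix x assume x: "x \<in> fraction R S a s"
    obtain c u where cu: "x = (c, u)" by (cases x)
    then have c: "c \<in> carrier R" "u \<in> S" "a \<otimes> u = c \<otimes> s"
      using x mem_fraction_iff h by auto
    note [simp] = c(1,2) h(1,2,3,4)
    have "s \<otimes> (b \<otimes> u) = (b \<otimes> s) \<otimes> u" by (simp add: m_ac)
    also have "\<dots> = (a \<otimes> u) \<otimes> t" unfolding h(5)[symmetric] by (simp add: m_ac)
    also have "\<dots> = s \<otimes> (c \<otimes> t)" unfolding c(3) by (simp add: m_ac)
    finally have "b \<otimes> u = c \<otimes> t" by (simp add: denom_cancel)
    then show "x \<in> fraction R S b t" using cu by (simp add: mem_fraction_iff)
  qed
  show ?thesis
    using sub[OF assms] sub[OF assms(3,4,1,2) assms(5)[symmetric]] by blast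
qed

lemma fraction_eq_iff:
  assumes "a \<in> carrier R" "s \<in> S" "b \<in> carrier R" "t \<in> S"
  shows "fraction R S a s = fraction R S b t \<longleftrightarrow> a \<otimes> t = b \<otimes> s"
  using fraction_eqI[OF assms] self_mem_fraction[OF assms(3,4)] mem_fraction_iff[OF assms(1,2)]
  by metis

abbreviation L where "L \<equiv> localization R S"

text \<open>The product in \<open>localization\<close> is a union over all pairs of representatives.
  All sets in this union coincide, so it collapses to the value at any one pair;
  \<open>loc_add\<close> works in the same way.\<close>

lemma loc_mult:
  assumes "a \<in> carrier R" "s \<in> S" "b \<in> carrier R" "t \<in> S"
  shows "fraction R S a s \<otimes>\<^bsub>L\<^esub> fraction R S b t = fraction R S (a \<otimes> b) (s \<otimes> t)"
proof -
  have "fraction R S (a' \<otimes> b') (s' \<otimes> t') = fraction R S (a \<otimes> b) (s \<otimes> t)"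
    if "(a', s') \<in> fraction R S a s" "(b', t') \<in> fraction R S b t" for a' s' b' t'
  proof -
    have h: "a' \<in> carrier R" "s' \<in> S" "a \<otimes> s' = a' \<otimes> s" "b' \<in> carrier R" "t' \<in> S" "b \<otimes> t' = b' \<otimes> t"
      using that assms by (auto simp: mem_fraction_iff)
    have "(a' \<otimes> b') \<otimes> (s \<otimes> t) = (a' \<otimes> s) \<otimes> (b' \<otimes> t)" using h(1,2,4,5) assms by (simp add: m_ac)
    also have "\<dots> = (a \<otimes> b) \<otimes> (s' \<otimes> t')"
      unfolding h(3,6)[symmetric] using h(1,2,4,5) assms by (simp add: m_ac)
    finally show ?thesis using h(1,2,4,5) assms by (intro fraction_eqI) (auto intro: mult_denom)
  qed
  then show ?thesis
    unfolding localization_def ring_record_simps monoid.simps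
    by (intro UN_constant_eq[OF self_mem_fraction[OF assms(1,2)]] ballI)
      (clarify, intro UN_constant_eq[OF self_mem_fraction[OF assms(3,4)]] ballI, auto)
qed

lemma loc_add:
  assumes "a \<in> carrier R" "s \<in> S" "b \<in> carrier R" "t \<in> S"
  shows "fraction R S a s \<oplus>\<^bsub>L\<^esub> fraction R S b t = fraction R S (a \<otimes> t \<oplus> b \<otimes> s) (s \<otimes> t)"
proof -
  have "fraction R S (a' \<otimes> t' \<oplus> b' \<otimes> s') (s' \<otimes> t') = fraction R S (a \<otimes> t \<oplus> b \<otimes> s) (s \<otimes> t)"
    if "(a', s') \<in> fraction R S a s" "(b', t') \<in> fraction R S b t" for a' s' b' t'
  proof -
    have h: "a' \<in> carrier R" "s' \<in> S" "a \<otimes> s' = a' \<otimes> s" "b' \<in> carrier R" "t' \<in> S" "b \<otimes> t' = b' \<otimes> t"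
      using that assms by (auto simp: mem_fraction_iff)
    have "(a' \<otimes> t' \<oplus> b' \<otimes> s') \<otimes> (s \<otimes> t) = (a' \<otimes> s) \<otimes> (t \<otimes> t') \<oplus> (b' \<otimes> t) \<otimes> (s \<otimes> s')"
      using h(1,2,4,5) assms by (simp add: m_ac l_distr r_distr)
    also have "\<dots> = (a \<otimes> t \<oplus> b \<otimes> s) \<otimes> (s' \<otimes> t')"
      unfolding h(3,6)[symmetric] using h(1,2,4,5) assms by (simp add: m_ac l_distr r_distr)
    finally show ?thesis using h(1,2,4,5) assms by (intro fraction_eqI) (auto intro: mult_denom)
  qed
  then show ?thesis
    unfolding localization_def ring_record_simps monoid.simps
    by (intro UN_constant_eq[OF self_mem_fraction[OF assms(1,2)]] ballI)
      (clarify, intro UN_constant_eq[OF self_mem_fraction[OF assms(3,4)]] ballI, auto)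
qed

lemma loc_zero: "\<zero>\<^bsub>L\<^esub> = fraction R S \<zero> \<one>"
  and loc_one: "\<one>\<^bsub>L\<^esub> = fraction R S \<one> \<one>"
  and loc_carrier: "carrier L = {fraction R S a s | a s. a \<in> carrier R \<and> s \<in> S}"
  by (simp_all add: localization_def)

lemma loc_closed [intro]: "\<lbrakk>a \<in> carrier R; s \<in> S\<rbrakk> \<Longrightarrow> fraction R S a s \<in> carrier L"
  by (auto simp: loc_carrier)

lemma loc_cases:
  assumes "x \<in> carrier L"
  obtains a s where "a \<in> carrier R" "s \<in> S" "x = fraction R S a s"
  using assms by (auto simp: loc_carrier)

lemma fraction_eq_zero_iff:
  assumes "a \<in> carrier R" "s \<in> S"
  shows "fraction R S a s = \<zero>\<^bsub>L\<^esub> \<longleftrightarrow> a = \<zero>"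
  using assms by (simp add: loc_zero fraction_eq_iff one_denom)

lemma loc_add_same:
  assumes "a \<in> carrier R" "s \<in> S" "b \<in> carrier R"
  shows "fraction R S a s \<oplus>\<^bsub>L\<^esub> fraction R S b s = fraction R S (a \<oplus> b) s"
  unfolding loc_add[OF assms(1,2,3,2)] using assms
  by (intro fraction_eqI) (auto intro: mult_denom simp: l_distr r_distr m_ac)

lemma cring_loc: "cring L"
proof (intro cringI abelian_groupI comm_monoidI)
  fix x y assume "x \<in> carrier L" "y \<in> carrier L"
  then obtain a s b t where x: "a \<in> carrier R" "s \<in> S" "x = fraction R S a s"
    and y: "b \<in> carrier R" "t \<in> S" "y = fraction R S b t" by (metis loc_cases)
  show "x \<oplus>\<^bsub>L\<^esub> y \<in> carrier L" "x \<otimes>\<^bsub>L\<^esub> y \<in> carrier L"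
    using x y by (auto simp: loc_add loc_mult mult_denom)
  show "x \<oplus>\<^bsub>L\<^esub> y = y \<oplus>\<^bsub>L\<^esub> x"
    using x y by (simp add: loc_add a_comm m_comm)
  show "x \<otimes>\<^bsub>L\<^esub> y = y \<otimes>\<^bsub>L\<^esub> x"
    using x y by (simp add: loc_mult m_comm)
next
  fix x y z assume "x \<in> carrier L" "y \<in> carrier L" "z \<in> carrier L"
  then obtain a s b t c u where x: "a \<in> carrier R" "s \<in> S" "x = fraction R S a s"
    and y: "b \<in> carrier R" "t \<in> S" "y = fraction R S b t"
    and z: "c \<in> carrier R" "u \<in> S" "z = fraction R S c u" by (metis loc_cases)
  note [simp] = x y z mult_denom
  show "x \<oplus>\<^bsub>L\<^esub> y \<oplus>\<^bsub>L\<^esub> z = x \<oplus>\<^bsub>L\<^esub> (y \<oplus>\<^bsub>L\<^esub> z)"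
    by (simp add: loc_add l_distr r_distr m_ac a_ac)
  show "x \<otimes>\<^bsub>L\<^esub> y \<otimes>\<^bsub>L\<^esub> z = x \<otimes>\<^bsub>L\<^esub> (y \<otimes>\<^bsub>L\<^esub> z)"
    by (simp add: loc_mult m_ac)
  show "(x \<oplus>\<^bsub>L\<^esub> y) \<otimes>\<^bsub>L\<^esub> z = x \<otimes>\<^bsub>L\<^esub> z \<oplus>\<^bsub>L\<^esub> y \<otimes>\<^bsub>L\<^esub> z"
    by (simp add: loc_mult loc_add) (intro fraction_eqI; simp add: l_distr r_distr m_ac)
next
  show "\<zero>\<^bsub>L\<^esub> \<in> carrier L" "\<one>\<^bsub>L\<^esub> \<in> carrier L"
    using one_denom by (auto simp: loc_zero loc_one)
next
  fix x assume "x \<in> carrier L"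
  then obtain a s where x: "a \<in> carrier R" "s \<in> S" "x = fraction R S a s" by (metis loc_cases)
  note [simp] = x one_denom
  show "\<zero>\<^bsub>L\<^esub> \<oplus>\<^bsub>L\<^esub> x = x" by (simp add: loc_zero loc_add)
  show "\<one>\<^bsub>L\<^esub> \<otimes>\<^bsub>L\<^esub> x = x" by (simp add: loc_one loc_mult)
  have "fraction R S (\<ominus> a) s \<oplus>\<^bsub>L\<^esub> x = \<zero>\<^bsub>L\<^esub>"
    by (simp add: loc_add_same l_neg fraction_eq_zero_iff)
  then show "\<exists>y\<in>carrier L. y \<oplus>\<^bsub>L\<^esub> x = \<zero>\<^bsub>L\<^esub>"
    using x(1,2) by (metis loc_closed a_inv_closed)
qed

lemma loc_minus:
  assumes "a \<in> carrier R" "s \<in> S"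
  shows "\<ominus>\<^bsub>L\<^esub> fraction R S a s = fraction R S (\<ominus> a) s"
proof -
  interpret L: cring L by (rule cring_loc)
  show ?thesis
    using assms by (intro L.minus_equality) (auto simp: loc_add_same l_neg fraction_eq_zero_iff)
qed

end


section \<open>Graded rings\<close>

locale graded =
  fixes K :: "('k, 'n) monoid_scheme" and R :: "('r, 'm) ring_scheme" (structure)
    and G :: "'k \<Rightarrow> 'r set"
  assumes graded_ring: "graded_ring K R G"
begin

sublocale cring R using graded_ring by (simp add: graded_ring_def)
sublocale K: comm_group K using graded_ring by (simp add: graded_ring_def)

lemma comp_subgroup: "w \<in> carrier K \<Longrightarrow> additive_subgroup (G w) R"
  using graded_ring by (simp add: graded_ring_def)

lemma comp_closed [intro]: "\<lbrakk>a \<in> G w; w \<in> carrier K\<rbrakk> \<Longrightarrow> a \<in> carrier R"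
  using additive_subgroup.a_subset[OF comp_subgroup] by blast

lemma comp_zero: "w \<in> carrier K \<Longrightarrow> \<zero> \<in> G w"
  using additive_subgroup.zero_closed[OF comp_subgroup] .

lemma comp_add: "\<lbrakk>w \<in> carrier K; a \<in> G w; b \<in> G w\<rbrakk> \<Longrightarrow> a \<oplus> b \<in> G w"
  using additive_subgroup.a_closed[OF comp_subgroup] .

lemma comp_minus: "\<lbrakk>w \<in> carrier K; a \<in> G w\<rbrakk> \<Longrightarrow> \<ominus> a \<in> G w"
  using abelian_group.a_inv_closed additive_subgroup.a_inv_closed[OF comp_subgroup] by blast

lemma comp_mult: "\<lbrakk>v \<in> carrier K; w \<in> carrier K; a \<in> G v; b \<in> G w\<rbrakk> \<Longrightarrow> a \<otimes> b \<in> G (v \<otimes>\<^bsub>K\<^esub> w)"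
  using graded_ring by (simp add: graded_ring_def)

section \<open>Homogeneous components of an element\<close>

definition is_decomp :: "'r \<Rightarrow> ('k \<Rightarrow> 'r) \<Rightarrow> bool" where
  "is_decomp x c \<longleftrightarrow> c \<in> (\<Pi>\<^sub>E w\<in>carrier K. G w) \<and> finite {w \<in> carrier K. c w \<noteq> \<zero>} \<and>
        x = (\<Oplus> w\<in>{w \<in> carrier K. c w \<noteq> \<zero>}. c w)"

definition proj :: "'k \<Rightarrow> 'r \<Rightarrow> 'r" where
  "proj w x = (THE c. is_decomp x c) w"

lemma ex1_decomp: "x \<in> carrier R \<Longrightarrow> \<exists>!c. is_decomp x c"
  using graded_ring by (simp add: graded_ring_def is_decomp_def)

lemma decomp: "x \<in> carrier R \<Longrightarrow> is_decomp x (\<lambda>w. proj w x)"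
  unfolding proj_def using theI'[OF ex1_decomp] by simp

text \<open>Terms of the sum may vanish, whereas \<open>is_decomp\<close> sums over the exact
  support. The extensional family \<open>d\<close> bridges the two, and uniqueness of decompositions
  does the rest.\<close>

lemma proj_eqI:
  assumes "finite T" "T \<subseteq> carrier K" "\<And>w. w \<in> T \<Longrightarrow> c w \<in> G w"
    and "v \<in> carrier K"
  shows "proj v (\<Oplus> w\<in>T. c w) = (if v \<in> T then c v else \<zero>)"
proof -
  define d where "d = (\<lambda>w\<in>carrier K. if w \<in> T then c w else \<zero>)"
  have supp: "{w \<in> carrier K. d w \<noteq> \<zero>} \<subseteq> T" by (auto simp: d_def)
  have "(\<Oplus> w\<in>T. c w) = (\<Oplus> w\<in>{w \<in> carrier K. d w \<noteq> \<zero>}. d w)"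
  proof (rule add.finprod_mono_neutral_cong_right[OF assms(1) supp])
    show "\<And>i. i \<in> T - {w \<in> carrier K. d w \<noteq> \<zero>} \<Longrightarrow> c i = \<zero>"
      using assms(2) by (auto simp: d_def subset_iff split: if_splits)
    show "c \<in> T \<rightarrow> carrier R" using assms by (auto simp: subset_iff)
    show "\<And>x. x \<in> {w \<in> carrier K. d w \<noteq> \<zero>} \<Longrightarrow> c x = d x" by (auto simp: d_def)
  qed
  moreover have "d \<in> (\<Pi>\<^sub>E w\<in>carrier K. G w)"
    using assms comp_zero by (auto simp: d_def)
  ultimately have "is_decomp (\<Oplus> w\<in>T. c w) d"
    using supp assms(1) finite_subset by (auto simp: is_decomp_def)
  moreover have "(\<Oplus> w\<in>T. c w) \<in> carrier R"
    using assms by (intro finsum_closed) (auto simp: subset_iff)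
  ultimately have "(THE c'. is_decomp (\<Oplus> w\<in>T. c w) c') = d"
    using ex1_decomp by (metis the_equality)
  then show ?thesis using assms(4) by (simp add: proj_def d_def)
qed

lemma proj_closed: "\<lbrakk>x \<in> carrier R; w \<in> carrier K\<rbrakk> \<Longrightarrow> proj w x \<in> G w"
  using decomp[of x] by (auto simp: is_decomp_def)

lemma finite_proj: "x \<in> carrier R \<Longrightarrow> finite {w \<in> carrier K. proj w x \<noteq> \<zero>}"
  using decomp[of x] by (simp add: is_decomp_def)

lemma sum_proj: "x \<in> carrier R \<Longrightarrow> x = (\<Oplus> w\<in>{w \<in> carrier K. proj w x \<noteq> \<zero>}. proj w x)"
  using decomp[of x] by (simp add: is_decomp_def)

lemma sum_proj_superset:
  assumes "x \<in> carrier R" "finite T" "T \<subseteq> carrier K" "{w \<in> carrier K. proj w x \<noteq> \<zero>} \<subseteq> T"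
  shows "x = (\<Oplus> w\<in>T. proj w x)"
proof -
  have "(\<Oplus> w\<in>T. proj w x) = (\<Oplus> w\<in>{w \<in> carrier K. proj w x \<noteq> \<zero>}. proj w x)"
    using assms comp_closed[OF proj_closed[OF assms(1)]]
    by (intro add.finprod_mono_neutral_cong_right) (auto simp: subset_iff)
  then show ?thesis using sum_proj[OF assms(1)] by simp
qed

lemma proj_comp: "\<lbrakk>a \<in> G v; v \<in> carrier K; w \<in> carrier K\<rbrakk> \<Longrightarrow> proj w a = (if w = v then a else \<zero>)"
  using proj_eqI[of "{v}" "\<lambda>_. a" w] comp_closed[of a v] by (simp add: Pi_def)

lemma proj_add:
  assumes "x \<in> carrier R" "y \<in> carrier R" "w \<in> carrier K"
  shows "proj w (x \<oplus> y) = proj w x \<oplus> proj w y"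
proof -
  define T where "T = insert w ({w \<in> carrier K. proj w x \<noteq> \<zero>} \<union> {w \<in> carrier K. proj w y \<noteq> \<zero>})"
  have T: "finite T" "T \<subseteq> carrier K" using assms finite_proj by (auto simp: T_def)
  have "x = (\<Oplus> w\<in>T. proj w x)" "y = (\<Oplus> w\<in>T. proj w y)"
    using assms T by (auto intro!: sum_proj_superset simp: T_def)
  then have "x \<oplus> y = (\<Oplus> w\<in>T. proj w x) \<oplus> (\<Oplus> w\<in>T. proj w y)" by simp
  also have "\<dots> = (\<Oplus> w\<in>T. proj w x \<oplus> proj w y)"
    using T assms proj_closed by (subst finsum_addf) (auto simp: subset_iff)
  finally have "x \<oplus> y = (\<Oplus> w\<in>T. proj w x \<oplus> proj w y)" .
  moreover have "proj v x \<oplus> proj v y \<in> G v" if "v \<in> T" for v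
    using that assms T proj_closed comp_add by (auto simp: subset_iff)
  ultimately show ?thesis
    using proj_eqI[of T "\<lambda>w. proj w x \<oplus> proj w y" w] T assms by (simp add: T_def)
qed

lemma proj_all_zero: "\<lbrakk>x \<in> carrier R; \<And>w. w \<in> carrier K \<Longrightarrow> proj w x = \<zero>\<rbrakk> \<Longrightarrow> x = \<zero>"
proof -
  assume a: "x \<in> carrier R" "\<And>w. w \<in> carrier K \<Longrightarrow> proj w x = \<zero>"
  then have e: "{w \<in> carrier K. proj w x \<noteq> \<zero>} = {}" by blast
  have "x = (\<Oplus> w\<in>{}. proj w x)" using sum_proj[OF a(1)] unfolding e .
  then show "x = \<zero>" by simp
qed

text \<open>Every component contains zero, so the empty sum falls under the homogeneous
  case.\<close>

lemma homog_induct [consumes 1, case_names homog add]: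
  assumes "x \<in> carrier R"
    and homog: "\<And>a w. \<lbrakk>w \<in> carrier K; a \<in> G w\<rbrakk> \<Longrightarrow> P a"
    and add: "\<And>a b. \<lbrakk>a \<in> carrier R; b \<in> carrier R; P a; P b\<rbrakk> \<Longrightarrow> P (a \<oplus> b)"
  shows "P x"
proof -
  have "P (\<Oplus> w\<in>T. proj w x)" if "finite T" "T \<subseteq> carrier K" for T
    using that
  proof (induction T rule: finite_induct)
    case empty
    show ?case using homog[OF K.one_closed comp_zero[OF K.one_closed]] by simp
  next
    case (insert v T)
    have "proj w x \<in> G w" "proj w x \<in> carrier R" if "w \<in> insert v T" for w
      using that insert.prems proj_closed[OF assms(1)] by auto
    then show ?case using insert homog[of v] add by (simp add: Pi_def)
  qed
  then show ?thesis using sum_proj[OF assms(1)] finite_proj[OF assms(1)]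
    by (metis (no_types, lifting) mem_Collect_eq subsetI)
qed

lemma proj_mult:
  assumes "a \<in> G v" "v \<in> carrier K" "w \<in> carrier K" "x \<in> carrier R"
  shows "proj (v \<otimes>\<^bsub>K\<^esub> w) (a \<otimes> x) = a \<otimes> proj w x"
  using assms(4)
proof (induction x rule: homog_induct)
  case (homog b u)
  then show ?case
    using assms comp_mult[of v u a b] comp_closed[of a v] comp_closed[of b u]
    by (simp add: proj_comp)
next
  case (add b c)
  then have "proj w b \<in> carrier R" "proj w c \<in> carrier R" "a \<in> carrier R"
    using assms proj_closed comp_closed by blast+
  then show ?case using add assms by (simp add: r_distr proj_add)
qed

text \<open>The component of \<open>\<one>\<close> in neutral degree fixes every homogeneous element
  under multiplication, hence by additivity every element; apply this to
  \<open>\<one>\<close>.\<close>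

lemma one_comp: "\<one> \<in> G \<one>\<^bsub>K\<^esub>"
proof -
  let ?e = "proj \<one>\<^bsub>K\<^esub> \<one>"
  have e: "?e \<in> G \<one>\<^bsub>K\<^esub>" "?e \<in> carrier R" by (auto intro: proj_closed)
  have "x \<otimes> ?e = x" if "x \<in> carrier R" for x
    using that
  proof (induction x rule: homog_induct)
    case (homog a w)
    then show ?case
      using proj_mult[of a w "\<one>\<^bsub>K\<^esub>" \<one>] comp_closed[of a w] by (simp add: proj_comp)
  next
    case (add a b)
    then show ?case using e by (simp add: l_distr)
  qed
  from this[of \<one>] e show ?thesis by simp
qed

lemma degree_unique: "\<lbrakk>a \<in> G v; a \<in> G w; v \<in> carrier K; w \<in> carrier K; a \<noteq> \<zero>\<rbrakk> \<Longrightarrow> v = w"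
  using proj_comp[of a v w] proj_comp[of a w w] by (auto split: if_splits)

lemma homogE:
  assumes "a \<in> homog K R G"
  obtains w where "w \<in> carrier K" "a \<in> G w" "a \<noteq> \<zero>" "a \<in> carrier R"
  using assms by (auto simp: homog_def)

lemma homogI: "\<lbrakk>a \<in> G w; w \<in> carrier K; a \<noteq> \<zero>\<rbrakk> \<Longrightarrow> a \<in> homog K R G"
  by (auto simp: homog_def)

lemma homog_closed [intro]: "a \<in> homog K R G \<Longrightarrow> a \<in> carrier R"
  by (auto elim: homogE)

lemma homog_zero: "\<zero> \<notin> homog K R G"
  by (simp add: homog_def)

end

text \<open>Additive maps \<open>P w\<close> that recover homogeneous elements give the uniqueness
  demanded by \<open>graded_ring\<close>: applied to any decomposition, \<open>P w\<close> returns
  its term of degree \<open>w\<close>.\<close>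

lemma graded_ringI:
  fixes K :: "('k, 'n) monoid_scheme" and R :: "('r, 'm) ring_scheme" (structure)
  assumes K: "comm_group K" and R: "cring R"
    and sub: "\<And>w. w \<in> carrier K \<Longrightarrow> additive_subgroup (G w) R"
    and mult: "\<And>v w a b. \<lbrakk>v \<in> carrier K; w \<in> carrier K; a \<in> G v; b \<in> G w\<rbrakk> \<Longrightarrow> a \<otimes> b \<in> G (v \<otimes>\<^bsub>K\<^esub> w)"
    and closed: "\<And>w x. \<lbrakk>w \<in> carrier K; x \<in> carrier R\<rbrakk> \<Longrightarrow> P w x \<in> G w"
    and add: "\<And>w x y. \<lbrakk>w \<in> carrier K; x \<in> carrier R; y \<in> carrier R\<rbrakk> \<Longrightarrow> P w (x \<oplus> y) = P w x \<oplus> P w y"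
    and proj: "\<And>v w a. \<lbrakk>v \<in> carrier K; w \<in> carrier K; a \<in> G v\<rbrakk> \<Longrightarrow> P w a = (if v = w then a else \<zero>)"
    and fin: "\<And>x. x \<in> carrier R \<Longrightarrow> finite {w \<in> carrier K. P w x \<noteq> \<zero>}"
    and sum: "\<And>x. x \<in> carrier R \<Longrightarrow> x = (\<Oplus> w\<in>{w \<in> carrier K. P w x \<noteq> \<zero>}. P w x)"
  shows "graded_ring K R G"
proof -
  interpret cring R by fact
  have clo: "a \<in> carrier R" if "a \<in> G w" "w \<in> carrier K" for a w
    using additive_subgroup.a_subset[OF sub[OF that(2)]] that(1) by blast
  have P0: "P w \<zero> = \<zero>" if "w \<in> carrier K" for w
    using proj[OF that that additive_subgroup.zero_closed[OF sub[OF that]]] by simp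
  have Psum: "P v (\<Oplus> w\<in>T. c w) = (\<Oplus> w\<in>T. P v (c w))"
    if "finite T" "\<And>w. w \<in> T \<Longrightarrow> c w \<in> carrier R" "v \<in> carrier K" for T and v and c :: "'k \<Rightarrow> 'r"
    using that
  proof (induction T rule: finite_induct)
    case (insert x F)
    then have "P v (c w) \<in> carrier R" if "w \<in> insert x F" for w
      using that clo closed by blast
    then show ?case using insert by (simp add: add Pi_def)
  qed (simp add: P0)
  show ?thesis unfolding graded_ring_def
  proof (intro conjI ballI K R)
    fix x assume x: "x \<in> carrier R"
    define d where "d = (\<lambda>w\<in>carrier K. P w x)"
    show "\<exists>!c. c \<in> (\<Pi>\<^sub>E w\<in>carrier K. G w) \<and> finite {w \<in> carrier K. c w \<noteq> \<zero>} \<and>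
        x = (\<Oplus> w\<in>{w \<in> carrier K. c w \<noteq> \<zero>}. c w)"
    proof (rule ex1I[of _ d])
      have supp: "{w \<in> carrier K. d w \<noteq> \<zero>} = {w \<in> carrier K. P w x \<noteq> \<zero>}"
        by (auto simp: d_def)
      have "(\<Oplus> w\<in>{w \<in> carrier K. d w \<noteq> \<zero>}. d w) = (\<Oplus> w\<in>{w \<in> carrier K. P w x \<noteq> \<zero>}. P w x)"
        unfolding supp using clo closed x by (intro finsum_cong') (auto simp: d_def)
      then show "d \<in> (\<Pi>\<^sub>E w\<in>carrier K. G w) \<and> finite {w \<in> carrier K. d w \<noteq> \<zero>} \<and>
        x = (\<Oplus> w\<in>{w \<in> carrier K. d w \<noteq> \<zero>}. d w)"
        using sum[OF x] fin[OF x] closed x unfolding supp by (auto simp: d_def)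
    next
      fix c assume c: "c \<in> (\<Pi>\<^sub>E w\<in>carrier K. G w) \<and> finite {w \<in> carrier K. c w \<noteq> \<zero>} \<and>
        x = (\<Oplus> w\<in>{w \<in> carrier K. c w \<noteq> \<zero>}. c w)"
      let ?T = "{w \<in> carrier K. c w \<noteq> \<zero>}"
      have cG: "c w \<in> G w" "c w \<in> carrier R" if "w \<in> carrier K" for w
        using c that clo by auto
      have "c v = P v x" if v: "v \<in> carrier K" for v
      proof -
        have "P v x = (\<Oplus> w\<in>?T. P v (c w))"
          using Psum[of ?T c v] c cG v by auto
        also have "\<dots> = (\<Oplus> w\<in>?T. if v = w then c w else \<zero>)"
          using cG v by (intro finsum_cong') (auto simp: proj)
        also have "\<dots> = c v"
        proof (cases "v \<in> ?T")
          case True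
          then show ?thesis using c cG finsum_singleton[of v ?T c] by (auto simp: Pi_def)
        next
          case False
          then have "(\<Oplus> w\<in>?T. if v = w then c w else \<zero>) = (\<Oplus> w\<in>?T. \<zero>)"
            using cG by (intro finsum_cong') auto
          then show ?thesis using False v by simp
        qed
        finally show ?thesis by simp
      qed
      then show "c = d" using c by (auto simp: d_def PiE_def extensional_def fun_eq_iff)
    qed
  qed (use sub mult in auto)
qed


section \<open>Graded integral rings and their fractions\<close>

lemma (in graded) proj_mem_imp_mem:
  assumes "additive_subgroup D R" "x \<in> carrier R" "\<And>w. w \<in> carrier K \<Longrightarrow> proj w x \<in> D"
  shows "x \<in> D"
proof -
  interpret D: additive_subgroup D R by fact
  have "(\<Oplus> w\<in>T. proj w x) \<in> D" if "finite T" "T \<subseteq> carrier K" for T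
    using that
  proof (induction T rule: finite_induct)
    case (insert v T)
    then have "proj w x \<in> carrier R" if "w \<in> insert v T" for w
      using that proj_closed[OF assms(2)] comp_closed by blast
    then show ?case using insert assms(3) by (simp add: Pi_def)
  qed simp
  then show ?thesis using sum_proj[OF assms(2)] finite_proj[OF assms(2)]
    by (metis (no_types, lifting) mem_Collect_eq subsetI)
qed

lemma (in graded) comp_inv_mult:
  assumes "u \<in> carrier K" "v \<in> carrier K"
  shows "inv\<^bsub>K\<^esub> u \<otimes>\<^bsub>K\<^esub> (v \<otimes>\<^bsub>K\<^esub> u) = v" "u \<otimes>\<^bsub>K\<^esub> (inv\<^bsub>K\<^esub> u \<otimes>\<^bsub>K\<^esub> v) = v"
  using assms K.m_comm[of v u] by (simp_all add: K.m_assoc[symmetric])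

locale graded_domain =
  fixes K :: "('k, 'n) monoid_scheme" and R :: "('r, 'm) ring_scheme" (structure)
    and G :: "'k \<Rightarrow> 'r set"
  assumes integral: "graded_integral K R G"
begin

sublocale graded K R G
  using integral by unfold_locales (simp add: graded_integral_def)

abbreviation H where "H \<equiv> homog K R G"

lemma one_not_zero: "\<one> \<noteq> \<zero>"
  using integral by (simp add: graded_integral_def)

lemma homog_integral: "\<lbrakk>a \<in> H; b \<in> carrier R; a \<otimes> b = \<zero>\<rbrakk> \<Longrightarrow> b = \<zero>"
  using integral by (simp add: graded_integral_def)

lemma homog_mult: "\<lbrakk>a \<in> H; b \<in> H\<rbrakk> \<Longrightarrow> a \<otimes> b \<in> H"
  by (metis comp_mult homogE homogI homog_integral homog_closed homog_zero K.m_closed)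

lemma one_homog: "\<one> \<in> H"
  using one_comp one_not_zero by (auto intro: homogI)

sublocale Q: fractions R H
  by unfold_locales (auto intro: one_homog homog_mult homog_integral)

lemma homog_pow: "a \<in> H \<Longrightarrow> a [^] (n::nat) \<in> H"
  by (induction n) (auto intro: one_homog homog_mult)

text \<open>For a degree \<open>u\<close> other than the expected one, \<open>b\<close> times the
  component of \<open>c\<close> in degree \<open>u\<close> is a component of
  \<open>b \<otimes> c\<close> in a degree other than \<open>w\<close>. It vanishes, and
  \<open>b\<close> can be cancelled.\<close>

lemma cofactor_comp:
  assumes "b \<in> G v" "b \<noteq> \<zero>" "v \<in> carrier K" "c \<in> carrier R" "b \<otimes> c \<in> G w" "w \<in> carrier K"
  shows "c \<in> G (inv\<^bsub>K\<^esub> v \<otimes>\<^bsub>K\<^esub> w)"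
proof -
  let ?u = "inv\<^bsub>K\<^esub> v \<otimes>\<^bsub>K\<^esub> w"
  have b: "b \<in> H" using assms homogI by blast
  have "proj u c = \<zero>" if u: "u \<in> carrier K" "u \<noteq> ?u" for u
  proof -
    have "v \<otimes>\<^bsub>K\<^esub> u \<noteq> w"
      using u assms comp_inv_mult(1)[of v u] by (metis K.m_comm)
    then have "b \<otimes> proj u c = \<zero>"
      using assms u proj_mult[of b v u c] proj_comp[of "b \<otimes> c" w "v \<otimes>\<^bsub>K\<^esub> u"] by simp
    then show ?thesis using b u assms proj_closed comp_closed homog_integral by blast
  qed
  then have "{w \<in> carrier K. proj w c \<noteq> \<zero>} \<subseteq> {?u}" by blast
  then have "c = (\<Oplus> w\<in>{?u}. proj w c)"
    using assms by (intro sum_proj_superset) auto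
  moreover have "proj ?u c \<in> G ?u" "proj ?u c \<in> carrier R"
    using assms proj_closed[of c ?u] comp_closed by auto
  ultimately show ?thesis by simp
qed

lemma cofactor_homog:
  assumes "b \<in> H" "c \<in> carrier R" "b \<otimes> c \<in> H"
  shows "c \<in> H"
proof -
  obtain v w where "v \<in> carrier K" "b \<in> G v" "b \<noteq> \<zero>" "w \<in> carrier K" "b \<otimes> c \<in> G w" "b \<otimes> c \<noteq> \<zero>"
    using assms by (metis homogE)
  moreover from this have "c \<noteq> \<zero>" using assms by auto
  ultimately show ?thesis using cofactor_comp[of b v c w] assms by (intro homogI[of c "inv\<^bsub>K\<^esub> v \<otimes>\<^bsub>K\<^esub> w"]) auto
qed

lemma homog_cancel: "\<lbrakk>s \<in> H; a \<in> carrier R; b \<in> carrier R\<rbrakk> \<Longrightarrow> s \<otimes> a = s \<otimes> b \<longleftrightarrow> a = b"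
  by (rule Q.denom_cancel)

abbreviation M where "M \<equiv> R\<lparr>carrier := H\<rparr>"

lemma comm_monoid_cancel_homog: "comm_monoid_cancel M"
proof (intro comm_monoid_cancelI comm_monoidI)
  fix a b c assume "a \<otimes>\<^bsub>M\<^esub> c = b \<otimes>\<^bsub>M\<^esub> c" "a \<in> carrier M" "b \<in> carrier M" "c \<in> carrier M"
  then show "a = b" using homog_cancel[of c a b] by (simp add: m_comm homog_closed)
qed (auto simp: m_assoc one_homog homog_mult homog_closed intro: m_comm)

lemma Units_homog: "Units M = homog_units K R G"
proof
  show "Units M \<subseteq> homog_units K R G"
    by (auto simp: homog_units_def Units_def homog_closed)
  show "homog_units K R G \<subseteq> Units M"
  proof
    fix u assume "u \<in> homog_units K R G"
    then obtain c where u: "u \<in> H" "c \<in> carrier R" "u \<otimes> c = \<one>" "c \<otimes> u = \<one>"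
      by (auto simp: homog_units_def Units_def)
    then have "c \<in> H" using cofactor_homog[of u c] one_homog by simp
    then show "u \<in> Units M" using u by (auto simp: Units_def)
  qed
qed

section \<open>The graded fraction ring\<close>

abbreviation FR where "FR \<equiv> frac_ring K R G"
abbreviation FG where "FG \<equiv> frac_grading K R G"
abbreviation fr where "fr a s \<equiv> fraction R H a s"

lemma FR_def: "FR = localization R H"
  by (simp add: frac_ring_def)

lemmas fr_mult = Q.loc_mult[folded FR_def]
  and fr_add = Q.loc_add[folded FR_def]
  and fr_add_same = Q.loc_add_same[folded FR_def]
  and fr_zero = Q.loc_zero[folded FR_def]
  and fr_one = Q.loc_one[folded FR_def]
  and fr_eq_zero_iff = Q.fraction_eq_zero_iff[folded FR_def]
  and fr_minus = Q.loc_minus[folded FR_def]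
  and fr_closed [intro] = Q.loc_closed[folded FR_def]
  and fr_cases = Q.loc_cases[folded FR_def]
  and cring_FR = Q.cring_loc[folded FR_def]
  and fr_eq_iff = Q.fraction_eq_iff
  and fr_eqI = Q.fraction_eqI

text \<open>\<open>frac_grading\<close> only asks for some representative with matching degrees.
  Cross multiplication and \<open>cofactor_comp\<close> transfer the degree to every
  representative.\<close>

lemma fr_mem_FG_iff:
  assumes "a \<in> carrier R" "s \<in> H" "s \<in> G u" "u \<in> carrier K" "w \<in> carrier K"
  shows "fr a s \<in> FG w \<longleftrightarrow> a \<in> G (w \<otimes>\<^bsub>K\<^esub> u)"
proof
  assume "a \<in> G (w \<otimes>\<^bsub>K\<^esub> u)" then show "fr a s \<in> FG w"
    using assms by (auto simp: frac_grading_def)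
next
  assume "fr a s \<in> FG w"
  then obtain b t u' where h: "fr a s = fr b t" "t \<in> H" "u' \<in> carrier K" "t \<in> G u'" "b \<in> G (w \<otimes>\<^bsub>K\<^esub> u')"
    by (auto simp: frac_grading_def)
  have b: "b \<in> carrier R" using h assms comp_closed by blast
  then have "a \<otimes> t = b \<otimes> s" using h assms by (simp add: fr_eq_iff)
  then have "t \<otimes> a \<in> G (w \<otimes>\<^bsub>K\<^esub> u' \<otimes>\<^bsub>K\<^esub> u)"
    using comp_mult[of "w \<otimes>\<^bsub>K\<^esub> u'" u b s] h assms by (simp add: m_comm homog_closed)
  then have "a \<in> G (inv\<^bsub>K\<^esub> u' \<otimes>\<^bsub>K\<^esub> (w \<otimes>\<^bsub>K\<^esub> u' \<otimes>\<^bsub>K\<^esub> u))"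
    using cofactor_comp[of t u' a "w \<otimes>\<^bsub>K\<^esub> u' \<otimes>\<^bsub>K\<^esub> u"] h assms homog_zero by (metis K.m_closed)
  moreover have "inv\<^bsub>K\<^esub> u' \<otimes>\<^bsub>K\<^esub> (w \<otimes>\<^bsub>K\<^esub> u' \<otimes>\<^bsub>K\<^esub> u) = w \<otimes>\<^bsub>K\<^esub> u"
    using assms h comp_inv_mult(1)[of u' "w \<otimes>\<^bsub>K\<^esub> u"] by (simp add: K.m_ac)
  ultimately show "a \<in> G (w \<otimes>\<^bsub>K\<^esub> u)" by simp
qed

lemma FG_cases:
  assumes "x \<in> FG w" "w \<in> carrier K"
  obtains a s u where "s \<in> H" "u \<in> carrier K" "s \<in> G u" "a \<in> G (w \<otimes>\<^bsub>K\<^esub> u)" "a \<in> carrier R" "x = fr a s"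
proof -
  obtain a s u where h: "x = fr a s" "s \<in> H" "u \<in> carrier K" "s \<in> G u" "a \<in> G (w \<otimes>\<^bsub>K\<^esub> u)"
    using assms by (auto simp: frac_grading_def)
  then show thesis using that[of s u a] assms comp_closed by blast
qed

lemma homog_FR: "homog K FR FG = {fr a s | a s. a \<in> H \<and> s \<in> H}"
proof (intro equalityI subsetI)
  fix x assume "x \<in> homog K FR FG"
  then obtain w where w: "w \<in> carrier K" "x \<in> FG w" "x \<noteq> \<zero>\<^bsub>FR\<^esub>" by (auto simp: homog_def)
  obtain a s u where h: "s \<in> H" "u \<in> carrier K" "s \<in> G u" "a \<in> G (w \<otimes>\<^bsub>K\<^esub> u)" "a \<in> carrier R" "x = fr a s"
    using FG_cases[OF w(2,1)] .
  then have "a \<in> H" using w fr_eq_zero_iff[of a s] by (intro homogI[of a "w \<otimes>\<^bsub>K\<^esub> u"]) auto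
  then show "x \<in> {fr a s | a s. a \<in> H \<and> s \<in> H}" using h by blast
next
  fix x assume "x \<in> {fr a s | a s. a \<in> H \<and> s \<in> H}"
  then obtain a s where h: "x = fr a s" "a \<in> H" "s \<in> H" by blast
  obtain u v where u: "u \<in> carrier K" "s \<in> G u" "v \<in> carrier K" "a \<in> G v"
    using h by (metis homogE)
  have "v \<otimes>\<^bsub>K\<^esub> inv\<^bsub>K\<^esub> u \<otimes>\<^bsub>K\<^esub> u = v" using u by (simp add: K.m_assoc)
  then have "x \<in> FG (v \<otimes>\<^bsub>K\<^esub> inv\<^bsub>K\<^esub> u)"
    using h u fr_mem_FG_iff[of a s u "v \<otimes>\<^bsub>K\<^esub> inv\<^bsub>K\<^esub> u"] by (simp add: homog_closed)
  moreover have "x \<noteq> \<zero>\<^bsub>FR\<^esub>" using h fr_eq_zero_iff[of a s] homog_zero by auto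
  ultimately show "x \<in> homog K FR FG" using u by (auto simp: homog_def)
qed

lemma fr_mem_homog_iff:
  assumes "a \<in> carrier R" "s \<in> H"
  shows "fr a s \<in> homog K FR FG \<longleftrightarrow> a \<in> H"
proof
  assume "fr a s \<in> homog K FR FG"
  then obtain b t where "fr a s = fr b t" "b \<in> H" "t \<in> H" by (auto simp: homog_FR)
  then have "t \<otimes> a \<in> H" using assms by (simp add: fr_eq_iff homog_closed m_comm homog_mult)
  then show "a \<in> H" using cofactor_homog assms \<open>t \<in> H\<close> by blast
qed (use assms in \<open>auto simp: homog_FR\<close>)

text \<open>Denominators are homogeneous in every representation, so a component of a fraction is
  obtained by projecting the numerator to the shifted degree. That the choice of representative is
  immaterial is \<open>frproj_fr\<close>.\<close>

definition frproj :: "'k \<Rightarrow> ('r \<times> 'r) set \<Rightarrow> ('r \<times> 'r) set" where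
  "frproj w x = (SOME y. \<exists>a s u. a \<in> carrier R \<and> s \<in> H \<and> u \<in> carrier K \<and> s \<in> G u \<and> x = fr a s \<and>
     y = fr (proj (w \<otimes>\<^bsub>K\<^esub> u) a) s)"

lemma frproj_fr:
  assumes "a \<in> carrier R" "s \<in> H" "s \<in> G u" "u \<in> carrier K" "w \<in> carrier K"
  shows "frproj w (fr a s) = fr (proj (w \<otimes>\<^bsub>K\<^esub> u) a) s"
  unfolding frproj_def
proof (rule some_equality)
  fix y assume "\<exists>a' s' u. a' \<in> carrier R \<and> s' \<in> H \<and> u \<in> carrier K \<and> s' \<in> G u \<and> fr a s = fr a' s' \<and>
     y = fr (proj (w \<otimes>\<^bsub>K\<^esub> u) a') s'"
  then obtain b t v where h: "b \<in> carrier R" "t \<in> H" "v \<in> carrier K" "t \<in> G v" "fr a s = fr b t"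
    "y = fr (proj (w \<otimes>\<^bsub>K\<^esub> v) b) t" by blast
  have pc: "proj (w \<otimes>\<^bsub>K\<^esub> v) b \<in> carrier R" "proj (w \<otimes>\<^bsub>K\<^esub> u) a \<in> carrier R"
    using assms h comp_closed[OF proj_closed] by simp_all
  have "t \<otimes> a = s \<otimes> b" using assms h by (simp add: fr_eq_iff m_comm homog_closed)
  then have "proj (v \<otimes>\<^bsub>K\<^esub> (w \<otimes>\<^bsub>K\<^esub> u)) (t \<otimes> a) = proj (u \<otimes>\<^bsub>K\<^esub> (w \<otimes>\<^bsub>K\<^esub> v)) (s \<otimes> b)"
    using assms h by (simp add: K.m_ac)
  then have "t \<otimes> proj (w \<otimes>\<^bsub>K\<^esub> u) a = s \<otimes> proj (w \<otimes>\<^bsub>K\<^esub> v) b"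
    using assms h by (simp add: proj_mult)
  then show "y = fr (proj (w \<otimes>\<^bsub>K\<^esub> u) a) s"
    unfolding h(6) using assms h pc by (intro fr_eqI) (simp_all add: m_comm homog_closed)
qed (use assms in blast)

lemma graded_ring_FR: "graded_ring K FR FG"
proof (rule graded_ringI[where P = frproj])
  interpret FR: cring FR by (rule cring_FR)
  show "comm_group K" "cring FR" by (fact K.comm_group_axioms cring_FR)+
  have pc: "proj w a \<in> carrier R" if "a \<in> carrier R" "w \<in> carrier K" for a w
    using that comp_closed[OF proj_closed] by blast
  have FRcases: "\<exists>a s u. a \<in> carrier R \<and> s \<in> H \<and> u \<in> carrier K \<and> s \<in> G u \<and> x = fr a s"
    if "x \<in> carrier FR" for x
    using that by (metis fr_cases homogE)
  have FGsub: "FG w \<subseteq> carrier FR" if "w \<in> carrier K" for w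
    using FG_cases[OF _ that] by (metis fr_closed subsetI)
  show "additive_subgroup (FG w) FR" if w: "w \<in> carrier K" for w
  proof (intro additive_subgroup.intro subgroup.intro)
    show "FG w \<subseteq> carrier (add_monoid FR)" using FGsub w by simp
    show "\<one>\<^bsub>add_monoid FR\<^esub> \<in> FG w"
      using w fr_mem_FG_iff[of \<zero> \<one> "\<one>\<^bsub>K\<^esub>" w] one_comp one_homog comp_zero by (simp add: fr_zero)
    fix x y assume x: "x \<in> FG w"
    obtain a s u where h: "s \<in> H" "u \<in> carrier K" "s \<in> G u" "a \<in> G (w \<otimes>\<^bsub>K\<^esub> u)" "a \<in> carrier R" "x = fr a s"
      using FG_cases[OF x w] .
    have "\<ominus>\<^bsub>FR\<^esub> x \<in> FG w"
      using h w fr_mem_FG_iff[of "\<ominus> a" s u w] by (simp add: fr_minus comp_minus)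
    then show "inv\<^bsub>add_monoid FR\<^esub> x \<in> FG w" by (simp add: a_inv_def)
    assume y: "y \<in> FG w"
    obtain b t v where g: "t \<in> H" "v \<in> carrier K" "t \<in> G v" "b \<in> G (w \<otimes>\<^bsub>K\<^esub> v)" "b \<in> carrier R" "y = fr b t"
      using FG_cases[OF y w] .
    have "a \<otimes> t \<in> G (w \<otimes>\<^bsub>K\<^esub> u \<otimes>\<^bsub>K\<^esub> v)" "b \<otimes> s \<in> G (w \<otimes>\<^bsub>K\<^esub> v \<otimes>\<^bsub>K\<^esub> u)"
      using h g w by (auto intro!: comp_mult)
    moreover have "w \<otimes>\<^bsub>K\<^esub> v \<otimes>\<^bsub>K\<^esub> u = w \<otimes>\<^bsub>K\<^esub> u \<otimes>\<^bsub>K\<^esub> v" using h g w by (simp add: K.m_ac)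
    ultimately have "a \<otimes> t \<oplus> b \<otimes> s \<in> G (w \<otimes>\<^bsub>K\<^esub> (u \<otimes>\<^bsub>K\<^esub> v))"
      using h g w by (simp add: K.m_assoc comp_add)
    moreover have "s \<otimes> t \<in> G (u \<otimes>\<^bsub>K\<^esub> v)" "s \<otimes> t \<in> H" using h g by (auto intro: comp_mult homog_mult)
    ultimately show "x \<otimes>\<^bsub>add_monoid FR\<^esub> y \<in> FG w"
      using h g w fr_mem_FG_iff[of "a \<otimes> t \<oplus> b \<otimes> s" "s \<otimes> t" "u \<otimes>\<^bsub>K\<^esub> v" w]
      by (simp add: fr_add homog_closed)
  qed
  show "x \<otimes>\<^bsub>FR\<^esub> y \<in> FG (w \<otimes>\<^bsub>K\<^esub> w')"
    if w: "w \<in> carrier K" "w' \<in> carrier K" and x: "x \<in> FG w" and y: "y \<in> FG w'" for w w' x y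
  proof -
    obtain a s u where h: "s \<in> H" "u \<in> carrier K" "s \<in> G u" "a \<in> G (w \<otimes>\<^bsub>K\<^esub> u)" "a \<in> carrier R" "x = fr a s"
      using FG_cases[OF x w(1)] .
    obtain b t v where g: "t \<in> H" "v \<in> carrier K" "t \<in> G v" "b \<in> G (w' \<otimes>\<^bsub>K\<^esub> v)" "b \<in> carrier R" "y = fr b t"
      using FG_cases[OF y w(2)] .
    have "a \<otimes> b \<in> G (w \<otimes>\<^bsub>K\<^esub> u \<otimes>\<^bsub>K\<^esub> (w' \<otimes>\<^bsub>K\<^esub> v))" "s \<otimes> t \<in> G (u \<otimes>\<^bsub>K\<^esub> v)" "s \<otimes> t \<in> H"
      using h g w by (auto intro!: comp_mult homog_mult)
    moreover have "w \<otimes>\<^bsub>K\<^esub> u \<otimes>\<^bsub>K\<^esub> (w' \<otimes>\<^bsub>K\<^esub> v) = w \<otimes>\<^bsub>K\<^esub> w' \<otimes>\<^bsub>K\<^esub> (u \<otimes>\<^bsub>K\<^esub> v)"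
      using h g w by (simp add: K.m_ac)
    ultimately show ?thesis
      using h g w fr_mem_FG_iff[of "a \<otimes> b" "s \<otimes> t" "u \<otimes>\<^bsub>K\<^esub> v" "w \<otimes>\<^bsub>K\<^esub> w'"]
      by (simp add: fr_mult)
  qed
  show "frproj w x \<in> FG w" if w: "w \<in> carrier K" "x \<in> carrier FR" for w x
  proof -
    obtain a s u where h: "a \<in> carrier R" "s \<in> H" "u \<in> carrier K" "s \<in> G u" "x = fr a s"
      using FRcases w(2) by blast
    then show ?thesis using w pc by (simp add: frproj_fr fr_mem_FG_iff proj_closed)
  qed
  show "frproj w (x \<oplus>\<^bsub>FR\<^esub> y) = frproj w x \<oplus>\<^bsub>FR\<^esub> frproj w y"
    if w: "w \<in> carrier K" and x: "x \<in> carrier FR" and y: "y \<in> carrier FR" for w x y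
  proof -
    obtain a s u where h: "a \<in> carrier R" "s \<in> H" "u \<in> carrier K" "s \<in> G u" "x = fr a s"
      using FRcases x by blast
    obtain b t v where g: "b \<in> carrier R" "t \<in> H" "v \<in> carrier K" "t \<in> G v" "y = fr b t"
      using FRcases y by blast
    have st: "s \<otimes> t \<in> G (u \<otimes>\<^bsub>K\<^esub> v)" "s \<otimes> t \<in> H" using h g by (auto intro: comp_mult homog_mult)
    have "proj (w \<otimes>\<^bsub>K\<^esub> (u \<otimes>\<^bsub>K\<^esub> v)) (a \<otimes> t \<oplus> b \<otimes> s)
        = proj (v \<otimes>\<^bsub>K\<^esub> (w \<otimes>\<^bsub>K\<^esub> u)) (t \<otimes> a) \<oplus> proj (u \<otimes>\<^bsub>K\<^esub> (w \<otimes>\<^bsub>K\<^esub> v)) (s \<otimes> b)"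
      using h g w by (simp add: proj_add homog_closed m_comm K.m_ac)
    also have "\<dots> = proj (w \<otimes>\<^bsub>K\<^esub> u) a \<otimes> t \<oplus> proj (w \<otimes>\<^bsub>K\<^esub> v) b \<otimes> s"
      using h g w pc by (simp add: proj_mult) (simp add: m_comm homog_closed)
    finally show ?thesis
      using h g w pc st by (simp add: fr_add frproj_fr[of _ "s \<otimes> t" "u \<otimes>\<^bsub>K\<^esub> v"] frproj_fr[of _ _ u] frproj_fr[of _ _ v] homog_closed)
  qed
  show "frproj w x = (if v = w then x else \<zero>\<^bsub>FR\<^esub>)"
    if w: "v \<in> carrier K" "w \<in> carrier K" and x: "x \<in> FG v" for v w x
  proof -
    obtain a s u where h: "s \<in> H" "u \<in> carrier K" "s \<in> G u" "a \<in> G (v \<otimes>\<^bsub>K\<^esub> u)" "a \<in> carrier R" "x = fr a s"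
      using FG_cases[OF x w(1)] .
    have "w \<otimes>\<^bsub>K\<^esub> u = v \<otimes>\<^bsub>K\<^esub> u \<longleftrightarrow> v = w" using h w by auto
    then show ?thesis using h w fr_eq_zero_iff[of \<zero> s]
      by (auto simp: frproj_fr[of _ _ u] proj_comp[of a "v \<otimes>\<^bsub>K\<^esub> u"])
  qed
  fix x assume x: "x \<in> carrier FR"
  obtain a s u where h: "a \<in> carrier R" "s \<in> H" "u \<in> carrier K" "s \<in> G u" "x = fr a s"
    using FRcases x by blast
  have eq: "frproj w x = fr (proj (w \<otimes>\<^bsub>K\<^esub> u) a) s" if "w \<in> carrier K" for w
    using h that by (simp add: frproj_fr)
  let ?T = "{w \<in> carrier K. frproj w x \<noteq> \<zero>\<^bsub>FR\<^esub>}"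
  have T: "?T = {w \<in> carrier K. proj (w \<otimes>\<^bsub>K\<^esub> u) a \<noteq> \<zero>}"
    using fr_eq_zero_iff[OF pc h(2)] eq h(3) by (metis (no_types, lifting) K.m_closed h(1))
  \<comment> \<open>The degrees of \<open>x\<close> are those of its numerator \<open>a\<close>
    shifted by the degree \<open>u\<close> of the denominator, so the decomposition of
    \<open>a\<close> can be reindexed to one of \<open>x\<close>.\<close>
  have inj: "inj_on (\<lambda>w. w \<otimes>\<^bsub>K\<^esub> u) ?T" using h by (auto simp: inj_on_def)
  have img: "(\<lambda>w. w \<otimes>\<^bsub>K\<^esub> u) ` ?T = {w \<in> carrier K. proj w a \<noteq> \<zero>}"
  proof (intro equalityI subsetI)
    fix v assume v: "v \<in> {w \<in> carrier K. proj w a \<noteq> \<zero>}"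
    then have "v = (v \<otimes>\<^bsub>K\<^esub> inv\<^bsub>K\<^esub> u) \<otimes>\<^bsub>K\<^esub> u" using h by (simp add: K.m_assoc)
    then show "v \<in> (\<lambda>w. w \<otimes>\<^bsub>K\<^esub> u) ` ?T" unfolding T using v h
      by (intro image_eqI[of _ _ "v \<otimes>\<^bsub>K\<^esub> inv\<^bsub>K\<^esub> u"]) auto
  qed (use T h in auto)
  show fin: "finite ?T"
    using finite_imageD[OF _ inj] finite_proj[OF h(1)] unfolding img by blast
  have sumfr: "(\<Oplus>\<^bsub>FR\<^esub>w\<in>T. fr (c w) s) = fr (\<Oplus>w\<in>T. c w) s"
    if "finite T" "\<And>w. w \<in> T \<Longrightarrow> c w \<in> carrier R" for T and c :: "'k \<Rightarrow> 'r"
    using that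
  proof (induction T rule: finite_induct)
    case empty
    then show ?case using h fr_eq_zero_iff[of \<zero> s] by simp
  next
    case (insert v T)
    have "(\<Oplus>w\<in>T. c w) \<in> carrier R" using insert.prems by (intro finsum_closed) auto
    moreover have "(\<lambda>w. fr (c w) s) \<in> T \<rightarrow> carrier FR" "fr (c v) s \<in> carrier FR"
      using insert.prems h fr_closed by auto
    ultimately show ?case
      using insert h FR.finsum_insert[of T v "\<lambda>w. fr (c w) s"] by (simp add: fr_add_same Pi_def)
  qed
  have "a = (\<Oplus>w\<in>(\<lambda>w. w \<otimes>\<^bsub>K\<^esub> u) ` ?T. proj w a)"
    unfolding img by (rule sum_proj[OF h(1)])
  also have "\<dots> = (\<Oplus>w\<in>?T. proj (w \<otimes>\<^bsub>K\<^esub> u) a)"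
    using inj h pc by (intro add.finprod_reindex) auto
  finally have "x = fr (\<Oplus>w\<in>?T. proj (w \<otimes>\<^bsub>K\<^esub> u) a) s" using h by simp
  also have "\<dots> = (\<Oplus>\<^bsub>FR\<^esub>w\<in>?T. fr (proj (w \<otimes>\<^bsub>K\<^esub> u) a) s)"
    using fin h pc by (intro sumfr[symmetric]) auto
  also have "\<dots> = (\<Oplus>\<^bsub>FR\<^esub>w\<in>?T. frproj w x)"
    using fr_closed[OF pc[OF h(1)] h(2)] h(3) by (intro FR.finsum_cong') (auto simp: eq)
  finally show "x = (\<Oplus>\<^bsub>FR\<^esub>w\<in>?T. frproj w x)" .
qed

lemma fr_inverse:
  assumes "a \<in> H" "s \<in> H"
  shows "fr a s \<otimes>\<^bsub>FR\<^esub> fr s a = \<one>\<^bsub>FR\<^esub>"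
  using assms by (simp add: fr_mult fr_one homog_closed) (intro fr_eqI; simp add: homog_closed homog_mult one_homog m_comm)

lemma one_FR_not_zero: "\<one>\<^bsub>FR\<^esub> \<noteq> \<zero>\<^bsub>FR\<^esub>"
  using fr_eq_zero_iff[of \<one> \<one>] one_homog one_not_zero by (simp add: fr_one)

lemma graded_simple_FR: "graded_simple K FR FG"
  unfolding graded_simple_def
proof (intro conjI graded_ring_FR one_FR_not_zero subsetI)
  fix x assume "x \<in> homog K FR FG"
  then obtain a s where "x = fr a s" "a \<in> H" "s \<in> H" by (auto simp: homog_FR)
  then show "x \<in> Units FR"
    unfolding Units_def using fr_inverse[of a s] fr_inverse[of s a] by (auto simp: homog_closed)
qed

end

section \<open>Valuations at graded primes\<close>

text \<open>The elementwise form of a discrete valuation of \<open>Q\<^sup>+(R)\<close> with valuation ring \<open>R\<^sub>p\<close>.\<close>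

definition graded_ord ::
  "('k, 'n) monoid_scheme \<Rightarrow> ('r, 'm) ring_scheme \<Rightarrow> ('k \<Rightarrow> 'r set) \<Rightarrow> 'r set \<Rightarrow> ('r \<Rightarrow> int) \<Rightarrow> bool" where
  "graded_ord K R G p v \<longleftrightarrow>
     (\<forall>a\<in>homog K R G. \<forall>b\<in>homog K R G. v (a \<otimes>\<^bsub>R\<^esub> b) = v a + v b) \<and>
     (\<exists>a\<in>homog K R G. \<exists>b\<in>homog K R G. v a = v b + 1) \<and>
     (\<forall>a\<in>homog K R G. \<forall>b\<in>homog K R G.
        v b \<le> v a \<longleftrightarrow> (\<exists>s\<in>homog K R G - p. \<exists>c\<in>carrier R. s \<otimes>\<^bsub>R\<^esub> a = b \<otimes>\<^bsub>R\<^esub> c))"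

text \<open>Evaluated at an arbitrary representative; additivity of \<open>v\<close> makes the
  choice immaterial (\<open>frac_val_fr\<close>). It is extensional because
  \<open>discrete_valuation\<close> asks for this.\<close>

definition frac_val ::
  "('k, 'n) monoid_scheme \<Rightarrow> ('r, 'm) ring_scheme \<Rightarrow> ('k \<Rightarrow> 'r set) \<Rightarrow> ('r \<Rightarrow> int) \<Rightarrow> ('r \<times> 'r) set \<Rightarrow> int" where
  "frac_val K R G v = (\<lambda>x\<in>homog K (frac_ring K R G) (frac_grading K R G).
     case (SOME p. p \<in> x) of (a, s) \<Rightarrow> v a - v s)"

context graded_domain
begin

lemma graded_primeD:
  assumes "graded_prime K R G p"
  shows "ideal p R" "\<one> \<notin> p" "p = Idl (p \<inter> H)"
    and "\<lbrakk>a \<in> H; b \<in> H; a \<otimes> b \<in> p\<rbrakk> \<Longrightarrow> a \<in> p \<or> b \<in> p"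
proof -
  show p: "ideal p R" "p = Idl (p \<inter> H)" using assms by (simp_all add: graded_prime_def)
  show "\<one> \<notin> p" using assms ideal.one_imp_carrier[OF p(1)] by (auto simp: graded_prime_def)
qed (use assms in \<open>auto simp: graded_prime_def\<close>)

lemma graded_prime_compl:
  assumes "graded_prime K R G p"
  shows "\<one> \<in> H - p" "\<lbrakk>a \<in> H - p; b \<in> H - p\<rbrakk> \<Longrightarrow> a \<otimes> b \<in> H - p"
  using graded_primeD[OF assms] one_homog homog_mult by blast+

lemma graded_prime_homog_nonempty:
  assumes "graded_prime K R G p" "p \<noteq> {\<zero>}"
  shows "p \<inter> H \<noteq> {}"
proof
  assume e: "p \<inter> H = {}"
  have "p = Idl {}" using graded_primeD(3)[OF assms(1)] unfolding e .
  moreover have "Idl {} \<subseteq> {\<zero>}" using genideal_minimal[OF zeroideal] by blast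
  moreover have "\<zero> \<in> p" using graded_primeD(1)[OF assms(1)] ideal.axioms(1) additive_subgroup.zero_closed by blast
  ultimately show False using assms(2) by blast
qed

lemma graded_ordD:
  assumes "graded_ord K R G p v"
  shows "\<And>a b. \<lbrakk>a \<in> H; b \<in> H\<rbrakk> \<Longrightarrow> v (a \<otimes> b) = v a + v b"
    and "\<And>a b. \<lbrakk>a \<in> H; b \<in> H\<rbrakk> \<Longrightarrow> v b \<le> v a \<longleftrightarrow> (\<exists>s\<in>H - p. \<exists>c\<in>carrier R. s \<otimes> a = b \<otimes> c)"
    and "\<exists>a\<in>H. \<exists>b\<in>H. v a = v b + 1"
    and "v \<one> = 0"
    and "\<And>a (n::nat). a \<in> H \<Longrightarrow> v (a [^] n) = int n * v a"
proof -
  show 1: "\<And>a b. \<lbrakk>a \<in> H; b \<in> H\<rbrakk> \<Longrightarrow> v (a \<otimes> b) = v a + v b"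
    and "\<And>a b. \<lbrakk>a \<in> H; b \<in> H\<rbrakk> \<Longrightarrow> v b \<le> v a \<longleftrightarrow> (\<exists>s\<in>H - p. \<exists>c\<in>carrier R. s \<otimes> a = b \<otimes> c)"
    and "\<exists>a\<in>H. \<exists>b\<in>H. v a = v b + 1"
    using assms unfolding graded_ord_def by blast+
  have "v (\<one> \<otimes> \<one>) = v \<one> + v \<one>" using 1 one_homog by blast
  then show 0: "v \<one> = 0" by simp
  show "v (a [^] n) = int n * v a" if "a \<in> H" for a and n :: nat
    by (induction n) (use that 0 in \<open>auto simp: 1 homog_pow algebra_simps\<close>)
qed

lemma graded_ord_nonneg:
  assumes "graded_ord K R G p v" "graded_prime K R G p" "a \<in> H"
  shows "0 \<le> v a"
proof -
  have "\<one> \<otimes> a = \<one> \<otimes> a" ..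
  then have "v \<one> \<le> v a"
    using graded_ordD(2)[OF assms(1), of a \<one>] graded_prime_compl(1)[OF assms(2)] assms(3) one_homog by blast
  then show ?thesis by (simp add: graded_ordD(4)[OF assms(1)])
qed

text \<open>Compare with \<open>v \<one> = 0\<close>: the value of \<open>a\<close> is at most 0 iff
  some \<open>s\<close> outside \<open>p\<close> is a multiple of \<open>a\<close>, and this means
  that \<open>a\<close> itself lies outside \<open>p\<close>.\<close>

lemma graded_ord_pos_iff:
  assumes "graded_ord K R G p v" "graded_prime K R G p" "a \<in> H"
  shows "0 < v a \<longleftrightarrow> a \<in> p"
proof -
  interpret p: ideal p R by (rule graded_primeD(1)[OF assms(2)])
  have "v a \<le> v \<one> \<longleftrightarrow> (\<exists>s\<in>H - p. \<exists>c\<in>carrier R. s \<otimes> \<one> = a \<otimes> c)"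
    using graded_ordD(2)[OF assms(1) one_homog assms(3)] .
  also have "\<dots> \<longleftrightarrow> a \<notin> p"
  proof
    assume "\<exists>s\<in>H - p. \<exists>c\<in>carrier R. s \<otimes> \<one> = a \<otimes> c"
    then obtain s c where "s \<in> H" "s \<notin> p" "c \<in> carrier R" "s = a \<otimes> c"
      by (auto simp: homog_closed)
    then show "a \<notin> p" using p.I_r_closed by blast
  next
    assume "a \<notin> p"
    moreover have "a \<otimes> \<one> = a \<otimes> \<one>" ..
    ultimately show "\<exists>s\<in>H - p. \<exists>c\<in>carrier R. s \<otimes> \<one> = a \<otimes> c" using assms(3) by blast
  qed
  finally show ?thesis using graded_ordD(4)[OF assms(1)] by auto
qed

lemma graded_ord_zero:
  assumes "graded_ord K R G p v" "graded_prime K R G p" "a \<in> H - p"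
  shows "v a = 0"
  using graded_ord_pos_iff[OF assms(1,2)] graded_ord_nonneg[OF assms(1,2)] assms(3)
  by (metis DiffD1 DiffD2 order_antisym_conv not_less)

text \<open>A graded prime is generated by its homogeneous elements, which are those of positive
  value.\<close>

lemma graded_ord_inj:
  assumes "graded_ord K R G p v" "graded_prime K R G p" "graded_ord K R G q w" "graded_prime K R G q"
    and "\<And>a. a \<in> H \<Longrightarrow> v a = w a"
  shows "p = q"
proof -
  have "a \<in> p \<longleftrightarrow> a \<in> q" if "a \<in> H" for a
    using graded_ord_pos_iff[OF assms(1,2) that] graded_ord_pos_iff[OF assms(3,4) that] assms(5)[OF that] by simp
  then have "p \<inter> H = q \<inter> H" by blast
  then show ?thesis using graded_primeD(3) assms by metis
qed

text \<open>Both functions induce the same order on homogeneous elements, as this order is described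
  in terms of \<open>p\<close> alone. Hence \<open>w\<close> is proportional to \<open>v\<close>,
  and since each of them attains the difference 1, the factor is a non-negative unit of the
  integers.\<close>

lemma graded_ord_unique:
  assumes v: "graded_ord K R G p v" and w: "graded_ord K R G p w" and a: "a \<in> H"
  shows "v a = w a"
proof -
  have le: "v b \<le> v a \<longleftrightarrow> w b \<le> w a" if "a \<in> H" "b \<in> H" for a b
    using that graded_ordD(2)[OF v] graded_ordD(2)[OF w] by simp
  obtain x y where xy: "x \<in> H" "y \<in> H" "v x = v y + 1" using graded_ordD(3)[OF v] by blast
  define m where "m = w x - w y"
  \<comment> \<open>If \<open>v a = k + v b\<close>, then \<open>a y^k\<close> and
    \<open>b x^k\<close> have the same value under \<open>v\<close>, therefore also under
    \<open>w\<close>.\<close>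
  have nat: "w a = int k * m + w b" if "a \<in> H" "b \<in> H" "v a = int k + v b" for a b k
  proof -
    let ?c = "a \<otimes> y [^] k" and ?d = "b \<otimes> x [^] k"
    have "v ?c = v ?d"
      using that xy by (simp add: graded_ordD[OF v] homog_pow algebra_simps)
    then have "w ?c = w ?d"
      using le[of ?c ?d] le[of ?d ?c] that xy by (simp add: homog_mult homog_pow)
    then show ?thesis
      using that xy by (simp add: graded_ordD[OF w] homog_pow m_def algebra_simps)
  qed
  have gen: "w a - w b = (v a - v b) * m" if "a \<in> H" "b \<in> H" for a b
  proof (cases "v b \<le> v a")
    case True
    then show ?thesis using nat[OF that, of "nat (v a - v b)"] by simp
  next
    case False
    then show ?thesis using nat[OF that(2,1), of "nat (v b - v a)"] by (simp add: algebra_simps)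
  qed
  obtain x' y' where "x' \<in> H" "y' \<in> H" "w x' = w y' + 1" using graded_ordD(3)[OF w] by blast
  then have "(v x' - v y') * m = 1" using gen[of x' y'] by simp
  moreover have "0 \<le> m" using le[of x y] xy by (simp add: m_def)
  ultimately have "m = 1" by (auto simp: zmult_eq_1_iff)
  then show ?thesis
    using gen[of a \<one>] a one_homog graded_ordD(4)[OF v] graded_ordD(4)[OF w] by simp
qed

lemma frac_val_fr:
  assumes v: "\<And>a b. \<lbrakk>a \<in> H; b \<in> H\<rbrakk> \<Longrightarrow> v (a \<otimes> b) = v a + v b" and a: "a \<in> H" "s \<in> H"
  shows "frac_val K R G v (fr a s) = v a - v s"
proof -
  obtain b t where bt: "(SOME p. p \<in> fr a s) = (b, t)" by (cases "SOME p. p \<in> fr a s")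
  have "(b, t) \<in> fr a s"
    unfolding bt[symmetric] using a Q.self_mem_fraction by (metis homog_closed someI)
  then have h: "b \<in> carrier R" "t \<in> H" "a \<otimes> t = b \<otimes> s"
    using Q.mem_fraction_iff a by (auto simp: homog_closed)
  have "s \<otimes> b \<in> H" using h a homog_mult m_comm by (metis homog_closed)
  then have "b \<in> H" using cofactor_homog a h by blast
  then have "v a + v t = v b + v s" using v h a by metis
  then show ?thesis
    using a bt fr_mem_homog_iff[of a s] by (simp add: frac_val_def homog_closed)
qed

lemma frac_val_eqI:
  assumes "\<nu> \<in> extensional (homog K FR FG)"
    and "\<And>a b. \<lbrakk>a \<in> H; b \<in> H\<rbrakk> \<Longrightarrow> v (a \<otimes> b) = v a + v b"
    and "\<And>a s. \<lbrakk>a \<in> H; s \<in> H\<rbrakk> \<Longrightarrow> \<nu> (fr a s) = v a - v s"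
  shows "frac_val K R G v = \<nu>"
proof (rule extensionalityI[of _ "homog K FR FG"])
  show "frac_val K R G v \<in> extensional (homog K FR FG)" by (simp add: frac_val_def)
  show "frac_val K R G v x = \<nu> x" if "x \<in> homog K FR FG" for x
    using that assms(2,3) frac_val_fr[of v] by (auto simp: homog_FR)
qed (fact assms)

lemma zero_FR_generate: "\<zero>\<^bsub>FR\<^esub> \<in> generate_ring FR X"
  using ring.zero_in_generate[of FR X] cring_FR by (simp add: cring_def)

lemma discrete_valuation_frac_val:
  assumes v: "graded_ord K R G p v" and p: "graded_prime K R G p"
  shows "discrete_valuation K FR FG (frac_val K R G v)"
  unfolding discrete_valuation_def
proof (intro conjI ballI impI)
  note vm = graded_ordD(1)[OF v]
  note val = frac_val_fr[of v, OF vm]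
  show "frac_val K R G v \<in> extensional (homog K FR FG)" by (simp add: frac_val_def)
  obtain x y where xy: "x \<in> H" "y \<in> H" "v x = v y + 1" using graded_ordD(3)[OF v] by blast
  \<comment> \<open>The fraction \<open>x / y\<close> has value 1, so its powers and those of
    \<open>y / x\<close> attain all integers.\<close>
  have "n \<in> frac_val K R G v ` homog K FR FG" for n :: int
  proof (cases n rule: int_cases2)
    case (nonneg k)
    let ?x = "fr (x [^] k) (y [^] k)"
    have "frac_val K R G v ?x = n"
      using nonneg xy by (simp add: val homog_pow graded_ordD(5)[OF v] algebra_simps)
    moreover have "?x \<in> homog K FR FG" using xy by (simp add: fr_mem_homog_iff homog_pow homog_closed)
    ultimately show ?thesis by (metis imageI)
  next
    case (nonpos k)
    let ?x = "fr (y [^] k) (x [^] k)"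
    have "frac_val K R G v ?x = n"
      using nonpos xy by (simp add: val homog_pow graded_ordD(5)[OF v] algebra_simps)
    moreover have "?x \<in> homog K FR FG" using xy by (simp add: fr_mem_homog_iff homog_pow homog_closed)
    ultimately show ?thesis by (metis imageI)
  qed
  then show "frac_val K R G v ` homog K FR FG = UNIV" by auto
  show "frac_val K R G v (x \<otimes>\<^bsub>FR\<^esub> y) = frac_val K R G v x + frac_val K R G v y"
    if "x \<in> homog K FR FG" "y \<in> homog K FR FG" for x y
    using that by (auto simp: homog_FR fr_mult homog_closed val homog_mult vm)
  fix w x y assume w: "w \<in> carrier K" and x: "x \<in> FG w - {\<zero>\<^bsub>FR\<^esub>}" and y: "y \<in> FG w - {\<zero>\<^bsub>FR\<^esub>}"
    and xy: "x \<oplus>\<^bsub>FR\<^esub> y \<noteq> \<zero>\<^bsub>FR\<^esub>"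
  have "min (frac_val K R G v x) (frac_val K R G v y) \<le> frac_val K R G v (x \<oplus>\<^bsub>FR\<^esub> y)"
    if x: "x \<in> FG w - {\<zero>\<^bsub>FR\<^esub>}" and y: "y \<in> FG w - {\<zero>\<^bsub>FR\<^esub>}" and xy: "x \<oplus>\<^bsub>FR\<^esub> y \<noteq> \<zero>\<^bsub>FR\<^esub>"
      and le: "frac_val K R G v y \<le> frac_val K R G v x" for x y
  proof -
    have "x \<in> homog K FR FG" "y \<in> homog K FR FG" "x \<oplus>\<^bsub>FR\<^esub> y \<in> homog K FR FG"
      using x y xy w graded.comp_add[OF graded.intro[OF graded_ring_FR], of w x y]
      by (auto simp: homog_def)
    then obtain a s b t where h: "a \<in> H" "s \<in> H" "b \<in> H" "t \<in> H" "x = fr a s" "y = fr b t"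
      "x \<oplus>\<^bsub>FR\<^esub> y \<in> homog K FR FG"
      unfolding homog_FR by blast
    then have sum: "a \<otimes> t \<oplus> b \<otimes> s \<in> H"
      by (simp add: fr_add homog_closed fr_mem_homog_iff homog_mult)
    \<comment> \<open>This inequality provides \<open>u\<close> outside \<open>p\<close>, of value
      0, with \<open>u (a t) = (b s) c\<close>. Then \<open>u\<close> times the numerator
      \<open>a t + b s\<close> of the sum equals \<open>(b s) (c + u)\<close>, and
      \<open>c + u\<close> has non-negative value.\<close>
    have "v (b \<otimes> s) \<le> v (a \<otimes> t)" using le h by (simp add: val vm)
    then obtain u c where u: "u \<in> H - p" "c \<in> carrier R" "u \<otimes> (a \<otimes> t) = b \<otimes> s \<otimes> c"
      using graded_ordD(2)[OF v homog_mult[OF h(1,4)] homog_mult[OF h(3,2)]] by blast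
    have uH: "u \<in> H" and bs: "b \<otimes> s \<in> H" and at: "a \<otimes> t \<in> H"
      using u(1) h(1-4) homog_mult by simp_all
    have "u \<otimes> (a \<otimes> t \<oplus> b \<otimes> s) = u \<otimes> (a \<otimes> t) \<oplus> u \<otimes> (b \<otimes> s)"
      using uH bs at by (simp add: r_distr homog_closed)
    also have "\<dots> = b \<otimes> s \<otimes> (c \<oplus> u)"
      unfolding u(3) using uH bs u(2) by (simp add: r_distr homog_closed m_comm[of u])
    finally have eq: "u \<otimes> (a \<otimes> t \<oplus> b \<otimes> s) = b \<otimes> s \<otimes> (c \<oplus> u)" .
    have "b \<otimes> s \<otimes> (c \<oplus> u) \<in> H" using homog_mult[OF uH sum] eq by simp
    then have cu: "c \<oplus> u \<in> H"
      using cofactor_homog[OF bs, of "c \<oplus> u"] u(2) uH homog_closed by simp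
    then have "v u + v (a \<otimes> t \<oplus> b \<otimes> s) = v (b \<otimes> s) + v (c \<oplus> u)"
      using vm[OF uH sum] vm[OF bs cu] eq by simp
    then have "v (b \<otimes> s) \<le> v (a \<otimes> t \<oplus> b \<otimes> s)"
      using graded_ord_zero[OF v p u(1)] graded_ord_nonneg[OF v p cu] by simp
    then show ?thesis using h sum le by (simp add: fr_add homog_closed val vm homog_mult)
  qed note ult = this
  interpret FR: cring FR by (rule cring_FR)
  have clo: "x \<in> carrier FR" "y \<in> carrier FR"
    using x y w graded.comp_closed[OF graded.intro[OF graded_ring_FR]] by blast+
  show "min (frac_val K R G v x) (frac_val K R G v y) \<le> frac_val K R G v (x \<oplus>\<^bsub>FR\<^esub> y)"
  proof (cases "frac_val K R G v y \<le> frac_val K R G v x")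
    case False
    then show ?thesis using ult[OF y x] xy clo by (simp add: FR.a_comm min.commute)
  qed (use ult[OF x y xy] in auto)
qed

text \<open>By the last clause of \<open>graded_ord\<close>, a homogeneous fraction of non-negative
  value can be rewritten with a denominator outside \<open>p\<close>, and such fractions form a
  ring. Conversely, the numerator of an element of the localization splits into homogeneous terms,
  and the denominator has value 0.\<close>

lemma valuation_at_frac_val:
  assumes v: "graded_ord K R G p v" and p: "graded_prime K R G p"
  shows "valuation_at K R G p (frac_val K R G v)"
  unfolding valuation_at_def
proof (intro conjI discrete_valuation_frac_val[OF v p] equalityI subsetI)
  note vm = graded_ordD(1)[OF v]
  note val = frac_val_fr[of v, OF vm]
  note pc = graded_prime_compl[OF p]
  let ?X = "{x \<in> homog K FR FG. 0 \<le> frac_val K R G v x}"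
  have locI: "fr a s \<in> graded_local K R G p" if "a \<in> carrier R" "s \<in> H - p" for a s
    using that by (auto simp: graded_local_def)
  fix x
  {
    assume "x \<in> valuation_ring K FR FG (frac_val K R G v)"
    then have "x \<in> generate_ring FR ?X" by (simp add: valuation_ring_def)
    then show "x \<in> graded_local K R G p"
    proof (induction rule: generate_ring.induct)
      case one
      show ?case using pc(1) by (simp add: fr_one locI)
    next
      case (incl x)
      then obtain a s where h: "a \<in> H" "s \<in> H" "x = fr a s" "0 \<le> frac_val K R G v x"
        by (auto simp: homog_FR)
      then obtain u c where u: "u \<in> H - p" "c \<in> carrier R" "u \<otimes> a = s \<otimes> c"
        using graded_ordD(2)[OF v h(1,2)] val by auto
      then have "fr a s = fr c u" using h by (intro fr_eqI) (auto simp: homog_closed m_comm)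
      then show ?case using u h by (simp add: locI)
    next
      case (a_inv x)
      then obtain a s where "a \<in> carrier R" "s \<in> H - p" "x = fr a s" by (auto simp: graded_local_def)
      then show ?case by (simp add: fr_minus locI)
    next
      case (eng_add x y)
      then obtain a s b t where "a \<in> carrier R" "s \<in> H - p" "x = fr a s" "b \<in> carrier R" "t \<in> H - p" "y = fr b t"
        by (auto simp: graded_local_def)
      moreover from this have "s \<otimes> t \<in> H - p" using pc(2) by blast
      ultimately show ?case by (simp add: fr_add locI homog_closed)
    next
      case (eng_mult x y)
      then obtain a s b t where "a \<in> carrier R" "s \<in> H - p" "x = fr a s" "b \<in> carrier R" "t \<in> H - p" "y = fr b t"
        by (auto simp: graded_local_def)
      moreover from this have "s \<otimes> t \<in> H - p" using pc(2) by blast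
      ultimately show ?case by (simp add: fr_mult locI homog_closed)
    qed
  }
  {
    assume "x \<in> graded_local K R G p"
    then obtain a s where a: "a \<in> carrier R" "s \<in> H - p" "x = fr a s" by (auto simp: graded_local_def)
    have "fr a s \<in> generate_ring FR ?X" using a(1)
    proof (induction a rule: homog_induct)
      case (homog a w)
      show ?case
      proof (cases "a = \<zero>")
        case True
        then show ?thesis using a zero_FR_generate fr_eq_zero_iff[of a s] by simp
      next
        case False
        then have "a \<in> H" using homog homogI by blast
        then have "fr a s \<in> ?X"
          using a graded_ord_nonneg[OF v p] graded_ord_zero[OF v p, of s] by (simp add: fr_mem_homog_iff homog_closed val)
        then show ?thesis by (rule generate_ring.incl)
      qed
    next
      case (add b c)
      then show ?case using generate_ring.eng_add[OF add(3,4)] a by (simp add: fr_add_same)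
    qed
    then show "x \<in> valuation_ring K FR FG (frac_val K R G v)" using a by (simp add: valuation_ring_def)
  }
qed

text \<open>The converse of \<open>valuation_at_frac_val\<close>. The valuation ring is given by
  generators, so it has to be shown that its homogeneous elements have non-negative value. The
  assumption that \<open>p\<close> is non-zero provides a fraction outside the localization.\<close>

lemma valuation_at_imp_graded_ord:
  assumes nu: "valuation_at K R G p \<nu>" and p: "graded_prime K R G p" "p \<noteq> {\<zero>}"
  shows "graded_ord K R G p (\<lambda>a. \<nu> (fr a \<one>))" "\<nu> = frac_val K R G (\<lambda>a. \<nu> (fr a \<one>))"
proof -
  interpret FR: cring FR by (rule cring_FR)
  let ?v = "\<lambda>a. \<nu> (fr a \<one>)"
  have d: "discrete_valuation K FR FG \<nu>" and ring: "valuation_ring K FR FG \<nu> = graded_local K R G p"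
    using nu by (auto simp: valuation_at_def)
  have frH: "fr a s \<in> homog K FR FG" if "a \<in> H" "s \<in> H" for a s
    using that fr_mem_homog_iff by (simp add: homog_closed)
  have mult: "\<nu> (x \<otimes>\<^bsub>FR\<^esub> y) = \<nu> x + \<nu> y" if "x \<in> homog K FR FG" "y \<in> homog K FR FG" for x y
    using d that by (auto simp: discrete_valuation_def)
  have vm: "?v (a \<otimes> b) = ?v a + ?v b" if "a \<in> H" "b \<in> H" for a b
    using mult[OF frH frH, of a \<one> b \<one>] that one_homog by (simp add: fr_mult homog_closed)
  have quot: "\<nu> (fr a s) = ?v a - ?v s" if "a \<in> H" "s \<in> H" for a s
  proof -
    have "fr a s \<otimes>\<^bsub>FR\<^esub> fr s \<one> = fr a \<one>"
      using that one_homog by (simp add: fr_mult homog_closed) (intro fr_eqI; simp add: homog_closed homog_mult m_ac)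
    then show ?thesis using mult[OF frH frH, of a s s \<one>] that one_homog by simp
  qed
  have incl: "x \<in> graded_local K R G p" if "x \<in> homog K FR FG" "0 \<le> \<nu> x" for x
    unfolding ring[symmetric] valuation_ring_def using that by (intro generate_ring.incl) simp
  \<comment> \<open>A homogeneous element of negative value in the valuation ring would generate all of \<open>Q\<^sup>+(R)\<close>.\<close>
  have nonneg: "0 \<le> \<nu> x" if x: "x \<in> homog K FR FG" "x \<in> graded_local K R G p" for x
  proof (rule ccontr)
    assume neg: "\<not> 0 \<le> \<nu> x"
    obtain a s where as: "a \<in> H" "s \<in> H" "x = fr a s" using x by (auto simp: homog_FR)
    \<comment> \<open>If \<open>z\<close> has value at least \<open>(n + 1) \<nu> x\<close>, then
      \<open>z / x\<close> has value at least \<open>n \<nu> x\<close>, and \<open>z\<close> is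
      \<open>x\<close> times \<open>z / x\<close>.\<close>
    have all: "z \<in> graded_local K R G p" if "z \<in> homog K FR FG" "int n * \<nu> x \<le> \<nu> z" for n z
      using that
    proof (induction n arbitrary: z)
      case (Suc n)
      obtain b t where bt: "b \<in> H" "t \<in> H" "z = fr b t" using Suc.prems by (auto simp: homog_FR)
      have si: "fr s a \<in> homog K FR FG" using as frH by blast
      have "\<nu> (fr s a) = - \<nu> x" using as quot by simp
      then have "int n * \<nu> x \<le> \<nu> (z \<otimes>\<^bsub>FR\<^esub> fr s a)"
        using Suc.prems mult[OF Suc.prems(1) si] by (simp add: algebra_simps)
      moreover have "z \<otimes>\<^bsub>FR\<^esub> fr s a \<in> homog K FR FG"
        using bt as frH by (simp add: fr_mult homog_closed homog_mult)
      ultimately have "z \<otimes>\<^bsub>FR\<^esub> fr s a \<in> graded_local K R G p" using Suc.IH by blast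
      then have "x \<otimes>\<^bsub>FR\<^esub> (z \<otimes>\<^bsub>FR\<^esub> fr s a) \<in> graded_local K R G p"
        using x(2) unfolding ring[symmetric] valuation_ring_def by (rule generate_ring.eng_mult[rotated])
      moreover have "x \<otimes>\<^bsub>FR\<^esub> (z \<otimes>\<^bsub>FR\<^esub> fr s a) = z"
        using bt as by (simp add: fr_mult homog_closed homog_mult) (intro fr_eqI; simp add: homog_closed homog_mult m_ac)
      ultimately show ?case by simp
    qed (simp add: incl)
    \<comment> \<open>For \<open>q\<close> in \<open>p\<close> the fraction \<open>1 / q\<close> is
      not in the localization, since a denominator \<open>t = b q\<close> would lie in
      \<open>p\<close>. But a large multiple of the negative number \<open>\<nu> x\<close> is below
      the value of \<open>1 / q\<close>.\<close>
    obtain q where q: "q \<in> p" "q \<in> H" using graded_prime_homog_nonempty[OF p] by blast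
    have z: "fr \<one> q \<in> homog K FR FG" using frH one_homog q by blast
    define n where "n = nat (- \<nu> (fr \<one> q))"
    have "int n * \<nu> x \<le> int n * (-1)" using neg by (intro mult_left_mono) auto
    also have "\<dots> \<le> \<nu> (fr \<one> q)" by (simp add: n_def)
    finally have "int n * \<nu> x \<le> \<nu> (fr \<one> q)" .
    then have "fr \<one> q \<in> graded_local K R G p" using all[OF z] by blast
    then obtain b t where "b \<in> carrier R" "t \<in> H - p" "fr \<one> q = fr b t" by (auto simp: graded_local_def)
    then have "t \<notin> p" "b \<in> carrier R" "t = b \<otimes> q"
      using fr_eq_iff[of \<one> q b t] q by (auto simp: homog_closed)
    then show False using q(1) ideal.I_l_closed[OF graded_primeD(1)[OF p(1)]] by blast
  qed
  have "?v b \<le> ?v a \<longleftrightarrow> (\<exists>s\<in>H - p. \<exists>c\<in>carrier R. s \<otimes> a = b \<otimes> c)" if ab: "a \<in> H" "b \<in> H" for a b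
  proof -
    have "?v b \<le> ?v a \<longleftrightarrow> fr a b \<in> graded_local K R G p"
      using quot[OF ab] incl[OF frH[OF ab]] nonneg[OF frH[OF ab]] by auto
    also have "\<dots> \<longleftrightarrow> (\<exists>c s. c \<in> carrier R \<and> s \<in> H - p \<and> fr a b = fr c s)"
      by (auto simp: graded_local_def)
    also have "\<dots> \<longleftrightarrow> (\<exists>s\<in>H - p. \<exists>c\<in>carrier R. s \<otimes> a = b \<otimes> c)"
    proof -
      have "fr a b = fr c s \<longleftrightarrow> s \<otimes> a = b \<otimes> c" if "c \<in> carrier R" "s \<in> H" for c s
        using ab that by (simp add: fr_eq_iff homog_closed m_comm)
      then show ?thesis by (metis (no_types, lifting) DiffD1)
    qed
    finally show ?thesis .
  qed
  moreover have "\<exists>a\<in>H. \<exists>b\<in>H. ?v a = ?v b + 1"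
  proof -
    have "1 \<in> \<nu> ` homog K FR FG" using d by (auto simp: discrete_valuation_def)
    then obtain x where "x \<in> homog K FR FG" "\<nu> x = 1" by (metis imageE)
    then obtain a b where "a \<in> H" "b \<in> H" "\<nu> (fr a b) = 1" by (auto simp: homog_FR)
    then show ?thesis using quot[of a b] by force
  qed
  ultimately show "graded_ord K R G p ?v" using vm by (simp add: graded_ord_def)
  show "\<nu> = frac_val K R G ?v"
    using d quot vm by (intro frac_val_eqI[symmetric]) (auto simp: discrete_valuation_def)
qed

lemma essential_valuations_eq:
  "essential_valuations K R G =
     {frac_val K R G v | p v. minimal_graded_prime K R G p \<and> graded_ord K R G p v}"
proof (intro equalityI subsetI)
  fix \<nu> assume "\<nu> \<in> essential_valuations K R G"
  then obtain p where p: "minimal_graded_prime K R G p" "valuation_at K R G p \<nu>"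
    by (auto simp: essential_valuations_def)
  then have "graded_prime K R G p" "p \<noteq> {\<zero>}" by (auto simp: minimal_graded_prime_def)
  then show "\<nu> \<in> {frac_val K R G v | p v. minimal_graded_prime K R G p \<and> graded_ord K R G p v}"
    using valuation_at_imp_graded_ord[OF p(2)] p(1) by blast
next
  fix \<nu> assume "\<nu> \<in> {frac_val K R G v | p v. minimal_graded_prime K R G p \<and> graded_ord K R G p v}"
  then obtain p v where p: "minimal_graded_prime K R G p" "graded_ord K R G p v" "\<nu> = frac_val K R G v" by blast
  then have "valuation_at K R G p \<nu>"
    using valuation_at_frac_val[OF p(2)] by (auto simp: minimal_graded_prime_def)
  then show "\<nu> \<in> essential_valuations K R G" using p by (auto simp: essential_valuations_def)
qed

text \<open>Justifies the definite description in \<open>divisor_valuation\<close>.\<close>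

lemma valuation_at_unique:
  assumes "valuation_at K R G p \<nu>" "valuation_at K R G p \<mu>" "graded_prime K R G p" "p \<noteq> {\<zero>}"
  shows "\<nu> = \<mu>"
proof -
  note n = valuation_at_imp_graded_ord[OF assms(1,3,4)] and m = valuation_at_imp_graded_ord[OF assms(2,3,4)]
  have "frac_val K R G (\<lambda>a. \<nu> (fr a \<one>)) = \<mu>"
  proof (rule frac_val_eqI)
    show "\<mu> \<in> extensional (homog K FR FG)" using assms(2) by (simp add: valuation_at_def discrete_valuation_def)
    show "\<nu> (fr (a \<otimes> b) \<one>) = \<nu> (fr a \<one>) + \<nu> (fr b \<one>)" if "a \<in> H" "b \<in> H" for a b
      using that by (rule graded_ordD(1)[OF n(1)])
    show "\<mu> (fr a s) = \<nu> (fr a \<one>) - \<nu> (fr s \<one>)" if "a \<in> H" "s \<in> H" for a s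
    proof -
      have "\<mu> (fr a s) = \<mu> (fr a \<one>) - \<mu> (fr s \<one>)"
        by (subst m(2)) (rule frac_val_fr[OF graded_ordD(1)[OF m(1)] that])
      then show ?thesis using graded_ord_unique[OF n(1) m(1)] that by simp
    qed
  qed
  then show ?thesis using n(2) by simp
qed

end

section \<open>Graded factorial rings\<close>

locale graded_ufd = graded_domain K R G
  for K :: "('k, 'n) monoid_scheme" and R :: "('r, 'm) ring_scheme" (structure) and G +
  assumes factorial: "graded_factorial K R G"
begin

sublocale M: factorial_monoid M
  using factorial by (simp add: graded_factorial_def)

lemma M_simps [simp]: "carrier M = H" "mult M = mult R" "one M = one R"
  by simp_all

definition prime_elems :: "'r set" where
  "prime_elems = {x \<in> H. prime M x}"

lemma irreducible_prime_elem: "\<lbrakk>x \<in> H; irreducible M x\<rbrakk> \<Longrightarrow> x \<in> prime_elems"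
  using M.irreducible_prime by (simp add: prime_elems_def)

lemma prime_elem_irreducible: "x \<in> prime_elems \<Longrightarrow> irreducible M x"
  using M.prime_irreducible by (auto simp: prime_elems_def)

lemma prime_elemD:
  assumes "x \<in> prime_elems"
  shows "x \<in> H" "x \<notin> Units M"
    and "\<lbrakk>a \<in> H; b \<in> H; x divides\<^bsub>M\<^esub> a \<otimes> b\<rbrakk> \<Longrightarrow> x divides\<^bsub>M\<^esub> a \<or> x divides\<^bsub>M\<^esub> b"
  using assms by (auto simp: prime_elems_def prime_def)

section \<open>Multiplicities of prime elements\<close>

lemma homog_dividesI: "\<lbrakk>a \<in> H; b \<in> H; c \<in> carrier R; b = a \<otimes> c\<rbrakk> \<Longrightarrow> a divides\<^bsub>M\<^esub> b"
  using cofactor_homog[of a c] by (auto simp: factor_def)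

lemma homog_dividesE:
  assumes "a divides\<^bsub>M\<^esub> b"
  obtains c where "c \<in> H" "b = a \<otimes> c"
  using assms by (auto simp: factor_def)

text \<open>Dividing out \<open>x\<close> leaves a proper factor, and proper divisibility is
  well-founded in a factorial monoid.\<close>

lemma ex_mult_prime:
  assumes x: "x \<in> prime_elems" and a: "a \<in> H"
  shows "\<exists>n b. b \<in> H \<and> a = x [^] (n::nat) \<otimes> b \<and> \<not> x divides\<^bsub>M\<^esub> b"
  using M.division_wellfounded a
proof (induction a rule: wf_induct_rule)
  case (less a)
  note x' = prime_elemD(1,2)[OF x]
  show ?case
  proof (cases "x divides\<^bsub>M\<^esub> a")
    case False
    have "a = x [^] (0::nat) \<otimes> a" using less.prems by (simp add: homog_closed)
    then show ?thesis using False less.prems by blast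
  next
    case True
    then obtain c where c: "c \<in> H" "a = x \<otimes> c" by (rule homog_dividesE)
    have "properfactor M c a"
      using M.properfactorI3[of a c x] c x' m_comm homog_closed by auto
    then obtain n b where "b \<in> H" "c = x [^] (n::nat) \<otimes> b" "\<not> x divides\<^bsub>M\<^esub> b"
      using less.IH[of c] c less.prems by auto
    moreover from this have "a = x [^] Suc n \<otimes> b"
      using c x' by (simp add: homog_closed m_ac)
    ultimately show ?thesis by blast
  qed
qed

definition mlt :: "'r \<Rightarrow> 'r \<Rightarrow> nat" where
  "mlt x a = (SOME n. \<exists>b\<in>H. a = x [^] n \<otimes> b \<and> \<not> x divides\<^bsub>M\<^esub> b)"

lemma mlt_decomp:
  assumes "x \<in> prime_elems" "a \<in> H"
  obtains b where "b \<in> H" "a = x [^] mlt x a \<otimes> b" "\<not> x divides\<^bsub>M\<^esub> b"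
proof -
  have "\<exists>b\<in>H. a = x [^] mlt x a \<otimes> b \<and> \<not> x divides\<^bsub>M\<^esub> b"
    unfolding mlt_def by (rule someI_ex) (use ex_mult_prime[OF assms] in blast)
  then show thesis using that by blast
qed

lemma mlt_eqI:
  assumes x: "x \<in> prime_elems" and b: "b \<in> H" "a = x [^] n \<otimes> b" "\<not> x divides\<^bsub>M\<^esub> b"
  shows "mlt x a = n"
proof -
  note xH = prime_elemD(1)[OF x]
  have aH: "a \<in> H" using b xH homog_pow homog_mult by simp
  obtain c where c: "c \<in> H" "a = x [^] mlt x a \<otimes> c" "\<not> x divides\<^bsub>M\<^esub> c"
    using mlt_decomp[OF x aH] .
  \<comment> \<open>If the exponents differed, cancelling the smaller power of \<open>x\<close>
    would leave a factor \<open>x\<close> in the cofactor belonging to it.\<close>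
  have lt: False if h: "m < (k::nat)" "d \<in> H" "e \<in> H" "x [^] m \<otimes> d = x [^] k \<otimes> e" "\<not> x divides\<^bsub>M\<^esub> d" for m k d e
  proof -
    obtain j where j: "k = m + Suc j" using less_imp_Suc_add[OF h(1)] by (metis add_Suc_right)
    have "x [^] k = x [^] m \<otimes> (x [^] j \<otimes> x)"
      unfolding j using xH by (simp add: nat_pow_mult[symmetric] homog_closed m_assoc)
    then have "x [^] m \<otimes> d = x [^] m \<otimes> (x \<otimes> (x [^] j \<otimes> e))"
      using that(2,3,4) xH by (simp add: m_ac homog_closed homog_pow)
    then have "d = x \<otimes> (x [^] j \<otimes> e)"
      using homog_cancel[OF homog_pow[OF xH]] that(2,3) xH by (simp add: homog_closed homog_pow)
    moreover have "x [^] j \<otimes> e \<in> H" using that(3) xH homog_pow homog_mult by simp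
    ultimately show False using that(5) by (auto simp: factor_def)
  qed
  show ?thesis
    using lt[of n "mlt x a" b c] lt[of "mlt x a" n c b] b c by (metis linorder_neqE_nat)
qed

lemma mlt_mult:
  assumes x: "x \<in> prime_elems" and "a \<in> H" "b \<in> H"
  shows "mlt x (a \<otimes> b) = mlt x a + mlt x b"
proof -
  note xH = prime_elemD(1)[OF x]
  obtain a' where a: "a' \<in> H" "a = x [^] mlt x a \<otimes> a'" "\<not> x divides\<^bsub>M\<^esub> a'" using mlt_decomp[OF x assms(2)] .
  obtain b' where b: "b' \<in> H" "b = x [^] mlt x b \<otimes> b'" "\<not> x divides\<^bsub>M\<^esub> b'" using mlt_decomp[OF x assms(3)] .
  have "a \<otimes> b = (x [^] mlt x a \<otimes> a') \<otimes> (x [^] mlt x b \<otimes> b')"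
    by (rule arg_cong2[where f = "(\<otimes>)", OF a(2) b(2)])
  also have "\<dots> = x [^] (mlt x a + mlt x b) \<otimes> (a' \<otimes> b')"
    using a(1) b(1) xH by (simp add: nat_pow_mult[symmetric] m_ac homog_closed)
  finally show ?thesis
    by (rule mlt_eqI[OF x homog_mult[OF a(1) b(1)]]) (use prime_elemD(3)[OF x a(1) b(1)] a(3) b(3) in blast)
qed

lemma mlt_zero_iff: "\<lbrakk>x \<in> prime_elems; a \<in> H\<rbrakk> \<Longrightarrow> mlt x a = 0 \<longleftrightarrow> \<not> x divides\<^bsub>M\<^esub> a"
proof
  assume h: "x \<in> prime_elems" "a \<in> H" "mlt x a = 0"
  obtain b where b: "b \<in> H" "a = x [^] mlt x a \<otimes> b" "\<not> x divides\<^bsub>M\<^esub> b" using mlt_decomp[OF h(1,2)] .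
  have "a = x [^] (0::nat) \<otimes> b" using b(2) unfolding h(3) .
  then show "\<not> x divides\<^bsub>M\<^esub> a" using b(1,3) by (simp add: homog_closed)
next
  assume h: "x \<in> prime_elems" "a \<in> H" "\<not> x divides\<^bsub>M\<^esub> a"
  then show "mlt x a = 0" using mlt_eqI[OF h(1,2), of a 0] by (simp add: homog_closed)
qed

lemma mlt_self: "x \<in> prime_elems \<Longrightarrow> mlt x x = 1"
  using mlt_eqI[of x \<one> x 1] prime_elemD(1,2)[of x] one_homog M.divides_unit[of x \<one>] M.Units_one_closed
  by (auto simp: homog_closed)

section \<open>Principal graded primes and their valuations\<close>

lemma cgenideal_mem_iff:
  assumes "x \<in> H" "a \<in> H"
  shows "a \<in> PIdl x \<longleftrightarrow> x divides\<^bsub>M\<^esub> a"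
  using assms m_comm homog_dividesI[of x a]
  by (auto simp: cgenideal_def homog_closed elim!: homog_dividesE)

lemma graded_prime_cgenideal:
  assumes x: "x \<in> prime_elems"
  shows "graded_prime K R G (PIdl x)"
proof -
  note x' = prime_elemD(1,2)[OF x]
  have xc: "x \<in> carrier R" using x' by (simp add: homog_closed)
  have id: "ideal (PIdl x) R" by (rule cgenideal_ideal[OF xc])
  have x_mem: "x \<in> PIdl x \<inter> H" using cgenideal_self[OF xc] x' by simp
  show ?thesis unfolding graded_prime_def
  proof (intro conjI id ballI impI equalityI)
    have "PIdl x \<inter> H \<subseteq> carrier R" by (auto simp: homog_closed)
    then show "PIdl x \<subseteq> Idl (PIdl x \<inter> H)"
      using cgenideal_minimal[OF genideal_ideal] genideal_self x_mem by blast
    show "Idl (PIdl x \<inter> H) \<subseteq> PIdl x" by (rule genideal_minimal[OF id]) blast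
    show "PIdl x \<noteq> carrier R"
    proof
      assume "PIdl x = carrier R"
      then have "x divides\<^bsub>M\<^esub> \<one>" using cgenideal_mem_iff[OF x'(1) one_homog] by simp
      then show False using x' M.divides_unit[of x \<one>] M.Units_one_closed by simp
    qed
    fix f g assume "f \<in> H" "g \<in> H" "f \<otimes> g \<in> PIdl x"
    then show "f \<in> PIdl x \<or> g \<in> PIdl x"
      using prime_elemD(3)[OF x] by (simp add: cgenideal_mem_iff x' homog_mult)
  qed
qed

text \<open>A homogeneous element of \<open>q\<close> is, up to a unit, a product of irreducible
  elements, and primeness of \<open>q\<close> puts one of these into \<open>q\<close>.\<close>

lemma graded_prime_contains_prime_elem:
  assumes q: "graded_prime K R G q" "q \<noteq> {\<zero>}"
  obtains y where "y \<in> prime_elems" "y \<in> q"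
proof -
  interpret q: ideal q R by (rule graded_primeD(1)[OF q(1)])
  obtain a where a: "a \<in> q" "a \<in> H" using graded_prime_homog_nonempty[OF q] by blast
  obtain fs where fs: "set fs \<subseteq> H" "wfactors M fs a" using M.wfactors_exist[of a] a by auto
  have "foldr (\<otimes>) fs \<one> \<in> q"
  proof -
    have "a divides\<^bsub>M\<^esub> foldr (\<otimes>) fs \<one>" using fs by (auto simp: wfactors_def associated_def)
    then obtain c where "c \<in> H" "foldr (\<otimes>) fs \<one> = a \<otimes> c" by (rule homog_dividesE)
    then show ?thesis using a q.I_r_closed homog_closed by simp
  qed
  then have "\<exists>y\<in>set fs. y \<in> q" using fs(1)
  proof (induction fs)
    case Nil
    then show ?case using graded_primeD(2)[OF q(1)] by simp
  next
    case (Cons f fs)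
    have "foldr (\<otimes>) fs \<one> \<in> H" using Cons.prems(2)
      by (induction fs) (auto simp: one_homog homog_mult)
    then have "f \<in> q \<or> foldr (\<otimes>) fs \<one> \<in> q"
      using Cons.prems graded_primeD(4)[OF q(1)] by simp
    then show ?case using Cons by auto
  qed
  then show thesis using that irreducible_prime_elem fs by (auto simp: wfactors_def)
qed

lemma prime_elem_associated:
  assumes "x \<in> prime_elems" "y \<in> prime_elems" "x divides\<^bsub>M\<^esub> y"
  shows "PIdl x = PIdl y"
proof -
  have "y divides\<^bsub>M\<^esub> x"
    using assms prime_elemD[OF assms(1)] prime_elem_irreducible[OF assms(2)]
    by (auto simp: irreducible_def properfactor_def)
  then obtain c d where "c \<in> H" "x = y \<otimes> c" "d \<in> H" "y = x \<otimes> d"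
    using assms(3) by (auto simp: factor_def)
  moreover have "x \<in> carrier R" "y \<in> carrier R" using assms prime_elemD homog_closed by blast+
  ultimately have "x \<in> PIdl y" "y \<in> PIdl x"
    unfolding cgenideal_def by (metis (mono_tags, lifting) homog_closed m_comm mem_Collect_eq)+
  then show ?thesis
    using cgenideal_minimal cgenideal_ideal \<open>x \<in> carrier R\<close> \<open>y \<in> carrier R\<close> by blast
qed

text \<open>Every non-zero graded prime contains a prime element and thus the principal prime
  generated by it. Between two principal primes of this kind an inclusion is an equality by
  \<open>prime_elem_associated\<close>.\<close>

lemma minimal_graded_prime_iff:
  "minimal_graded_prime K R G p \<longleftrightarrow> (\<exists>x\<in>prime_elems. p = PIdl x)"
proof
  assume p: "minimal_graded_prime K R G p"
  then have p': "graded_prime K R G p" "p \<noteq> {\<zero>}" by (auto simp: minimal_graded_prime_def)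
  then obtain y where y: "y \<in> prime_elems" "y \<in> p" by (rule graded_prime_contains_prime_elem)
  have "PIdl y \<subseteq> p" using cgenideal_minimal[OF graded_primeD(1)[OF p'(1)] y(2)] .
  moreover have "PIdl y \<noteq> {\<zero>}"
    using cgenideal_self[of y] prime_elemD(1)[OF y(1)] homog_zero by (auto simp: homog_closed)
  ultimately show "\<exists>x\<in>prime_elems. p = PIdl x"
    using p graded_prime_cgenideal[OF y(1)] y(1) unfolding minimal_graded_prime_def by blast
next
  assume "\<exists>x\<in>prime_elems. p = PIdl x"
  then obtain x where x: "x \<in> prime_elems" "p = PIdl x" by blast
  note x' = prime_elemD[OF x(1)]
  have "PIdl x \<noteq> {\<zero>}" using cgenideal_self[of x] x'(1) homog_zero by (auto simp: homog_closed)
  moreover have "q = PIdl x" if q: "graded_prime K R G q" "q \<noteq> {\<zero>}" "q \<subseteq> PIdl x" for q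
  proof -
    obtain y where y: "y \<in> prime_elems" "y \<in> q" using graded_prime_contains_prime_elem[OF q(1,2)] .
    then have "x divides\<^bsub>M\<^esub> y" using q(3) cgenideal_mem_iff x'(1) prime_elemD(1)[OF y(1)] by blast
    then have "PIdl x = PIdl y" using prime_elem_associated x(1) y(1) by blast
    then show ?thesis using cgenideal_minimal[OF graded_primeD(1)[OF q(1)] y(2)] q(3) by blast
  qed
  ultimately show "minimal_graded_prime K R G p"
    using graded_prime_cgenideal[OF x(1)] x(2) unfolding minimal_graded_prime_def by blast
qed

lemma graded_ord_mlt:
  assumes x: "x \<in> prime_elems"
  shows "graded_ord K R G (PIdl x) (\<lambda>a. int (mlt x a))"
  unfolding graded_ord_def
proof (intro conjI ballI)
  note xH = prime_elemD(1)[OF x]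
  show "int (mlt x (a \<otimes> b)) = int (mlt x a) + int (mlt x b)" if "a \<in> H" "b \<in> H" for a b
    using mlt_mult[OF x that] by simp
  have "mlt x \<one> + mlt x \<one> = mlt x \<one>" using mlt_mult[OF x one_homog one_homog] by simp
  then show "\<exists>a\<in>H. \<exists>b\<in>H. int (mlt x a) = int (mlt x b) + 1"
    using xH one_homog mlt_self[OF x] by (intro bexI[of _ x] bexI[of _ \<one>]) auto
  fix a b assume ab: "a \<in> H" "b \<in> H"
  show "int (mlt x b) \<le> int (mlt x a) \<longleftrightarrow> (\<exists>s\<in>H - PIdl x. \<exists>c\<in>carrier R. s \<otimes> a = b \<otimes> c)"
  proof
    assume le: "int (mlt x b) \<le> int (mlt x a)"
    obtain a' where a: "a' \<in> H" "a = x [^] mlt x a \<otimes> a'" "\<not> x divides\<^bsub>M\<^esub> a'" using mlt_decomp[OF x ab(1)] .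
    obtain b' where b: "b' \<in> H" "b = x [^] mlt x b \<otimes> b'" "\<not> x divides\<^bsub>M\<^esub> b'" using mlt_decomp[OF x ab(2)] .
    obtain k where k: "mlt x a = mlt x b + k" using le by (metis nat_le_iff_add of_nat_le_iff)
    \<comment> \<open>Witnesses for the comparison: \<open>s\<close> is the part \<open>b'\<close>
      of \<open>b\<close> prime to \<open>x\<close>, and \<open>c\<close> is \<open>a\<close> with
      as many factors \<open>x\<close> removed as \<open>b\<close> has.\<close>
    define c where "c = x [^] k \<otimes> a'"
    have "b' \<otimes> a = b' \<otimes> (x [^] (mlt x b + k) \<otimes> a')"
      unfolding k[symmetric] by (rule arg_cong[OF a(2)])
    also have "\<dots> = (x [^] mlt x b \<otimes> b') \<otimes> c"
      unfolding c_def using a(1) b(1) xH by (simp add: nat_pow_mult[symmetric] m_ac homog_closed)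
    also have "\<dots> = b \<otimes> c" by (rule arg_cong[where f = "\<lambda>z. z \<otimes> c", OF b(2)[symmetric]])
    finally have "b' \<otimes> a = b \<otimes> c" .
    moreover have "b' \<in> H - PIdl x" using b(1,3) cgenideal_mem_iff[OF xH b(1)] by blast
    moreover have "c \<in> carrier R" using a(1) xH by (simp add: c_def homog_closed)
    ultimately show "\<exists>s\<in>H - PIdl x. \<exists>c\<in>carrier R. s \<otimes> a = b \<otimes> c" by blast
  next
    assume "\<exists>s\<in>H - PIdl x. \<exists>c\<in>carrier R. s \<otimes> a = b \<otimes> c"
    then obtain s c where s: "s \<in> H" "s \<notin> PIdl x" "c \<in> carrier R" "s \<otimes> a = b \<otimes> c" by blast
    then have "c \<in> H" using ab homog_mult cofactor_homog by metis
    then have "mlt x s + mlt x a = mlt x b + mlt x c" using mlt_mult[OF x] s ab by metis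
    moreover have "mlt x s = 0" using mlt_zero_iff[OF x s(1)] s(2) cgenideal_mem_iff[OF xH s(1)] by simp
    ultimately show "int (mlt x b) \<le> int (mlt x a)" by simp
  qed
qed

abbreviation pval where "pval x \<equiv> frac_val K R G (\<lambda>a. int (mlt x a))"

lemma essential_valuations_ufd:
  "essential_valuations K R G = (\<lambda>x. pval x) ` prime_elems"
proof (intro equalityI subsetI)
  fix \<nu> assume "\<nu> \<in> essential_valuations K R G"
  then obtain p v where p: "minimal_graded_prime K R G p" "graded_ord K R G p v" "\<nu> = frac_val K R G v"
    by (auto simp: essential_valuations_eq)
  then obtain x where x: "x \<in> prime_elems" "p = PIdl x" by (auto simp: minimal_graded_prime_iff)
  have "pval x = \<nu>"
  proof (rule frac_val_eqI)
    show "\<nu> \<in> extensional (homog K FR FG)" using p(3) by (simp add: frac_val_def)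
    show "int (mlt x (a \<otimes> b)) = int (mlt x a) + int (mlt x b)" if "a \<in> H" "b \<in> H" for a b
      using mlt_mult[OF x(1) that] by simp
    show "\<nu> (fr a s) = int (mlt x a) - int (mlt x s)" if "a \<in> H" "s \<in> H" for a s
      using frac_val_fr[OF graded_ordD(1)[OF p(2)] that] p(3) that
        graded_ord_unique[OF p(2) graded_ord_mlt[OF x(1), folded x(2)]] by simp
  qed
  then show "\<nu> \<in> (\<lambda>x. pval x) ` prime_elems" using x(1) by blast
next
  fix \<nu> assume "\<nu> \<in> (\<lambda>x. pval x) ` prime_elems"
  then show "\<nu> \<in> essential_valuations K R G"
    using graded_ord_mlt minimal_graded_prime_iff by (auto simp: essential_valuations_eq)
qed

section \<open>Divisibility in terms of multiplicities, and the Krull property\<close>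

lemma ex_prime_divisor:
  assumes "b \<in> H" "b \<notin> Units M"
  shows "\<exists>y\<in>prime_elems. y divides\<^bsub>M\<^esub> b"
proof -
  obtain fs where fs: "set fs \<subseteq> H" "factors M fs b" using M.factors_exist[of b] assms by auto
  then have "fs \<noteq> []" using assms M.Units_one_closed by (auto simp: factors_def)
  then obtain f gs where gs: "fs = f # gs" by (cases fs) auto
  have "foldr (\<otimes>) gs \<one> \<in> H" if "set gs \<subseteq> H" for gs
    using that by (induction gs) (auto simp: one_homog homog_mult)
  then have "f divides\<^bsub>M\<^esub> b" using fs gs by (auto simp: factors_def factor_def)
  then show ?thesis using fs gs irreducible_prime_elem by (auto simp: factors_def)
qed

text \<open>Induction along proper factors of \<open>b\<close>: a prime divisor of \<open>b\<close>
  has positive multiplicity in \<open>a\<close> as well, so it can be removed from both.\<close>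

lemma divides_if_mlt_le:
  assumes "b \<in> H" "a \<in> H" "\<And>x. x \<in> prime_elems \<Longrightarrow> mlt x b \<le> mlt x a"
  shows "b divides\<^bsub>M\<^esub> a"
  using M.division_wellfounded assms
proof (induction b arbitrary: a rule: wf_induct_rule)
  case (less b)
  show ?case
  proof (cases "b \<in> Units M")
    case True
    then show ?thesis using M.unit_divides less.prems by simp
  next
    case False
    then obtain y where yp: "y \<in> prime_elems" and y: "y \<in> prime_elems" "y \<in> H" "y divides\<^bsub>M\<^esub> b"
      using ex_prime_divisor[OF less.prems(1)] prime_elemD(1) by blast
    obtain b' where b: "b' \<in> H" "b = y \<otimes> b'" using y(3) by (rule homog_dividesE)
    have "mlt y a \<noteq> 0"
      using less.prems(3)[OF yp] mlt_zero_iff[OF yp less.prems(1)] y(3) by auto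
    then obtain a' where a: "a' \<in> H" "a = y \<otimes> a'"
      using mlt_zero_iff[OF yp less.prems(2)] homog_dividesE by metis
    have "properfactor M b' b"
      using M.properfactorI3[of b b' y] b y prime_elemD(2)[OF yp] m_comm homog_closed by auto
    moreover have "mlt x b' \<le> mlt x a'" if "x \<in> prime_elems" for x
      using less.prems(3)[OF that] mlt_mult[OF that] a b y by simp
    ultimately have "b' divides\<^bsub>M\<^esub> a'"
      using less.IH[of b' a'] a b less.prems by auto
    then obtain c where "c \<in> H" "a' = b' \<otimes> c" by (rule homog_dividesE)
    then show ?thesis using a b y by (intro homog_dividesI[of b a c]) (auto simp: homog_closed homog_mult m_assoc)
  qed
qed

text \<open>Prime elements are counted by the ideals they generate, since each may have infinitely
  many associates. Each of these ideals is generated by one of the factors of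
  \<open>a\<close>.\<close>

lemma finite_mlt_nonzero:
  assumes a: "a \<in> H"
  shows "finite (cgenideal R ` {x \<in> prime_elems. mlt x a \<noteq> 0})"
proof -
  obtain fs where fs: "set fs \<subseteq> H" "wfactors M fs a" using M.wfactors_exist[of a] a by auto
  have foldr: "foldr (\<otimes>) fs \<one> \<in> H" if "set fs \<subseteq> H" for fs
    using that by (induction fs) (auto simp: one_homog homog_mult)
  have "PIdl x \<in> cgenideal R ` set fs" if x: "x \<in> prime_elems" "mlt x a \<noteq> 0" for x
  proof -
    have "x divides\<^bsub>M\<^esub> a" using mlt_zero_iff[OF x(1) a] x(2) by blast
    moreover have "a divides\<^bsub>M\<^esub> foldr (\<otimes>) fs \<one>" using fs by (auto simp: wfactors_def associated_def)
    ultimately have "x divides\<^bsub>M\<^esub> foldr (\<otimes>) fs \<one>"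
      using M.divides_trans[of x a] prime_elemD(1)[OF x(1)] by simp
    then have "\<exists>f\<in>set fs. x divides\<^bsub>M\<^esub> f" using fs(1)
    proof (induction fs)
      case Nil
      then show ?case using M.divides_unit[of x \<one>] prime_elemD(1,2)[OF x(1)] M.Units_one_closed by simp
    next
      case (Cons f fs)
      then show ?case using prime_elemD(3)[OF x(1), of f "foldr (\<otimes>) fs \<one>"] foldr[of fs] by auto
    qed
    then obtain f where f: "f \<in> set fs" "x divides\<^bsub>M\<^esub> f" by blast
    then have "f \<in> prime_elems" using fs irreducible_prime_elem by (auto simp: wfactors_def)
    then show ?thesis using prime_elem_associated[OF x(1) _ f(2)] f(1) by blast
  qed
  then have "cgenideal R ` {x \<in> prime_elems. mlt x a \<noteq> 0} \<subseteq> cgenideal R ` set fs" by blast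
  then show ?thesis using finite_subset by blast
qed

lemma mlt_cong:
  assumes "x \<in> prime_elems" "y \<in> prime_elems" "PIdl x = PIdl y" "a \<in> H"
  shows "mlt x a = mlt y a"
  using graded_ord_unique[OF graded_ord_mlt[OF assms(1)], of "\<lambda>a. int (mlt y a)" a]
    graded_ord_mlt[OF assms(2)] assms(3,4) by simp

lemma frac_val_ext: "frac_val K R G v \<in> extensional (homog K FR FG)"
  by (simp add: frac_val_def)

text \<open>The essential valuations on \<open>Q\<^sup>+(R)\<close> serve as defining family. An
  element \<open>a / s\<close> of all their rings need not be homogeneous, so \<open>s\<close> is
  shown to divide every component of \<open>a\<close>.\<close>

theorem graded_Krull: "graded_Krull K R G"
proof -
  let ?i = "\<lambda>a. fr a \<one>"
  let ?V = "essential_valuations K R G"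
  note [simp] = homog_closed one_homog
  have val: "pval x (fr a s) = int (mlt x a) - int (mlt x s)"
    if "x \<in> prime_elems" "a \<in> H" "s \<in> H" for x a s
    using that frac_val_fr[of "\<lambda>a. int (mlt x a)" a s] by (simp add: mlt_mult)
  have ring: "valuation_ring K FR FG (pval x) = graded_local K R G (PIdl x)"
    if "x \<in> prime_elems" for x
    using valuation_at_frac_val[OF graded_ord_mlt graded_prime_cgenideal] that by (simp add: valuation_at_def)
  have hom: "?i \<in> ring_hom R FR"
    by (intro ring_hom_memI) (auto simp: fr_mult fr_add fr_one)
  have inj: "inj_on ?i (carrier R)" by (auto simp: inj_on_def fr_eq_iff)
  have deg: "?i ` G w \<subseteq> FG w" if "w \<in> carrier K" for w
    using that one_comp fr_mem_FG_iff[of _ \<one> "\<one>\<^bsub>K\<^esub>" w] comp_closed by auto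
  have img: "?i ` carrier R = {x \<in> carrier FR. \<forall>\<nu>\<in>?V. x \<in> valuation_ring K FR FG \<nu>}"
  proof (intro equalityI subsetI)
    fix z assume "z \<in> ?i ` carrier R"
    then obtain a where a: "a \<in> carrier R" "z = fr a \<one>" by blast
    have "z \<in> graded_local K R G (PIdl x)" if "x \<in> prime_elems" for x
      using a(1) graded_prime_compl(1)[OF graded_prime_cgenideal[OF that]]
      unfolding a(2) graded_local_def by blast
    then show "z \<in> {x \<in> carrier FR. \<forall>\<nu>\<in>?V. x \<in> valuation_ring K FR FG \<nu>}"
      using a by (auto simp: essential_valuations_ufd ring)
  next
    fix z assume "z \<in> {x \<in> carrier FR. \<forall>\<nu>\<in>?V. x \<in> valuation_ring K FR FG \<nu>}"
    then have z: "z \<in> carrier FR" "\<And>x. x \<in> prime_elems \<Longrightarrow> z \<in> graded_local K R G (PIdl x)"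
      by (auto simp: essential_valuations_ufd ring)
    obtain a s where a: "a \<in> carrier R" "s \<in> H" "z = fr a s" using fr_cases[OF z(1)] .
    have id: "ideal (PIdl s) R" using cgenideal_ideal a by simp
    have "proj w a \<in> PIdl s" if w: "w \<in> carrier K" for w
    proof (cases "proj w a = \<zero>")
      case True
      then show ?thesis using id additive_subgroup.zero_closed ideal.axioms(1) by metis
    next
      case False
      then have pa: "proj w a \<in> H" using w a proj_closed homogI by blast
      obtain u where u: "u \<in> carrier K" "s \<in> G u" using a homogE by metis
      \<comment> \<open>At each prime element \<open>x\<close> there is another representation
        \<open>b / t\<close> with \<open>t\<close> outside \<open>PIdl x\<close>. The component of
        \<open>t a = s b\<close> in a suitable degree compares \<open>s\<close> with the component
        of \<open>a\<close>.\<close>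
      have "mlt x s \<le> mlt x (proj w a)" if x: "x \<in> prime_elems" for x
      proof -
        obtain b t where t: "b \<in> carrier R" "t \<in> H" "t \<notin> PIdl x" "z = fr b t"
          using z(2)[OF x] by (auto simp: graded_local_def)
        obtain v where v: "v \<in> carrier K" "t \<in> G v" using t homogE by metis
        have "t \<otimes> a = s \<otimes> b" using a t by (simp add: fr_eq_iff m_comm)
        then have "proj (v \<otimes>\<^bsub>K\<^esub> w) (t \<otimes> a) = proj (u \<otimes>\<^bsub>K\<^esub> (inv\<^bsub>K\<^esub> u \<otimes>\<^bsub>K\<^esub> (v \<otimes>\<^bsub>K\<^esub> w))) (s \<otimes> b)"
          using u v w comp_inv_mult(2) by simp
        then have "t \<otimes> proj w a = s \<otimes> proj (inv\<^bsub>K\<^esub> u \<otimes>\<^bsub>K\<^esub> (v \<otimes>\<^bsub>K\<^esub> w)) b"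
          using u v w a t by (simp add: proj_mult)
        moreover have "proj (inv\<^bsub>K\<^esub> u \<otimes>\<^bsub>K\<^esub> (v \<otimes>\<^bsub>K\<^esub> w)) b \<in> carrier R"
          using comp_closed[OF proj_closed] u v w t by simp
        ultimately have "int (mlt x s) \<le> int (mlt x (proj w a))"
          using graded_ordD(2)[OF graded_ord_mlt[OF x] pa a(2)] t(2,3) by blast
        then show ?thesis by simp
      qed
      then have "s divides\<^bsub>M\<^esub> proj w a" using divides_if_mlt_le[OF a(2) pa] by blast
      then show ?thesis using cgenideal_mem_iff a pa by simp
    qed
    then have "a \<in> PIdl s"
      using proj_mem_imp_mem[of "PIdl s" a] id a ideal.axioms(1) by blast
    then obtain c where "c \<in> carrier R" "a = c \<otimes> s" by (auto simp: cgenideal_def)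
    then have "z = fr c \<one>" using a by (simp add: fr_eq_iff)
    then show "z \<in> ?i ` carrier R" using \<open>c \<in> carrier R\<close> by blast
  qed
  have fin: "finite {\<nu> \<in> ?V. \<nu> x \<noteq> 0}" if x: "x \<in> ?i ` carrier R \<inter> homog K FR FG" for x
  proof -
    obtain a where a: "a \<in> H" "x = fr a \<one>" using x by (auto simp: fr_mem_homog_iff)
    \<comment> \<open>One prime element is chosen for each ideal. The valuation \<open>pval\<close>
      depends on the ideal only, so finitely many ideals leave finitely many valuations.\<close>
    define g where "g = (\<lambda>p. pval (SOME x. x \<in> prime_elems \<and> PIdl x = p))"
    have "pval y = g (PIdl y)" if y: "y \<in> prime_elems" for y
    proof -
      let ?y = "SOME x. x \<in> prime_elems \<and> PIdl x = PIdl y"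
      have y': "?y \<in> prime_elems" "PIdl ?y = PIdl y"
        using someI[of "\<lambda>x. x \<in> prime_elems \<and> PIdl x = PIdl y" y] y by auto
      have "pval y = pval ?y"
        using y y' by (intro frac_val_eqI) (auto simp: mlt_mult val mlt_cong[OF y y'(1)] frac_val_ext)
      then show ?thesis by (simp add: g_def)
    qed note g = this
    have "mlt y \<one> = 0" if "y \<in> prime_elems" for y
      using mlt_mult[OF that one_homog one_homog] by simp
    then have "\<nu> \<in> g ` cgenideal R ` {y \<in> prime_elems. mlt y a \<noteq> 0}" if "\<nu> \<in> ?V" "\<nu> x \<noteq> 0" for \<nu>
    proof -
      obtain y where y: "y \<in> prime_elems" "\<nu> = pval y"
        using \<open>\<nu> \<in> ?V\<close> by (auto simp: essential_valuations_ufd)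
      then have "mlt y a \<noteq> 0" using \<open>\<nu> x \<noteq> 0\<close> a \<open>\<And>y. y \<in> prime_elems \<Longrightarrow> mlt y \<one> = 0\<close> by (auto simp: val)
      then show ?thesis using y g[OF y(1)] by blast
    qed
    then have "{\<nu> \<in> ?V. \<nu> x \<noteq> 0} \<subseteq> g ` cgenideal R ` {y \<in> prime_elems. mlt y a \<noteq> 0}" by blast
    then show ?thesis using finite_mlt_nonzero[OF a(1)] finite_subset by blast
  qed
  have dv: "\<forall>\<nu>\<in>?V. discrete_valuation K FR FG \<nu>"
    by (auto simp: essential_valuations_def valuation_at_def)
  show ?thesis unfolding graded_Krull_def
    by (intro conjI exI[of _ FR] exI[of _ FG] exI[of _ ?V] exI[of _ ?i];
      (fact graded_ring graded_simple_FR dv hom inj img | rule ballI, erule deg | rule ballI, erule fin))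
qed

end

section \<open>Krull domains\<close>

lemma homog_trivial: "homog zero_group A (trivial_grading A) = carrier A - {\<zero>\<^bsub>A\<^esub>}"
  by (simp add: homog_def trivial_grading_def singleton_group_def)

text \<open>Makes the theory of graded domains available for ungraded ones, so that orders and
  valuations need to be studied only once.\<close>

lemma (in domain) graded_domain_trivial: "graded_domain zero_group R (trivial_grading R)"
proof
  have add: "additive_subgroup (carrier R) R"
    by (simp add: add.subgroup_self additive_subgroup.intro)
  have "graded_ring zero_group R (trivial_grading R)"
  proof (rule graded_ringI[where P = "\<lambda>_ x. x"])
    show "comm_group zero_group" by (simp add: comm_group_def comm_monoid_def comm_monoid_axioms_def singleton_group_def group.is_monoid[OF singleton_group, unfolded singleton_group_def] singleton_group[unfolded singleton_group_def])
    show "cring R" by (rule is_cring)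
    show "x = (\<Oplus>w\<in>{w \<in> carrier zero_group. x \<noteq> \<zero>}. x)" if "x \<in> carrier R" for x
    proof (cases "x = \<zero>")
      case False
      then have "{w \<in> carrier zero_group. x \<noteq> \<zero>} = {()}" by (auto simp: singleton_group_def)
      then show ?thesis using that by simp
    qed simp
  qed (use add in \<open>auto simp: trivial_grading_def\<close>)
  then show "graded_integral zero_group R (trivial_grading R)"
    using integral by (auto simp: graded_integral_def homog_trivial)
qed

lemma (in domain) trivial_graded_prime_iff:
  "graded_prime zero_group R (trivial_grading R) p \<longleftrightarrow> primeideal p R"
proof
  assume p: "graded_prime zero_group R (trivial_grading R) p"
  then interpret p: ideal p R by (simp add: graded_prime_def)
  show "primeideal p R"
  proof (rule primeidealI[OF p.is_ideal is_cring])
    show "carrier R \<noteq> p" using p by (auto simp: graded_prime_def)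
    fix a b assume "a \<in> carrier R" "b \<in> carrier R" "a \<otimes> b \<in> p"
    then show "a \<in> p \<or> b \<in> p"
      using p p.zero_closed unfolding graded_prime_def homog_trivial by blast
  qed
next
  assume "primeideal p R"
  then interpret p: primeideal p R .
  have "p = Idl (p \<inter> (carrier R - {\<zero>}))"
  proof
    interpret I: ideal "Idl (p \<inter> (carrier R - {\<zero>}))" R by (intro genideal_ideal) auto
    show "p \<subseteq> Idl (p \<inter> (carrier R - {\<zero>}))"
    proof
      fix x assume x: "x \<in> p"
      show "x \<in> Idl (p \<inter> (carrier R - {\<zero>}))"
      proof (cases "x = \<zero>")
        case False
        then show ?thesis using x genideal_self[of "p \<inter> (carrier R - {\<zero>})"] p.Icarr by blast
      qed simp
    qed
    show "Idl (p \<inter> (carrier R - {\<zero>})) \<subseteq> p" by (rule genideal_minimal[OF p.is_ideal]) blast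
  qed
  then show "graded_prime zero_group R (trivial_grading R) p"
    using p.is_ideal p.I_prime p.I_notcarr by (auto simp: graded_prime_def homog_trivial)
qed

text \<open>A Krull domain: \<open>V\<close> consists of the restrictions to \<open>A\<close> of a defining family of valuations.\<close>

locale weighted_domain = domain A for A :: "('a, 'm) ring_scheme" (structure) +
  fixes V :: "('a \<Rightarrow> int) set"
  assumes w_mult: "\<lbrakk>w \<in> V; a \<in> carrier A - {\<zero>}; b \<in> carrier A - {\<zero>}\<rbrakk> \<Longrightarrow> w (a \<otimes> b) = w a + w b"
    and w_nonneg: "\<lbrakk>w \<in> V; a \<in> carrier A - {\<zero>}\<rbrakk> \<Longrightarrow> 0 \<le> w a"
    and w_add: "\<lbrakk>w \<in> V; a \<in> carrier A - {\<zero>}; b \<in> carrier A - {\<zero>}; a \<oplus> b \<noteq> \<zero>\<rbrakk> \<Longrightarrow> min (w a) (w b) \<le> w (a \<oplus> b)"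
    and w_div: "\<lbrakk>a \<in> carrier A - {\<zero>}; b \<in> carrier A - {\<zero>}; \<And>w. w \<in> V \<Longrightarrow> w b \<le> w a\<rbrakk> \<Longrightarrow> \<exists>c\<in>carrier A. a = b \<otimes> c"
    and w_fin: "a \<in> carrier A - {\<zero>} \<Longrightarrow> finite {w \<in> V. w a \<noteq> 0}"
begin

abbreviation T :: "unit \<Rightarrow> 'a set" where "T \<equiv> trivial_grading A"
abbreviation Z :: "'a set" where "Z \<equiv> carrier A - {\<zero>}"

sublocale D: graded_domain zero_group A T by (rule graded_domain_trivial)

lemma Z_mult: "\<lbrakk>a \<in> Z; b \<in> Z\<rbrakk> \<Longrightarrow> a \<otimes> b \<in> Z"
  using integral by auto

lemma Z_pow: "a \<in> Z \<Longrightarrow> a [^] (n::nat) \<in> Z"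
  by (induction n) (use Z_mult in auto)

lemma w_one: "w \<in> V \<Longrightarrow> w \<one> = 0"
  using w_mult[of w \<one> \<one>] by simp

lemma w_pow: "\<lbrakk>w \<in> V; a \<in> Z\<rbrakk> \<Longrightarrow> w (a [^] (n::nat)) = int n * w a"
proof (induction n)
  case (Suc n)
  then show ?case using w_mult[of w "a [^] n" a] Z_pow[of a n] by (simp add: algebra_simps)
qed (simp add: w_one)

lemma Z_factor: "\<lbrakk>a \<in> Z; a = b \<otimes> c; b \<in> carrier A; c \<in> carrier A\<rbrakk> \<Longrightarrow> b \<in> Z \<and> c \<in> Z"
  by auto

section \<open>Centers of weights and approximation\<close>

definition center :: "('a \<Rightarrow> int) \<Rightarrow> 'a set" where
  "center w = insert \<zero> {a \<in> Z. 0 < w a}"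

lemma primeideal_center:
  assumes w: "w \<in> V"
  shows "primeideal (center w) A"
proof (rule primeidealI)
  \<comment> \<open>The element \<open>\<ominus> \<one>\<close> has weight 0 because its square is
    \<open>\<one>\<close>, so negation preserves weights.\<close>
  have neg: "w (\<ominus> a) = w a" if "a \<in> Z" for a
  proof -
    have m1: "\<ominus> \<one> \<in> Z" using one_not_zero by (metis Diff_iff a_inv_closed add.inv_eq_1_iff one_closed singletonD)
    have "w (\<ominus> \<one> \<otimes> \<ominus> \<one>) = w (\<ominus> \<one>) + w (\<ominus> \<one>)" using w_mult[OF w m1 m1] .
    then have "w (\<ominus> \<one>) = 0" using w_one[OF w] by (simp add: l_minus)
    then show ?thesis using w_mult[OF w m1 that] that by (simp add: l_minus)
  qed
  have mult: "x \<otimes> a \<in> center w" if "a \<in> center w" "x \<in> carrier A" for a x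
  proof (cases "a = \<zero> \<or> x = \<zero>")
    case False
    then show ?thesis using that w_mult[OF w, of x a] w_nonneg[OF w, of x] Z_mult[of x a] by (auto simp: center_def)
  qed (use that in \<open>auto simp: center_def\<close>)
  show "ideal (center w) A"
  proof (rule idealI[OF ring_axioms])
    show "subgroup (center w) (add_monoid A)"
    proof
      fix x y assume x: "x \<in> center w"
      show "inv\<^bsub>add_monoid A\<^esub> x \<in> center w"
        using x neg by (auto simp: center_def a_inv_def[symmetric])
      assume y: "y \<in> center w"
      show "x \<otimes>\<^bsub>add_monoid A\<^esub> y \<in> center w"
      proof (cases "x = \<zero> \<or> y = \<zero> \<or> x \<oplus> y = \<zero>")
        case False
        then have xy: "x \<in> Z" "y \<in> Z" "x \<oplus> y \<noteq> \<zero>" "0 < w x" "0 < w y" using x y by (auto simp: center_def)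
        then have "0 < w (x \<oplus> y)" using w_add[OF w xy(1-3)] by simp
        then show ?thesis using xy by (auto simp: center_def)
      qed (use x y in \<open>auto simp: center_def\<close>)
    qed (auto simp: center_def)
    show "a \<otimes> x \<in> center w" "x \<otimes> a \<in> center w" if "a \<in> center w" "x \<in> carrier A" for a x
      using mult[OF that] m_comm[of a x] that by (auto simp: center_def)
  qed
  show "carrier A \<noteq> center w"
  proof
    assume "carrier A = center w"
    then have "\<one> \<in> center w" using one_closed by blast
    then show False using w_one[OF w] by (simp add: center_def)
  qed
  fix a b assume ab: "a \<in> carrier A" "b \<in> carrier A" "a \<otimes> b \<in> center w"
  show "a \<in> center w \<or> b \<in> center w"
  proof (cases "a = \<zero> \<or> b = \<zero>")
    case False
    then have "0 < w a + w b" using ab w_mult[OF w, of a b] Z_mult[of a b] by (auto simp: center_def)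
    then show ?thesis using False ab by (auto simp: center_def)
  qed (auto simp: center_def)
qed (rule is_cring)

text \<open>Multiply powers of elements of positive weight outside \<open>p\<close>; as all weights
  are non-negative, no factor spoils what the others achieve. The set \<open>W\<close> is arbitrary
  because the lemma is applied to members of \<open>V\<close> and later to the orders at minimal
  primes.\<close>

lemma ex_large_outside:
  assumes p: "primeideal p A" and fin: "finite W"
    and "\<And>w a b. \<lbrakk>w \<in> W; a \<in> Z; b \<in> Z\<rbrakk> \<Longrightarrow> w (a \<otimes> b) = w a + w b"
    and "\<And>w a. \<lbrakk>w \<in> W; a \<in> Z\<rbrakk> \<Longrightarrow> 0 \<le> w a"
    and "\<And>w. w \<in> W \<Longrightarrow> \<exists>b\<in>carrier A - p. 0 < w b"
  shows "\<exists>s\<in>carrier A - p. \<forall>w\<in>W. n w \<le> (w s :: int)"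
  using fin assms(3-)
proof (induction W rule: finite_induct)
  case empty
  then show ?case using primeideal.I_notcarr[OF p] ideal.one_imp_carrier[OF primeideal.axioms(1)[OF p]] by blast
next
  case (insert u W)
  interpret p: primeideal p A by fact
  note mult = insert.prems(1) and nonneg = insert.prems(2)
  have notp: "x \<in> Z" if "x \<in> carrier A - p" for x using that p.zero_closed by auto
  have "\<exists>s\<in>carrier A - p. \<forall>w\<in>W. n w \<le> w s"
    by (rule insert.IH) (use insert.prems in auto)
  then obtain s where s: "s \<in> carrier A - p" "\<forall>w\<in>W. n w \<le> w s" by blast
  obtain b where b: "b \<in> carrier A - p" "0 < u b" using insert.prems(3) by auto
  have "\<one> \<notin> p" using p.one_imp_carrier p.I_notcarr by blast
  have pw: "b [^] (k::nat) \<in> carrier A - p" for k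
  proof (induction k)
    case (Suc k)
    then show ?case using b p.I_prime[of "b [^] k" b] by auto
  qed (use \<open>\<one> \<notin> p\<close> in simp)
  \<comment> \<open>The weight \<open>u b\<close> is at least 1, so the \<open>k\<close>-th power of
    \<open>b\<close> has \<open>u\<close>-weight at least \<open>n u\<close>.\<close>
  define k where "k = nat (n u)"
  let ?s = "s \<otimes> b [^] k"
  have s': "?s \<in> carrier A - p" using s pw[of k] p.I_prime[of s "b [^] k"] by auto
  have val: "w (s \<otimes> b [^] k) = w s + int k * w b" if w: "w \<in> insert u W" for w and k :: nat
  proof -
    have "w \<one> = 0" using mult[OF w, of \<one> \<one>] by simp
    then have "w (b [^] k) = int k * w b"
      by (induction k) (simp_all add: mult[OF w notp[OF pw] notp[OF b(1)]] algebra_simps)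
    then show ?thesis using mult[OF w notp[OF s(1)] notp[OF pw]] by simp
  qed
  have "n w \<le> w ?s" if w: "w \<in> insert u W" for w
  proof (cases "w = u")
    case True
    have "n u \<le> int k * 1" by (simp add: k_def)
    also have "\<dots> \<le> int k * u b" using b(2) by (intro mult_left_mono) auto
    also have "\<dots> \<le> u ?s" using val[of u] nonneg[OF _ notp[OF s(1)], of u] by auto
    finally show ?thesis using True by simp
  next
    case False
    then have "n w \<le> w s" using w s by auto
    moreover have "0 \<le> int k * w b" using nonneg[OF w notp[OF b(1)]] by simp
    ultimately show ?thesis using val[OF w] by simp
  qed
  then show ?case using s' by blast
qed

text \<open>Suppose that no weight positive at \<open>a\<close> is centered inside \<open>p\<close>.
  There are finitely many of them, so some \<open>s\<close> outside \<open>p\<close> satisfies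
  \<open>w a \<le> w s\<close> for all \<open>w\<close>. Then \<open>a\<close> divides
  \<open>s\<close>, which puts \<open>s\<close> into \<open>p\<close>.\<close>

lemma ex_center_subset:
  assumes p: "primeideal p A" and a: "a \<in> p" "a \<noteq> \<zero>"
  obtains w where "w \<in> V" "0 < w a" "center w \<subseteq> p"
proof -
  interpret p: primeideal p A by fact
  have aZ: "a \<in> Z" using a p.Icarr by blast
  have "\<exists>w\<in>V. 0 < w a \<and> center w \<subseteq> p"
  proof (rule ccontr)
    assume no: "\<not> ?thesis"
    let ?W = "{w \<in> V. w a \<noteq> 0}"
    have "\<exists>b\<in>carrier A - p. 0 < w b" if "w \<in> ?W" for w
    proof -
      have "0 < w a" using that w_nonneg[of w a] aZ by auto
      then have "\<not> center w \<subseteq> p" using that no by auto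
      then show ?thesis using p.zero_closed by (auto simp: center_def)
    qed
    then have "\<exists>s\<in>carrier A - p. \<forall>w\<in>?W. w a \<le> w s"
      by (intro ex_large_outside[OF p w_fin[OF aZ]]) (use w_mult w_nonneg in auto)
    then obtain s where s: "s \<in> carrier A - p" "\<forall>w\<in>?W. w a \<le> w s" by blast
    have sZ: "s \<in> Z" using s p.zero_closed by auto
    have "w a \<le> w s" if "w \<in> V" for w
      using s that w_nonneg[OF that sZ] by (cases "w a = 0") auto
    then obtain c where "c \<in> carrier A" "s = a \<otimes> c" using w_div[OF sZ aZ] by blast
    then show False using s a p.I_r_closed by auto
  qed
  then show thesis using that by blast
qed

section \<open>Orders at minimal primes\<close>

definition min_prime :: "'a set \<Rightarrow> bool" where
  "min_prime p \<longleftrightarrow> primeideal p A \<and> p \<noteq> {\<zero>} \<and> (\<forall>q. primeideal q A \<and> q \<noteq> {\<zero>} \<and> q \<subseteq> p \<longrightarrow> q = p)"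

lemma min_prime_iff: "minimal_graded_prime zero_group A T p \<longleftrightarrow> min_prime p"
  by (simp add: min_prime_def minimal_graded_prime_def trivial_graded_prime_iff)

lemma min_primeD:
  assumes "min_prime p"
  shows "primeideal p A" "\<exists>a. a \<in> p \<and> a \<in> Z" "\<one> \<notin> p" "x \<in> carrier A - p \<Longrightarrow> x \<in> Z"
proof -
  show p: "primeideal p A" using assms by (simp add: min_prime_def)
  interpret p: primeideal p A by fact
  show "\<exists>a. a \<in> p \<and> a \<in> Z" using assms p.zero_closed p.Icarr unfolding min_prime_def by blast
  show "\<one> \<notin> p" using p.one_imp_carrier p.I_notcarr by blast
  show "x \<in> Z" if "x \<in> carrier A - p" using that p.zero_closed by auto
qed

lemma center_nontrivial: "\<lbrakk>0 < w a; a \<in> Z\<rbrakk> \<Longrightarrow> center w \<noteq> {\<zero>}"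
  by (auto simp: center_def)

lemma min_prime_center:
  assumes p: "min_prime p" and "w \<in> V" "0 < w a" "a \<in> Z" "center w \<subseteq> p"
  shows "center w = p"
  using assms primeideal_center center_nontrivial unfolding min_prime_def by metis

text \<open>Up to a factor outside \<open>p\<close>, divisibility is decided by the weights centered
  at \<open>p\<close>: the finitely many others that are positive at \<open>b\<close> are not
  centered inside \<open>p\<close>, so a factor \<open>s\<close> outside \<open>p\<close> can raise
  them sufficiently.\<close>

lemma min_prime_le_iff:
  assumes p: "min_prime p" and ab: "a \<in> Z" "b \<in> Z"
  shows "(\<forall>w\<in>V. center w = p \<longrightarrow> w b \<le> w a) \<longleftrightarrow> (\<exists>s\<in>Z - p. \<exists>c\<in>carrier A. s \<otimes> a = b \<otimes> c)"
proof
  assume le: "\<forall>w\<in>V. center w = p \<longrightarrow> w b \<le> w a"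
  let ?W = "{w \<in> V. w b \<noteq> 0 \<and> center w \<noteq> p}"
  have "\<exists>x\<in>carrier A - p. 0 < w x" if w: "w \<in> ?W" for w
  proof -
    have "0 < w b" using w w_nonneg[of w b] ab by auto
    then have "\<not> center w \<subseteq> p" using w min_prime_center[OF p, of w b] ab by auto
    then show ?thesis using ideal.axioms(1)[OF primeideal.axioms(1)[OF min_primeD(1)[OF p]]] additive_subgroup.zero_closed
      by (auto simp: center_def)
  qed
  moreover have "finite ?W" using w_fin[OF ab(2)] by (rule rev_finite_subset) auto
  ultimately have "\<exists>s\<in>carrier A - p. \<forall>w\<in>?W. w b \<le> w s"
    by (intro ex_large_outside[OF min_primeD(1)[OF p]]) (use w_mult w_nonneg in auto)
  then obtain s where s: "s \<in> carrier A - p" "\<forall>w\<in>?W. w b \<le> w s" by blast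
  have sZ: "s \<in> Z" using min_primeD(4)[OF p s(1)] .
  have "w b \<le> w (s \<otimes> a)" if w: "w \<in> V" for w
    using w_mult[OF w sZ ab(1)] w_nonneg[OF w sZ] w_nonneg[OF w ab(1)] s(2) le w
    by (cases "w b = 0"; cases "center w = p") force+
  then obtain c where "c \<in> carrier A" "s \<otimes> a = b \<otimes> c"
    using w_div[OF Z_mult[OF sZ ab(1)] ab(2)] by blast
  then show "\<exists>s\<in>Z - p. \<exists>c\<in>carrier A. s \<otimes> a = b \<otimes> c" using s sZ by blast
next
  assume "\<exists>s\<in>Z - p. \<exists>c\<in>carrier A. s \<otimes> a = b \<otimes> c"
  then obtain s c where s: "s \<in> Z" "s \<notin> p" "c \<in> carrier A" "s \<otimes> a = b \<otimes> c" by blast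
  then have cZ: "c \<in> Z" using Z_factor[of "s \<otimes> a" b c] Z_mult[of s a] ab by auto
  have "w b \<le> w a" if w: "w \<in> V" "center w = p" for w
  proof -
    have "w s = 0" using s(1,2) w w_nonneg[OF w(1) s(1)] by (auto simp: center_def)
    moreover have "w s + w a = w b + w c" using w_mult[OF w(1)] s ab cZ by metis
    ultimately show ?thesis using w_nonneg[OF w(1) cZ] by simp
  qed
  then show "\<forall>w\<in>V. center w = p \<longrightarrow> w b \<le> w a" by blast
qed

text \<open>
  Comparing \<open>a ^ w\<^sub>0(b)\<close> and \<open>b ^ w\<^sub>0(a)\<close> for a weight \<open>w\<^sub>0\<close> maximizing the ratio \<open>w(a)/w(b)\<close> produces
  an element of weight \<open>0\<close> under \<open>w\<^sub>0\<close>, hence outside \<open>p\<close>, hence of weight \<open>0\<close> under all \<open>w\<close> centered at \<open>p\<close>.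
\<close>

lemma weights_proportional:
  assumes p: "min_prime p" and ab: "a \<in> Z" "a \<in> p" "b \<in> Z" "b \<in> p"
    and w: "w1 \<in> V" "center w1 = p" "w2 \<in> V" "center w2 = p"
  shows "w1 a * w2 b = w1 b * w2 a"
proof -
  let ?W = "{w \<in> V. center w = p}"
  have pos: "0 < w x" if "w \<in> ?W" "x \<in> p" "x \<in> Z" for w x
    using that by (auto simp: center_def)
  have "?W \<subseteq> {w \<in> V. w a \<noteq> 0}" using pos[OF _ ab(2,1)] by force
  then have "finite ?W" using w_fin[OF ab(1)] finite_subset by blast
  moreover have "?W \<noteq> {}" using w by blast
  ultimately obtain w0 where w0: "w0 \<in> ?W" "\<And>w. w \<in> ?W \<Longrightarrow> real_of_int (w a) / w b \<le> real_of_int (w0 a) / w0 b"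
    using obtains_MAX[of ?W "\<lambda>w. real_of_int (w a) / w b"] by (metis (no_types, lifting) Max_ge finite_imageI imageI)
  have max: "w a * w0 b \<le> w0 a * w b" if "w \<in> ?W" for w
  proof -
    have "real_of_int (w a) * w0 b \<le> real_of_int (w0 a) * w b"
      using w0(2)[OF that] pos[OF that ab(4,3)] pos[OF w0(1) ab(4,3)] by (simp add: field_simps)
    then show ?thesis by (metis of_int_le_iff of_int_mult)
  qed
  define m n where "m = nat (w0 b)" and "n = nat (w0 a)"
  have mn: "int m = w0 b" "int n = w0 a"
    using pos[OF w0(1) ab(4,3)] pos[OF w0(1) ab(2,1)] by (auto simp: m_def n_def)
  have pw: "w (b [^] n) = w0 a * w b" "w (a [^] m) = w0 b * w a" if "w \<in> ?W" for w
    using that w_pow[OF _ ab(1), of w m] w_pow[OF _ ab(3), of w n] mn by simp_all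
  have "\<forall>w\<in>V. center w = p \<longrightarrow> w (a [^] m) \<le> w (b [^] n)"
    using pw max by (auto simp: mult.commute)
  then obtain s c where s: "s \<in> Z" "s \<notin> p" "c \<in> carrier A" "s \<otimes> b [^] n = a [^] m \<otimes> c"
    using min_prime_le_iff[OF p Z_pow[OF ab(3)] Z_pow[OF ab(1)]] by blast
  have cZ: "c \<in> Z" using Z_factor[of "s \<otimes> b [^] n" "a [^] m" c] Z_mult[OF s(1) Z_pow[OF ab(3)]] s ab by auto
  have wc: "w c = w0 a * w b - w0 b * w a" if wW: "w \<in> ?W" for w
  proof -
    have "w s = 0" using s(1,2) wW w_nonneg[of w s] by (auto simp: center_def)
    moreover have "w s + w (b [^] n) = w (a [^] m) + w c"
      using wW w_mult s(4) s(1) cZ Z_pow[OF ab(1)] Z_pow[OF ab(3)] by (metis (mono_tags, lifting) mem_Collect_eq)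
    ultimately show ?thesis using pw[OF wW] by simp
  qed
  have "w0 c = 0" using wc[OF w0(1)] by simp
  then have "c \<notin> p" using pos[OF w0(1) _ cZ] by auto
  then have eq: "w0 a * w b = w0 b * w a" if "w \<in> ?W" for w
    using wc[OF that] that cZ w_nonneg[of w c] by (auto simp: center_def)
  have "w0 b * (w1 a * w2 b) = (w0 b * w1 a) * w2 b" by simp
  also have "\<dots> = w1 b * (w0 a * w2 b)" using eq[of w1] w by (simp add: ac_simps)
  also have "\<dots> = w0 b * (w1 b * w2 a)" using eq[of w2] w by (simp add: ac_simps)
  finally show ?thesis using pos[OF w0(1) ab(4,3)] by simp
qed

text \<open>By \<open>weights_proportional\<close> a single weight centered at \<open>p\<close>
  decides divisibility in the localization. Division by the least positive difference
  \<open>d\<close> of its values makes it attain the difference 1.\<close>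

lemma ex_graded_ord:
  assumes p: "min_prime p"
  shows "\<exists>v. graded_ord zero_group A T p v"
proof -
  obtain x where x: "x \<in> p" "x \<in> Z" using min_primeD(2)[OF p] by blast
  obtain w where w: "w \<in> V" "0 < w x" "center w \<subseteq> p"
    using ex_center_subset[OF min_primeD(1)[OF p], of x] x by auto
  then have wp: "center w = p" using min_prime_center[OF p] x by blast
  have le: "w b \<le> w a \<longleftrightarrow> (\<exists>s\<in>Z - p. \<exists>c\<in>carrier A. s \<otimes> a = b \<otimes> c)" if ab: "a \<in> Z" "b \<in> Z" for a b
  proof -
    have "w' b \<le> w' a" if le: "w b \<le> w a" and w': "w' \<in> V" "center w' = p" for w'
    proof (cases "b \<in> p")
      case False
      then have "w' b = 0" using ab w' w_nonneg[OF w'(1) ab(2)] by (auto simp: center_def)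
      then show ?thesis using w_nonneg[OF w'(1) ab(1)] by simp
    next
      case True
      then have b: "0 < w b" "0 < w' b" using wp w' ab by (auto simp: center_def)
      then have a: "a \<in> p" using le wp ab by (auto simp: center_def)
      have "w' b * w b \<le> w' b * w a" using le b by simp
      also have "\<dots> = w' a * w b" using weights_proportional[OF p ab(1) a ab(2) True w' w(1) wp] by simp
      finally show ?thesis using b by simp
    qed
    then have "w b \<le> w a \<longleftrightarrow> (\<forall>w\<in>V. center w = p \<longrightarrow> w b \<le> w a)" using w wp by blast
    then show ?thesis using min_prime_le_iff[OF p ab] by simp
  qed
  define P where "P = (\<lambda>n. 0 < n \<and> (\<exists>a\<in>Z. \<exists>b\<in>Z. w a - w b = int n))"
  have "P (nat (w x))" unfolding P_def
  proof
    show "\<exists>a\<in>Z. \<exists>b\<in>Z. w a - w b = int (nat (w x))"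
      using w x w_one[OF w(1)] by (intro bexI[of _ x] bexI[of _ \<one>]) auto
  qed (use w in simp)
  then have "P (LEAST n. P n)" by (rule LeastI)
  moreover define d where "d = (LEAST n. P n)"
  ultimately obtain t t' where d: "0 < d" "t \<in> Z" "t' \<in> Z" "w t - w t' = int d" by (auto simp: P_def)
  have dvd: "int d dvd w a" if a: "a \<in> Z" for a
  proof -
    define k where "k = nat (w a div int d)"
    have k: "int k = w a div int d" using w_nonneg[OF w(1) a] by (simp add: k_def pos_imp_zdiv_nonneg_iff d)
    \<comment> \<open>The remainder of \<open>w a\<close> modulo \<open>d\<close> is again a
      difference of two values, so minimality of \<open>d\<close> forces it to be 0.\<close>
    have "w (a \<otimes> t' [^] k) - w (t [^] k) = w a - int k * (w t - w t')"
      using w_mult[OF w(1) a Z_pow[OF d(3)]] w_pow[OF w(1)] d by (simp add: algebra_simps)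
    also have "\<dots> = int (nat (w a mod int d))"
    proof -
      have "w a mod int d = w a - int k * int d" using k by (simp add: minus_div_mult_eq_mod)
      moreover have "0 \<le> w a mod int d" using d(1) by simp
      ultimately show ?thesis using d(4) by simp
    qed
    finally have eq: "w (a \<otimes> t' [^] k) - w (t [^] k) = int (nat (w a mod int d))" .
    have "P (nat (w a mod int d))" if "0 < nat (w a mod int d)"
      unfolding P_def using that eq Z_mult[OF a Z_pow[OF d(3)]] Z_pow[OF d(2)] by metis
    moreover have "nat (w a mod int d) < d" using d(1) by (simp add: nat_less_iff)
    ultimately have "nat (w a mod int d) = 0" using not_less_Least[of _ P] unfolding d_def by blast
    then show ?thesis using d(1) by (metis dvd_eq_mod_eq_0 nat_eq_iff2 of_nat_0 of_nat_0_less_iff pos_mod_sign nat_0_iff order_antisym)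
  qed
  define v where "v = (\<lambda>a. w a div int d)"
  have wv: "w a = int d * v a" if "a \<in> Z" for a using dvd[OF that] by (simp add: v_def)
  have "graded_ord zero_group A T p v" unfolding graded_ord_def homog_trivial
  proof (intro conjI ballI)
    fix a b assume ab: "a \<in> Z" "b \<in> Z"
    show "v (a \<otimes> b) = v a + v b"
      using w_mult[OF w(1) ab] wv[OF Z_mult[OF ab]] wv[OF ab(1)] wv[OF ab(2)] d(1) by (simp add: distrib_left[symmetric])
    show "v b \<le> v a \<longleftrightarrow> (\<exists>s\<in>Z - p. \<exists>c\<in>carrier A. s \<otimes> a = b \<otimes> c)"
      using le[OF ab] wv[OF ab(1)] wv[OF ab(2)] d(1) by simp
  next
    have "int d * v t = int d * (v t' + 1)" using d wv[OF d(2)] wv[OF d(3)] by (simp add: distrib_left)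
    then show "\<exists>a\<in>Z. \<exists>b\<in>Z. v a = v b + 1" using d by auto
  qed
  then show ?thesis by blast
qed

text \<open>Each of these primes is the center of one of the finitely many weights that are positive
  at \<open>a\<close>.\<close>

lemma finite_min_primes:
  assumes "a \<in> Z"
  shows "finite {p. min_prime p \<and> a \<in> p}"
proof -
  have "{p. min_prime p \<and> a \<in> p} \<subseteq> center ` {w \<in> V. w a \<noteq> 0}"
  proof
    fix p assume "p \<in> {p. min_prime p \<and> a \<in> p}"
    then have p: "min_prime p" "a \<in> p" by auto
    then obtain w where w: "w \<in> V" "0 < w a" "center w \<subseteq> p"
      using ex_center_subset[OF min_primeD(1)[OF p(1)] p(2)] assms by auto
    then have "p = center w" using min_prime_center[OF p(1)] assms by blast
    then show "p \<in> center ` {w \<in> V. w a \<noteq> 0}" using w by auto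
  qed
  then show ?thesis using w_fin[OF assms] finite_surj by blast
qed

text \<open>Used when all powers of a fraction have a common denominator: such a fraction has
  non-negative weights and hence lies in the ring.\<close>

lemma le_of_bounded_multiples:
  fixes x y z :: int
  assumes "\<And>n. int n * x \<le> int n * y + z"
  shows "x \<le> y"
proof (rule ccontr)
  assume "\<not> x \<le> y"
  then have "int (nat (z + 1)) * 1 \<le> int (nat (z + 1)) * (x - y)" by (intro mult_left_mono) auto
  then show False using assms[of "nat (z + 1)"] by (simp add: algebra_simps split: if_splits)
qed

text \<open>
  If \<open>a/b\<close> is not in \<open>A\<close>, then choosing \<open>c\<close> suitably the ideal \<open>(b : ca)\<close> is prime. It is minimal:
  either it is mapped into itself by \<open>ca/b\<close>, which then lies in \<open>A\<close>, or its localization is principal.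
\<close>

lemma divides_if_locally_divides:
  assumes ab: "a \<in> Z" "b \<in> Z"
    and loc: "\<And>p. min_prime p \<Longrightarrow> \<exists>s\<in>Z - p. \<exists>c\<in>carrier A. s \<otimes> a = b \<otimes> c"
  shows "\<exists>c\<in>carrier A. a = b \<otimes> c"
proof (rule ccontr)
  assume no: "\<not> ?thesis"
  let ?dv = "\<lambda>x. \<exists>c\<in>carrier A. x = b \<otimes> c"
  let ?W = "{w \<in> V. w b \<noteq> 0}"
  \<comment> \<open>The total amount by which \<open>c a\<close> falls short of divisibility by
    \<open>b\<close>. Among the \<open>c\<close> for which \<open>c a\<close> is not divisible by
    \<open>b\<close>, one with least shortfall is taken.\<close>
  define \<mu> where "\<mu> = (\<lambda>c. \<Sum>w\<in>?W. nat (w b - w (c \<otimes> a)))"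
  have "\<one> \<in> Z \<and> \<not> ?dv (\<one> \<otimes> a)" using no ab by simp
  then obtain c where c: "c \<in> Z" "\<not> ?dv (c \<otimes> a)"
    and least: "\<And>c'. c' \<in> Z \<and> \<not> ?dv (c' \<otimes> a) \<Longrightarrow> \<mu> c \<le> \<mu> c'"
    using ex_has_least_nat[of "\<lambda>c. c \<in> Z \<and> \<not> ?dv (c \<otimes> a)" \<one> \<mu>] by blast
  define e where "e = c \<otimes> a"
  have eZ: "e \<in> Z" using Z_mult c ab by (simp add: e_def)
  have [simp]: "e \<in> carrier A" "b \<in> carrier A" "a \<in> carrier A" "c \<in> carrier A" using eZ ab c by auto
  have cancel: "x = y" if "b \<otimes> x = b \<otimes> y" "x \<in> carrier A" "y \<in> carrier A" for x y
    using m_lcancel[of b x y] that ab by auto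
  define q where "q = {x \<in> carrier A. ?dv (x \<otimes> e)}"
  have q_divI: "x \<in> q" if xZ: "x \<in> Z" and le: "\<And>w. w \<in> ?W \<Longrightarrow> w b \<le> w x + w e" for x
  proof -
    have "w b \<le> w (x \<otimes> e)" if w: "w \<in> V" for w
      using le[of w] w_mult[OF w xZ eZ] w_nonneg[OF w xZ] w_nonneg[OF w eZ] w
      by (cases "w b = 0") auto
    then have "?dv (x \<otimes> e)" using w_div[OF Z_mult[OF xZ eZ] ab(2)] by blast
    then show ?thesis using xZ by (simp add: q_def)
  qed
  have q_div: "w b \<le> w x + w e" if xq: "x \<in> q" and that: "x \<in> Z" "w \<in> V" for w x
  proof -
    obtain y where y: "y \<in> carrier A" "x \<otimes> e = b \<otimes> y" using xq unfolding q_def by blast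
    have "y \<in> Z" using Z_factor[of "x \<otimes> e" b y] Z_mult[OF that(1) eZ] y by auto
    then have "w x + w e = w b + w y"
      using w_mult[OF that(2,1) eZ] w_mult[OF that(2) ab(2), of y] y(2) by simp
    then show ?thesis using w_nonneg[OF that(2) \<open>y \<in> Z\<close>] by simp
  qed
  have idq: "ideal q A"
  proof (rule idealI[OF ring_axioms])
    show "subgroup q (add_monoid A)"
    proof
      show "q \<subseteq> carrier (add_monoid A)" by (auto simp: q_def)
      show "\<one>\<^bsub>add_monoid A\<^esub> \<in> q" by (auto simp: q_def intro!: bexI[of _ \<zero>])
      fix x y assume x: "x \<in> q"
      then obtain z where z: "x \<in> carrier A" "z \<in> carrier A" "x \<otimes> e = b \<otimes> z" by (auto simp: q_def)
      then have "\<ominus> x \<otimes> e = b \<otimes> \<ominus> z" by (simp add: l_minus r_minus)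
      then have "\<ominus> x \<in> q" using z by (auto simp: q_def)
      then show "inv\<^bsub>add_monoid A\<^esub> x \<in> q" by (simp add: a_inv_def)
      assume "y \<in> q"
      then obtain z' where z': "y \<in> carrier A" "z' \<in> carrier A" "y \<otimes> e = b \<otimes> z'" by (auto simp: q_def)
      then have "(x \<oplus> y) \<otimes> e = b \<otimes> (z \<oplus> z')" using z by (simp add: l_distr r_distr)
      then show "x \<otimes>\<^bsub>add_monoid A\<^esub> y \<in> q" using z z' by (auto simp: q_def)
    qed
    show "x \<otimes> r \<in> q" "r \<otimes> x \<in> q" if xq: "x \<in> q" and that: "r \<in> carrier A" for x r
    proof -
      obtain z where z: "x \<in> carrier A" "z \<in> carrier A" "x \<otimes> e = b \<otimes> z" using xq unfolding q_def by blast
      have "(r \<otimes> x) \<otimes> e = r \<otimes> (x \<otimes> e)" using z that by (simp add: m_assoc)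
      also have "\<dots> = b \<otimes> (r \<otimes> z)" unfolding z(3) using z(1,2) that by (simp add: m_lcomm)
      finally show "r \<otimes> x \<in> q" using z that by (auto simp: q_def)
      then show "x \<otimes> r \<in> q" using m_comm[of x r] z that by simp
    qed
  qed
  then interpret q: ideal q A .
  have ce: "\<not> ?dv e" using c(2) unfolding e_def .
  have one_q: "\<one> \<notin> q"
  proof
    assume "\<one> \<in> q"
    then have "?dv (\<one> \<otimes> e)" unfolding q_def by blast
    then show False using ce by simp
  qed
  have "primeideal q A"
  proof (rule primeidealI[OF idq is_cring])
    show "carrier A \<noteq> q" using one_q by auto
    fix x y assume xy: "x \<in> carrier A" "y \<in> carrier A" "x \<otimes> y \<in> q"
    show "x \<in> q \<or> y \<in> q"
    proof (rule ccontr)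
      assume "\<not> (x \<in> q \<or> y \<in> q)"
      then have xq: "x \<notin> q" and yq: "y \<notin> q" by auto
      then have Z: "x \<in> Z" "y \<in> Z" using xy q.zero_closed by auto
      have xc: "(x \<otimes> c) \<otimes> a = x \<otimes> e" using xy by (simp add: e_def m_assoc)
      have "\<not> ?dv ((x \<otimes> c) \<otimes> a)" using xq xy(1) unfolding xc q_def by blast
      then have le: "\<mu> c \<le> \<mu> (x \<otimes> c)" using least Z_mult[OF Z(1) c(1)] by blast
      have trm: "nat (w b - w (x \<otimes> e)) \<le> nat (w b - w e)" if "w \<in> ?W" for w
        using that w_mult[of w x e] w_nonneg[of w x] Z eZ by auto
      \<comment> \<open>Multiplying by \<open>x\<close> cannot increase any term of the shortfall,
        and by minimality it cannot decrease the sum. So \<open>x\<close> has weight 0 wherever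
        \<open>e\<close> falls short, and the condition on \<open>x y\<close> is a condition on
        \<open>y\<close> alone.\<close>
      have "nat (w b - w (x \<otimes> e)) = nat (w b - w e)" if w: "w \<in> ?W" for w
      proof (rule ccontr)
        assume "nat (w b - w (x \<otimes> e)) \<noteq> nat (w b - w e)"
        then have "nat (w b - w (x \<otimes> e)) < nat (w b - w e)" using trm[OF w] by linarith
        then have "(\<Sum>w\<in>?W. nat (w b - w (x \<otimes> e))) < (\<Sum>w\<in>?W. nat (w b - w e))"
        proof (intro sum_strict_mono_ex1[OF w_fin[OF ab(2)]])
          show "\<forall>w\<in>?W. nat (w b - w (x \<otimes> e)) \<le> nat (w b - w e)" using trm by blast
          assume "nat (w b - w (x \<otimes> e)) < nat (w b - w e)"
          then show "\<exists>w\<in>?W. nat (w b - w (x \<otimes> e)) < nat (w b - w e)" using w by blast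
        qed
        then show False using le unfolding \<mu>_def xc e_def[symmetric] by simp
      qed note eq = this
      have "w b \<le> w y + w e" if w: "w \<in> ?W" for w
      proof -
        have wV: "w \<in> V" using w by simp
        have "w b \<le> (w x + w y) + w e"
          using q_div[OF xy(3) Z_mult[OF Z] wV] w_mult[OF wV Z] by simp
        moreover have "w (x \<otimes> e) = w x + w e" using w_mult[OF wV Z(1) eZ] .
        moreover have "w b \<le> w e \<or> w (x \<otimes> e) = w e" using eq[OF w] by linarith
        ultimately show ?thesis using w_nonneg[OF wV Z(2)] by linarith
      qed
      then show False using q_divI[OF Z(2)] yq by blast
    qed
  qed
  then interpret q: primeideal q A .
  have "b \<in> carrier A" "e \<in> carrier A" by simp_all
  then have bq: "b \<in> q" unfolding q_def by blast
  \<comment> \<open>If \<open>e / b\<close> mapped \<open>q\<close> into itself, iterating it on the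
    element \<open>b\<close> of \<open>q\<close> would show that \<open>b^n\<close> divides
    \<open>e^n b\<close> for all \<open>n\<close>, hence that \<open>b\<close> divides
    \<open>e\<close>.\<close>
  have "\<exists>y s. y \<in> q \<and> s \<in> carrier A - q \<and> y \<otimes> e = b \<otimes> s"
  proof (rule ccontr)
    assume neg: "\<not> ?thesis"
    have ex: "\<exists>y\<in>q. y \<in> Z \<and> e [^] n \<otimes> b = b [^] n \<otimes> y" for n :: nat
    proof (induction n)
      case 0
      show ?case using bq ab by (intro bexI[of _ b]) auto
    next
      case (Suc n)
      then obtain y where y: "y \<in> q" "y \<in> Z" "e [^] n \<otimes> b = b [^] n \<otimes> y" by blast
      obtain s where s: "s \<in> carrier A" "y \<otimes> e = b \<otimes> s" using y(1) unfolding q_def by blast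
      then have sq: "s \<in> q" using neg y by blast
      have sZ: "s \<in> Z" using Z_factor[OF Z_mult[OF y(2) eZ] s(2) _ s(1)] by simp
      have "e [^] Suc n \<otimes> b = (e [^] n \<otimes> b) \<otimes> e" by (simp add: m_ac)
      also have "\<dots> = b [^] n \<otimes> (y \<otimes> e)" unfolding y(3) using y(2) by (simp add: m_assoc)
      also have "\<dots> = b [^] Suc n \<otimes> s" unfolding s(2) using s(1) by (simp add: m_ac)
      finally show ?case using sq sZ by blast
    qed
    have "w b \<le> w e" if w: "w \<in> V" for w
    proof (rule le_of_bounded_multiples[where z = "w b"])
      fix n :: nat
      obtain y where y: "y \<in> q" "y \<in> Z" "e [^] n \<otimes> b = b [^] n \<otimes> y" using ex[of n] by blast
      then have "int n * w e + w b = int n * w b + w y"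
        using w_mult[OF w Z_pow[OF eZ, of n] ab(2)] w_mult[OF w Z_pow[OF ab(2), of n] y(2)]
          w_pow[OF w eZ, of n] w_pow[OF w ab(2), of n] y(3) by simp
      then show "int n * w b \<le> int n * w e + w b" using w_nonneg[OF w y(2)] by simp
    qed
    then have "?dv e" using w_div[OF eZ ab(2)] by blast
    then show False using ce by blast
  qed
  then obtain y s where y: "y \<in> q" "s \<in> carrier A" "s \<notin> q" "y \<otimes> e = b \<otimes> s" by blast
  have sZ: "s \<in> Z" using y(2,3) q.zero_closed by blast
  have yZ: "y \<in> Z" using Z_factor[OF Z_mult[OF ab(2) sZ] y(4)[symmetric]] y(1) q.Icarr by simp
  \<comment> \<open>As \<open>e / b\<close> sends \<open>y\<close> to \<open>s\<close>, which is
    invertible in the localization at \<open>q\<close>, the localized ideal is generated by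
    \<open>y\<close>.\<close>
  have princ: "\<exists>z\<in>carrier A. s \<otimes> x = y \<otimes> z" if xq: "x \<in> q" for x
  proof -
    obtain z where z: "x \<in> carrier A" "z \<in> carrier A" "x \<otimes> e = b \<otimes> z" using xq unfolding q_def by blast
    have "b \<otimes> (s \<otimes> x) = (b \<otimes> s) \<otimes> x" using z(1) y(2) by (simp add: m_assoc)
    also have "\<dots> = y \<otimes> (x \<otimes> e)" unfolding y(4)[symmetric] using z(1) yZ by (simp add: m_ac)
    also have "\<dots> = b \<otimes> (y \<otimes> z)" unfolding z(3) using z(2) yZ by (simp add: m_lcomm)
    finally show ?thesis using cancel[of "s \<otimes> x" "y \<otimes> z"] z(1,2) y(2) yZ by auto
  qed
  have "min_prime q" unfolding min_prime_def
  proof (intro conjI allI impI q.primeideal_axioms)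
    show "q \<noteq> {\<zero>}" using bq ab by auto
    fix p assume "primeideal p A \<and> p \<noteq> {\<zero>} \<and> p \<subseteq> q"
    then have p: "primeideal p A" "p \<noteq> {\<zero>}" "p \<subseteq> q" by auto
    interpret p: primeideal p A by fact
    have sp: "s \<notin> p" using p(3) y(3) by blast
    show "p = q"
    proof (cases "y \<in> p")
      case True
      have "x \<in> p" if "x \<in> q" for x
      proof -
        obtain z where "z \<in> carrier A" "s \<otimes> x = y \<otimes> z" using princ[OF \<open>x \<in> q\<close>] by blast
        then have "s \<otimes> x \<in> p" using p.I_r_closed[OF True] by simp
        then show ?thesis using p.I_prime[of s x] sp y(2) q.Icarr[OF that] by blast
      qed
      then show ?thesis using p(3) by blast
    next
      case False
      obtain x where x: "x \<in> p" "x \<in> Z" using p(2) p.zero_closed p.Icarr by blast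
      \<comment> \<open>A non-zero element of \<open>p\<close> is divisible by every power of
        \<open>y\<close>, up to powers of \<open>s\<close>. This forces \<open>y\<close> to divide
        \<open>s\<close>, although \<open>s\<close> is not in \<open>q\<close>.\<close>
      have ex: "\<exists>z\<in>p. z \<in> Z \<and> s [^] n \<otimes> x = y [^] n \<otimes> z" for n :: nat
      proof (induction n)
        case 0
        show ?case using x by (intro bexI[of _ x]) auto
      next
        case (Suc n)
        then obtain z where z: "z \<in> p" "z \<in> Z" "s [^] n \<otimes> x = y [^] n \<otimes> z" by blast
        then obtain z' where z': "z' \<in> carrier A" "s \<otimes> z = y \<otimes> z'" using princ[of z] p(3) by blast
        have "s \<otimes> z \<in> p" using p.I_l_closed z(1) y(2) by simp
        then have "y \<otimes> z' \<in> p" using z'(2) by simp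
        then have zp: "z' \<in> p" using p.I_prime[of y z'] False yZ z'(1) by blast
        have zZ: "z' \<in> Z" using Z_factor[OF Z_mult[OF sZ z(2)] z'(2) _ z'(1)] yZ by blast
        have "s [^] Suc n \<otimes> x = s \<otimes> (s [^] n \<otimes> x)" using y(2) x(2) by (simp add: m_ac)
        also have "\<dots> = y [^] n \<otimes> (s \<otimes> z)" unfolding z(3) using z(2) y(2) yZ by (simp add: m_lcomm)
        also have "\<dots> = y [^] Suc n \<otimes> z'" unfolding z'(2) using z'(1) yZ by (simp add: m_assoc)
        finally show ?case using zp zZ by blast
      qed
      have "w y \<le> w s" if w: "w \<in> V" for w
      proof (rule le_of_bounded_multiples[where z = "w x"])
        fix n :: nat
        obtain z where z: "z \<in> p" "z \<in> Z" "s [^] n \<otimes> x = y [^] n \<otimes> z" using ex[of n] by blast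
        then have "int n * w s + w x = int n * w y + w z"
          using w_mult[OF w Z_pow[OF sZ, of n] x(2)] w_mult[OF w Z_pow[OF yZ, of n] z(2)]
            w_pow[OF w sZ, of n] w_pow[OF w yZ, of n] z(3) by simp
        then show "int n * w y \<le> int n * w s + w x" using w_nonneg[OF w z(2)] by simp
      qed
      then obtain c' where "c' \<in> carrier A" "s = y \<otimes> c'" using w_div[OF sZ yZ] by blast
      then show ?thesis using y q.I_r_closed by blast
    qed
  qed
  then obtain s' c' where s: "s' \<in> Z - q" "c' \<in> carrier A" "s' \<otimes> a = b \<otimes> c'" using loc by blast
  have "s' \<otimes> e = c \<otimes> (s' \<otimes> a)" using s(1) by (simp add: e_def m_lcomm)
  also have "\<dots> = b \<otimes> (c \<otimes> c')" unfolding s(3) using s(2) by (simp add: m_lcomm)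
  finally have "s' \<otimes> e = b \<otimes> (c \<otimes> c')" .
  moreover have "s' \<in> carrier A" "c \<otimes> c' \<in> carrier A" using s(1,2) by simp_all
  ultimately have "s' \<in> q" unfolding q_def by blast
  then show False using s(1) by blast
qed

end

text \<open>For the trivial group the ambient graded simple ring is a field. Pulling its valuations
  back along \<open>i\<close> gives \<open>V\<close>, and \<open>b\<close> divides \<open>a\<close>
  if the quotient of their images lies in all valuation rings.\<close>

lemma Krull_ring_imp_weighted_domain:
  fixes A :: "('a, 'm) ring_scheme" (structure)
  assumes "Krull_ring A"
  shows "\<exists>V. weighted_domain A V"
proof -
  obtain S :: "('a \<times> 'a) set ring" and H V i where
    simple: "graded_simple zero_group S H" and
    val: "\<forall>\<nu>\<in>V. discrete_valuation zero_group S H \<nu>" and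
    i: "i \<in> ring_hom A S" "inj_on i (carrier A)" and
    img: "i ` carrier A = {x \<in> carrier S. \<forall>\<nu>\<in>V. x \<in> valuation_ring zero_group S H \<nu>}" and
    fin: "\<forall>x \<in> i ` carrier A \<inter> homog zero_group S H. finite {\<nu> \<in> V. \<nu> x \<noteq> 0}"
    using assms unfolding graded_Krull_def by (elim exE conjE) (rule that, assumption+)
  have gr: "graded_ring zero_group A (trivial_grading A)" using assms by (simp add: graded_Krull_def)
  interpret A: graded zero_group A "trivial_grading A" using gr by unfold_locales
  interpret S: graded zero_group S H using simple by unfold_locales (simp add: graded_simple_def)
  interpret i: ring_hom_cring A S i using i A.is_cring S.is_cring by (simp add: ring_hom_cring_def ring_hom_cring_axioms_def)
  have u: "() \<in> carrier zero_group" by (simp add: singleton_group_def)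
  have Hc: "H () = carrier S"
    using S.comp_closed[OF _ u] S.proj_mem_imp_mem[OF S.comp_subgroup[OF u]] S.proj_closed
    by (metis (full_types) old.unit.exhaust subsetI subset_antisym)
  have hom: "homog zero_group S H = carrier S - {\<zero>\<^bsub>S\<^esub>}"
    using Hc by (auto simp: homog_def singleton_group_def)
  have units: "x \<in> Units S" if "x \<in> carrier S - {\<zero>\<^bsub>S\<^esub>}" for x
    using simple that by (auto simp: graded_simple_def hom)
  have S1: "\<one>\<^bsub>S\<^esub> \<noteq> \<zero>\<^bsub>S\<^esub>" using simple by (simp add: graded_simple_def)
  have Sdom: "x \<otimes>\<^bsub>S\<^esub> y \<noteq> \<zero>\<^bsub>S\<^esub>" if "x \<in> carrier S - {\<zero>\<^bsub>S\<^esub>}" "y \<in> carrier S - {\<zero>\<^bsub>S\<^esub>}" for x y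
  proof
    assume "x \<otimes>\<^bsub>S\<^esub> y = \<zero>\<^bsub>S\<^esub>"
    then have "inv\<^bsub>S\<^esub> x \<otimes>\<^bsub>S\<^esub> (x \<otimes>\<^bsub>S\<^esub> y) = \<zero>\<^bsub>S\<^esub>" using units that by simp
    then show False using units[OF that(1)] that by (simp add: S.m_assoc[symmetric])
  qed
  have i0: "i a \<noteq> \<zero>\<^bsub>S\<^esub>" if "a \<in> carrier A" "a \<noteq> \<zero>" for a
    using i(2) that by (metis A.zero_closed i.hom_zero inj_onD)
  have iZ: "i a \<in> carrier S - {\<zero>\<^bsub>S\<^esub>}" if "a \<in> carrier A - {\<zero>}" for a
    using i0 that by auto
  have dom: "domain A"
  proof (intro domainI A.is_cring)
    show "\<one> \<noteq> \<zero>" using S1 by (metis i.hom_one i.hom_zero)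
    fix a b assume ab: "a \<otimes> b = \<zero>" "a \<in> carrier A" "b \<in> carrier A"
    then have "i a \<otimes>\<^bsub>S\<^esub> i b = \<zero>\<^bsub>S\<^esub>" by (metis i.hom_mult i.hom_zero)
    then show "a = \<zero> \<or> b = \<zero>" using Sdom[of "i a" "i b"] iZ ab by blast
  qed
  have vm: "\<nu> (x \<otimes>\<^bsub>S\<^esub> y) = \<nu> x + \<nu> y" if "\<nu> \<in> V" "x \<in> carrier S - {\<zero>\<^bsub>S\<^esub>}" "y \<in> carrier S - {\<zero>\<^bsub>S\<^esub>}" for \<nu> x y
    using bspec[OF val that(1)] that(2,3) unfolding discrete_valuation_def hom by blast
  have va: "min (\<nu> x) (\<nu> y) \<le> \<nu> (x \<oplus>\<^bsub>S\<^esub> y)"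
    if "\<nu> \<in> V" "x \<in> carrier S - {\<zero>\<^bsub>S\<^esub>}" "y \<in> carrier S - {\<zero>\<^bsub>S\<^esub>}" "x \<oplus>\<^bsub>S\<^esub> y \<noteq> \<zero>\<^bsub>S\<^esub>" for \<nu> x y
    using bspec[OF val that(1)] that(2,3,4) Hc u unfolding discrete_valuation_def by blast
  \<comment> \<open>As \<open>valuation_ring\<close> is a generated subring, an induction over its
    generation is needed to see that its non-zero elements have non-negative value.\<close>
  have vr: "x \<in> valuation_ring zero_group S H \<nu> \<longleftrightarrow> 0 \<le> \<nu> x"
    if v: "\<nu> \<in> V" and x: "x \<in> carrier S - {\<zero>\<^bsub>S\<^esub>}" for \<nu> x
  proof
    assume "0 \<le> \<nu> x" then show "x \<in> valuation_ring zero_group S H \<nu>"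
      unfolding valuation_ring_def hom using x by (intro generate_ring.incl) simp
  next
    have v1: "\<nu> \<one>\<^bsub>S\<^esub> = 0" using vm[OF v, of "\<one>\<^bsub>S\<^esub>" "\<one>\<^bsub>S\<^esub>"] S1 by simp
    have neg: "\<nu> (\<ominus>\<^bsub>S\<^esub> y) = \<nu> y" if "y \<in> carrier S - {\<zero>\<^bsub>S\<^esub>}" for y
    proof -
      have m1: "\<ominus>\<^bsub>S\<^esub> \<one>\<^bsub>S\<^esub> \<in> carrier S - {\<zero>\<^bsub>S\<^esub>}" using S1 by simp
      have "\<nu> (\<ominus>\<^bsub>S\<^esub> \<one>\<^bsub>S\<^esub> \<otimes>\<^bsub>S\<^esub> \<ominus>\<^bsub>S\<^esub> \<one>\<^bsub>S\<^esub>) = 2 * \<nu> (\<ominus>\<^bsub>S\<^esub> \<one>\<^bsub>S\<^esub>)" using vm[OF v m1 m1] by simp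
      then have "\<nu> (\<ominus>\<^bsub>S\<^esub> \<one>\<^bsub>S\<^esub>) = 0" using v1 by (simp add: S.l_minus)
      then show ?thesis using vm[OF v m1 that] that by (simp add: S.l_minus)
    qed
    assume "x \<in> valuation_ring zero_group S H \<nu>"
    then have "x \<in> generate_ring S {x \<in> carrier S - {\<zero>\<^bsub>S\<^esub>}. 0 \<le> \<nu> x}" by (simp add: valuation_ring_def hom)
    then have "x \<in> carrier S \<and> (x = \<zero>\<^bsub>S\<^esub> \<or> 0 \<le> \<nu> x)"
    proof (induction rule: generate_ring.induct)
      case (a_inv h)
      then show ?case using neg[of h] by (cases "h = \<zero>\<^bsub>S\<^esub>") auto
    next
      case (eng_add x y)
      then have xy: "x \<in> carrier S" "y \<in> carrier S" "x = \<zero>\<^bsub>S\<^esub> \<or> 0 \<le> \<nu> x" "y = \<zero>\<^bsub>S\<^esub> \<or> 0 \<le> \<nu> y"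
        by auto
      consider "x = \<zero>\<^bsub>S\<^esub>" | "y = \<zero>\<^bsub>S\<^esub>" | "x \<oplus>\<^bsub>S\<^esub> y = \<zero>\<^bsub>S\<^esub>"
        | "x \<noteq> \<zero>\<^bsub>S\<^esub>" "y \<noteq> \<zero>\<^bsub>S\<^esub>" "x \<oplus>\<^bsub>S\<^esub> y \<noteq> \<zero>\<^bsub>S\<^esub>" by blast
      then show ?case
      proof cases
        case 4
        then have "min (\<nu> x) (\<nu> y) \<le> \<nu> (x \<oplus>\<^bsub>S\<^esub> y)" using va[OF v] xy(1,2) by blast
        then show ?thesis using 4 xy by simp
      qed (use xy in simp_all)
    next
      case (eng_mult x y)
      then have xy: "x \<in> carrier S" "y \<in> carrier S" "x = \<zero>\<^bsub>S\<^esub> \<or> 0 \<le> \<nu> x" "y = \<zero>\<^bsub>S\<^esub> \<or> 0 \<le> \<nu> y"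
        by auto
      consider "x = \<zero>\<^bsub>S\<^esub>" | "y = \<zero>\<^bsub>S\<^esub>" | "x \<noteq> \<zero>\<^bsub>S\<^esub>" "y \<noteq> \<zero>\<^bsub>S\<^esub>" by blast
      then show ?case
      proof cases
        case 3
        then have "\<nu> (x \<otimes>\<^bsub>S\<^esub> y) = \<nu> x + \<nu> y" using vm[OF v] xy(1,2) by blast
        then show ?thesis using 3 xy by simp
      qed (use xy in simp_all)
    qed (auto simp: v1)
    then show "0 \<le> \<nu> x" using x by simp
  qed
  have "weighted_domain A ((\<lambda>\<nu> a. \<nu> (i a)) ` V)"
  proof (intro weighted_domain.intro[OF dom] weighted_domain_axioms.intro)
    fix w a b assume w: "w \<in> (\<lambda>\<nu> a. \<nu> (i a)) ` V" and a: "a \<in> carrier A - {\<zero>}"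
    then obtain \<nu> where \<nu>: "\<nu> \<in> V" "w = (\<lambda>a. \<nu> (i a))" by blast
    have "i a \<in> i ` carrier A" using a by blast
    then show "0 \<le> w a" using vr[OF \<nu>(1) iZ[OF a]] \<nu> by (auto simp: img)
    assume b: "b \<in> carrier A - {\<zero>}"
    show "w (a \<otimes> b) = w a + w b" using vm[OF \<nu>(1) iZ[OF a] iZ[OF b]] a b \<nu>(2) by simp
    assume "a \<oplus> b \<noteq> \<zero>"
    then show "min (w a) (w b) \<le> w (a \<oplus> b)"
      using va[OF \<nu>(1) iZ[OF a] iZ[OF b]] i0[of "a \<oplus> b"] a b \<nu>(2) by simp
  next
    fix a b assume a: "a \<in> carrier A - {\<zero>}" and b: "b \<in> carrier A - {\<zero>}"
      and le: "\<And>w. w \<in> (\<lambda>\<nu> a. \<nu> (i a)) ` V \<Longrightarrow> w b \<le> w a"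
    define z where "z = i a \<otimes>\<^bsub>S\<^esub> inv\<^bsub>S\<^esub> (i b)"
    have ub: "i b \<in> Units S" using units iZ b by blast
    have zc: "z \<in> carrier S" using ub a by (simp add: z_def)
    have zb: "i b \<otimes>\<^bsub>S\<^esub> z = i a" unfolding z_def using ub a b by (simp add: S.m_lcomm[of "i b"])
    have "i b \<in> carrier S" using b by simp
    then have "z \<noteq> \<zero>\<^bsub>S\<^esub>" using zb i0[of a] a S.r_null[of "i b"] by (metis Diff_iff singletonI)
    then have z: "z \<in> carrier S - {\<zero>\<^bsub>S\<^esub>}" using zc by blast
    have "z \<in> valuation_ring zero_group S H \<nu>" if v: "\<nu> \<in> V" for \<nu>
    proof -
      have "\<nu> (i b) \<le> \<nu> (i a)" using le[of "\<lambda>a. \<nu> (i a)"] v by blast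
      then show ?thesis using vr[OF v z] vm[OF v iZ[OF b] z] zb by simp
    qed
    then have "z \<in> i ` carrier A" using zc by (simp add: img)
    then obtain c where c: "c \<in> carrier A" "z = i c" by blast
    then have "i a = i (b \<otimes> c)" using zb b by simp
    then show "\<exists>c\<in>carrier A. a = b \<otimes> c" using i(2) c a b by (metis A.m_closed DiffD1 inj_onD)
  next
    fix a assume a: "a \<in> carrier A - {\<zero>}"
    have "finite {\<nu> \<in> V. \<nu> (i a) \<noteq> 0}" using a iZ[OF a] by (intro bspec[OF fin]) (simp add: hom)
    moreover have "{w \<in> (\<lambda>\<nu> a. \<nu> (i a)) ` V. w a \<noteq> 0} \<subseteq> (\<lambda>\<nu> a. \<nu> (i a)) ` {\<nu> \<in> V. \<nu> (i a) \<noteq> 0}" by auto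
    ultimately show "finite {w \<in> (\<lambda>\<nu> a. \<nu> (i a)) ` V. w a \<noteq> 0}" by (rule finite_surj)
  qed
  then show ?thesis by blast
qed

section \<open>Spectra and divisors of Krull domains\<close>

context domain
begin

lemma primeideal_zero: "primeideal {\<zero>} R"
  using zeroprimeideal .

section \<open>Prime ideals and irreducible closed sets\<close>

definition closed_at :: "'a set \<Rightarrow> 'a set set" where
  "closed_at p = {q. primeideal q R \<and> p \<subseteq> q}"

lemma open_generalize: "\<lbrakk>openin (Spec R) U; p \<in> U; primeideal q R; q \<subseteq> p\<rbrakk> \<Longrightarrow> q \<in> U"
  unfolding openin_Spec by blast

lemma open_primeideal: "\<lbrakk>openin (Spec R) U; p \<in> U\<rbrakk> \<Longrightarrow> primeideal p R"
  unfolding openin_Spec by blast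

text \<open>Open sets are stable under passing to smaller primes, and the zero ideal is the smallest
  one. Sections over non-empty open sets will be evaluated at this point.\<close>

lemma open_generic: "\<lbrakk>openin (Spec R) U; U \<noteq> {}\<rbrakk> \<Longrightarrow> {\<zero>} \<in> U"
proof -
  assume U: "openin (Spec R) U" "U \<noteq> {}"
  then obtain p where p: "p \<in> U" by blast
  interpret p: primeideal p R using open_primeideal[OF U(1) p] .
  show "{\<zero>} \<in> U" using open_generalize[OF U(1) p primeideal_zero] p.zero_closed by simp
qed

lemma open_basic: "f \<in> carrier R \<Longrightarrow> openin (Spec R) {p. primeideal p R \<and> f \<notin> p}"
  unfolding openin_Spec by (intro exI[of _ "{f}"]) auto

lemma closedin_Spec_iff: "closedin (Spec R) Z \<longleftrightarrow> (\<exists>S \<subseteq> carrier R. Z = {p. primeideal p R \<and> S \<subseteq> p})"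
proof
  assume "closedin (Spec R) Z"
  then obtain S where S: "S \<subseteq> carrier R" "topspace (Spec R) - Z = {p. primeideal p R \<and> \<not> S \<subseteq> p}" "Z \<subseteq> topspace (Spec R)"
    by (auto simp: closedin_def openin_Spec)
  then have "Z = {p. primeideal p R \<and> S \<subseteq> p}" unfolding topspace_Spec by blast
  then show "\<exists>S \<subseteq> carrier R. Z = {p. primeideal p R \<and> S \<subseteq> p}" using S(1) by blast
next
  assume "\<exists>S \<subseteq> carrier R. Z = {p. primeideal p R \<and> S \<subseteq> p}"
  then obtain S where S: "S \<subseteq> carrier R" "Z = {p. primeideal p R \<and> S \<subseteq> p}" by blast
  have "topspace (Spec R) - Z = {p. primeideal p R \<and> \<not> S \<subseteq> p}" unfolding topspace_Spec S(2) by blast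
  then have "openin (Spec R) (topspace (Spec R) - Z)" unfolding openin_Spec using S(1) by blast
  then show "closedin (Spec R) Z" unfolding closedin_def using S(2) by (auto simp: topspace_Spec)
qed

lemma closed_at_closed: "primeideal p R \<Longrightarrow> closedin (Spec R) (closed_at p)"
  unfolding closedin_Spec_iff closed_at_def
  using ideal.Icarr[OF primeideal.axioms(1)] by (intro exI[of _ p]) auto

lemma closure_of_point:
  assumes "primeideal p R"
  shows "Spec R closure_of {p} = closed_at p"
proof
  show "Spec R closure_of {p} \<subseteq> closed_at p"
    using closure_of_minimal[of "{p}" "closed_at p" "Spec R"] closed_at_closed[OF assms] assms
    by (auto simp: closed_at_def)
  show "closed_at p \<subseteq> Spec R closure_of {p}"
  proof
    fix q assume "q \<in> closed_at p"
    then have q: "primeideal q R" "p \<subseteq> q" by (auto simp: closed_at_def)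
    then show "q \<in> Spec R closure_of {p}"
      using open_generalize[OF _ _ assms] by (auto simp: in_closure_of topspace_Spec)
  qed
qed

lemma irreducible_closed_at:
  assumes p: "primeideal p R"
  shows "irreducible_closedin (Spec R) (closed_at p)"
  unfolding irreducible_closedin_def
proof (intro conjI allI impI closed_at_closed[OF p])
  show "closed_at p \<noteq> {}" using p by (auto simp: closed_at_def)
  fix C D assume "closedin (Spec R) C" "closedin (Spec R) D" "closed_at p \<subseteq> C \<union> D"
  moreover have "p \<in> closed_at p" using p by (auto simp: closed_at_def)
  ultimately show "closed_at p \<subseteq> C \<or> closed_at p \<subseteq> D"
    unfolding closedin_Spec_iff closed_at_def by blast
qed

text \<open>The intersection of all points of \<open>Z\<close> is its generic point; irreducibility,
  applied to the zero sets of two factors, makes it prime.\<close>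

lemma irreducible_closedin_obtains:
  assumes Z: "irreducible_closedin (Spec R) Z"
  obtains p where "primeideal p R" "Z = closed_at p"
proof -
  obtain S where S: "S \<subseteq> carrier R" "Z = {p. primeideal p R \<and> S \<subseteq> p}"
    using Z closedin_Spec_iff[of Z] by (auto simp: irreducible_closedin_def)
  have ne: "Z \<noteq> {}" using Z by (simp add: irreducible_closedin_def)
  have pr: "primeideal q R" if "q \<in> Z" for q using that S by blast
  define I where "I = \<Inter>Z"
  have id: "ideal I R" unfolding I_def
    using i_Intersect[of Z] ne pr primeideal.axioms(1) by blast
  have "primeideal I R"
  proof (rule primeidealI[OF id is_cring])
    obtain q where q: "q \<in> Z" using ne by blast
    then have "I \<subseteq> q" "q \<noteq> carrier R" using pr[OF q] primeideal.I_notcarr by (auto simp: I_def)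
    then show "carrier R \<noteq> I"
      using ideal.Icarr[OF primeideal.axioms(1)[OF pr[OF q]]] by blast
    fix a b assume ab: "a \<in> carrier R" "b \<in> carrier R" "a \<otimes> b \<in> I"
    have "Z \<subseteq> {q. primeideal q R \<and> {a} \<subseteq> q} \<union> {q. primeideal q R \<and> {b} \<subseteq> q}"
      using ab pr primeideal.I_prime[of _ R a b] by (auto simp: I_def)
    moreover have "closedin (Spec R) {q. primeideal q R \<and> {a} \<subseteq> q}" "closedin (Spec R) {q. primeideal q R \<and> {b} \<subseteq> q}"
      unfolding closedin_Spec_iff using ab by blast+
    ultimately have "Z \<subseteq> {q. primeideal q R \<and> {a} \<subseteq> q} \<or> Z \<subseteq> {q. primeideal q R \<and> {b} \<subseteq> q}"
      using Z unfolding irreducible_closedin_def by blast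
    then show "a \<in> I \<or> b \<in> I" by (auto simp: I_def)
  qed
  moreover have "Z = closed_at I"
  proof
    show "Z \<subseteq> closed_at I" using pr by (auto simp: closed_at_def I_def)
    show "closed_at I \<subseteq> Z" using S by (auto simp: closed_at_def I_def)
  qed
  ultimately show thesis using that by blast
qed

lemma closed_at_subset_iff: "\<lbrakk>primeideal p R; primeideal q R\<rbrakk> \<Longrightarrow> closed_at p \<subseteq> closed_at q \<longleftrightarrow> q \<subseteq> p"
  by (auto simp: closed_at_def)

end

context weighted_domain
begin

text \<open>Chains of irreducible closed sets are descending chains of primes starting at
  \<open>Y\<close>. A chain of length at least 1 excludes \<open>{\<zero>}\<close>, and a non-zero
  prime strictly inside \<open>Y\<close> would give one of length 2 ending at
  \<open>{\<zero>}\<close>.\<close>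

lemma codim_eq_one_iff:
  assumes Y: "primeideal Y A"
  shows "codim (Spec A) (closed_at Y) = 1 \<longleftrightarrow> min_prime Y"
proof
  let ?E = "{enat n | n. \<exists>C. C 0 = closed_at Y \<and> (\<forall>i\<le>n. irreducible_closedin (Spec A) (C i)) \<and>
     (\<forall>i<n. C i \<subset> C (Suc i))}"
  {
    assume cd: "codim (Spec A) (closed_at Y) = 1"
    then have S: "Sup ?E = 1" by (simp add: codim_def)
    have "\<not> (\<forall>e\<in>?E. e \<le> 0)"
    proof
      assume "\<forall>e\<in>?E. e \<le> 0"
      then have "Sup ?E \<le> 0" by (intro Sup_least) blast
      then show False using S by simp
    qed
    then obtain n C where n: "0 < n" "C 0 = closed_at Y" "\<forall>i\<le>n. irreducible_closedin (Spec A) (C i)" "\<forall>i<n. C i \<subset> C (Suc i)"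
      by (auto simp: zero_enat_def)
    have irr1: "irreducible_closedin (Spec A) (C 1)" and sub: "closed_at Y \<subset> C 1"
      using n(1,2,3) n(4)[rule_format, of 0] by auto
    obtain p where p: "primeideal p A" "C 1 = closed_at p" using irreducible_closedin_obtains[OF irr1] .
    then have pY: "p \<subseteq> Y" "p \<noteq> Y" using sub closed_at_subset_iff[OF Y p(1)] by auto
    have zp: "\<zero> \<in> p" using p(1) additive_subgroup.zero_closed[OF ideal.axioms(1)[OF primeideal.axioms(1)]] by blast
    show "min_prime Y" unfolding min_prime_def
    proof (intro conjI allI impI Y)
      show "Y \<noteq> {\<zero>}" using pY zp by blast
      fix q assume "primeideal q A \<and> q \<noteq> {\<zero>} \<and> q \<subseteq> Y"
      then have q: "primeideal q A" "q \<noteq> {\<zero>}" "q \<subseteq> Y" by auto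
      show "q = Y"
      proof (rule ccontr)
        assume "q \<noteq> Y"
        define C where "C = (\<lambda>i::nat. if i = 0 then closed_at Y else if i = 1 then closed_at q else closed_at {\<zero>})"
        have zq: "\<zero> \<in> q" using q(1) additive_subgroup.zero_closed[OF ideal.axioms(1)[OF primeideal.axioms(1)]] by blast
        have "\<forall>i\<le>2. irreducible_closedin (Spec A) (C i)"
          using irreducible_closed_at Y q(1) primeideal_zero by (auto simp: C_def)
        moreover have "\<forall>i<2. C i \<subset> C (Suc i)"
        proof (intro allI impI)
          fix i :: nat assume "i < 2"
          then have "i = 0 \<or> i = 1" by auto
          moreover have "closed_at Y \<subset> closed_at q"
            using q(3) \<open>q \<noteq> Y\<close> closed_at_subset_iff[OF Y q(1)] closed_at_subset_iff[OF q(1) Y] by auto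
          moreover have "closed_at q \<subset> closed_at {\<zero>}"
            using q(2) zq closed_at_subset_iff[OF q(1) primeideal_zero] closed_at_subset_iff[OF primeideal_zero q(1)] by auto
          ultimately show "C i \<subset> C (Suc i)" by (auto simp: C_def)
        qed
        ultimately have "enat 2 \<in> ?E"
          by (intro CollectI exI[of _ 2] conjI refl exI[of _ C]) (auto simp: C_def)
        then have "enat 2 \<le> Sup ?E" by (rule Sup_upper)
        then show False using S by (simp add: one_enat_def)
      qed
    qed
  }
  {
    assume mp: "min_prime Y"
    have "Sup ?E = 1"
    proof (rule antisym)
      show "Sup ?E \<le> 1"
      proof (rule Sup_least)
        fix e assume "e \<in> ?E"
        then obtain n C where n: "e = enat n" "C 0 = closed_at Y" "\<forall>i\<le>n. irreducible_closedin (Spec A) (C i)" "\<forall>i<n. C i \<subset> C (Suc i)"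
          by blast
        have "n < 2"
        proof (rule ccontr)
          assume "\<not> n < 2"
          then have i: "irreducible_closedin (Spec A) (C 1)" "irreducible_closedin (Spec A) (C 2)"
            and s: "C 0 \<subset> C 1" "C 1 \<subset> C 2" using n(3) n(4)[rule_format, of 0] n(4)[rule_format, of 1]
            by (auto simp: numeral_2_eq_2)
          obtain p where p: "primeideal p A" "C 1 = closed_at p" using irreducible_closedin_obtains[OF i(1)] .
          obtain q where q: "primeideal q A" "C 2 = closed_at q" using irreducible_closedin_obtains[OF i(2)] .
          have "p \<subset> Y" using s(1) unfolding n(2) p(2) using closed_at_subset_iff[OF Y p(1)] by auto
          then have p0: "p = {\<zero>}" using mp p(1) unfolding min_prime_def by blast
          have "q \<subset> p" using s(2) unfolding p(2) q(2) using closed_at_subset_iff[OF p(1) q(1)] by auto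
          moreover have "\<zero> \<in> q" using q(1) additive_subgroup.zero_closed[OF ideal.axioms(1)[OF primeideal.axioms(1)]] by blast
          ultimately show False using p0 by blast
        qed
        then show "e \<le> 1" using n(1) by (simp add: one_enat_def)
      qed
      define C where "C = (\<lambda>i::nat. if i = 0 then closed_at Y else closed_at {\<zero>})"
      have z: "\<zero> \<in> Y" using Y additive_subgroup.zero_closed[OF ideal.axioms(1)[OF primeideal.axioms(1)]] by blast
      have "\<not> Y \<subseteq> {\<zero>}" using mp z unfolding min_prime_def by blast
      then have "closed_at Y \<subset> closed_at {\<zero>}"
        using z closed_at_subset_iff[OF Y primeideal_zero] closed_at_subset_iff[OF primeideal_zero Y] by simp
      then have "enat 1 \<in> ?E" using irreducible_closed_at Y primeideal_zero
        by (intro CollectI exI[of _ 1] conjI refl exI[of _ C]) (auto simp: C_def)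
      then show "1 \<le> Sup ?E" unfolding one_enat_def by (rule Sup_upper)
    qed
    then show "codim (Spec A) (closed_at Y) = 1" by (simp add: codim_def)
  }
qed

lemma prime_divisors_eq: "prime_divisors A = {Y. min_prime Y}"
  using codim_eq_one_iff closure_of_point by (auto simp: prime_divisors_def topspace_Spec min_prime_def)

section \<open>Valuations of the function field\<close>

abbreviation FA where "FA \<equiv> fraction_field A"
abbreviation q where "q a s \<equiv> fraction A (homog zero_group A T) a s"
abbreviation QZ where "QZ \<equiv> carrier FA - {\<zero>\<^bsub>FA\<^esub>}"
abbreviation val where "val \<equiv> divisor_valuation A"

lemma mem_homog [simp]: "a \<in> homog zero_group A T \<longleftrightarrow> a \<in> carrier A \<and> a \<noteq> \<zero>"
  by (simp add: homog_trivial)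

text \<open>The choice is harmless: by \<open>graded_ord_unique\<close> the values on non-zero
  elements are determined.\<close>

definition ord :: "'a set \<Rightarrow> 'a \<Rightarrow> int" where
  "ord p = (SOME v. graded_ord zero_group A T p v)"

lemma graded_ord_ord: "min_prime p \<Longrightarrow> graded_ord zero_group A T p (ord p)"
  unfolding ord_def by (rule someI_ex[OF ex_graded_ord])

lemma min_prime_graded: "min_prime p \<Longrightarrow> graded_prime zero_group A T p"
  by (simp add: min_prime_def trivial_graded_prime_iff)

lemma divisor_valuation_eq:
  assumes p: "min_prime p"
  shows "val p = frac_val zero_group A T (ord p)"
  unfolding divisor_valuation_def
proof (rule the_equality)
  show v: "valuation_at zero_group A T p (frac_val zero_group A T (ord p))"
    by (rule D.valuation_at_frac_val[OF graded_ord_ord[OF p] min_prime_graded[OF p]])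
  show "\<nu> = frac_val zero_group A T (ord p)" if "valuation_at zero_group A T p \<nu>" for \<nu>
    using D.valuation_at_unique[OF that v min_prime_graded[OF p]] p by (simp add: min_prime_def)
qed

lemma ord_mult: "\<lbrakk>min_prime p; a \<in> Z; b \<in> Z\<rbrakk> \<Longrightarrow> ord p (a \<otimes> b) = ord p a + ord p b"
  using D.graded_ordD(1)[OF graded_ord_ord] by simp

lemma ord_nonneg: "\<lbrakk>min_prime p; a \<in> Z\<rbrakk> \<Longrightarrow> 0 \<le> ord p a"
  using D.graded_ord_nonneg[OF graded_ord_ord min_prime_graded] by simp

lemma ord_pos_iff: "\<lbrakk>min_prime p; a \<in> Z\<rbrakk> \<Longrightarrow> 0 < ord p a \<longleftrightarrow> a \<in> p"
  using D.graded_ord_pos_iff[OF graded_ord_ord min_prime_graded] by simp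

lemma val_q: "\<lbrakk>min_prime p; a \<in> Z; s \<in> Z\<rbrakk> \<Longrightarrow> val p (q a s) = ord p a - ord p s"
  using D.frac_val_fr[of "ord p" a s] ord_mult by (simp add: divisor_valuation_eq)

lemma q_in_QZ: "\<lbrakk>a \<in> Z; s \<in> Z\<rbrakk> \<Longrightarrow> q a s \<in> QZ"
  using D.fr_closed[of a s] D.fr_eq_zero_iff[of a s] by auto

lemma QZ_cases:
  assumes "x \<in> QZ"
  obtains a s where "a \<in> Z" "s \<in> Z" "x = q a s"
proof -
  obtain a s where h: "a \<in> carrier A" "s \<in> homog zero_group A T" "x = q a s"
    using D.fr_cases[of x] assms by blast
  then have "a \<noteq> \<zero>" using assms D.fr_eq_zero_iff[of a s] by auto
  then show thesis using that h by auto
qed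

sublocale FA: cring FA by (rule D.cring_FR)

lemma q_mult: "\<lbrakk>a \<in> carrier A; s \<in> Z; b \<in> carrier A; t \<in> Z\<rbrakk> \<Longrightarrow> q a s \<otimes>\<^bsub>FA\<^esub> q b t = q (a \<otimes> b) (s \<otimes> t)"
  using D.fr_mult[of a s b t] by simp

lemma q_eq_iff: "\<lbrakk>a \<in> carrier A; s \<in> Z; b \<in> carrier A; t \<in> Z\<rbrakk> \<Longrightarrow> q a s = q b t \<longleftrightarrow> a \<otimes> t = b \<otimes> s"
  using D.fr_eq_iff[of a s b t] by simp

lemma q_one: "\<one>\<^bsub>FA\<^esub> = q \<one> \<one>" by (rule D.fr_one)

lemma one_QZ: "\<one>\<^bsub>FA\<^esub> \<in> QZ" unfolding q_one by (rule q_in_QZ) simp_all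

lemma QZ_mult: "\<lbrakk>x \<in> QZ; y \<in> QZ\<rbrakk> \<Longrightarrow> x \<otimes>\<^bsub>FA\<^esub> y \<in> QZ"
  by (metis QZ_cases q_mult q_in_QZ Z_mult DiffD1)

lemma QZ_inv:
  assumes "x \<in> QZ"
  obtains y where "y \<in> QZ" "x \<otimes>\<^bsub>FA\<^esub> y = \<one>\<^bsub>FA\<^esub>"
proof -
  obtain a s where h: "a \<in> Z" "s \<in> Z" "x = q a s" using QZ_cases[OF assms] .
  have "x \<otimes>\<^bsub>FA\<^esub> q s a = \<one>\<^bsub>FA\<^esub>" unfolding h(3) using D.fr_inverse[of a s] h(1,2) by simp
  then show thesis using that[OF q_in_QZ[OF h(2,1)]] by blast
qed

lemma val_mult: "\<lbrakk>min_prime p; x \<in> QZ; y \<in> QZ\<rbrakk> \<Longrightarrow> val p (x \<otimes>\<^bsub>FA\<^esub> y) = val p x + val p y"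
proof -
  assume p: "min_prime p" and x: "x \<in> QZ" and y: "y \<in> QZ"
  obtain a s where h: "a \<in> Z" "s \<in> Z" "x = q a s" using QZ_cases[OF x] .
  obtain b t where g: "b \<in> Z" "t \<in> Z" "y = q b t" using QZ_cases[OF y] .
  have "x \<otimes>\<^bsub>FA\<^esub> y = q (a \<otimes> b) (s \<otimes> t)" unfolding h(3) g(3) using h g by (intro q_mult) auto
  then show ?thesis
    using val_q[OF p Z_mult[OF h(1) g(1)] Z_mult[OF h(2) g(2)]] val_q[OF p h(1,2)] val_q[OF p g(1,2)]
      ord_mult[OF p h(1) g(1)] ord_mult[OF p h(2) g(2)] h(3) g(3) by simp
qed

lemma val_one: "min_prime p \<Longrightarrow> val p \<one>\<^bsub>FA\<^esub> = 0"
  using val_mult[OF _ one_QZ one_QZ] by simp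

lemma val_add:
  assumes p: "min_prime p" and x: "x \<in> QZ" and y: "y \<in> QZ" and xy: "x \<oplus>\<^bsub>FA\<^esub> y \<noteq> \<zero>\<^bsub>FA\<^esub>"
  shows "min (val p x) (val p y) \<le> val p (x \<oplus>\<^bsub>FA\<^esub> y)"
proof -
  have u: "() \<in> carrier zero_group" by (simp add: singleton_group_def)
  have "z \<in> frac_grading zero_group A T ()" if z: "z \<in> QZ" for z
  proof -
    obtain a s where h: "a \<in> Z" "s \<in> Z" "z = q a s" using QZ_cases[OF z] .
    have "s \<in> T ()" "a \<in> T (() \<otimes>\<^bsub>zero_group\<^esub> ())" using h by (simp_all add: trivial_grading_def)
    then show ?thesis unfolding h(3) using D.fr_mem_FG_iff[OF _ _ _ u u, of a s] h by simp
  qed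
  moreover have "discrete_valuation zero_group FA (frac_grading zero_group A T) (val p)"
    unfolding divisor_valuation_eq[OF p] by (rule D.discrete_valuation_frac_val[OF graded_ord_ord[OF p] min_prime_graded[OF p]])
  ultimately show ?thesis using x y xy u unfolding discrete_valuation_def by blast
qed

lemma finite_ord: "a \<in> Z \<Longrightarrow> finite {Y. min_prime Y \<and> ord Y a \<noteq> 0}"
proof -
  assume a: "a \<in> Z"
  have "{Y. min_prime Y \<and> ord Y a \<noteq> 0} \<subseteq> {Y. min_prime Y \<and> a \<in> Y}"
    using ord_pos_iff[OF _ a] ord_nonneg[OF _ a] by force
  then show ?thesis using finite_min_primes[OF a] finite_subset by blast
qed

lemma finite_val:
  assumes "x \<in> QZ"
  shows "finite {Y. min_prime Y \<and> val Y x \<noteq> 0}"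
proof -
  obtain a s where h: "a \<in> Z" "s \<in> Z" "x = q a s" using QZ_cases[OF assms] .
  have "{Y. min_prime Y \<and> val Y x \<noteq> 0} \<subseteq> {Y. min_prime Y \<and> ord Y a \<noteq> 0} \<union> {Y. min_prime Y \<and> ord Y s \<noteq> 0}"
    using val_q h by auto
  then show ?thesis using finite_ord[OF h(1)] finite_ord[OF h(2)] finite_subset by blast
qed

text \<open>The ring is the intersection of its localizations at minimal primes: apply
  \<open>divides_if_locally_divides\<close> to numerator and denominator.\<close>

lemma val_nonneg_imp_integral:
  assumes "x \<in> QZ" "\<And>Y. min_prime Y \<Longrightarrow> 0 \<le> val Y x"
  obtains a where "a \<in> Z" "x = q a \<one>"
proof -
  obtain a s where h: "a \<in> Z" "s \<in> Z" "x = q a s" using QZ_cases[OF assms(1)] .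
  have "\<exists>c\<in>carrier A. a = s \<otimes> c"
  proof (rule divides_if_locally_divides[OF h(1,2)])
    fix p assume p: "min_prime p"
    have "ord p s \<le> ord p a" using assms(2)[OF p] val_q[OF p h(1,2)] h(3) by simp
    then show "\<exists>t\<in>Z - p. \<exists>c\<in>carrier A. t \<otimes> a = s \<otimes> c"
      using D.graded_ordD(2)[OF graded_ord_ord[OF p], of a s] h by (auto simp: homog_trivial)
  qed
  then obtain c where c: "c \<in> carrier A" "a = s \<otimes> c" by blast
  have cZ: "c \<in> Z" using Z_factor[OF h(1) c(2) _ c(1)] h(2) by blast
  have "q a s = q c \<one>" using h c cZ by (subst q_eq_iff) (auto simp: m_comm)
  then show thesis using that cZ h(3) by simp
qed

text \<open>A minimal prime with negative \<open>m\<close> lies outside \<open>U\<close>. It is then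
  not contained in \<open>p\<close>, as \<open>U\<close> contains with \<open>p\<close> all smaller
  primes. So it has elements outside \<open>p\<close>, and \<open>ex_large_outside\<close> produces
  \<open>f\<close>.\<close>

lemma clear_denominators:
  fixes m :: "'a set \<Rightarrow> int"
  assumes U: "openin (Spec A) U" "p \<in> U" and fin: "finite {Y. min_prime Y \<and> m Y < 0}"
    and nonneg: "\<And>Y. \<lbrakk>min_prime Y; Y \<in> U\<rbrakk> \<Longrightarrow> 0 \<le> m Y"
  obtains f where "f \<in> carrier A - p" "\<And>Y. min_prime Y \<Longrightarrow> 0 \<le> ord Y f + m Y"
proof -
  let ?W = "{Y. min_prime Y \<and> m Y < 0}"
  have p: "primeideal p A" using open_primeideal[OF U] .
  define g where "g = (\<lambda>w. \<Sum>Y\<in>?W. - m Y)"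
  \<comment> \<open>The bound has to be a function of the order and not of the prime it comes from,
    so the sum of all deficits is used for each of them.\<close>
  have "\<exists>f\<in>carrier A - p. \<forall>w\<in>ord ` ?W. (\<Sum>Y\<in>?W. - m Y) \<le> w f"
  proof (rule ex_large_outside[OF p])
    show "finite (ord ` ?W)" using fin by simp
    show "\<exists>b\<in>carrier A - p. 0 < w b" if w: "w \<in> ord ` ?W" for w
    proof -
      obtain Y where Y: "min_prime Y" "m Y < 0" "w = ord Y" using w by blast
      have "\<not> Y \<subseteq> p"
        using nonneg[OF Y(1)] Y(1,2) open_generalize[OF U] by (auto simp: min_prime_def)
      then obtain b where b: "b \<in> Y" "b \<notin> p" by blast
      have "b \<in> carrier A" using ideal.Icarr[OF primeideal.axioms(1)[OF min_primeD(1)[OF Y(1)]] b(1)] .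
      moreover have "b \<noteq> \<zero>" using b(2) p additive_subgroup.zero_closed[OF ideal.axioms(1)[OF primeideal.axioms(1)]] by blast
      ultimately have "0 < ord Y b" using ord_pos_iff[OF Y(1)] b(1) by blast
      then show ?thesis using b(2) \<open>b \<in> carrier A\<close> Y(3) by blast
    qed
  qed (use ord_mult ord_nonneg in auto)
  then obtain f where f: "f \<in> carrier A - p" "\<And>Y. Y \<in> ?W \<Longrightarrow> (\<Sum>Y\<in>?W. - m Y) \<le> ord Y f" by blast
  have fZ: "f \<in> Z" using f(1) p additive_subgroup.zero_closed[OF ideal.axioms(1)[OF primeideal.axioms(1)]] by blast
  have "0 \<le> ord Y f + m Y" if Y: "min_prime Y" for Y
  proof (cases "m Y < 0")
    case True
    then have "- m Y \<le> (\<Sum>Y\<in>?W. - m Y)" using Y fin by (intro member_le_sum) auto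
    then show ?thesis using f(2)[of Y] True Y by simp
  qed (use ord_nonneg[OF Y fZ] in simp)
  then show thesis using that f(1) by blast
qed

subsection \<open>Rational functions and divisors\<close>

definition cst :: "'a set set \<Rightarrow> ('a \<times> 'a) set \<Rightarrow> 'a set \<Rightarrow> ('a \<times> 'a) set" where
  "cst U x = (\<lambda>p\<in>U. x)"

text \<open>Every neighbourhood of a point contains \<open>{\<zero>}\<close>, so a locally constant
  function takes its value at \<open>{\<zero>}\<close> everywhere. Over the empty set all constants
  become the same function, which is why that case is treated apart.\<close>

lemma rational_functions_carrier:
  assumes U: "openin (Spec A) U"
  shows "carrier (rational_functions A U) = cst U ` carrier FA"
proof (intro equalityI subsetI)
  fix f assume f: "f \<in> carrier (rational_functions A U)"
  show "f \<in> cst U ` carrier FA"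
  proof (cases "U = {}")
    case True
    then have "f = cst U \<zero>\<^bsub>FA\<^esub>" using f by (auto simp: rational_functions_def cst_def)
    then show ?thesis by blast
  next
    case False
    have fP: "f \<in> U \<rightarrow>\<^sub>E carrier FA"
      and loc: "\<forall>p\<in>U. \<exists>V. openin (Spec A) V \<and> p \<in> V \<and> V \<subseteq> U \<and> (\<forall>q\<in>V. f q = f p)"
      using f by (auto simp: rational_functions_def)
    have "f p = f {\<zero>}" if "p \<in> U" for p
      using loc that open_generic by (metis empty_iff)
    then have "f = cst U (f {\<zero>})" using fP by (auto simp: cst_def PiE_def extensional_def fun_eq_iff)
    moreover have "f {\<zero>} \<in> carrier FA" using fP open_generic[OF U False] by blast
    ultimately show ?thesis by blast
  qed
next
  fix f assume "f \<in> cst U ` carrier FA"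
  then show "f \<in> carrier (rational_functions A U)"
    using U by (auto simp: rational_functions_def cst_def)
qed

lemma cst_ops:
  "cst U x \<otimes>\<^bsub>rational_functions A U\<^esub> cst U y = cst U (x \<otimes>\<^bsub>FA\<^esub> y)"
  "cst U x \<oplus>\<^bsub>rational_functions A U\<^esub> cst U y = cst U (x \<oplus>\<^bsub>FA\<^esub> y)"
  "\<one>\<^bsub>rational_functions A U\<^esub> = cst U \<one>\<^bsub>FA\<^esub>"
  "\<zero>\<^bsub>rational_functions A U\<^esub> = cst U \<zero>\<^bsub>FA\<^esub>"
  by (auto simp: rational_functions_def cst_def restrict_def fun_eq_iff)

lemma cst_inj: "U \<noteq> {} \<Longrightarrow> cst U x = cst U y \<longleftrightarrow> x = y"
  by (metis all_not_in_conv cst_def restrict_apply')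

lemma restrict_cst: "U' \<subseteq> U \<Longrightarrow> restrict (cst U x) U' = cst U' x"
  by (auto simp: cst_def restrict_def fun_eq_iff)

text \<open>As the image of the function field under \<open>cst\<close> this is a ring even over the
  empty set, where it is the zero ring.\<close>

lemma ring_rational_functions:
  assumes U: "openin (Spec A) U"
  shows "ring (rational_functions A U)"
proof -
  have "cst U \<in> ring_hom FA (rational_functions A U)"
    using rational_functions_carrier[OF U] by (intro ring_hom_memI) (auto simp: cst_ops)
  then have "ring (rational_functions A U \<lparr> carrier := cst U ` carrier FA, zero := cst U \<zero>\<^bsub>FA\<^esub> \<rparr>)"
    by (rule FA.ring_hom_imp_img_ring)
  moreover have "rational_functions A U \<lparr> carrier := cst U ` carrier FA, zero := cst U \<zero>\<^bsub>FA\<^esub> \<rparr> = rational_functions A U"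
    using rational_functions_carrier[OF U] cst_ops(4)[of U] by simp
  ultimately show ?thesis by simp
qed

lemma finsum_cst:
  assumes U: "openin (Spec A) U" and "finite B" "\<And>i. i \<in> B \<Longrightarrow> g i \<in> carrier FA"
  shows "(\<Oplus>\<^bsub>rational_functions A U\<^esub>i\<in>B. cst U (g i)) = cst U (\<Oplus>\<^bsub>FA\<^esub>i\<in>B. g i)"
proof -
  interpret RU: ring "rational_functions A U" by (rule ring_rational_functions[OF U])
  show ?thesis using assms(2,3)
  proof (induction B rule: finite_induct)
    case (insert i B)
    have "(\<lambda>i. cst U (g i)) \<in> B \<rightarrow> carrier (rational_functions A U)" "cst U (g i) \<in> carrier (rational_functions A U)"
      using insert.prems rational_functions_carrier[OF U] by auto
    then show ?case using insert by (simp add: cst_ops Pi_def)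
  qed (simp add: cst_ops)
qed

lemma effective_iff: "effective D \<longleftrightarrow> (\<forall>Y. 0 \<le> Poly_Mapping.lookup D Y)"
  by (simp add: effective_def)

lemma lookup_divisor_of:
  assumes "x \<in> QZ"
  shows "Poly_Mapping.lookup (divisor_of A U (cst U x)) Y = (if min_prime Y \<and> Y \<in> U then val Y x else 0)"
proof -
  have eq: "(\<lambda>Y. if Y \<in> prime_divisors A \<inter> U then divisor_valuation A Y (cst U x Y) else 0)
      = (\<lambda>Y. if min_prime Y \<and> Y \<in> U then val Y x else 0)"
    by (auto simp: prime_divisors_eq cst_def)
  have "finite {Y. (if min_prime Y \<and> Y \<in> U then val Y x else 0) \<noteq> 0}"
    by (rule finite_subset[OF _ finite_val[OF assms]]) auto
  then show ?thesis unfolding divisor_of_def eq by simp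
qed

lemma lookup_restrict_divisor:
  "Poly_Mapping.lookup (restrict_divisor D U) Y = (if Y \<in> U then Poly_Mapping.lookup D Y else 0)"
proof -
  have "finite {Y. (if Y \<in> U then Poly_Mapping.lookup D Y else 0) \<noteq> 0}"
    by (rule finite_subset[OF _ finite_lookup[of D]]) auto
  then show ?thesis by (simp add: restrict_divisor_def)
qed

text \<open>The sections of \<open>\<O>(D)\<close> over a non-empty open set, as elements of the function field.\<close>

definition Gam :: "'a set set \<Rightarrow> 'a divisor \<Rightarrow> ('a \<times> 'a) set set" where
  "Gam U D = {x \<in> carrier FA. x = \<zero>\<^bsub>FA\<^esub> \<or> (\<forall>Y. min_prime Y \<and> Y \<in> U \<longrightarrow> 0 \<le> val Y x + Poly_Mapping.lookup D Y)}"

abbreviation W where "W \<equiv> {D :: 'a divisor. Poly_Mapping.keys D \<subseteq> {Y. min_prime Y}}"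

lemma WDiv_eq: "WDiv A (topspace (Spec A)) = free_Abelian_group {Y. min_prime Y}"
proof -
  have "prime_divisors A \<inter> topspace (Spec A) = {Y. min_prime Y}"
    by (auto simp: prime_divisors_eq topspace_Spec min_prime_def)
  then show ?thesis by (simp add: WDiv_def)
qed

lemma W_lookup: "\<lbrakk>D \<in> W; \<not> min_prime Y\<rbrakk> \<Longrightarrow> Poly_Mapping.lookup D Y = 0"
  by (metis (mono_tags, lifting) in_keys_iff mem_Collect_eq subset_iff)

lemma W_add: "\<lbrakk>D \<in> W; E \<in> W\<rbrakk> \<Longrightarrow> D + E \<in> W"
  using keys_add[of D E] by blast

lemma W_diff: "\<lbrakk>D \<in> W; E \<in> W\<rbrakk> \<Longrightarrow> D - E \<in> W"
  using keys_diff[of D E] by blast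

lemma W_zero: "0 \<in> W" by simp

lemma divisor_sections_iff:
  assumes U: "openin (Spec A) U" "U \<noteq> {}" and D: "D \<in> W" and x: "x \<in> carrier FA"
  shows "cst U x \<in> divisor_sections A D U \<longleftrightarrow> x \<in> Gam U D"
proof (cases "x = \<zero>\<^bsub>FA\<^esub>")
  case True
  then show ?thesis using x rational_functions_carrier[OF U(1)] by (auto simp: divisor_sections_def Gam_def cst_ops)
next
  case False
  then have "cst U x \<noteq> \<zero>\<^bsub>rational_functions A U\<^esub>" using cst_inj[OF U(2)] by (simp add: cst_ops)
  moreover have "effective (divisor_of A U (cst U x) + restrict_divisor D U) \<longleftrightarrow>
      (\<forall>Y. min_prime Y \<and> Y \<in> U \<longrightarrow> 0 \<le> val Y x + Poly_Mapping.lookup D Y)"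
    using W_lookup[OF D] False x
    by (auto simp: effective_iff lookup_add lookup_divisor_of lookup_restrict_divisor split: if_splits)
  ultimately show ?thesis using x False rational_functions_carrier[OF U(1)]
    by (auto simp: divisor_sections_def Gam_def)
qed

lemma divisor_sections_eq:
  assumes U: "openin (Spec A) U" "U \<noteq> {}" and D: "D \<in> W"
  shows "divisor_sections A D U = cst U ` Gam U D"
proof -
  have "divisor_sections A D U \<subseteq> cst U ` carrier FA"
    using rational_functions_carrier[OF U(1)] by (auto simp: divisor_sections_def)
  moreover have "Gam U D \<subseteq> carrier FA" by (auto simp: Gam_def)
  ultimately show ?thesis using divisor_sections_iff[OF assms] by blast
qed

lemma Gam_closed: "x \<in> Gam U D \<Longrightarrow> x \<in> carrier FA"
  by (simp add: Gam_def)

lemma Gam_zero: "\<zero>\<^bsub>FA\<^esub> \<in> Gam U D"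
  by (simp add: Gam_def)

lemma Gam_mono: "\<lbrakk>x \<in> Gam U D; U' \<subseteq> U\<rbrakk> \<Longrightarrow> x \<in> Gam U' D"
  by (auto simp: Gam_def)

lemma GamD: "\<lbrakk>x \<in> Gam U D; x \<noteq> \<zero>\<^bsub>FA\<^esub>; min_prime Y; Y \<in> U\<rbrakk> \<Longrightarrow> 0 \<le> val Y x + Poly_Mapping.lookup D Y"
  by (auto simp: Gam_def)

lemma GamI: "\<lbrakk>x \<in> carrier FA; \<And>Y. \<lbrakk>x \<noteq> \<zero>\<^bsub>FA\<^esub>; min_prime Y; Y \<in> U\<rbrakk> \<Longrightarrow> 0 \<le> val Y x + Poly_Mapping.lookup D Y\<rbrakk> \<Longrightarrow> x \<in> Gam U D"
  by (auto simp: Gam_def)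

lemma Gam_mult:
  assumes "x \<in> Gam U D" "y \<in> Gam U E"
  shows "x \<otimes>\<^bsub>FA\<^esub> y \<in> Gam U (D + E)"
proof (rule GamI)
  show "x \<otimes>\<^bsub>FA\<^esub> y \<in> carrier FA" using assms Gam_closed by blast
  fix Y assume "x \<otimes>\<^bsub>FA\<^esub> y \<noteq> \<zero>\<^bsub>FA\<^esub>" and Y: "min_prime Y" "Y \<in> U"
  then have "x \<in> QZ" "y \<in> QZ" using assms Gam_closed by auto
  then show "0 \<le> val Y (x \<otimes>\<^bsub>FA\<^esub> y) + Poly_Mapping.lookup (D + E) Y"
    using val_mult[OF Y(1)] GamD[OF assms(1) _ Y] GamD[OF assms(2) _ Y] by (simp add: lookup_add)
qed

lemma Gam_add:
  assumes "x \<in> Gam U D" "y \<in> Gam U D"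
  shows "x \<oplus>\<^bsub>FA\<^esub> y \<in> Gam U D"
proof (cases "x = \<zero>\<^bsub>FA\<^esub> \<or> y = \<zero>\<^bsub>FA\<^esub>")
  case True
  then show ?thesis using assms Gam_closed[OF assms(1)] Gam_closed[OF assms(2)] by auto
next
  case False
  have c: "x \<in> QZ" "y \<in> QZ" using False assms Gam_closed by auto
  show ?thesis
  proof (rule GamI)
    show "x \<oplus>\<^bsub>FA\<^esub> y \<in> carrier FA" using c by simp
    fix Y assume h: "x \<oplus>\<^bsub>FA\<^esub> y \<noteq> \<zero>\<^bsub>FA\<^esub>" "min_prime Y" "Y \<in> U"
    then show "0 \<le> val Y (x \<oplus>\<^bsub>FA\<^esub> y) + Poly_Mapping.lookup D Y"
      using val_add[OF h(2) c h(1)] GamD[OF assms(1) _ h(2,3)] GamD[OF assms(2) _ h(2,3)] False by linarith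
  qed
qed

abbreviation X where "X \<equiv> topspace (Spec A)"

lemma open_X: "openin (Spec A) X" by simp

lemma X_nonempty: "X \<noteq> {}"
  using primeideal_zero by (auto simp: topspace_Spec)

lemma min_prime_in_X: "min_prime Y \<Longrightarrow> Y \<in> X"
  by (simp add: topspace_Spec min_prime_def)

definition pdiv :: "('a \<times> 'a) set \<Rightarrow> 'a divisor" where
  "pdiv x = divisor_of A X (cst X x)"

lemma lookup_pdiv: "x \<in> QZ \<Longrightarrow> Poly_Mapping.lookup (pdiv x) Y = (if min_prime Y then val Y x else 0)"
  using lookup_divisor_of[of x X Y] min_prime_in_X by (auto simp: pdiv_def)

lemma pdiv_W: "x \<in> QZ \<Longrightarrow> pdiv x \<in> W"
  using lookup_pdiv[of x] by (metis (mono_tags, lifting) in_keys_iff mem_Collect_eq subsetI)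

lemma pdiv_mult: "\<lbrakk>x \<in> QZ; y \<in> QZ\<rbrakk> \<Longrightarrow> pdiv (x \<otimes>\<^bsub>FA\<^esub> y) = pdiv x + pdiv y"
  using QZ_mult by (intro poly_mapping_eqI) (auto simp: lookup_pdiv lookup_add val_mult)

lemma principal_divisors_eq: "principal_divisors A = pdiv ` QZ"
proof -
  have "Units (rational_functions A X) = cst X ` QZ"
  proof (intro equalityI subsetI)
    fix f assume "f \<in> Units (rational_functions A X)"
    then obtain x y where "f = cst X x" "x \<in> carrier FA" "y \<in> carrier FA" "cst X x \<otimes>\<^bsub>rational_functions A X\<^esub> cst X y = \<one>\<^bsub>rational_functions A X\<^esub>"
      using rational_functions_carrier[OF open_X] by (auto simp: Units_def)
    moreover from this have "x \<otimes>\<^bsub>FA\<^esub> y = \<one>\<^bsub>FA\<^esub>" by (simp add: cst_ops cst_inj[OF X_nonempty])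
    ultimately show "f \<in> cst X ` QZ" using one_QZ by auto
  next
    fix f assume "f \<in> cst X ` QZ"
    then obtain x where x: "x \<in> QZ" "f = cst X x" by blast
    obtain y where y: "y \<in> QZ" "x \<otimes>\<^bsub>FA\<^esub> y = \<one>\<^bsub>FA\<^esub>" using QZ_inv[OF x(1)] .
    have "cst X y \<otimes>\<^bsub>rational_functions A X\<^esub> f = \<one>\<^bsub>rational_functions A X\<^esub>"
      "f \<otimes>\<^bsub>rational_functions A X\<^esub> cst X y = \<one>\<^bsub>rational_functions A X\<^esub>"
      using x y FA.m_comm[of x y] by (auto simp: cst_ops)
    then show "f \<in> Units (rational_functions A X)"
      using x y rational_functions_carrier[OF open_X] by (auto simp: Units_def)
  qed
  then show ?thesis by (auto simp: principal_divisors_def Let_def pdiv_def)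
qed

end

section \<open>Cox sheaves in terms of elements of the function field\<close>

lemma (in abelian_monoid) finsum_swap:
  assumes "finite S" "finite B" "\<And>i j. \<lbrakk>i \<in> S; j \<in> B\<rbrakk> \<Longrightarrow> f i j \<in> carrier G"
  shows "(\<Oplus>i\<in>S. \<Oplus>j\<in>B. f i j) = (\<Oplus>j\<in>B. \<Oplus>i\<in>S. f i j)"
  using assms(1,3)
proof (induction S rule: finite_induct)
  case empty
  then show ?case by simp
next
  case (insert k S)
  have c: "(\<Oplus>j\<in>B. f i j) \<in> carrier G" if "i \<in> insert k S" for i
    using insert.prems that by (intro finsum_closed) auto
  have "(\<Oplus>i\<in>insert k S. \<Oplus>j\<in>B. f i j) = (\<Oplus>j\<in>B. f k j) \<oplus> (\<Oplus>i\<in>S. \<Oplus>j\<in>B. f i j)"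
    using insert.hyps c by (intro finsum_insert) auto
  also have "\<dots> = (\<Oplus>j\<in>B. f k j) \<oplus> (\<Oplus>j\<in>B. \<Oplus>i\<in>S. f i j)" using insert by simp
  also have "\<dots> = (\<Oplus>j\<in>B. f k j \<oplus> (\<Oplus>i\<in>S. f i j))"
    using insert.prems by (intro finsum_addf[symmetric]) (auto intro!: finsum_closed)
  also have "\<dots> = (\<Oplus>j\<in>B. \<Oplus>i\<in>insert k S. f i j)"
    using insert.prems insert.hyps by (intro finsum_cong') (auto intro!: finsum_closed)
  finally show ?case .
qed

text \<open>Serves to replace the grading group \<open>K\<close> by the class group without changing
  the sections.\<close>

lemma graded_ring_regrade:
  assumes gr: "graded_ring K R G" and C: "comm_group C" and k: "k \<in> iso C K"
  shows "graded_ring C R (\<lambda>c. G (k c))"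
proof -
  interpret graded K R G using gr by unfold_locales
  have kc: "k c \<in> carrier K" if "c \<in> carrier C" for c using k that by (auto simp: iso_def hom_def)
  have bij: "bij_betw k (carrier C) (carrier K)" using k by (simp add: iso_def)
  have pc: "proj w x \<in> carrier R" if "x \<in> carrier R" "w \<in> carrier K" for x w
    using that comp_closed[OF proj_closed] by blast
  show ?thesis
  proof (rule graded_ringI[where P = "\<lambda>c x. proj (k c) x"])
    show "comm_group C" "cring R" by (fact C is_cring)+
    show "additive_subgroup (G (k w)) R" if "w \<in> carrier C" for w using comp_subgroup kc that by blast
    show "a \<otimes>\<^bsub>R\<^esub> b \<in> G (k (v \<otimes>\<^bsub>C\<^esub> w))"
      if "v \<in> carrier C" "w \<in> carrier C" "a \<in> G (k v)" "b \<in> G (k w)" for v w a b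
    proof -
      have "k (v \<otimes>\<^bsub>C\<^esub> w) = k v \<otimes>\<^bsub>K\<^esub> k w" using k that by (auto simp: iso_def hom_def)
      then show ?thesis using comp_mult[OF kc[OF that(1)] kc[OF that(2)] that(3,4)] by simp
    qed
    show "proj (k w) x \<in> G (k w)" if "w \<in> carrier C" "x \<in> carrier R" for w x using that kc proj_closed by blast
    show "proj (k w) (x \<oplus>\<^bsub>R\<^esub> y) = proj (k w) x \<oplus>\<^bsub>R\<^esub> proj (k w) y"
      if "w \<in> carrier C" "x \<in> carrier R" "y \<in> carrier R" for w x y using that kc proj_add by blast
    show "proj (k w) a = (if v = w then a else \<zero>\<^bsub>R\<^esub>)" if "v \<in> carrier C" "w \<in> carrier C" "a \<in> G (k v)" for v w a
    proof -
      have "k w = k v \<longleftrightarrow> v = w" using bij that by (auto simp: bij_betw_def inj_on_def)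
      then show ?thesis using proj_comp[OF that(3) kc[OF that(1)] kc[OF that(2)]] by simp
    qed
    fix x assume x: "x \<in> carrier R"
    let ?T = "{w \<in> carrier C. proj (k w) x \<noteq> \<zero>\<^bsub>R\<^esub>}"
    have inj: "inj_on k ?T" using bij by (auto simp: bij_betw_def inj_on_def)
    have img: "k ` ?T = {w \<in> carrier K. proj w x \<noteq> \<zero>\<^bsub>R\<^esub>}"
      using bij by (auto simp: bij_betw_def)
    show "finite ?T" using finite_imageD[OF _ inj] finite_proj[OF x] unfolding img by blast
    have "x = (\<Oplus>\<^bsub>R\<^esub>w\<in>k ` ?T. proj w x)" unfolding img by (rule sum_proj[OF x])
    also have "\<dots> = (\<Oplus>\<^bsub>R\<^esub>w\<in>?T. proj (k w) x)"
      using inj kc pc[OF x] by (intro finsum_reindex) auto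
    finally show "x = (\<Oplus>\<^bsub>R\<^esub>w\<in>?T. proj (k w) x)" .
  qed
qed

lemma graded_sheafD:
  assumes "graded_sheaf K X F"
  shows "openin X U \<Longrightarrow> graded_ring K (sec F U) (hcomp F U)"
    and "\<lbrakk>openin X U; openin X U'; U' \<subseteq> U\<rbrakk> \<Longrightarrow> res F U U' \<in> ring_hom (sec F U) (sec F U')"
    and "\<lbrakk>openin X U; openin X U'; U' \<subseteq> U; w \<in> carrier K; s \<in> hcomp F U w\<rbrakk> \<Longrightarrow> res F U U' s \<in> hcomp F U' w"
    and "\<lbrakk>openin X U; s \<in> carrier (sec F U)\<rbrakk> \<Longrightarrow> res F U U s = s"
    and "\<lbrakk>openin X U; openin X U'; openin X U''; U'' \<subseteq> U'; U' \<subseteq> U; s \<in> carrier (sec F U)\<rbrakk> \<Longrightarrow>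
        res F U' U'' (res F U U' s) = res F U U'' s"
    and "\<lbrakk>\<And>U. U \<in> \<U> \<Longrightarrow> openin X U; \<And>U. U \<in> \<U> \<Longrightarrow> f U \<in> carrier (sec F U);
        \<And>U U'. \<lbrakk>U \<in> \<U>; U' \<in> \<U>\<rbrakk> \<Longrightarrow> res F U (U \<inter> U') (f U) = res F U' (U \<inter> U') (f U')\<rbrakk> \<Longrightarrow>
        \<exists>!s. s \<in> carrier (sec F (\<Union>\<U>)) \<and> (\<forall>U\<in>\<U>. res F (\<Union>\<U>) U s = f U)"
proof -
  note d = assms[unfolded graded_sheaf_def]
  note d1 = conjunct1[OF d] and d2 = conjunct1[OF conjunct2[OF d]]
    and d3 = conjunct1[OF conjunct2[OF conjunct2[OF d]]]
    and d4 = conjunct1[OF conjunct2[OF conjunct2[OF conjunct2[OF d]]]]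
    and d5 = conjunct2[OF conjunct2[OF conjunct2[OF conjunct2[OF d]]]]
  show "openin X U \<Longrightarrow> graded_ring K (sec F U) (hcomp F U)" using d1 by blast
  show "\<lbrakk>openin X U; openin X U'; U' \<subseteq> U\<rbrakk> \<Longrightarrow> res F U U' \<in> ring_hom (sec F U) (sec F U')" using d2 by blast
  show "\<lbrakk>openin X U; openin X U'; U' \<subseteq> U; w \<in> carrier K; s \<in> hcomp F U w\<rbrakk> \<Longrightarrow> res F U U' s \<in> hcomp F U' w"
    using d2 by blast
  show "\<lbrakk>openin X U; s \<in> carrier (sec F U)\<rbrakk> \<Longrightarrow> res F U U s = s" using d3 by blast
  show "\<lbrakk>openin X U; openin X U'; openin X U''; U'' \<subseteq> U'; U' \<subseteq> U; s \<in> carrier (sec F U)\<rbrakk> \<Longrightarrow>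
        res F U' U'' (res F U U' s) = res F U U'' s" using d4 by blast
  show "\<lbrakk>\<And>U. U \<in> \<U> \<Longrightarrow> openin X U; \<And>U. U \<in> \<U> \<Longrightarrow> f U \<in> carrier (sec F U);
        \<And>U U'. \<lbrakk>U \<in> \<U>; U' \<in> \<U>\<rbrakk> \<Longrightarrow> res F U (U \<inter> U') (f U) = res F U' (U \<inter> U') (f U')\<rbrakk> \<Longrightarrow>
        \<exists>!s. s \<in> carrier (sec F (\<Union>\<U>)) \<and> (\<forall>U\<in>\<U>. res F (\<Union>\<U>) U s = f U)"
    by (rule d5[THEN spec, THEN spec, THEN mp, THEN mp]; blast)
qed

lemma graded_sheaf_homD:
  assumes "graded_sheaf_hom L K X F F' \<kappa> \<phi>"
  shows "\<kappa> \<in> hom L K"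
    and "openin X U \<Longrightarrow> \<phi> U \<in> ring_hom (sec F U) (sec F' U)"
    and "\<lbrakk>openin X U; w \<in> carrier L; s \<in> hcomp F U w\<rbrakk> \<Longrightarrow> \<phi> U s \<in> hcomp F' U (\<kappa> w)"
    and "\<lbrakk>openin X U; openin X U'; U' \<subseteq> U; s \<in> carrier (sec F U)\<rbrakk> \<Longrightarrow>
        \<phi> U' (res F U U' s) = res F' U U' (\<phi> U s)"
proof -
  note d = assms[unfolded graded_sheaf_hom_def]
  note d1 = conjunct1[OF d] and d2 = conjunct1[OF conjunct2[OF d]] and d3 = conjunct2[OF conjunct2[OF d]]
  show "\<kappa> \<in> hom L K" by (rule d1)
  show "openin X U \<Longrightarrow> \<phi> U \<in> ring_hom (sec F U) (sec F' U)"
    and "\<lbrakk>openin X U; w \<in> carrier L; s \<in> hcomp F U w\<rbrakk> \<Longrightarrow> \<phi> U s \<in> hcomp F' U (\<kappa> w)"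
    using d2 by blast+
  show "\<lbrakk>openin X U; openin X U'; U' \<subseteq> U; s \<in> carrier (sec F U)\<rbrakk> \<Longrightarrow>
        \<phi> U' (res F U U' s) = res F' U U' (\<phi> U s)" using d3 by blast
qed

lemma graded_sheaf_homI:
  assumes "\<kappa> \<in> hom L K"
    and "\<And>U. openin X U \<Longrightarrow> \<phi> U \<in> ring_hom (sec F U) (sec F' U)"
    and "\<And>U w s. \<lbrakk>openin X U; w \<in> carrier L; s \<in> hcomp F U w\<rbrakk> \<Longrightarrow> \<phi> U s \<in> hcomp F' U (\<kappa> w)"
    and "\<And>U U' s. \<lbrakk>openin X U; openin X U'; U' \<subseteq> U; s \<in> carrier (sec F U)\<rbrakk> \<Longrightarrow>
        \<phi> U' (res F U U' s) = res F' U U' (\<phi> U s)"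
  shows "graded_sheaf_hom L K X F F' \<kappa> \<phi>"
  unfolding graded_sheaf_hom_def using assms by (intro conjI allI impI ballI image_subsetI)

lemma graded_sheaf_isoD:
  assumes "graded_sheaf_iso L K X F F' \<kappa> \<phi>"
  shows "graded_sheaf_hom L K X F F' \<kappa> \<phi>" "\<kappa> \<in> iso L K"
    and "openin X U \<Longrightarrow> bij_betw (\<phi> U) (carrier (sec F U)) (carrier (sec F' U))"
    and "\<lbrakk>openin X U; w \<in> carrier L\<rbrakk> \<Longrightarrow> \<phi> U ` hcomp F U w = hcomp F' U (\<kappa> w)"
proof -
  note d = assms[unfolded graded_sheaf_iso_def]
  show "graded_sheaf_hom L K X F F' \<kappa> \<phi>" "\<kappa> \<in> iso L K"
    by (rule conjunct1[OF d], rule conjunct1[OF conjunct2[OF d]])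
  show "openin X U \<Longrightarrow> bij_betw (\<phi> U) (carrier (sec F U)) (carrier (sec F' U))"
    and "\<lbrakk>openin X U; w \<in> carrier L\<rbrakk> \<Longrightarrow> \<phi> U ` hcomp F U w = hcomp F' U (\<kappa> w)"
    using conjunct2[OF conjunct2[OF d]] by blast+
qed

text \<open>The empty family covers the empty set, and gluing is unique.\<close>

lemma graded_sheaf_empty:
  assumes F: "graded_sheaf K X F" and s: "s \<in> carrier (sec F {})" "t \<in> carrier (sec F {})"
  shows "s = t"
  using graded_sheafD(6)[OF F, of "{}"] s by auto

context weighted_domain
begin

section \<open>The divisorial sheaf and the class group\<close>

abbreviation DS where "DS \<equiv> divisorial_sheaf A"
abbreviation RU where "RU U \<equiv> rational_functions A U"
abbreviation WD where "WD \<equiv> WDiv A X"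

lemma WD_simps: "carrier WD = W" "mult WD = (+)" "one WD = 0"
  unfolding WDiv_eq by (auto simp: free_Abelian_group_def)

lemma comm_group_WD: "comm_group WD"
  unfolding WDiv_eq by (rule abelian_free_Abelian_group)

lemma DS_carrier: "s \<in> carrier (sec DS U) \<longleftrightarrow> (\<forall>D\<in>W. s D \<in> divisor_sections A D U) \<and>
    (\<forall>D. D \<notin> W \<longrightarrow> s D = \<zero>\<^bsub>RU U\<^esub>) \<and> finite {D. s D \<noteq> \<zero>\<^bsub>RU U\<^esub>}"
  unfolding divisorial_sheaf_def Let_def WD_simps by simp

lemma DS_mult: "s \<otimes>\<^bsub>sec DS U\<^esub> t = (\<lambda>D. \<Oplus>\<^bsub>RU U\<^esub>E\<in>{E. s E \<noteq> \<zero>\<^bsub>RU U\<^esub>}. s E \<otimes>\<^bsub>RU U\<^esub> t (D - E))"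
  and DS_add: "s \<oplus>\<^bsub>sec DS U\<^esub> t = (\<lambda>D. s D \<oplus>\<^bsub>RU U\<^esub> t D)"
  and DS_one: "\<one>\<^bsub>sec DS U\<^esub> = (\<lambda>D. if D = 0 then \<one>\<^bsub>RU U\<^esub> else \<zero>\<^bsub>RU U\<^esub>)"
  and DS_res: "res DS U U' s = (\<lambda>D. restrict (s D) U')"
  unfolding divisorial_sheaf_def Let_def by simp_all

lemma DS_hcomp: "s \<in> hcomp DS U D \<longleftrightarrow> s \<in> carrier (sec DS U) \<and> (\<forall>E. E \<noteq> D \<longrightarrow> s E = \<zero>\<^bsub>RU U\<^esub>)"
  unfolding divisorial_sheaf_def Let_def by simp

text \<open>The monomial \<open>x \<chi>\<^sup>D\<close> in the encoding of
  \<open>divisorial_sheaf\<close>.\<close>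

definition single :: "'a set set \<Rightarrow> 'a divisor \<Rightarrow> ('a \<times> 'a) set \<Rightarrow> 'a divisor \<Rightarrow> 'a set \<Rightarrow> ('a \<times> 'a) set" where
  "single U D x = (\<lambda>E. if E = D then cst U x else \<zero>\<^bsub>RU U\<^esub>)"

lemma single_carrier:
  assumes "openin (Spec A) U" "U \<noteq> {}" "D \<in> W" "x \<in> Gam U D"
  shows "single U D x \<in> carrier (sec DS U)"
proof -
  have "{E. single U D x E \<noteq> \<zero>\<^bsub>RU U\<^esub>} \<subseteq> {D}" by (auto simp: single_def)
  then show ?thesis
    using assms divisor_sections_eq[OF assms(1,2)] Gam_zero finite_subset
    by (auto simp: DS_carrier single_def cst_ops)
qed

lemma hcomp_DS:
  assumes U: "openin (Spec A) U" "U \<noteq> {}" and D: "D \<in> W"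
  shows "bij_betw (single U D) (Gam U D) (hcomp DS U D)"
proof (rule bij_betwI')
  show "single U D x = single U D y \<longleftrightarrow> x = y" for x y
    using cst_inj[OF U(2), of x y] by (auto simp: single_def fun_eq_iff)
  show "single U D x \<in> hcomp DS U D" if "x \<in> Gam U D" for x
    using single_carrier[OF U D that] by (auto simp: DS_hcomp single_def)
  show "\<exists>x\<in>Gam U D. s = single U D x" if "s \<in> hcomp DS U D" for s
  proof -
    have s: "s D \<in> divisor_sections A D U" "\<And>E. E \<noteq> D \<Longrightarrow> s E = \<zero>\<^bsub>RU U\<^esub>"
      using that D by (auto simp: DS_hcomp DS_carrier)
    then obtain x where "x \<in> Gam U D" "s D = cst U x" using divisor_sections_eq[OF U D] by blast
    then show ?thesis using s(2) by (intro bexI[of _ x]) (auto simp: single_def)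
  qed
qed

lemma single_add: "single U D x \<oplus>\<^bsub>sec DS U\<^esub> single U D y = single U D (x \<oplus>\<^bsub>FA\<^esub> y)"
  by (auto simp: DS_add single_def cst_ops fun_eq_iff)

lemma single_one: "\<one>\<^bsub>sec DS U\<^esub> = single U 0 \<one>\<^bsub>FA\<^esub>"
  by (auto simp: DS_one single_def cst_ops)

lemma single_mult:
  assumes U: "openin (Spec A) U" "U \<noteq> {}" and xy: "x \<in> carrier FA" "y \<in> carrier FA"
  shows "single U D x \<otimes>\<^bsub>sec DS U\<^esub> single U E y = single U (D + E) (x \<otimes>\<^bsub>FA\<^esub> y)"
proof
  fix B
  interpret RU: ring "RU U" by (rule ring_rational_functions[OF U(1)])
  have c: "cst U z \<in> carrier (RU U)" if "z \<in> carrier FA" for z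
    using that rational_functions_carrier[OF U(1)] by blast
  have eq: "single U D x D \<otimes>\<^bsub>RU U\<^esub> single U E y (B - D) = single U (D + E) (x \<otimes>\<^bsub>FA\<^esub> y) B"
    using xy by (auto simp: single_def cst_ops algebra_simps)
  show "(single U D x \<otimes>\<^bsub>sec DS U\<^esub> single U E y) B = single U (D + E) (x \<otimes>\<^bsub>FA\<^esub> y) B"
  proof (cases "x = \<zero>\<^bsub>FA\<^esub>")
    case True
    then have e: "{F. single U D x F \<noteq> \<zero>\<^bsub>RU U\<^esub>} = {}" by (auto simp: single_def cst_ops)
    show ?thesis using True xy unfolding DS_mult e by (simp add: single_def cst_ops)
  next
    case False
    then have e: "{F. single U D x F \<noteq> \<zero>\<^bsub>RU U\<^esub>} = {D}"
      using cst_inj[OF U(2)] by (auto simp: single_def cst_ops)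
    have "single U (D + E) (x \<otimes>\<^bsub>FA\<^esub> y) B \<in> carrier (RU U)" using c xy by (auto simp: single_def)
    then show ?thesis unfolding DS_mult e using eq by simp
  qed
qed

lemma restrict_single: "\<lbrakk>U' \<subseteq> U\<rbrakk> \<Longrightarrow> res DS U U' (single U D x) = single U' D x"
  by (auto simp: DS_res single_def cst_ops restrict_cst)

lemma subgroup_principal: "subgroup (pdiv ` QZ) WD"
proof (rule group.subgroupI)
  show "group WD" using comm_group_WD comm_group.axioms(2) by blast
  show "pdiv ` QZ \<subseteq> carrier WD" using pdiv_W WD_simps by auto
  show "pdiv ` QZ \<noteq> {}" using one_QZ by blast
  have p1: "pdiv \<one>\<^bsub>FA\<^esub> = 0" using pdiv_mult[OF one_QZ one_QZ] by simp
  fix a assume "a \<in> pdiv ` QZ"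
  then obtain x where x: "x \<in> QZ" "a = pdiv x" by blast
  obtain y where y: "y \<in> QZ" "x \<otimes>\<^bsub>FA\<^esub> y = \<one>\<^bsub>FA\<^esub>" using QZ_inv[OF x(1)] .
  have "pdiv y = - a" using pdiv_mult[OF x(1) y(1)] y(2) p1 x(2) by (simp add: eq_neg_iff_add_eq_0 add.commute)
  moreover have "inv\<^bsub>WD\<^esub> a = - a" using pdiv_W[OF x(1)] x(2) unfolding WDiv_eq by simp
  ultimately show "inv\<^bsub>WD\<^esub> a \<in> pdiv ` QZ" using y(1) by (metis imageI)
  fix b assume "b \<in> pdiv ` QZ"
  then obtain z where z: "z \<in> QZ" "b = pdiv z" by blast
  then have "a \<otimes>\<^bsub>WD\<^esub> b = pdiv (x \<otimes>\<^bsub>FA\<^esub> z)" using x pdiv_mult by (simp add: WD_simps)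
  then show "a \<otimes>\<^bsub>WD\<^esub> b \<in> pdiv ` QZ" using QZ_mult[OF x(1) z(1)] by simp
qed

lemma Cl_facts:
  shows "comm_group (Cl A)"
    and "D \<in> W \<Longrightarrow> divisor_class A D \<in> carrier (Cl A)"
    and "\<lbrakk>D \<in> W; E \<in> W\<rbrakk> \<Longrightarrow> divisor_class A (D + E) = divisor_class A D \<otimes>\<^bsub>Cl A\<^esub> divisor_class A E"
    and "c \<in> carrier (Cl A) \<Longrightarrow> \<exists>D\<in>W. c = divisor_class A D"
    and "D \<in> W \<Longrightarrow> divisor_class A D = \<one>\<^bsub>Cl A\<^esub> \<longleftrightarrow> D \<in> pdiv ` QZ"
proof -
  interpret WD: comm_group WD by (rule comm_group_WD)
  interpret N: normal "pdiv ` QZ" WD using subgroup_principal by (rule WD.subgroup_imp_normal)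
  have Cl: "Cl A = WD Mod (pdiv ` QZ)" by (simp add: Cl_def principal_divisors_eq)
  have cl: "divisor_class A D = pdiv ` QZ #>\<^bsub>WD\<^esub> D" for D
    by (simp add: divisor_class_def principal_divisors_eq)
  have hom: "(\<lambda>D. pdiv ` QZ #>\<^bsub>WD\<^esub> D) \<in> hom WD (WD Mod (pdiv ` QZ))" by (rule N.r_coset_hom_Mod)
  show "comm_group (Cl A)" unfolding Cl by (rule WD.abelian_FactGroup[OF subgroup_principal])
  show "D \<in> W \<Longrightarrow> divisor_class A D \<in> carrier (Cl A)"
    using hom unfolding Cl cl WD_simps[symmetric] by (auto simp: hom_def)
  show "\<lbrakk>D \<in> W; E \<in> W\<rbrakk> \<Longrightarrow> divisor_class A (D + E) = divisor_class A D \<otimes>\<^bsub>Cl A\<^esub> divisor_class A E"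
    using hom_mult[OF hom, of D E] WD_simps unfolding Cl cl by simp
  show "c \<in> carrier (Cl A) \<Longrightarrow> \<exists>D\<in>W. c = divisor_class A D"
    unfolding Cl cl using WD_simps by (auto simp: FactGroup_def RCOSETS_def)
  show "divisor_class A D = \<one>\<^bsub>Cl A\<^esub> \<longleftrightarrow> D \<in> pdiv ` QZ" if "D \<in> W"
    unfolding Cl cl using WD.coset_join1[OF _ _ subgroup_principal, of D] WD.coset_join2[OF _ subgroup_principal, of D] that WD_simps
    by (auto simp: FactGroup_def)
qed

end

text \<open>
  A Cox sheaf amounts to an epimorphism \<open>\<delta>\<close> from divisors onto \<open>K\<close> with kernel the principal divisors
  and isomorphisms \<open>M U D\<close> from \<open>\<O>(D)(U)\<close> onto the component of degree \<open>\<delta> D\<close>.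
\<close>

locale cox = weighted_domain A V for A :: "('a, 'm) ring_scheme" (structure) and V +
  fixes K :: "('k, 'n) monoid_scheme" and F :: "('a set, 's, 'k) graded_presheaf" and \<delta> M
  assumes K: "comm_group K" and F: "graded_sheaf K (Spec A) F"
    and deg_closed: "D \<in> W \<Longrightarrow> \<delta> D \<in> carrier K"
    and deg_add: "\<lbrakk>D \<in> W; E \<in> W\<rbrakk> \<Longrightarrow> \<delta> (D + E) = \<delta> D \<otimes>\<^bsub>K\<^esub> \<delta> E"
    and deg_surj: "w \<in> carrier K \<Longrightarrow> \<exists>D\<in>W. \<delta> D = w"
    and deg_one_iff: "D \<in> W \<Longrightarrow> \<delta> D = \<one>\<^bsub>K\<^esub> \<longleftrightarrow> D \<in> pdiv ` QZ"
    and M_bij: "\<lbrakk>openin (Spec A) U; U \<noteq> {}; D \<in> W\<rbrakk> \<Longrightarrow> bij_betw (M U D) (Gam U D) (hcomp F U (\<delta> D))"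
    and M_add: "\<lbrakk>openin (Spec A) U; U \<noteq> {}; D \<in> W; x \<in> Gam U D; y \<in> Gam U D\<rbrakk> \<Longrightarrow>
      M U D (x \<oplus>\<^bsub>FA\<^esub> y) = M U D x \<oplus>\<^bsub>sec F U\<^esub> M U D y"
    and M_mult: "\<lbrakk>openin (Spec A) U; U \<noteq> {}; D \<in> W; E \<in> W; x \<in> Gam U D; y \<in> Gam U E\<rbrakk> \<Longrightarrow>
      M U (D + E) (x \<otimes>\<^bsub>FA\<^esub> y) = M U D x \<otimes>\<^bsub>sec F U\<^esub> M U E y"
    and M_one: "\<lbrakk>openin (Spec A) U; U \<noteq> {}\<rbrakk> \<Longrightarrow> M U 0 \<one>\<^bsub>FA\<^esub> = \<one>\<^bsub>sec F U\<^esub>"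
    and M_res: "\<lbrakk>openin (Spec A) U; U \<noteq> {}; openin (Spec A) U'; U' \<noteq> {}; U' \<subseteq> U; D \<in> W; x \<in> Gam U D\<rbrakk> \<Longrightarrow>
      res F U U' (M U D x) = M U' D x"

text \<open>Take for \<open>\<delta>\<close> the class map followed by the inverse of
  \<open>\<kappa>\<close>, and for \<open>M\<close> the map \<open>single\<close> followed by
  \<open>\<pi>\<close> and the inverse of \<open>\<phi>\<close>. Identities between sections of
  \<open>F\<close> are checked after applying the injective map \<open>\<phi>\<close>.\<close>

lemma (in weighted_domain) Cox_sheaf_imp_cox:
  fixes K :: "('k, 'n) monoid_scheme" and F :: "('a set, 's, 'k) graded_presheaf"
  assumes K: "comm_group K" and F: "graded_sheaf K (Spec A) F" and cox: "Cox_sheaf A K F"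
  shows "\<exists>\<delta> M. cox A V K F \<delta> M"
proof -
  obtain F' :: "('a set, 's, 'a divisor set) graded_presheaf" and \<kappa> \<phi> where cl: "Cl_graded_Cox_sheaf A F'" and iso: "graded_sheaf_iso K (Cl A) (Spec A) F F' \<kappa> \<phi>"
    using cox unfolding Cox_sheaf_def by blast
  obtain \<pi> where \<pi>: "graded_sheaf_hom WD (Cl A) (Spec A) DS F' (divisor_class A) \<pi>"
    and \<pi>_bij: "\<And>D U. \<lbrakk>D \<in> W; openin (Spec A) U\<rbrakk> \<Longrightarrow>
         bij_betw (\<pi> U) (hcomp DS U D) (hcomp F' U (divisor_class A D))"
    and F': "graded_sheaf (Cl A) (Spec A) F'"
    using cl unfolding Cl_graded_Cox_sheaf_def WD_simps by blast
  interpret K: comm_group K by fact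
  define k where "k = inv_into (carrier K) \<kappa>"
  have \<kappa>: "\<kappa> \<in> iso K (Cl A)" using iso by (simp add: graded_sheaf_iso_def)
  then have k: "k \<in> iso (Cl A) K" unfolding k_def by (rule K.iso_set_sym)
  have kc: "k c \<in> carrier K" if "c \<in> carrier (Cl A)" for c using k that by (auto simp: iso_def hom_def)
  have k\<kappa>: "\<kappa> (k c) = c" if "c \<in> carrier (Cl A)" for c
    using \<kappa> that unfolding k_def by (auto simp: iso_def bij_betw_def f_inv_into_f)
  have \<kappa>k: "k (\<kappa> w) = w" "\<kappa> w \<in> carrier (Cl A)" if "w \<in> carrier K" for w
    using \<kappa> that unfolding k_def by (auto simp: iso_def bij_betw_def hom_def)
  define \<delta> where "\<delta> D = k (divisor_class A D)" for D
  define j where "j U = inv_into (carrier (sec F U)) (\<phi> U)" for U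
  define M where "M U D x = j U (\<pi> U (single U D x))" for U D x
  have hom\<phi>: "\<phi> U \<in> ring_hom (sec F U) (sec F' U)" "bij_betw (\<phi> U) (carrier (sec F U)) (carrier (sec F' U))"
    "\<And>w. w \<in> carrier K \<Longrightarrow> \<phi> U ` hcomp F U w = hcomp F' U (\<kappa> w)" if "openin (Spec A) U" for U
    using graded_sheaf_homD(2)[OF graded_sheaf_isoD(1)[OF iso]] graded_sheaf_isoD(3,4)[OF iso] that by blast+
  have res\<phi>: "\<phi> U' (res F U U' s) = res F' U U' (\<phi> U s)"
    if "openin (Spec A) U" "openin (Spec A) U'" "U' \<subseteq> U" "s \<in> carrier (sec F U)" for U U' s
    using graded_sheaf_homD(4)[OF graded_sheaf_isoD(1)[OF iso] that] .
  have hom\<pi>: "\<pi> U \<in> ring_hom (sec DS U) (sec F' U)" if "openin (Spec A) U" for U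
    using graded_sheaf_homD(2)[OF \<pi> that] .
  have res\<pi>: "\<pi> U' (res DS U U' s) = res F' U U' (\<pi> U s)"
    if "openin (Spec A) U" "openin (Spec A) U'" "U' \<subseteq> U" "s \<in> carrier (sec DS U)" for U U' s
    using graded_sheaf_homD(4)[OF \<pi> that] .
  have jc: "j U s \<in> carrier (sec F U)" "\<phi> U (j U s) = s" if "openin (Spec A) U" "s \<in> carrier (sec F' U)" for U s
    using hom\<phi>(2)[OF that(1)] that(2) unfolding j_def
    by (auto simp: bij_betw_def f_inv_into_f inv_into_into)
  have jI: "j U s = t" if "openin (Spec A) U" "t \<in> carrier (sec F U)" "\<phi> U t = s" for U s t
    using hom\<phi>(2)[OF that(1)] that(2,3) unfolding j_def by (auto simp: bij_betw_def)
  have \<pi>c: "\<pi> U (single U D x) \<in> carrier (sec F' U)"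
    if "openin (Spec A) U" "U \<noteq> {}" "D \<in> W" "x \<in> Gam U D" for U D x
    using ring_hom_closed[OF hom\<pi>[OF that(1)] single_carrier[OF that]] .
  show ?thesis
  proof (intro exI[of _ \<delta>] exI[of _ M] cox.intro cox_axioms.intro weighted_domain_axioms K F)
    fix D assume D: "D \<in> W"
    show "\<delta> D \<in> carrier K" using kc Cl_facts(2)[OF D] by (simp add: \<delta>_def)
    show "\<delta> (D + E) = \<delta> D \<otimes>\<^bsub>K\<^esub> \<delta> E" if "E \<in> W" for E
      using k Cl_facts(2)[OF D] Cl_facts(2)[OF that] Cl_facts(3)[OF D that] by (auto simp: \<delta>_def iso_def hom_def)
    have "\<delta> D = \<one>\<^bsub>K\<^esub> \<longleftrightarrow> divisor_class A D = \<one>\<^bsub>Cl A\<^esub>"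
    proof -
      interpret Cl: comm_group "Cl A" by (rule Cl_facts(1))
      have "k \<one>\<^bsub>Cl A\<^esub> = \<one>\<^bsub>K\<^esub>"
        using hom_one[of k "Cl A" K] k Cl.group_axioms K.group_axioms by (simp add: iso_def)
      then show ?thesis using k\<kappa>[OF Cl_facts(2)[OF D]] k\<kappa>[OF Cl.one_closed] by (metis \<delta>_def)
    qed
    then show "\<delta> D = \<one>\<^bsub>K\<^esub> \<longleftrightarrow> D \<in> pdiv ` QZ" using Cl_facts(5)[OF D] by simp
  next
    fix w assume w: "w \<in> carrier K"
    obtain D where "D \<in> W" "\<kappa> w = divisor_class A D" using Cl_facts(4)[OF \<kappa>k(2)[OF w]] by blast
    then show "\<exists>D\<in>W. \<delta> D = w" using \<kappa>k(1)[OF w] by (auto simp: \<delta>_def)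
  next
    fix U D assume U: "openin (Spec A) U" "U \<noteq> {}" and D: "D \<in> W"
    have F_sub: "hcomp F U (\<delta> D) \<subseteq> carrier (sec F U)"
      using graded.comp_closed[OF graded.intro[OF graded_sheafD(1)[OF F U(1)]]] kc Cl_facts(2)[OF D]
      unfolding \<delta>_def by blast
    have "bij_betw (\<phi> U) (hcomp F U (\<delta> D)) (hcomp F' U (divisor_class A D))"
      using hom\<phi>(2)[OF U(1)] hom\<phi>(3)[OF U(1) kc[OF Cl_facts(2)[OF D]]] F_sub k\<kappa>[OF Cl_facts(2)[OF D]]
      unfolding \<delta>_def bij_betw_def by (auto intro: inj_on_subset)
    then have "bij_betw (inv_into (hcomp F U (\<delta> D)) (\<phi> U)) (hcomp F' U (divisor_class A D)) (hcomp F U (\<delta> D))"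
      by (rule bij_betw_inv_into)
    then have "bij_betw (inv_into (hcomp F U (\<delta> D)) (\<phi> U) \<circ> (\<pi> U \<circ> single U D)) (Gam U D) (hcomp F U (\<delta> D))"
      using bij_betw_trans[OF bij_betw_trans[OF hcomp_DS[OF U D] \<pi>_bij[OF D U(1)]]] by blast
    moreover have "(inv_into (hcomp F U (\<delta> D)) (\<phi> U) \<circ> (\<pi> U \<circ> single U D)) x = M U D x" if x: "x \<in> Gam U D" for x
    proof -
      have "\<pi> U (single U D x) \<in> hcomp F' U (divisor_class A D)"
        using bij_betwE[OF \<pi>_bij[OF D U(1)]] bij_betwE[OF hcomp_DS[OF U D]] x by blast
      then have "\<pi> U (single U D x) \<in> \<phi> U ` hcomp F U (\<delta> D)"
        using hom\<phi>(3)[OF U(1) kc[OF Cl_facts(2)[OF D]]] k\<kappa>[OF Cl_facts(2)[OF D]] by (simp add: \<delta>_def)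
      then obtain t where t: "t \<in> hcomp F U (\<delta> D)" "\<phi> U t = \<pi> U (single U D x)" by auto
      then have "M U D x = t" unfolding M_def using jI[OF U(1)] F_sub by blast
      moreover have "inv_into (hcomp F U (\<delta> D)) (\<phi> U) (\<phi> U t) = t"
        using t(1) hom\<phi>(2)[OF U(1)] F_sub by (intro inv_into_f_f) (auto simp: bij_betw_def intro: inj_on_subset)
      ultimately show ?thesis using t(2) by simp
    qed
    ultimately show "bij_betw (M U D) (Gam U D) (hcomp F U (\<delta> D))" by (simp cong: bij_betw_cong)
    fix x assume x: "x \<in> Gam U D"
    interpret FU: graded K "sec F U" "hcomp F U" using graded_sheafD(1)[OF F U(1)] by unfold_locales
    note px = \<pi>c[OF U D x]
    show "M U D (x \<oplus>\<^bsub>FA\<^esub> y) = M U D x \<oplus>\<^bsub>sec F U\<^esub> M U D y" if y: "y \<in> Gam U D" for y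
    proof -
      note py = \<pi>c[OF U D y]
      have "\<phi> U (M U D x \<oplus>\<^bsub>sec F U\<^esub> M U D y) = \<pi> U (single U D x) \<oplus>\<^bsub>sec F' U\<^esub> \<pi> U (single U D y)"
        unfolding M_def using ring_hom_add[OF hom\<phi>(1)[OF U(1)]] jc[OF U(1) px] jc[OF U(1) py] by simp
      also have "\<dots> = \<pi> U (single U D (x \<oplus>\<^bsub>FA\<^esub> y))"
        using ring_hom_add[OF hom\<pi>[OF U(1)] single_carrier[OF U D x] single_carrier[OF U D y]] by (simp add: single_add)
      finally show ?thesis unfolding M_def using jI[OF U(1)] jc(1)[OF U(1) px] jc(1)[OF U(1) py] by blast
    qed
    show "M U (D + E) (x \<otimes>\<^bsub>FA\<^esub> y) = M U D x \<otimes>\<^bsub>sec F U\<^esub> M U E y" if E: "E \<in> W" and y: "y \<in> Gam U E" for E y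
    proof -
      note py = \<pi>c[OF U E y]
      have "\<phi> U (M U D x \<otimes>\<^bsub>sec F U\<^esub> M U E y) = \<pi> U (single U D x) \<otimes>\<^bsub>sec F' U\<^esub> \<pi> U (single U E y)"
        unfolding M_def using ring_hom_mult[OF hom\<phi>(1)[OF U(1)]] jc[OF U(1) px] jc[OF U(1) py] by simp
      also have "\<dots> = \<pi> U (single U (D + E) (x \<otimes>\<^bsub>FA\<^esub> y))"
        using ring_hom_mult[OF hom\<pi>[OF U(1)] single_carrier[OF U D x] single_carrier[OF U E y]]
          single_mult[OF U Gam_closed[OF x] Gam_closed[OF y]] by simp
      finally show ?thesis unfolding M_def using jI[OF U(1)] jc(1)[OF U(1) px] jc(1)[OF U(1) py] by blast
    qed
    show "res F U U' (M U D x) = M U' D x" if U': "openin (Spec A) U'" "U' \<noteq> {}" "U' \<subseteq> U" for U'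
    proof -
      have c: "res F U U' (M U D x) \<in> carrier (sec F U')"
        using ring_hom_closed[OF graded_sheafD(2)[OF F U(1) U'(1,3)]] jc(1)[OF U(1) px] by (simp add: M_def)
      have "\<phi> U' (res F U U' (M U D x)) = res F' U U' (\<pi> U (single U D x))"
        using res\<phi>[OF U(1) U'(1,3) jc(1)[OF U(1) px]] jc(2)[OF U(1) px] by (simp add: M_def)
      also have "\<dots> = \<pi> U' (single U' D x)"
        using res\<pi>[OF U(1) U'(1,3) single_carrier[OF U D x]] restrict_single[OF U'(3)] by simp
      finally show ?thesis using jI[OF U'(1) c] by (simp add: M_def)
    qed
  next
    fix U assume U: "openin (Spec A) U" "U \<noteq> {}"
    interpret FU: graded K "sec F U" "hcomp F U" using graded_sheafD(1)[OF F U(1)] by unfold_locales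
    have "\<pi> U (single U 0 \<one>\<^bsub>FA\<^esub>) = \<one>\<^bsub>sec F' U\<^esub>" using ring_hom_one[OF hom\<pi>[OF U(1)]] by (simp add: single_one)
    moreover have "\<phi> U \<one>\<^bsub>sec F U\<^esub> = \<one>\<^bsub>sec F' U\<^esub>" using ring_hom_one[OF hom\<phi>(1)[OF U(1)]] .
    ultimately show "M U 0 \<one>\<^bsub>FA\<^esub> = \<one>\<^bsub>sec F U\<^esub>" unfolding M_def using jI[OF U(1)] by simp
  qed
qed

context cox
begin

section \<open>From the maps on sections to a Cox sheaf\<close>

sublocale K: comm_group K by (rule K)

lemma M_comp: "\<lbrakk>openin (Spec A) U; U \<noteq> {}; D \<in> W; x \<in> Gam U D\<rbrakk> \<Longrightarrow> M U D x \<in> hcomp F U (\<delta> D)"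
  using bij_betwE[OF M_bij] by blast

lemma graded_sec: "openin (Spec A) U \<Longrightarrow> graded K (sec F U) (hcomp F U)"
  using graded_sheafD(1)[OF F] by unfold_locales

lemma M_closed: "\<lbrakk>openin (Spec A) U; U \<noteq> {}; D \<in> W; x \<in> Gam U D\<rbrakk> \<Longrightarrow> M U D x \<in> carrier (sec F U)"
  using graded.comp_closed[OF graded_sec M_comp deg_closed] by blast

lemma M_surj:
  assumes "openin (Spec A) U" "U \<noteq> {}" "D \<in> W" "s \<in> hcomp F U (\<delta> D)"
  obtains x where "x \<in> Gam U D" "s = M U D x"
  using assms M_bij[OF assms(1-3)] by (auto simp: bij_betw_def)

lemma M_inj: "\<lbrakk>openin (Spec A) U; U \<noteq> {}; D \<in> W; x \<in> Gam U D; y \<in> Gam U D; M U D x = M U D y\<rbrakk> \<Longrightarrow> x = y"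
  using bij_betw_imp_inj_on[OF M_bij] by (meson inj_onD)

lemma M_zero:
  assumes "openin (Spec A) U" "U \<noteq> {}" "D \<in> W"
  shows "M U D \<zero>\<^bsub>FA\<^esub> = \<zero>\<^bsub>sec F U\<^esub>"
proof -
  interpret FU: graded K "sec F U" "hcomp F U" by (rule graded_sec[OF assms(1)])
  have c: "M U D \<zero>\<^bsub>FA\<^esub> \<in> carrier (sec F U)" using M_closed[OF assms Gam_zero] .
  have "M U D \<zero>\<^bsub>FA\<^esub> \<oplus>\<^bsub>sec F U\<^esub> M U D \<zero>\<^bsub>FA\<^esub> = M U D \<zero>\<^bsub>FA\<^esub>"
    using M_add[OF assms Gam_zero Gam_zero] by simp
  then show ?thesis using c by (simp add: FU.add.l_cancel_one)
qed

lemma M_eq_zero_iff: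
  "\<lbrakk>openin (Spec A) U; U \<noteq> {}; D \<in> W; x \<in> Gam U D\<rbrakk> \<Longrightarrow> M U D x = \<zero>\<^bsub>sec F U\<^esub> \<longleftrightarrow> x = \<zero>\<^bsub>FA\<^esub>"
  using M_zero M_inj[OF _ _ _ _ Gam_zero] by metis

text \<open>Recovers the coefficient in degree \<open>D\<close> as an element of the function field
  by evaluation at the generic point.\<close>

definition sval :: "('a divisor \<Rightarrow> 'a set \<Rightarrow> ('a \<times> 'a) set) \<Rightarrow> 'a divisor \<Rightarrow> ('a \<times> 'a) set" where
  "sval s D = s D {\<zero>}"

lemma sval:
  assumes U: "openin (Spec A) U" "U \<noteq> {}" and s: "s \<in> carrier (sec DS U)"
  shows "s D = cst U (sval s D)" "D \<in> W \<Longrightarrow> sval s D \<in> Gam U D" "s D = \<zero>\<^bsub>RU U\<^esub> \<longleftrightarrow> sval s D = \<zero>\<^bsub>FA\<^esub>"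
    "sval s D \<in> carrier FA"
proof -
  have z: "{\<zero>} \<in> U" using open_generic[OF U] .
  have v: "sval s D = x" if "s D = cst U x" for x using that z by (simp add: sval_def cst_def)
  show 1: "s D = cst U (sval s D)"
  proof (cases "D \<in> W")
    case True
    then have "s D \<in> cst U ` Gam U D"
      using conjunct1[OF s[unfolded DS_carrier]] divisor_sections_eq[OF U True] by blast
    then obtain x where "s D = cst U x" by blast
    then show ?thesis using v by simp
  next
    case False
    then have "s D = cst U \<zero>\<^bsub>FA\<^esub>" using s by (simp add: DS_carrier cst_ops)
    then show ?thesis using v by simp
  qed
  show "sval s D \<in> Gam U D" if "D \<in> W"
  proof -
    have "s D \<in> cst U ` Gam U D"
      using conjunct1[OF s[unfolded DS_carrier]] divisor_sections_eq[OF U that] that by blast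
    then show ?thesis using v by auto
  qed
  show "s D = \<zero>\<^bsub>RU U\<^esub> \<longleftrightarrow> sval s D = \<zero>\<^bsub>FA\<^esub>" using 1 cst_inj[OF U(2)] by (metis cst_ops(4))
  then show "sval s D \<in> carrier FA"
    using \<open>D \<in> W \<Longrightarrow> sval s D \<in> Gam U D\<close> s Gam_closed by (cases "D \<in> W") (auto simp: DS_carrier)
qed

text \<open>The additive extension of the maps \<open>M U D\<close> to finite sums. Over the empty
  set there is no point at which to evaluate, but the target has a single section.\<close>

definition coxmap :: "'a set set \<Rightarrow> ('a divisor \<Rightarrow> 'a set \<Rightarrow> ('a \<times> 'a) set) \<Rightarrow> 's" where
  "coxmap U s = (if U = {} then \<zero>\<^bsub>sec F U\<^esub>
     else \<Oplus>\<^bsub>sec F U\<^esub>D\<in>{D. s D \<noteq> \<zero>\<^bsub>RU U\<^esub>}. M U D (sval s D))"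

lemma coxmap_sum:
  assumes U: "openin (Spec A) U" "U \<noteq> {}" and s: "s \<in> carrier (sec DS U)"
    and B: "finite B" "B \<subseteq> W" "{D. s D \<noteq> \<zero>\<^bsub>RU U\<^esub>} \<subseteq> B"
  shows "coxmap U s = (\<Oplus>\<^bsub>sec F U\<^esub>D\<in>B. M U D (sval s D))"
proof -
  interpret FU: graded K "sec F U" "hcomp F U" by (rule graded_sec[OF U(1)])
  have c: "M U D (sval s D) \<in> carrier (sec F U)" if "D \<in> B" for D
    using M_closed[OF U _ sval(2)[OF U s]] that B(2) by blast
  have z: "M U D (sval s D) = \<zero>\<^bsub>sec F U\<^esub>" if "D \<in> B - {D. s D \<noteq> \<zero>\<^bsub>RU U\<^esub>}" for D
    using that sval(3)[OF U s, of D] M_zero[OF U] B(2) by auto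
  have "(\<Oplus>\<^bsub>sec F U\<^esub>D\<in>{D. s D \<noteq> \<zero>\<^bsub>RU U\<^esub>}. M U D (sval s D)) = (\<Oplus>\<^bsub>sec F U\<^esub>D\<in>B. M U D (sval s D))"
    using c z B by (intro FU.add.finprod_mono_neutral_cong_left) auto
  then show ?thesis using U by (simp add: coxmap_def)
qed

lemma supp_DS: "s \<in> carrier (sec DS U) \<Longrightarrow> finite {D. s D \<noteq> \<zero>\<^bsub>RU U\<^esub>} \<and> {D. s D \<noteq> \<zero>\<^bsub>RU U\<^esub>} \<subseteq> W"
  by (auto simp: DS_carrier)

lemma coxmap_empty: "coxmap {} s = \<zero>\<^bsub>sec F {}\<^esub>"
  by (simp add: coxmap_def)

lemma coxmap_closed:
  assumes U: "openin (Spec A) U" and s: "s \<in> carrier (sec DS U)"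
  shows "coxmap U s \<in> carrier (sec F U)"
proof (cases "U = {}")
  case True
  then show ?thesis using graded_sec[OF U] by (simp add: coxmap_def graded_def graded_ring_def cring.cring_simprules(2))
next
  case False
  interpret FU: graded K "sec F U" "hcomp F U" by (rule graded_sec[OF U])
  have "M U D (sval s D) \<in> carrier (sec F U)" if "s D \<noteq> \<zero>\<^bsub>RU U\<^esub>" for D
    using M_closed[OF U False _ sval(2)[OF U False s]] that supp_DS[OF s] by blast
  then show ?thesis using False by (auto simp: coxmap_def intro!: FU.finsum_closed)
qed

text \<open>For sums, both supports are enlarged to their union. A product is a convolution, hence
  gives a double sum over degrees; interchanging the sums and shifting the index of the inner one
  splits it into the product of the images.\<close>

lemma coxmap_hom:
  assumes U: "openin (Spec A) U"
  shows "coxmap U \<in> ring_hom (sec DS U) (sec F U)"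
proof (cases "U = {}")
  case True
  interpret FU: graded K "sec F U" "hcomp F U" by (rule graded_sec[OF U])
  have eq: "x = y" if "x \<in> carrier (sec F U)" "y \<in> carrier (sec F U)" for x y
    using graded_sheaf_empty[OF F] that True by blast
  have cz: "coxmap U s = \<zero>\<^bsub>sec F U\<^esub>" for s by (simp add: coxmap_def True)
  show ?thesis by (intro ring_hom_memI; (rule eq)?; simp add: cz)
next
  case U': False
  interpret FU: graded K "sec F U" "hcomp F U" by (rule graded_sec[OF U])
  interpret RU: ring "RU U" by (rule ring_rational_functions[OF U])
  show ?thesis
  proof (rule ring_hom_memI)
    fix s assume s: "s \<in> carrier (sec DS U)"
    show "coxmap U s \<in> carrier (sec F U)" by (rule coxmap_closed[OF U s])
    let ?S = "{D. s D \<noteq> \<zero>\<^bsub>RU U\<^esub>}"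
    note S = supp_DS[OF s]
    note vs = sval[OF U U' s]
    fix t assume t: "t \<in> carrier (sec DS U)"
    let ?T = "{D. t D \<noteq> \<zero>\<^bsub>RU U\<^esub>}"
    note T = supp_DS[OF t]
    note vt = sval[OF U U' t]
    have Ms: "M U D (sval s D) \<in> carrier (sec F U)" if "D \<in> W" for D using M_closed[OF U U' that vs(2)[OF that]] .
    have Mt: "M U D (sval t D) \<in> carrier (sec F U)" if "D \<in> W" for D using M_closed[OF U U' that vt(2)[OF that]] .
    have DSI: "r \<in> carrier (sec DS U) \<and> (\<forall>D. sval r D = v D)"
      if "\<And>D. r D = cst U (v D)" "\<And>D. D \<in> W \<Longrightarrow> v D \<in> Gam U D" "finite {D. v D \<noteq> \<zero>\<^bsub>FA\<^esub>}" "\<And>D. D \<notin> W \<Longrightarrow> v D = \<zero>\<^bsub>FA\<^esub>" for r v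
    proof -
      have "sval r D = v D" for D using that(1) open_generic[OF U U'] by (simp add: sval_def cst_def)
      moreover have "{D. r D \<noteq> \<zero>\<^bsub>RU U\<^esub>} = {D. v D \<noteq> \<zero>\<^bsub>FA\<^esub>}" using that(1) cst_inj[OF U'] by (auto simp: cst_ops)
      ultimately show ?thesis using that divisor_sections_eq[OF U U'] by (auto simp: DS_carrier cst_ops)
    qed
    show "coxmap U (s \<oplus>\<^bsub>sec DS U\<^esub> t) = coxmap U s \<oplus>\<^bsub>sec F U\<^esub> coxmap U t"
    proof -
      let ?r = "s \<oplus>\<^bsub>sec DS U\<^esub> t" and ?v = "\<lambda>D. sval s D \<oplus>\<^bsub>FA\<^esub> sval t D"
      have z: "?v D = \<zero>\<^bsub>FA\<^esub>" if "D \<notin> ?S \<union> ?T" for D using that vs(3)[of D] vt(3)[of D] by simp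
      have fin: "finite (?S \<union> ?T)" "?S \<union> ?T \<subseteq> W" using S T by auto
      have r: "?r \<in> carrier (sec DS U) \<and> (\<forall>D. sval ?r D = ?v D)"
      proof (rule DSI)
        show "?r D = cst U (?v D)" for D using vs(1)[of D] vt(1)[of D] by (simp add: DS_add cst_ops[symmetric])
        show "?v D \<in> Gam U D" if "D \<in> W" for D using Gam_add[OF vs(2)[OF that] vt(2)[OF that]] .
        show "finite {D. ?v D \<noteq> \<zero>\<^bsub>FA\<^esub>}" by (rule finite_subset[OF _ fin(1)]) (use z in blast)
        show "?v D = \<zero>\<^bsub>FA\<^esub>" if "D \<notin> W" for D using z that fin(2) by blast
      qed
      have sub: "{D. ?r D \<noteq> \<zero>\<^bsub>RU U\<^esub>} \<subseteq> ?S \<union> ?T"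
      proof
        fix D assume "D \<in> {D. ?r D \<noteq> \<zero>\<^bsub>RU U\<^esub>}"
        then have "?v D \<noteq> \<zero>\<^bsub>FA\<^esub>" using sval(3)[OF U U' conjunct1[OF r], of D] r by simp
        then show "D \<in> ?S \<union> ?T" using z by blast
      qed
      have "coxmap U ?r = (\<Oplus>\<^bsub>sec F U\<^esub>D\<in>?S \<union> ?T. M U D (?v D))"
        using coxmap_sum[OF U U' conjunct1[OF r] fin sub] r by simp
      also have "\<dots> = (\<Oplus>\<^bsub>sec F U\<^esub>D\<in>?S \<union> ?T. M U D (sval s D) \<oplus>\<^bsub>sec F U\<^esub> M U D (sval t D))"
        using fin(2) Ms Mt M_add[OF U U' _ vs(2) vt(2)] by (intro FU.finsum_cong') (auto simp: subset_iff)
      also have "\<dots> = coxmap U s \<oplus>\<^bsub>sec F U\<^esub> coxmap U t"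
        using coxmap_sum[OF U U' s fin] coxmap_sum[OF U U' t fin] fin(2) Ms Mt
        by (subst FU.finsum_addf) (auto simp: subset_iff)
      finally show ?thesis .
    qed
    show "coxmap U (s \<otimes>\<^bsub>sec DS U\<^esub> t) = coxmap U s \<otimes>\<^bsub>sec F U\<^esub> coxmap U t"
    proof -
      let ?r = "s \<otimes>\<^bsub>sec DS U\<^esub> t" and ?v = "\<lambda>D. \<Oplus>\<^bsub>FA\<^esub>E\<in>?S. sval s E \<otimes>\<^bsub>FA\<^esub> sval t (D - E)"
      \<comment> \<open>A finite set of degrees outside which the convolution vanishes: the sums of
        a degree of \<open>s\<close> and a degree of \<open>t\<close>.\<close>
      define B where "B = (\<lambda>(D, E). D + E) ` (?S \<times> ?T)"
      have "D + E \<in> W" if "D \<in> ?S" "E \<in> ?T" for D E using W_add that S T by blast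
      then have B: "finite B" "B \<subseteq> W"
        using S T unfolding B_def image_subset_iff by (simp, force)
      have tz: "sval t (D - E) = \<zero>\<^bsub>FA\<^esub>" if "D \<notin> B" "E \<in> ?S" for D E
      proof (rule ccontr)
        assume "sval t (D - E) \<noteq> \<zero>\<^bsub>FA\<^esub>"
        then have "D - E \<in> ?T" using vt(3) by simp
        then have "(\<lambda>(D, E). D + E) (E, D - E) \<in> B" unfolding B_def using that(2) by blast
        then show False using that(1) by simp
      qed
      have vc: "?v D \<in> carrier FA" for D using vs(4) vt(4) by (intro FA.finsum_closed) auto
      have z: "?v D = \<zero>\<^bsub>FA\<^esub>" if "D \<notin> B" for D
      proof -
        have "?v D = (\<Oplus>\<^bsub>FA\<^esub>E\<in>?S. \<zero>\<^bsub>FA\<^esub>)" using tz[OF that] vs(4) by (intro FA.finsum_cong') auto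
        then show ?thesis by simp
      qed
      have tW: "sval t (D - E) \<in> Gam U (D - E)" if "E \<in> ?S" "D \<in> W" for D E
        using vt(2) W_diff that S by blast
      have prod: "sval s E \<otimes>\<^bsub>FA\<^esub> sval t (D - E) \<in> Gam U D" if "E \<in> ?S" "D \<in> W" for D E
        using Gam_mult[OF vs(2)[of E] tW[OF that]] that S by auto
      have Gsum: "(\<Oplus>\<^bsub>FA\<^esub>E\<in>S'. g E) \<in> Gam U D \<and> M U D (\<Oplus>\<^bsub>FA\<^esub>E\<in>S'. g E) = (\<Oplus>\<^bsub>sec F U\<^esub>E\<in>S'. M U D (g E))"
        if "finite S'" "\<And>E. E \<in> S' \<Longrightarrow> g E \<in> Gam U D" "D \<in> W" for S' g and D :: "'a divisor"
        using that(1,2)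
      proof (induction S' rule: finite_induct)
        case empty
        then show ?case using Gam_zero M_zero[OF U U' that(3)] by simp
      next
        case (insert E S')
        have "g E' \<in> carrier FA" "M U D (g E') \<in> carrier (sec F U)" if "E' \<in> insert E S'" for E'
          using insert.prems[OF that] Gam_closed M_closed[OF U U' \<open>D \<in> W\<close>] by blast+
        then show ?case using insert Gam_add M_add[OF U U' \<open>D \<in> W\<close>] by (simp add: Pi_def)
      qed
      have r: "?r \<in> carrier (sec DS U) \<and> (\<forall>D. sval ?r D = ?v D)"
      proof (rule DSI)
        show "?r D = cst U (?v D)" for D
        proof -
          have "?r D = (\<Oplus>\<^bsub>RU U\<^esub>E\<in>?S. cst U (sval s E \<otimes>\<^bsub>FA\<^esub> sval t (D - E)))"
          proof -
            have "s E \<otimes>\<^bsub>RU U\<^esub> t (D - E) = cst U (sval s E \<otimes>\<^bsub>FA\<^esub> sval t (D - E))" for E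
              using vs(1)[of E] vt(1)[of "D - E"] cst_ops(1)[of U "sval s E" "sval t (D - E)"] by simp
            moreover have "cst U (sval s E \<otimes>\<^bsub>FA\<^esub> sval t (D - E)) \<in> carrier (RU U)" for E
              using vs(4) vt(4) rational_functions_carrier[OF U] by blast
            ultimately show ?thesis unfolding DS_mult by (intro RU.finsum_cong') auto
          qed
          also have "\<dots> = cst U (?v D)" using S vs(4) vt(4) by (intro finsum_cst[OF U]) auto
          finally show ?thesis .
        qed
        show "?v D \<in> Gam U D" if "D \<in> W" for D using Gsum[OF conjunct1[OF S] prod[OF _ that] that] by simp
        show "finite {D. ?v D \<noteq> \<zero>\<^bsub>FA\<^esub>}" by (rule finite_subset[OF _ B(1)]) (use z in blast)
        show "?v D = \<zero>\<^bsub>FA\<^esub>" if "D \<notin> W" for D using z that B(2) by blast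
      qed
      have sub: "{D. ?r D \<noteq> \<zero>\<^bsub>RU U\<^esub>} \<subseteq> B"
      proof
        fix D assume "D \<in> {D. ?r D \<noteq> \<zero>\<^bsub>RU U\<^esub>}"
        then have "?v D \<noteq> \<zero>\<^bsub>FA\<^esub>" using sval(3)[OF U U' conjunct1[OF r], of D] r by simp
        then show "D \<in> B" using z by blast
      qed
      have Mtd: "M U (D - E) (sval t (D - E)) \<in> carrier (sec F U)" if "E \<in> ?S" "D \<in> W" for D E
        using M_closed[OF U U' _ tW[OF that]] W_diff that S by blast
      have term_eq: "M U D (sval s E \<otimes>\<^bsub>FA\<^esub> sval t (D - E)) = M U E (sval s E) \<otimes>\<^bsub>sec F U\<^esub> M U (D - E) (sval t (D - E))"
        if "E \<in> ?S" "D \<in> W" for D E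
      proof -
        have E: "E \<in> W" using that S by blast
        show ?thesis using M_mult[OF U U' E W_diff[OF that(2) E] vs(2)[OF E] tW[OF that]] by simp
      qed
      \<comment> \<open>Shifting \<open>B\<close> by \<open>E\<close> yields a set that contains the
        support of \<open>t\<close>, so the inner sum does not depend on \<open>E\<close>.\<close>
      have inner: "(\<Oplus>\<^bsub>sec F U\<^esub>D\<in>B. M U (D - E) (sval t (D - E))) = coxmap U t" if E: "E \<in> ?S" for E
      proof -
        let ?B = "(\<lambda>D. D - E) ` B"
        have EW: "E \<in> W" using E S by blast
        have "?T \<subseteq> ?B"
        proof
          fix D assume "D \<in> ?T"
          then have "E + D \<in> B" using E unfolding B_def by force
          then show "D \<in> ?B" by (intro image_eqI[of _ _ "E + D"]) auto
        qed
        moreover have "?B \<subseteq> W" using B(2) EW W_diff by blast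
        ultimately have "coxmap U t = (\<Oplus>\<^bsub>sec F U\<^esub>D\<in>?B. M U D (sval t D))"
          using coxmap_sum[OF U U' t] B(1) by blast
        also have "\<dots> = (\<Oplus>\<^bsub>sec F U\<^esub>D\<in>B. M U (D - E) (sval t (D - E)))"
          using Mt \<open>?B \<subseteq> W\<close> by (intro FU.finsum_reindex) (auto simp: inj_on_def)
        finally show ?thesis by simp
      qed
      have "coxmap U ?r = (\<Oplus>\<^bsub>sec F U\<^esub>D\<in>B. M U D (?v D))"
        using coxmap_sum[OF U U' conjunct1[OF r] B sub] r by simp
      also have "\<dots> = (\<Oplus>\<^bsub>sec F U\<^esub>D\<in>B. \<Oplus>\<^bsub>sec F U\<^esub>E\<in>?S. M U E (sval s E) \<otimes>\<^bsub>sec F U\<^esub> M U (D - E) (sval t (D - E)))"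
      proof (rule FU.finsum_cong')
        show "M U D (?v D) = (\<Oplus>\<^bsub>sec F U\<^esub>E\<in>?S. M U E (sval s E) \<otimes>\<^bsub>sec F U\<^esub> M U (D - E) (sval t (D - E)))"
          if D: "D \<in> B" for D
        proof -
          have DW: "D \<in> W" using D B(2) by blast
          have "M U D (?v D) = (\<Oplus>\<^bsub>sec F U\<^esub>E\<in>?S. M U D (sval s E \<otimes>\<^bsub>FA\<^esub> sval t (D - E)))"
            using Gsum[OF conjunct1[OF S] prod[OF _ DW] DW] by simp
          also have "\<dots> = (\<Oplus>\<^bsub>sec F U\<^esub>E\<in>?S. M U E (sval s E) \<otimes>\<^bsub>sec F U\<^esub> M U (D - E) (sval t (D - E)))"
            using term_eq[OF _ DW] Ms Mtd[OF _ DW] S by (intro FU.finsum_cong') auto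
          finally show ?thesis .
        qed
        show "(\<lambda>D. \<Oplus>\<^bsub>sec F U\<^esub>E\<in>?S. M U E (sval s E) \<otimes>\<^bsub>sec F U\<^esub> M U (D - E) (sval t (D - E))) \<in> B \<rightarrow> carrier (sec F U)"
          using Ms Mtd S B(2) by (intro Pi_I FU.finsum_closed) (auto simp: subset_iff)
      qed simp
      also have "\<dots> = (\<Oplus>\<^bsub>sec F U\<^esub>E\<in>?S. \<Oplus>\<^bsub>sec F U\<^esub>D\<in>B. M U E (sval s E) \<otimes>\<^bsub>sec F U\<^esub> M U (D - E) (sval t (D - E)))"
        using S B Ms Mtd by (intro FU.finsum_swap) (auto simp: subset_iff)
      also have "\<dots> = (\<Oplus>\<^bsub>sec F U\<^esub>E\<in>?S. M U E (sval s E) \<otimes>\<^bsub>sec F U\<^esub> coxmap U t)"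
      proof (rule FU.finsum_cong')
        fix E assume E: "E \<in> ?S"
        then have EW: "E \<in> W" using S by blast
        have "(\<Oplus>\<^bsub>sec F U\<^esub>D\<in>B. M U E (sval s E) \<otimes>\<^bsub>sec F U\<^esub> M U (D - E) (sval t (D - E)))
            = M U E (sval s E) \<otimes>\<^bsub>sec F U\<^esub> (\<Oplus>\<^bsub>sec F U\<^esub>D\<in>B. M U (D - E) (sval t (D - E)))"
          using B Ms[OF EW] Mtd[OF E] by (intro FU.finsum_rdistr[symmetric]) (auto simp: subset_iff)
        then show "(\<Oplus>\<^bsub>sec F U\<^esub>D\<in>B. M U E (sval s E) \<otimes>\<^bsub>sec F U\<^esub> M U (D - E) (sval t (D - E)))
            = M U E (sval s E) \<otimes>\<^bsub>sec F U\<^esub> coxmap U t" using inner[OF E] by simp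
      qed (use Ms S coxmap_closed[OF U t] in auto)
      also have "\<dots> = coxmap U s \<otimes>\<^bsub>sec F U\<^esub> coxmap U t"
        unfolding coxmap_sum[OF U U' s conjunct1[OF S] conjunct2[OF S] order_refl]
        using Ms coxmap_closed[OF U t] S by (intro FU.finsum_ldistr[symmetric]) auto
      finally show ?thesis .
    qed
  next
    have one: "\<one>\<^bsub>FA\<^esub> \<in> Gam U 0" using one_QZ by (intro GamI) (auto simp: val_one)
    have s1: "\<one>\<^bsub>sec DS U\<^esub> \<in> carrier (sec DS U)" unfolding single_one by (rule single_carrier[OF U U' _ one]) simp
    have "coxmap U \<one>\<^bsub>sec DS U\<^esub> = (\<Oplus>\<^bsub>sec F U\<^esub>D\<in>{0}. M U D (sval \<one>\<^bsub>sec DS U\<^esub> D))"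
      by (rule coxmap_sum[OF U U' s1]) (auto simp: DS_one)
    also have "\<dots> = M U 0 \<one>\<^bsub>FA\<^esub>"
    proof -
      have "sval \<one>\<^bsub>sec DS U\<^esub> 0 = \<one>\<^bsub>FA\<^esub>" using open_generic[OF U U'] by (simp add: sval_def DS_one cst_ops cst_def)
      then show ?thesis using M_closed[OF U U' _ one] by simp
    qed
    finally show "coxmap U \<one>\<^bsub>sec DS U\<^esub> = \<one>\<^bsub>sec F U\<^esub>" using M_one[OF U U'] by simp
  qed
qed

lemma coxmap_single:
  assumes U: "openin (Spec A) U" "U \<noteq> {}" and D: "D \<in> W" and x: "x \<in> Gam U D"
  shows "coxmap U (single U D x) = M U D x"
proof -
  interpret FU: graded K "sec F U" "hcomp F U" by (rule graded_sec[OF U(1)])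
  have "coxmap U (single U D x) = (\<Oplus>\<^bsub>sec F U\<^esub>E\<in>{D}. M U E (sval (single U D x) E))"
    by (rule coxmap_sum[OF U single_carrier[OF U D x]]) (use D in \<open>auto simp: single_def\<close>)
  moreover have "sval (single U D x) D = x" using open_generic[OF U] by (simp add: sval_def single_def cst_def)
  ultimately show ?thesis using M_closed[OF U D x] by simp
qed

lemma coxmap_bij:
  assumes U: "openin (Spec A) U" and D: "D \<in> W"
  shows "bij_betw (coxmap U) (hcomp DS U D) (hcomp F U (\<delta> D))"
proof (cases "U = {}")
  case True
  interpret FU: graded K "sec F U" "hcomp F U" by (rule graded_sec[OF U])
  have z: "x = \<zero>\<^bsub>sec F U\<^esub>" if "x \<in> carrier (sec F U)" for x
    using graded_sheaf_empty[OF F] that True FU.zero_closed by blast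
  have "hcomp F U (\<delta> D) = {\<zero>\<^bsub>sec F U\<^esub>}"
    using z FU.comp_closed[OF _ deg_closed[OF D]] FU.comp_zero[OF deg_closed[OF D]] by blast
  moreover have "hcomp DS U D = {\<lambda>E. \<zero>\<^bsub>RU U\<^esub>}"
  proof -
    have rz: "f = \<zero>\<^bsub>RU U\<^esub>" if "f \<in> carrier (RU U)" for f
      using that rational_functions_carrier[OF U] True by (auto simp: cst_ops cst_def)
    have "s = (\<lambda>E. \<zero>\<^bsub>RU U\<^esub>)" if "s \<in> hcomp DS U D" for s
    proof
      fix E show "s E = \<zero>\<^bsub>RU U\<^esub>" using that rz D by (cases "E = D") (auto simp: DS_hcomp DS_carrier divisor_sections_def)
    qed
    moreover have "\<zero>\<^bsub>RU U\<^esub> \<in> carrier (RU U)" using rational_functions_carrier[OF U] by (auto simp: cst_ops)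
    then have "(\<lambda>E. \<zero>\<^bsub>RU U\<^esub>) \<in> hcomp DS U D" by (auto simp: DS_hcomp DS_carrier divisor_sections_def)
    ultimately show ?thesis by blast
  qed
  ultimately show ?thesis using True coxmap_empty by (simp add: bij_betw_def)
next
  case False
  have eq: "(coxmap U \<circ> single U D) x = M U D x" if "x \<in> Gam U D" for x using coxmap_single[OF U False D that] by simp
  have "bij_betw (coxmap U \<circ> single U D) (Gam U D) (hcomp F U (\<delta> D))"
    using M_bij[OF U False D] eq by (simp cong: bij_betw_cong)
  then show ?thesis by (simp add: bij_betw_comp_iff[OF hcomp_DS[OF U False D]])
qed

lemma coxmap_res:
  assumes U: "openin (Spec A) U" and U': "openin (Spec A) U'" "U' \<subseteq> U" and s: "s \<in> carrier (sec DS U)"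
  shows "coxmap U' (res DS U U' s) = res F U U' (coxmap U s)"
proof (cases "U' = {}")
  case True
  interpret FU: graded K "sec F U'" "hcomp F U'" by (rule graded_sec[OF U'(1)])
  have "res F U U' (coxmap U s) \<in> carrier (sec F U')"
    using ring_hom_closed[OF graded_sheafD(2)[OF F U U']] coxmap_closed[OF U s] by blast
  then show ?thesis
    using graded_sheaf_empty[OF F] True coxmap_empty FU.zero_closed by metis
next
  case ne': False
  then have ne: "U \<noteq> {}" using U'(2) by blast
  interpret FU: graded K "sec F U" "hcomp F U" by (rule graded_sec[OF U])
  interpret FU': graded K "sec F U'" "hcomp F U'" by (rule graded_sec[OF U'(1)])
  interpret r: ring_hom_cring "sec F U" "sec F U'" "res F U U'"
    using graded_sheafD(2)[OF F U U'] FU.is_cring FU'.is_cring by (simp add: ring_hom_cring_def ring_hom_cring_axioms_def)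
  let ?S = "{D. s D \<noteq> \<zero>\<^bsub>RU U\<^esub>}" and ?r = "res DS U U' s"
  note S = supp_DS[OF s]
  note vs = sval[OF U ne s]
  have rD: "?r D = cst U' (sval s D)" for D using vs(1)[of D] restrict_cst[OF U'(2)] by (simp add: DS_res)
  have rv: "sval ?r D = sval s D" for D using rD[of D] open_generic[OF U'(1) ne'] by (simp add: sval_def cst_def)
  have supp: "{D. ?r D \<noteq> \<zero>\<^bsub>RU U'\<^esub>} = ?S"
    using rD vs(3) cst_inj[OF ne'] by (auto simp: cst_ops)
  have rc: "?r \<in> carrier (sec DS U')"
    unfolding DS_carrier supp using S rD vs(2) Gam_mono[OF _ U'(2)] divisor_sections_eq[OF U'(1) ne'] supp by blast
  have Mc: "M U D (sval s D) \<in> carrier (sec F U)" if "D \<in> W" for D using M_closed[OF U ne that vs(2)[OF that]] .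
  have "coxmap U' ?r = (\<Oplus>\<^bsub>sec F U'\<^esub>D\<in>?S. M U' D (sval s D))"
    using ne' supp rv by (simp add: coxmap_def)
  also have "\<dots> = (\<Oplus>\<^bsub>sec F U'\<^esub>D\<in>?S. res F U U' (M U D (sval s D)))"
    using S M_res[OF U ne U'(1) ne' U'(2) _ vs(2)] r.hom_closed[OF Mc] by (intro FU'.finsum_cong') auto
  also have "\<dots> = res F U U' (\<Oplus>\<^bsub>sec F U\<^esub>D\<in>?S. M U D (sval s D))"
    using Mc S by (subst r.hom_finsum) (auto simp: comp_def)
  also have "\<dots> = res F U U' (coxmap U s)" using ne by (simp add: coxmap_def)
  finally show ?thesis .
qed

text \<open>The isomorphism \<open>k\<close> from the class group to \<open>K\<close> is induced by
  \<open>\<delta>\<close>. Regrading \<open>F\<close> along \<open>k\<close> leaves its sections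
  unchanged, so the required isomorphism of sheaves is the identity on sections.\<close>

theorem Cox_sheaf: "Cox_sheaf A K F"
proof -
  interpret WD: comm_group WD by (rule comm_group_WD)
  have hom\<delta>: "\<delta> \<in> hom WD K" using deg_closed deg_add WD_simps by (auto simp: hom_def)
  interpret d: group_hom WD K \<delta> using hom\<delta> by unfold_locales
  have ker: "kernel WD K \<delta> = pdiv ` QZ"
    unfolding kernel_def WD_simps using deg_one_iff pdiv_W by blast
  have surj: "\<delta> ` carrier WD = carrier K" unfolding WD_simps using deg_closed deg_surj by blast
  define k where "k = (\<lambda>c. the_elem (\<delta> ` c))"
  have k: "k \<in> iso (Cl A) K"
    using d.FactGroup_iso_set[OF surj] unfolding ker k_def by (simp add: Cl_def principal_divisors_eq)
  have kcl: "k (divisor_class A D) = \<delta> D" if D: "D \<in> W" for D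
  proof -
    have "\<delta> ` divisor_class A D = {\<delta> D}"
    proof -
      have cls: "divisor_class A D = (\<lambda>h. h + D) ` (pdiv ` QZ)"
        unfolding divisor_class_def principal_divisors_eq r_coset_def WD_simps by blast
      have "\<delta> (h + D) = \<delta> D" if h: "h \<in> pdiv ` QZ" for h
      proof -
        have hW: "h \<in> W" using h pdiv_W by blast
        show ?thesis using deg_one_iff[OF hW] deg_add[OF hW D] h deg_closed[OF D] by simp
      qed
      then have "\<delta> ` divisor_class A D = (\<lambda>h. \<delta> D) ` (pdiv ` QZ)"
        unfolding cls image_image[of \<delta>] by (rule image_cong[OF refl])
      moreover have "pdiv ` QZ \<noteq> {}" using one_QZ by blast
      ultimately show ?thesis by (simp add: image_constant_conv)
    qed
    then show ?thesis by (simp add: k_def)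
  qed
  interpret Cl: comm_group "Cl A" by (rule Cl_facts(1))
  have kc: "k c \<in> carrier K" if "c \<in> carrier (Cl A)" for c using k that by (auto simp: iso_def hom_def)
  define \<kappa> where "\<kappa> = inv_into (carrier (Cl A)) k"
  have \<kappa>: "\<kappa> \<in> iso K (Cl A)" unfolding \<kappa>_def by (rule Cl.iso_set_sym[OF k])
  have k\<kappa>: "k (\<kappa> w) = w" if "w \<in> carrier K" for w
    using k that unfolding \<kappa>_def by (auto simp: iso_def bij_betw_def f_inv_into_f)
  define F' :: "('a set, 's, 'a divisor set) graded_presheaf"
    where "F' = \<lparr>sec = sec F, res = res F, hcomp = (\<lambda>U c. hcomp F U (k c))\<rparr>"
  have simps: "sec F' = sec F" "res F' = res F" "\<And>U c. hcomp F' U c = hcomp F U (k c)" by (simp_all add: F'_def)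
  have F'_sheaf: "graded_sheaf (Cl A) (Spec A) F'"
    unfolding graded_sheaf_def simps
  proof (intro conjI)
    show "\<forall>U. openin (Spec A) U \<longrightarrow> graded_ring (Cl A) (sec F U) (\<lambda>c. hcomp F U (k c))"
      using graded_ring_regrade[OF graded_sheafD(1)[OF F] Cl_facts(1) k] by blast
    show "\<forall>U U'. openin (Spec A) U \<longrightarrow> openin (Spec A) U' \<longrightarrow> U' \<subseteq> U \<longrightarrow> res F U U' \<in> ring_hom (sec F U) (sec F U') \<and>
        (\<forall>w\<in>carrier (Cl A). res F U U' ` hcomp F U (k w) \<subseteq> hcomp F U' (k w))"
      using graded_sheafD(2)[OF F] graded_sheafD(3)[OF F _ _ _ kc] by blast
    note d = conjunct2[OF conjunct2[OF F[unfolded graded_sheaf_def]]]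
    show "\<forall>U. openin (Spec A) U \<longrightarrow> (\<forall>s\<in>carrier (sec F U). res F U U s = s)" by (rule conjunct1[OF d])
    show "\<forall>U V W. openin (Spec A) U \<longrightarrow> openin (Spec A) V \<longrightarrow> openin (Spec A) W \<longrightarrow> W \<subseteq> V \<longrightarrow> V \<subseteq> U \<longrightarrow>
        (\<forall>s\<in>carrier (sec F U). res F V W (res F U V s) = res F U W s)" by (rule conjunct1[OF conjunct2[OF d]])
    show "\<forall>\<U> f. (\<forall>U\<in>\<U>. openin (Spec A) U \<and> f U \<in> carrier (sec F U)) \<longrightarrow>
        (\<forall>U\<in>\<U>. \<forall>V\<in>\<U>. res F U (U \<inter> V) (f U) = res F V (U \<inter> V) (f V)) \<longrightarrow>
        (\<exists>!s. s \<in> carrier (sec F (\<Union>\<U>)) \<and> (\<forall>U\<in>\<U>. res F (\<Union>\<U>) U s = f U))" by (rule conjunct2[OF conjunct2[OF d]])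
  qed
  have "graded_sheaf_hom WD (Cl A) (Spec A) DS F' (divisor_class A) coxmap"
  proof (rule graded_sheaf_homI)
    show "divisor_class A \<in> hom WD (Cl A)" using Cl_facts(2,3) WD_simps by (auto simp: hom_def)
    show "coxmap U s \<in> hcomp F' U (divisor_class A D)"
      if "openin (Spec A) U" "D \<in> carrier WD" "s \<in> hcomp DS U D" for U D s
      using bij_betwE[OF coxmap_bij[OF that(1)]] that(2,3) kcl[of D] unfolding simps WD_simps by auto
    show "coxmap U \<in> ring_hom (sec DS U) (sec F' U)" if "openin (Spec A) U" for U
      unfolding simps by (rule coxmap_hom[OF that])
    show "coxmap U' (res DS U U' s) = res F' U U' (coxmap U s)"
      if "openin (Spec A) U" "openin (Spec A) U'" "U' \<subseteq> U" "s \<in> carrier (sec DS U)" for U U' s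
      unfolding simps by (rule coxmap_res[OF that])
  qed
  moreover have "bij_betw (coxmap U) (hcomp DS U D) (hcomp F' U (divisor_class A D))"
    if "D \<in> W" "openin (Spec A) U" for D U using coxmap_bij[OF that(2,1)] kcl[OF that(1)] by (simp add: simps)
  ultimately have cl: "Cl_graded_Cox_sheaf A F'"
    unfolding Cl_graded_Cox_sheaf_def WD_simps using F'_sheaf by blast
  have "graded_sheaf_iso K (Cl A) (Spec A) F F' \<kappa> (\<lambda>U s. s)"
    unfolding graded_sheaf_iso_def graded_sheaf_hom_def simps
    using \<kappa> k\<kappa> by (auto simp: iso_def ring_hom_def bij_betw_def)
  then show ?thesis unfolding Cox_sheaf_def using cl by blast
qed

end

section \<open>The associated sheaf of a graded algebra\<close>

locale graded_alg = A: weighted_domain A V + graded_domain K R G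
  for A :: "('a, 'm) ring_scheme" and V
    and K :: "('k, 'n) monoid_scheme" and R :: "('r, 'l) ring_scheme" (structure) and G +
  fixes \<phi> :: "'a \<Rightarrow> 'r"
  assumes \<phi>_hom: "\<phi> \<in> ring_hom A R" and \<phi>_deg: "\<phi> ` carrier A \<subseteq> G \<one>\<^bsub>K\<^esub>" and \<phi>_inj: "inj_on \<phi> (carrier A)"
begin

sublocale \<phi>: ring_hom_cring A R \<phi>
  using \<phi>_hom A.is_cring is_cring by (simp add: ring_hom_cring_def ring_hom_cring_axioms_def)

lemma \<phi>_comp: "a \<in> carrier A \<Longrightarrow> \<phi> a \<in> G \<one>\<^bsub>K\<^esub>"
  using \<phi>_deg by blast

lemma \<phi>_eq_zero_iff: "a \<in> carrier A \<Longrightarrow> \<phi> a = \<zero> \<longleftrightarrow> a = \<zero>\<^bsub>A\<^esub>"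
  using \<phi>_inj \<phi>.hom_zero by (metis A.zero_closed inj_onD)

lemma \<phi>_homog: "\<lbrakk>a \<in> carrier A; a \<noteq> \<zero>\<^bsub>A\<^esub>\<rbrakk> \<Longrightarrow> \<phi> a \<in> H"
  using \<phi>_comp \<phi>_eq_zero_iff by (intro homogI[of "\<phi> a" "\<one>\<^bsub>K\<^esub>"]) auto

abbreviation S where "S p \<equiv> stalk_denoms A \<phi> p"

lemma prime_outside:
  assumes "primeideal p A" "f \<in> carrier A - p"
  shows "f \<noteq> \<zero>\<^bsub>A\<^esub>" "f \<in> carrier A" "\<phi> f \<in> H" "\<phi> f \<in> S p" "\<phi> f \<in> carrier R"
proof -
  interpret p: primeideal p A by fact
  show f: "f \<noteq> \<zero>\<^bsub>A\<^esub>" "f \<in> carrier A" using assms(2) p.zero_closed by auto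
  show "\<phi> f \<in> H" using \<phi>_homog f by blast
  show "\<phi> f \<in> S p" using assms(2) by (simp add: stalk_denoms_def)
  show "\<phi> f \<in> carrier R" using f by simp
qed

lemma S_cases:
  assumes "t \<in> S p"
  obtains f where "f \<in> carrier A - p" "t = \<phi> f"
  using assms by (auto simp: stalk_denoms_def)

lemma fractions_S:
  assumes p: "primeideal p A"
  shows "fractions R (S p)"
proof -
  interpret p: primeideal p A by fact
  show ?thesis
  proof (intro fractions.intro fractions_axioms.intro is_cring)
    show "S p \<subseteq> carrier R" by (auto simp: stalk_denoms_def)
    have "\<one>\<^bsub>A\<^esub> \<in> carrier A - p" using p.one_imp_carrier p.I_notcarr by auto
    then show "\<one> \<in> S p" unfolding stalk_denoms_def \<phi>.hom_one[symmetric] by (rule imageI)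
    fix s assume "s \<in> S p"
    then obtain f where f: "f \<in> carrier A - p" "s = \<phi> f" by (rule S_cases)
    show "a = \<zero>" if "a \<in> carrier R" "s \<otimes> a = \<zero>" for a
      using homog_integral[OF prime_outside(3)[OF p f(1)]] that f(2) by blast
    fix t assume "t \<in> S p"
    then obtain g where g: "g \<in> carrier A - p" "t = \<phi> g" by (rule S_cases)
    have "f \<otimes>\<^bsub>A\<^esub> g \<in> carrier A - p" using f(1) g(1) p.I_prime by auto
    moreover have "s \<otimes> t = \<phi> (f \<otimes>\<^bsub>A\<^esub> g)" using f g by simp
    ultimately show "s \<otimes> t \<in> S p" unfolding stalk_denoms_def by blast
  qed
qed

text \<open>A \<open>fraction\<close> is the set of all pairs representing it. Dropping the pairs
  with denominator outside \<open>S p\<close> turns an element of \<open>Q\<^sup>+(R)\<close> that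
  has a representation over \<open>S p\<close> into an element of the stalk at
  \<open>p\<close>.\<close>

definition germ :: "'a set \<Rightarrow> ('r \<times> 'r) set \<Rightarrow> ('r \<times> 'r) set" where
  "germ p z = z \<inter> (UNIV \<times> S p)"

lemma fraction_S_eq_germ:
  assumes p: "primeideal p A" and a: "a \<in> carrier R" and f: "f \<in> carrier A - p"
  shows "fraction R (S p) a (\<phi> f) = germ p (fr a (\<phi> f))"
proof -
  interpret Sp: fractions R "S p" by (rule fractions_S[OF p])
  have "S p \<subseteq> H" using prime_outside(3)[OF p] by (auto simp: stalk_denoms_def)
  then show ?thesis
    using Sp.mem_fraction_iff[OF a prime_outside(4)[OF p f]] Q.mem_fraction_iff[OF a prime_outside(3)[OF p f]]
    unfolding germ_def by auto
qed

lemma germ_eq_iff: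
  assumes p: "primeideal p A" and a: "a \<in> carrier R" "b \<in> carrier R" and f: "f \<in> carrier A - p" "g \<in> carrier A - p"
  shows "germ p (fr a (\<phi> f)) = germ p (fr b (\<phi> g)) \<longleftrightarrow> fr a (\<phi> f) = fr b (\<phi> g)"
proof -
  interpret Sp: fractions R "S p" by (rule fractions_S[OF p])
  show ?thesis
    unfolding fraction_S_eq_germ[OF p a(1) f(1), symmetric] fraction_S_eq_germ[OF p a(2) f(2), symmetric]
    using Sp.fraction_eq_iff[OF a(1) prime_outside(4)[OF p f(1)] a(2) prime_outside(4)[OF p f(2)]]
      fr_eq_iff[OF a(1) prime_outside(3)[OF p f(1)] a(2) prime_outside(3)[OF p f(2)]] by simp
qed

text \<open>
  As the point \<open>0\<close> lies in every non-empty open set, a section of the associated sheaf consists of the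
  germs of a single element of \<open>Q\<^sup>+(R)\<close>.
\<close>

definition reg :: "'r set \<Rightarrow> 'a set set \<Rightarrow> ('r \<times> 'r) set set" where
  "reg N U = {z. \<forall>p\<in>U. \<exists>a\<in>N. \<exists>f\<in>carrier A - p. z = fr a (\<phi> f)}"

definition sect :: "'a set set \<Rightarrow> ('r \<times> 'r) set \<Rightarrow> 'a set \<Rightarrow> ('r \<times> 'r) set" where
  "sect U z = (\<lambda>p\<in>U. germ p z)"

lemma reg_mono: "\<lbrakk>z \<in> reg N U; N \<subseteq> N'; U' \<subseteq> U\<rbrakk> \<Longrightarrow> z \<in> reg N' U'"
  unfolding reg_def by blast

lemma regD: "\<lbrakk>z \<in> reg N U; p \<in> U\<rbrakk> \<Longrightarrow> \<exists>a\<in>N. \<exists>f\<in>carrier A - p. z = fr a (\<phi> f)"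
  unfolding reg_def by blast

lemma assoc_sections_eq:
  assumes U: "openin (Spec A) U" "U \<noteq> {}" and N: "N \<subseteq> carrier R"
  shows "assoc_sections A R \<phi> N U = sect U ` reg N U"
proof (intro equalityI subsetI)
  fix s assume s: "s \<in> assoc_sections A R \<phi> N U"
  have gen: "{\<zero>\<^bsub>A\<^esub>} \<in> U" "primeideal {\<zero>\<^bsub>A\<^esub>} A" using A.open_generic[OF U] A.primeideal_zero by auto
  have ext: "s \<in> extensional U" using s by (simp add: assoc_sections_def PiE_def)
  have loc: "\<exists>a\<in>N. \<exists>f\<in>carrier A - p. s p = germ p (fr a (\<phi> f)) \<and> s {\<zero>\<^bsub>A\<^esub>} = germ {\<zero>\<^bsub>A\<^esub>} (fr a (\<phi> f))"
    if p: "p \<in> U" for p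
  proof -
    obtain U' a f where h: "openin (Spec A) U'" "p \<in> U'" "U' \<subseteq> U" "a \<in> N" "f \<in> carrier A"
      "\<forall>q\<in>U'. f \<notin> q \<and> s q = fraction R (S q) a (\<phi> f)"
      using s p unfolding assoc_sections_def by blast
    have "{\<zero>\<^bsub>A\<^esub>} \<in> U'" using A.open_generic[OF h(1)] h(2) by blast
    then have "s p = germ p (fr a (\<phi> f))" "s {\<zero>\<^bsub>A\<^esub>} = germ {\<zero>\<^bsub>A\<^esub>} (fr a (\<phi> f))"
      using h fraction_S_eq_germ[OF A.open_primeideal[OF h(1)]] N by (metis DiffI subsetD)+
    then show ?thesis using h by blast
  qed
  \<comment> \<open>The candidate for the global fraction is taken from the stalk at the zero ideal;
    comparison at that point identifies it with all local fractions.\<close>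
  obtain a0 f0 where z: "a0 \<in> N" "f0 \<in> carrier A - {\<zero>\<^bsub>A\<^esub>}" "s {\<zero>\<^bsub>A\<^esub>} = germ {\<zero>\<^bsub>A\<^esub>} (fr a0 (\<phi> f0))"
    using loc[OF gen(1)] by blast
  let ?z = "fr a0 (\<phi> f0)"
  have eq: "\<exists>a\<in>N. \<exists>f\<in>carrier A - p. s p = germ p (fr a (\<phi> f)) \<and> ?z = fr a (\<phi> f)" if p: "p \<in> U" for p
  proof -
    obtain a f where h: "a \<in> N" "f \<in> carrier A - p" "s p = germ p (fr a (\<phi> f))" "s {\<zero>\<^bsub>A\<^esub>} = germ {\<zero>\<^bsub>A\<^esub>} (fr a (\<phi> f))"
      using loc[OF p] by blast
    have "f \<in> carrier A - {\<zero>\<^bsub>A\<^esub>}" using prime_outside(1)[OF A.open_primeideal[OF U(1) p] h(2)] h(2) by blast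
    then have "?z = fr a (\<phi> f)"
      using germ_eq_iff[OF gen(2), of a0 a f0 f] z h N by auto
    then show ?thesis using h by blast
  qed
  then have "?z \<in> reg N U" unfolding reg_def by blast
  moreover have "s = sect U ?z"
  proof (rule extensionalityI[OF ext])
    show "sect U ?z \<in> extensional U" by (simp add: sect_def)
    show "s p = sect U ?z p" if "p \<in> U" for p using eq[OF that] that by (auto simp: sect_def)
  qed
  ultimately show "s \<in> sect U ` reg N U" by blast
next
  fix s assume "s \<in> sect U ` reg N U"
  then obtain z where z: "z \<in> reg N U" "s = sect U z" by blast
  have "s \<in> (\<Pi>\<^sub>E p\<in>U. carrier (localization R (S p)))"
  proof (rule PiE_I)
    fix p assume p: "p \<in> U"
    note pp = A.open_primeideal[OF U(1) p]
    obtain a f where h: "a \<in> N" "f \<in> carrier A - p" "z = fr a (\<phi> f)" using regD[OF z(1) p] by blast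
    then have "s p = fraction R (S p) a (\<phi> f)" using z(2) p fraction_S_eq_germ[OF pp, of a f] N by (auto simp: sect_def)
    then show "s p \<in> carrier (localization R (S p))"
      using h N prime_outside(4)[OF pp h(2)] by (auto simp: localization_def)
  qed (use z(2) in \<open>simp add: sect_def\<close>)
  moreover have "\<exists>U'. openin (Spec A) U' \<and> p \<in> U' \<and> U' \<subseteq> U \<and>
          (\<exists>a\<in>N. \<exists>f\<in>carrier A. \<forall>q\<in>U'. f \<notin> q \<and> s q = fraction R (S q) a (\<phi> f))" if p: "p \<in> U" for p
  proof -
    obtain a f where h: "a \<in> N" "f \<in> carrier A - p" "z = fr a (\<phi> f)" using regD[OF z(1) p] by blast
    let ?U = "U \<inter> {q. primeideal q A \<and> f \<notin> q}"
    have "openin (Spec A) ?U" using U(1) A.open_basic[of f] h(2) by blast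
    moreover have "p \<in> ?U" using p h(2) A.open_primeideal[OF U(1) p] by simp
    moreover have "\<forall>q\<in>?U. f \<notin> q \<and> s q = fraction R (S q) a (\<phi> f)"
    proof
      fix q assume q: "q \<in> ?U"
      then have "f \<in> carrier A - q" "a \<in> carrier R" using h N by auto
      then show "f \<notin> q \<and> s q = fraction R (S q) a (\<phi> f)"
        using q h(3) z(2) fraction_S_eq_germ[of q a f] by (simp add: sect_def)
    qed
    ultimately show ?thesis using h by blast
  qed
  ultimately show "s \<in> assoc_sections A R \<phi> N U" unfolding assoc_sections_def by blast
qed

lemma sect_inj:
  assumes U: "openin (Spec A) U" "U \<noteq> {}" and z: "z \<in> reg (carrier R) U" "w \<in> reg (carrier R) U" "sect U z = sect U w"
  shows "z = w"
proof -
  have p: "{\<zero>\<^bsub>A\<^esub>} \<in> U" using A.open_generic[OF U] .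
  obtain a f where h: "a \<in> carrier R" "f \<in> carrier A - {\<zero>\<^bsub>A\<^esub>}" "z = fr a (\<phi> f)" using regD[OF z(1) p] by blast
  obtain b g where k: "b \<in> carrier R" "g \<in> carrier A - {\<zero>\<^bsub>A\<^esub>}" "w = fr b (\<phi> g)" using regD[OF z(2) p] by blast
  have "germ {\<zero>\<^bsub>A\<^esub>} z = germ {\<zero>\<^bsub>A\<^esub>} w" using z(3) p unfolding sect_def by (metis restrict_apply')
  then show ?thesis unfolding h(3) k(3) using germ_eq_iff[OF A.primeideal_zero h(1) k(1) h(2) k(2)] by simp
qed

abbreviation AS where "AS \<equiv> assoc_sheaf A R G \<phi>"

lemma AS_simps:
  "carrier (sec AS U) = assoc_sections A R \<phi> (carrier R) U"
  "s \<otimes>\<^bsub>sec AS U\<^esub> t = (\<lambda>p\<in>U. s p \<otimes>\<^bsub>localization R (S p)\<^esub> t p)"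
  "s \<oplus>\<^bsub>sec AS U\<^esub> t = (\<lambda>p\<in>U. s p \<oplus>\<^bsub>localization R (S p)\<^esub> t p)"
  "\<one>\<^bsub>sec AS U\<^esub> = (\<lambda>p\<in>U. \<one>\<^bsub>localization R (S p)\<^esub>)"
  "res AS U U' s = restrict s U'"
  "hcomp AS U w = assoc_sections A R \<phi> (G w) U"
  by (simp_all add: assoc_sheaf_def)

lemma reg_ops:
  assumes U: "openin (Spec A) U" and z: "z \<in> reg (carrier R) U" "w \<in> reg (carrier R) U"
  shows "z \<otimes>\<^bsub>FR\<^esub> w \<in> reg (carrier R) U" "z \<oplus>\<^bsub>FR\<^esub> w \<in> reg (carrier R) U"
    and "sect U z \<otimes>\<^bsub>sec AS U\<^esub> sect U w = sect U (z \<otimes>\<^bsub>FR\<^esub> w)"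
    and "sect U z \<oplus>\<^bsub>sec AS U\<^esub> sect U w = sect U (z \<oplus>\<^bsub>FR\<^esub> w)"
proof -
  have loc: "(\<exists>a\<in>carrier R. \<exists>f\<in>carrier A - p. z \<otimes>\<^bsub>FR\<^esub> w = fr a (\<phi> f)) \<and> (\<exists>a\<in>carrier R. \<exists>f\<in>carrier A - p. z \<oplus>\<^bsub>FR\<^esub> w = fr a (\<phi> f)) \<and>
      germ p z \<otimes>\<^bsub>localization R (S p)\<^esub> germ p w = germ p (z \<otimes>\<^bsub>FR\<^esub> w) \<and>
      germ p z \<oplus>\<^bsub>localization R (S p)\<^esub> germ p w = germ p (z \<oplus>\<^bsub>FR\<^esub> w)" if p: "p \<in> U" for p
  proof -
    note pp = A.open_primeideal[OF U p]
    interpret p: primeideal p A by (rule pp)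
    interpret Sp: fractions R "S p" by (rule fractions_S[OF pp])
    obtain a f where h: "a \<in> carrier R" "f \<in> carrier A - p" "z = fr a (\<phi> f)" using regD[OF z(1) p] by blast
    obtain b g where k: "b \<in> carrier R" "g \<in> carrier A - p" "w = fr b (\<phi> g)" using regD[OF z(2) p] by blast
    note f = prime_outside[OF pp h(2)] and g = prime_outside[OF pp k(2)]
    have fg: "f \<otimes>\<^bsub>A\<^esub> g \<in> carrier A - p" using h(2) k(2) p.I_prime by auto
    have \<phi>fg: "\<phi> (f \<otimes>\<^bsub>A\<^esub> g) = \<phi> f \<otimes> \<phi> g" using f(2) g(2) by simp
    have c: "a \<otimes> \<phi> g \<oplus> b \<otimes> \<phi> f \<in> carrier R" "a \<otimes> b \<in> carrier R" using h(1) k(1) f(5) g(5) by simp_all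
    have m: "z \<otimes>\<^bsub>FR\<^esub> w = fr (a \<otimes> b) (\<phi> (f \<otimes>\<^bsub>A\<^esub> g))"
      unfolding h(3) k(3) \<phi>fg by (rule fr_mult[OF h(1) f(3) k(1) g(3)])
    have s: "z \<oplus>\<^bsub>FR\<^esub> w = fr (a \<otimes> \<phi> g \<oplus> b \<otimes> \<phi> f) (\<phi> (f \<otimes>\<^bsub>A\<^esub> g))"
      unfolding h(3) k(3) \<phi>fg by (rule fr_add[OF h(1) f(3) k(1) g(3)])
    have "germ p z \<otimes>\<^bsub>localization R (S p)\<^esub> germ p w = germ p (z \<otimes>\<^bsub>FR\<^esub> w)"
      unfolding m unfolding fraction_S_eq_germ[OF pp c(2) fg, symmetric] unfolding \<phi>fg
      unfolding h(3) k(3) fraction_S_eq_germ[OF pp h(1,2), symmetric] fraction_S_eq_germ[OF pp k(1,2), symmetric]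
      by (rule Sp.loc_mult[OF h(1) f(4) k(1) g(4)])
    moreover have "germ p z \<oplus>\<^bsub>localization R (S p)\<^esub> germ p w = germ p (z \<oplus>\<^bsub>FR\<^esub> w)"
      unfolding s unfolding fraction_S_eq_germ[OF pp c(1) fg, symmetric] unfolding \<phi>fg
      unfolding h(3) k(3) fraction_S_eq_germ[OF pp h(1,2), symmetric] fraction_S_eq_germ[OF pp k(1,2), symmetric]
      by (rule Sp.loc_add[OF h(1) f(4) k(1) g(4)])
    ultimately show ?thesis using m s c fg by blast
  qed
  show "z \<otimes>\<^bsub>FR\<^esub> w \<in> reg (carrier R) U" "z \<oplus>\<^bsub>FR\<^esub> w \<in> reg (carrier R) U"
    unfolding reg_def using loc by blast+
  show "sect U z \<otimes>\<^bsub>sec AS U\<^esub> sect U w = sect U (z \<otimes>\<^bsub>FR\<^esub> w)"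
    "sect U z \<oplus>\<^bsub>sec AS U\<^esub> sect U w = sect U (z \<oplus>\<^bsub>FR\<^esub> w)"
    unfolding AS_simps sect_def using loc by (auto simp: restrict_def fun_eq_iff)
qed

lemma sect_one:
  assumes U: "openin (Spec A) U"
  shows "\<one>\<^bsub>sec AS U\<^esub> = sect U \<one>\<^bsub>FR\<^esub>" "\<one>\<^bsub>FR\<^esub> \<in> reg (carrier R) U"
proof -
  have loc: "\<one>\<^bsub>A\<^esub> \<in> carrier A - p \<and> \<one>\<^bsub>localization R (S p)\<^esub> = germ p \<one>\<^bsub>FR\<^esub>" if "p \<in> U" for p
  proof -
    note pp = A.open_primeideal[OF U that]
    interpret p: primeideal p A by (rule pp)
    interpret Sp: fractions R "S p" by (rule fractions_S[OF pp])
    have one: "\<one>\<^bsub>A\<^esub> \<in> carrier A - p" using p.one_imp_carrier p.I_notcarr by auto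
    then show ?thesis using fraction_S_eq_germ[OF pp one_closed one] by (simp add: Sp.loc_one fr_one)
  qed
  show "\<one>\<^bsub>sec AS U\<^esub> = sect U \<one>\<^bsub>FR\<^esub>"
    unfolding AS_simps sect_def using loc by (auto simp: restrict_def fun_eq_iff)
  have "\<one>\<^bsub>FR\<^esub> = fr \<one> (\<phi> \<one>\<^bsub>A\<^esub>)" by (simp add: fr_one)
  then show "\<one>\<^bsub>FR\<^esub> \<in> reg (carrier R) U" unfolding reg_def using loc one_closed by blast
qed

lemma restrict_sect: "U' \<subseteq> U \<Longrightarrow> restrict (sect U z) U' = sect U' z"
  by (auto simp: sect_def restrict_def fun_eq_iff)

lemma assoc_sections_empty: "assoc_sections A R \<phi> N {} = {\<lambda>_. undefined}"
  by (auto simp: assoc_sections_def)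

end


section \<open>Transport along isomorphisms of domains\<close>

lemma ring_hom_bij_inv:
  assumes A: "cring A" and B: "cring B" and h: "h \<in> ring_hom A B" "bij_betw h (carrier A) (carrier B)"
  shows "inv_into (carrier A) h \<in> ring_hom B A" "bij_betw (inv_into (carrier A) h) (carrier B) (carrier A)"
proof -
  have "h \<in> ring_iso A B" using h by (simp add: ring_iso_def)
  then have "inv_into (carrier A) h \<in> ring_iso B A" by (rule ring_iso_set_sym[OF cring.axioms(1)[OF A]])
  then show "inv_into (carrier A) h \<in> ring_hom B A" "bij_betw (inv_into (carrier A) h) (carrier B) (carrier A)"
    by (simp_all add: ring_iso_def)
qed

lemma primeideal_image:
  assumes A: "cring A" and B: "cring B" and h: "h \<in> ring_hom A B" "bij_betw h (carrier A) (carrier B)"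
    and p: "primeideal p A"
  shows "primeideal (h ` p) B"
proof -
  let ?k = "inv_into (carrier A) h"
  interpret p: primeideal p A by fact
  interpret k: ring_hom_ring B A ?k
    using ring_hom_bij_inv(1)[OF A B h] A B
    by (simp add: ring_hom_ring_def ring_hom_ring_axioms_def cring_def)
  have "?k (h a) = a" if "a \<in> p" for a using h(2) p.Icarr[OF that] by (simp add: bij_betw_def)
  moreover have "h (?k b) = b" if "b \<in> carrier B" for b
    using h(2) that by (simp add: bij_betw_def f_inv_into_f)
  ultimately have "h ` p = {b \<in> carrier B. ?k b \<in> p}"
    using ring_hom_closed[OF h(1) p.Icarr] by (auto intro: image_eqI[OF sym])
  then show ?thesis using k.primeideal_vimage[OF B p] by simp
qed

lemma min_prime_image:
  assumes A: "weighted_domain A V" and B: "weighted_domain B V'"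
    and h: "h \<in> ring_hom A B" "bij_betw h (carrier A) (carrier B)"
    and p: "weighted_domain.min_prime A p"
  shows "weighted_domain.min_prime B (h ` p)"
proof -
  interpret A: weighted_domain A V by fact
  interpret B: weighted_domain B V' by fact
  let ?k = "inv_into (carrier A) h"
  note k = ring_hom_bij_inv[OF A.is_cring B.is_cring h]
  have sub: "q \<subseteq> carrier B" if "primeideal q B" for q using ideal.Icarr[OF primeideal.axioms(1)[OF that]] by blast
  have hk: "h ` ?k ` q = q" if "primeideal q B" for q
    using h(2) by (intro image_inv_into_cancel[OF _ sub[OF that]]) (simp add: bij_betw_def)
  have pp: "primeideal p A" using p by (simp add: A.min_prime_def)
  have "p \<subseteq> carrier A" using ideal.Icarr[OF primeideal.axioms(1)[OF pp]] by blast
  then have kh: "?k ` h ` p = p"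
    using inv_into_image_cancel h(2) by (metis bij_betw_imp_inj_on)
  have zero: "h \<zero>\<^bsub>A\<^esub> = \<zero>\<^bsub>B\<^esub>" "?k \<zero>\<^bsub>B\<^esub> = \<zero>\<^bsub>A\<^esub>"
    using ring_hom_zero[OF h(1) A.ring_axioms B.ring_axioms] ring_hom_zero[OF k(1) B.ring_axioms A.ring_axioms] by auto
  show ?thesis unfolding B.min_prime_def
  proof (intro conjI allI impI)
    show "primeideal (h ` p) B" by (rule primeideal_image[OF A.is_cring B.is_cring h pp])
    show "h ` p \<noteq> {\<zero>\<^bsub>B\<^esub>}" using kh zero(2) p by (metis A.min_prime_def image_empty image_insert)
    fix q assume q: "primeideal q B \<and> q \<noteq> {\<zero>\<^bsub>B\<^esub>} \<and> q \<subseteq> h ` p"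
    then have "primeideal (?k ` q) A" by (intro primeideal_image[OF B.is_cring A.is_cring k]) blast
    moreover have "?k ` q \<noteq> {\<zero>\<^bsub>A\<^esub>}" using q hk[of q] zero(1) by (metis image_empty image_insert)
    moreover have "?k ` q \<subseteq> p" using q kh by (metis image_mono)
    ultimately show "q = h ` p" using p hk[of q] q unfolding A.min_prime_def by metis
  qed
qed

text \<open>Condition (iii) concerns the valuations of the ring of degree zero, which is only
  isomorphic to \<open>A\<close> and lives on another type. Minimal primes and orders are
  transported along the isomorphism \<open>h\<close>.\<close>

locale domain_iso = A: weighted_domain A V for A :: "('a, 'm) ring_scheme" and V +
  fixes B :: "('b, 'l) ring_scheme" and h :: "'a \<Rightarrow> 'b"
  assumes B: "cring B" and h: "h \<in> ring_hom A B" "bij_betw h (carrier A) (carrier B)"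
begin

definition k :: "'b \<Rightarrow> 'a" where "k = inv_into (carrier A) h"

lemma k: "k \<in> ring_hom B A" "bij_betw k (carrier B) (carrier A)"
  using ring_hom_bij_inv[OF A.is_cring B h] by (simp_all add: k_def)

lemma kh: "a \<in> carrier A \<Longrightarrow> k (h a) = a"
  and hk: "b \<in> carrier B \<Longrightarrow> h (k b) = b"
  using h(2) by (auto simp: k_def bij_betw_def f_inv_into_f)

sublocale k: ring_hom_cring B A k
  using k B A.is_cring by (simp add: ring_hom_cring_def ring_hom_cring_axioms_def)

lemma k_zero_iff: "b \<in> carrier B \<Longrightarrow> k b = \<zero>\<^bsub>A\<^esub> \<longleftrightarrow> b = \<zero>\<^bsub>B\<^esub>"
  using k(2) k.hom_zero cring.cring_simprules(2)[OF B] by (metis bij_betw_def inj_onD)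

lemma k_nonzero: "b \<in> carrier B - {\<zero>\<^bsub>B\<^esub>} \<Longrightarrow> k b \<in> carrier A - {\<zero>\<^bsub>A\<^esub>}"
  using k_zero_iff by auto

lemma k_inj: "\<lbrakk>a \<in> carrier B; b \<in> carrier B; k a = k b\<rbrakk> \<Longrightarrow> a = b"
  using k(2) by (meson bij_betw_def inj_onD)

lemma domain_B: "domain B"
proof (intro domainI B)
  show "\<one>\<^bsub>B\<^esub> \<noteq> \<zero>\<^bsub>B\<^esub>" using k.hom_one k.hom_zero A.one_not_zero by metis
  fix a b assume ab: "a \<otimes>\<^bsub>B\<^esub> b = \<zero>\<^bsub>B\<^esub>" "a \<in> carrier B" "b \<in> carrier B"
  then have "k a \<otimes>\<^bsub>A\<^esub> k b = \<zero>\<^bsub>A\<^esub>" using k.hom_mult k.hom_zero by metis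
  then show "a = \<zero>\<^bsub>B\<^esub> \<or> b = \<zero>\<^bsub>B\<^esub>" using A.integral_iff ab(2,3) k_zero_iff k.hom_closed by metis
qed

sublocale B: weighted_domain B "(\<lambda>w b. w (k b)) ` V"
proof (intro weighted_domain.intro[OF domain_B] weighted_domain_axioms.intro)
  fix w a b assume "w \<in> (\<lambda>w b. w (k b)) ` V" and a: "a \<in> carrier B - {\<zero>\<^bsub>B\<^esub>}"
  then obtain u where u: "u \<in> V" "w = (\<lambda>b. u (k b))" by blast
  show "0 \<le> w a" using A.w_nonneg[OF u(1) k_nonzero[OF a]] u(2) by simp
  assume b: "b \<in> carrier B - {\<zero>\<^bsub>B\<^esub>}"
  show "w (a \<otimes>\<^bsub>B\<^esub> b) = w a + w b"
    using A.w_mult[OF u(1) k_nonzero[OF a] k_nonzero[OF b]] u(2) a b by simp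
  assume "a \<oplus>\<^bsub>B\<^esub> b \<noteq> \<zero>\<^bsub>B\<^esub>"
  then have "k a \<oplus>\<^bsub>A\<^esub> k b \<noteq> \<zero>\<^bsub>A\<^esub>" using a b k_zero_iff[of "a \<oplus>\<^bsub>B\<^esub> b"] cring.cring_simprules(1)[OF B] by simp
  then show "min (w a) (w b) \<le> w (a \<oplus>\<^bsub>B\<^esub> b)"
    using A.w_add[OF u(1) k_nonzero[OF a] k_nonzero[OF b]] u(2) a b by simp
next
  fix a b assume a: "a \<in> carrier B - {\<zero>\<^bsub>B\<^esub>}" and b: "b \<in> carrier B - {\<zero>\<^bsub>B\<^esub>}"
    and le: "\<And>w. w \<in> (\<lambda>w b. w (k b)) ` V \<Longrightarrow> w b \<le> w a"
  have "u (k b) \<le> u (k a)" if "u \<in> V" for u using le[of "\<lambda>b. u (k b)"] that by blast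
  then obtain c where c: "c \<in> carrier A" "k a = k b \<otimes>\<^bsub>A\<^esub> c" using A.w_div[OF k_nonzero[OF a] k_nonzero[OF b]] by blast
  have hc: "h c \<in> carrier B" using ring_hom_closed[OF h(1) c(1)] .
  have "k a = k (b \<otimes>\<^bsub>B\<^esub> h c)" using c b kh hc by simp
  then have "a = b \<otimes>\<^bsub>B\<^esub> h c" using k_inj a b hc cring.cring_simprules(5)[OF B] by (metis DiffD1)
  then show "\<exists>c\<in>carrier B. a = b \<otimes>\<^bsub>B\<^esub> c" using hc by blast
next
  fix a assume a: "a \<in> carrier B - {\<zero>\<^bsub>B\<^esub>}"
  have "{w \<in> (\<lambda>w b. w (k b)) ` V. w a \<noteq> 0} \<subseteq> (\<lambda>w b. w (k b)) ` {w \<in> V. w (k a) \<noteq> 0}" by auto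
  then show "finite {w \<in> (\<lambda>w b. w (k b)) ` V. w a \<noteq> 0}" using A.w_fin[OF k_nonzero[OF a]] finite_surj by blast
qed

lemma min_prime_preimage:
  assumes q: "B.min_prime q"
  obtains p where "A.min_prime p" "q = h ` p"
proof
  show "A.min_prime (k ` q)" by (rule min_prime_image[OF B.weighted_domain_axioms A.weighted_domain_axioms k q])
  have "q \<subseteq> carrier B" using ideal.Icarr[OF primeideal.axioms(1)[OF B.min_primeD(1)[OF q]]] by blast
  then show "q = h ` k ` q" by (auto simp: image_image hk subset_iff)
qed

lemma graded_ord_image:
  assumes p: "A.min_prime p"
  shows "graded_ord zero_group B (trivial_grading B) (h ` p) (\<lambda>b. A.ord p (k b))"
  unfolding graded_ord_def homog_trivial
proof (intro conjI ballI)
  have go: "graded_ord zero_group A (trivial_grading A) p (A.ord p)" by (rule A.graded_ord_ord[OF p])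
  show "A.ord p (k (a \<otimes>\<^bsub>B\<^esub> b)) = A.ord p (k a) + A.ord p (k b)"
    if "a \<in> carrier B - {\<zero>\<^bsub>B\<^esub>}" "b \<in> carrier B - {\<zero>\<^bsub>B\<^esub>}" for a b
    using A.ord_mult[OF p k_nonzero[OF that(1)] k_nonzero[OF that(2)]] that by simp
  have hZ: "h a \<in> carrier B - {\<zero>\<^bsub>B\<^esub>}" if "a \<in> carrier A - {\<zero>\<^bsub>A\<^esub>}" for a
    using ring_hom_closed[OF h(1), of a] kh[of a] k.hom_zero that by auto
  obtain x y where xy: "x \<in> carrier A - {\<zero>\<^bsub>A\<^esub>}" "y \<in> carrier A - {\<zero>\<^bsub>A\<^esub>}" "A.ord p x = A.ord p y + 1"
    using go unfolding graded_ord_def homog_trivial by blast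
  then show "\<exists>a\<in>carrier B - {\<zero>\<^bsub>B\<^esub>}. \<exists>b\<in>carrier B - {\<zero>\<^bsub>B\<^esub>}. A.ord p (k a) = A.ord p (k b) + 1"
    using hZ[OF xy(1)] hZ[OF xy(2)] kh by (metis DiffD1)
  fix a b assume a: "a \<in> carrier B - {\<zero>\<^bsub>B\<^esub>}" and b: "b \<in> carrier B - {\<zero>\<^bsub>B\<^esub>}"
  have iff: "A.ord p (k b) \<le> A.ord p (k a) \<longleftrightarrow>
      (\<exists>s\<in>carrier A - {\<zero>\<^bsub>A\<^esub>} - p. \<exists>c\<in>carrier A. s \<otimes>\<^bsub>A\<^esub> k a = k b \<otimes>\<^bsub>A\<^esub> c)"
    using go k_nonzero[OF a] k_nonzero[OF b] unfolding graded_ord_def homog_trivial by blast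
  show "A.ord p (k b) \<le> A.ord p (k a) \<longleftrightarrow>
      (\<exists>s\<in>carrier B - {\<zero>\<^bsub>B\<^esub>} - h ` p. \<exists>c\<in>carrier B. s \<otimes>\<^bsub>B\<^esub> a = b \<otimes>\<^bsub>B\<^esub> c)"
    unfolding iff
  proof
    assume "\<exists>s\<in>carrier A - {\<zero>\<^bsub>A\<^esub>} - p. \<exists>c\<in>carrier A. s \<otimes>\<^bsub>A\<^esub> k a = k b \<otimes>\<^bsub>A\<^esub> c"
    then obtain s c where s: "s \<in> carrier A - {\<zero>\<^bsub>A\<^esub>}" "s \<notin> p" "c \<in> carrier A" "s \<otimes>\<^bsub>A\<^esub> k a = k b \<otimes>\<^bsub>A\<^esub> c" by blast
    have hc: "h c \<in> carrier B" using ring_hom_closed[OF h(1) s(3)] .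
    have "k (h s \<otimes>\<^bsub>B\<^esub> a) = k (b \<otimes>\<^bsub>B\<^esub> h c)" using s hZ[OF s(1)] a b hc kh by simp
    then have "h s \<otimes>\<^bsub>B\<^esub> a = b \<otimes>\<^bsub>B\<^esub> h c" using k_inj hZ[OF s(1)] a b hc cring.cring_simprules(5)[OF B] by (metis DiffD1)
    moreover have "h s \<notin> h ` p"
      using s(1,2) kh ideal.Icarr[OF primeideal.axioms(1)[OF A.min_primeD(1)[OF p]]] by (metis DiffD1 imageE)
    ultimately show "\<exists>s\<in>carrier B - {\<zero>\<^bsub>B\<^esub>} - h ` p. \<exists>c\<in>carrier B. s \<otimes>\<^bsub>B\<^esub> a = b \<otimes>\<^bsub>B\<^esub> c"
      using hZ[OF s(1)] hc by blast
  next
    assume "\<exists>s\<in>carrier B - {\<zero>\<^bsub>B\<^esub>} - h ` p. \<exists>c\<in>carrier B. s \<otimes>\<^bsub>B\<^esub> a = b \<otimes>\<^bsub>B\<^esub> c"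
    then obtain s c where s: "s \<in> carrier B - {\<zero>\<^bsub>B\<^esub>}" "s \<notin> h ` p" "c \<in> carrier B" "s \<otimes>\<^bsub>B\<^esub> a = b \<otimes>\<^bsub>B\<^esub> c" by blast
    have "k s \<otimes>\<^bsub>A\<^esub> k a = k b \<otimes>\<^bsub>A\<^esub> k c" using s a b k.hom_mult by (metis DiffD1)
    moreover have "k s \<notin> p" using s(1,2) hk by (metis DiffD1 image_eqI)
    ultimately show "\<exists>s\<in>carrier A - {\<zero>\<^bsub>A\<^esub>} - p. \<exists>c\<in>carrier A. s \<otimes>\<^bsub>A\<^esub> k a = k b \<otimes>\<^bsub>A\<^esub> c"
      using k_nonzero[OF s(1)] s(3) by blast
  qed
qed

text \<open>The essential valuation of \<open>B\<close> that belongs to the prime divisor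
  \<open>p\<close> of \<open>A\<close>.\<close>

abbreviation eB where "eB p \<equiv> frac_val zero_group B (trivial_grading B) (\<lambda>b. A.ord p (k b))"

lemma essential_valuations_B:
  "essential_valuations zero_group B (trivial_grading B) =
     eB ` {p. A.min_prime p}"
proof (intro equalityI subsetI)
  fix \<nu> assume "\<nu> \<in> essential_valuations zero_group B (trivial_grading B)"
  then obtain q v where q: "B.min_prime q" "graded_ord zero_group B (trivial_grading B) q v"
    "\<nu> = frac_val zero_group B (trivial_grading B) v"
    by (auto simp: B.D.essential_valuations_eq B.min_prime_iff)
  obtain p where p: "A.min_prime p" "q = h ` p" using min_prime_preimage[OF q(1)] .
  note go = graded_ord_image[OF p(1), folded p(2)]
  have "eB p = \<nu>"
  proof (rule B.D.frac_val_eqI)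
    show "\<nu> \<in> extensional (homog zero_group B.FA (frac_grading zero_group B (trivial_grading B)))"
      using q(3) by (simp add: frac_val_def)
    show "A.ord p (k (a \<otimes>\<^bsub>B\<^esub> b)) = A.ord p (k a) + A.ord p (k b)"
      if "a \<in> B.D.H" "b \<in> B.D.H" for a b
      using B.D.graded_ordD(1)[OF go that] .
    show "\<nu> (B.q a s) = A.ord p (k a) - A.ord p (k s)"
      if "a \<in> B.D.H" "s \<in> B.D.H" for a s
      using B.D.frac_val_fr[OF B.D.graded_ordD(1)[OF q(2)] that] q(3)
        B.D.graded_ord_unique[OF q(2) go that(1)] B.D.graded_ord_unique[OF q(2) go that(2)] by simp
  qed
  then show "\<nu> \<in> eB ` {p. A.min_prime p}"
    using p(1) by blast
next
  fix \<nu> assume "\<nu> \<in> eB ` {p. A.min_prime p}"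
  then obtain p where p: "A.min_prime p" "\<nu> = eB p" by blast
  then show "\<nu> \<in> essential_valuations zero_group B (trivial_grading B)"
    using graded_ord_image[OF p(1)] min_prime_image[OF A.weighted_domain_axioms B.weighted_domain_axioms h p(1)] B.min_prime_iff
    by (auto simp: B.D.essential_valuations_eq)
qed

lemma frac_val_B:
  assumes "A.min_prime p" "a \<in> carrier B - {\<zero>\<^bsub>B\<^esub>}" "s \<in> carrier B - {\<zero>\<^bsub>B\<^esub>}"
  shows "eB p (B.q a s) = A.ord p (k a) - A.ord p (k s)"
  by (rule B.D.frac_val_fr[OF B.D.graded_ordD(1)[OF graded_ord_image[OF assms(1)]]]) (use assms in auto)

end

section \<open>The ring of global sections of a Cox sheaf\<close>

text \<open>A homogeneous element that annihilates \<open>b\<close> annihilates each component of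
  \<open>b\<close>, so only products of homogeneous elements matter.\<close>

lemma (in graded) integral_if_homog:
  assumes one: "\<one> \<noteq> \<zero>"
    and int: "\<And>a b. \<lbrakk>a \<in> homog K R G; b \<in> homog K R G\<rbrakk> \<Longrightarrow> a \<otimes> b \<noteq> \<zero>"
  shows "graded_domain K R G"
proof
  have "b = \<zero>" if a: "a \<in> homog K R G" and b: "b \<in> carrier R" and ab: "a \<otimes> b = \<zero>" for a b
  proof (rule proj_all_zero[OF b])
    fix w assume w: "w \<in> carrier K"
    obtain v where v: "v \<in> carrier K" "a \<in> G v" using homogE[OF a] by metis
    have "a \<otimes> proj w b = proj (v \<otimes>\<^bsub>K\<^esub> w) \<zero>" using proj_mult[OF v(2,1) w b] ab by simp
    also have "\<dots> = \<zero>" using proj_comp[OF comp_zero[OF v(1)] v(1), of "v \<otimes>\<^bsub>K\<^esub> w"] v w by simp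
    finally show "proj w b = \<zero>"
      using int[OF a homogI[OF proj_closed[OF b w] w]] by blast
  qed
  then show "graded_integral K R G" using graded_ring one by (simp add: graded_integral_def)
qed

text \<open>A degree preserving homomorphism commutes with the projections to components, so its
  kernel can be tested on homogeneous elements.\<close>

lemma (in graded) graded_hom_inj:
  assumes R': "graded K R' G'" and h: "h \<in> ring_hom R R'"
    and deg: "\<And>w a. \<lbrakk>w \<in> carrier K; a \<in> G w\<rbrakk> \<Longrightarrow> h a \<in> G' w"
    and inj: "\<And>w a. \<lbrakk>w \<in> carrier K; a \<in> G w; h a = \<zero>\<^bsub>R'\<^esub>\<rbrakk> \<Longrightarrow> a = \<zero>"
  shows "inj_on h (carrier R)"
proof -
  interpret R': graded K R' G' by fact
  interpret h: ring_hom_cring R R' h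
    using h is_cring R'.is_cring by (simp add: ring_hom_cring_def ring_hom_cring_axioms_def)
  have pr: "R'.proj w (h x) = h (proj w x)" if w: "w \<in> carrier K" and x: "x \<in> carrier R" for w x
    using x
  proof (induction x rule: homog_induct)
    case (homog a v)
    then show ?case using R'.proj_comp[OF deg[OF homog] homog(1) w] proj_comp[OF homog(2,1) w] by simp
  next
    case (add a b)
    have "proj w a \<in> carrier R" "proj w b \<in> carrier R" using add w comp_closed[OF proj_closed] by blast+
    then show ?case using add w by (simp add: proj_add R'.proj_add)
  qed
  have ker: "x = \<zero>" if x: "x \<in> carrier R" and hx: "h x = \<zero>\<^bsub>R'\<^esub>" for x
  proof (rule proj_all_zero[OF x])
    fix w assume w: "w \<in> carrier K"
    have "R'.proj w \<zero>\<^bsub>R'\<^esub> = \<zero>\<^bsub>R'\<^esub>" using R'.proj_comp[OF R'.comp_zero[OF w] w w] by simp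
    then show "proj w x = \<zero>" using inj[OF w proj_closed[OF x w]] pr[OF w x] hx by simp
  qed
  show ?thesis
  proof (rule inj_onI)
    fix x y assume xy: "x \<in> carrier R" "y \<in> carrier R" "h x = h y"
    have "h (x \<ominus> y) = \<zero>\<^bsub>R'\<^esub>" using xy by (simp add: minus_eq R'.r_neg)
    then have "x \<ominus> y = \<zero>" using ker[of "x \<ominus> y"] xy by simp
    then show "x = y" using xy by simp
  qed
qed

context cox
begin

lemma deg_zero: "\<delta> 0 = \<one>\<^bsub>K\<^esub>"
proof -
  have "\<delta> 0 \<otimes>\<^bsub>K\<^esub> \<delta> 0 = \<delta> 0" using deg_add[OF W_zero W_zero] by simp
  then show ?thesis using deg_closed[OF W_zero] by (simp add: K.l_cancel_one)
qed

lemma deg_eqD: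
  assumes "D \<in> W" "E \<in> W" "\<delta> D = \<delta> E"
  obtains h where "h \<in> QZ" "pdiv h = D - E"
proof -
  have "\<delta> (D - E) \<otimes>\<^bsub>K\<^esub> \<delta> E = \<delta> E"
    using deg_add[OF W_diff[OF assms(1,2)] assms(2)] assms(3) by simp
  then have "\<delta> (D - E) = \<one>\<^bsub>K\<^esub>"
    using deg_closed[OF W_diff[OF assms(1,2)]] deg_closed[OF assms(2)] by (simp add: K.r_cancel_one)
  then have "D - E \<in> pdiv ` QZ" using deg_one_iff[OF W_diff[OF assms(1,2)]] by simp
  then obtain h where "h \<in> QZ" "D - E = pdiv h" by blast
  then show thesis using that by metis
qed

lemma ord_one: "min_prime Y \<Longrightarrow> ord Y \<one> = 0"
  using ord_mult[of Y \<one> \<one>] by simp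

lemma val_inv: "\<lbrakk>min_prime Y; x \<in> QZ; y \<in> QZ; x \<otimes>\<^bsub>FA\<^esub> y = \<one>\<^bsub>FA\<^esub>\<rbrakk> \<Longrightarrow> val Y y = - val Y x"
  using val_mult[of Y x y] val_one[of Y] by simp

text \<open>The case \<open>D = 0\<close>: by \<open>val_nonneg_imp_integral\<close> the global
  sections of the structure sheaf are the elements of \<open>A\<close>.\<close>

lemma Gam_X0: "Gam X 0 = (\<lambda>a. q a \<one>) ` carrier A"
proof (intro equalityI subsetI)
  fix x assume x: "x \<in> Gam X 0"
  show "x \<in> (\<lambda>a. q a \<one>) ` carrier A"
  proof (cases "x = \<zero>\<^bsub>FA\<^esub>")
    case True
    then show ?thesis using D.fr_zero by blast
  next
    case False
    have "0 \<le> val Y x" if "min_prime Y" for Y using GamD[OF x False that min_prime_in_X[OF that]] by simp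
    then obtain a where "a \<in> Z" "x = q a \<one>" using val_nonneg_imp_integral[of x] False Gam_closed[OF x] by blast
    then show ?thesis by blast
  qed
next
  fix x assume "x \<in> (\<lambda>a. q a \<one>) ` carrier A"
  then obtain a where a: "a \<in> carrier A" "x = q a \<one>" by blast
  show "x \<in> Gam X 0"
  proof (cases "a = \<zero>")
    case True
    then show ?thesis using a(2) Gam_zero[of X 0] D.fr_zero by simp
  next
    case False
    then have aZ: "a \<in> Z" using a by simp
    show ?thesis
    proof (rule GamI)
      show "x \<in> carrier FA" using q_in_QZ[OF aZ, of \<one>] a(2) by simp
      show "0 \<le> val Y x + Poly_Mapping.lookup 0 Y" if "min_prime Y" for Y
        using val_q[OF that aZ, of \<one>] ord_one[OF that] ord_nonneg[OF that aZ] a(2) by simp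
    qed
  qed
qed

section \<open>Values of homogeneous sections along prime divisors\<close>

abbreviation RX where "RX \<equiv> sec F X"
abbreviation GX where "GX \<equiv> hcomp F X"

lemma Gam_QZ: "\<lbrakk>x \<in> Gam U D; x \<noteq> \<zero>\<^bsub>FA\<^esub>\<rbrakk> \<Longrightarrow> x \<in> QZ"
  using Gam_closed by blast

lemma homog_sec_cases:
  assumes U: "openin (Spec A) U" "U \<noteq> {}" and s: "s \<in> homog K (sec F U) (hcomp F U)"
  obtains D x where "D \<in> W" "x \<in> Gam U D" "x \<noteq> \<zero>\<^bsub>FA\<^esub>" "s = M U D x"
proof -
  obtain w where w: "w \<in> carrier K" "s \<in> hcomp F U w" "s \<noteq> \<zero>\<^bsub>sec F U\<^esub>" using s by (auto simp: homog_def)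
  obtain D where D: "D \<in> W" "\<delta> D = w" using deg_surj[OF w(1)] by blast
  obtain x where x: "x \<in> Gam U D" "s = M U D x" using M_surj[OF U D(1)] w(2) D(2) by metis
  then have "x \<noteq> \<zero>\<^bsub>FA\<^esub>" using M_zero[OF U D(1)] w(3) by metis
  then show thesis using that D(1) x by blast
qed

lemma M_homog:
  assumes U: "openin (Spec A) U" "U \<noteq> {}" and "D \<in> W" "x \<in> Gam U D" "x \<noteq> \<zero>\<^bsub>FA\<^esub>"
  shows "M U D x \<in> homog K (sec F U) (hcomp F U)"
proof -
  interpret FU: graded K "sec F U" "hcomp F U" by (rule graded_sec[OF U(1)])
  show ?thesis
    using FU.homogI[OF M_comp[OF assms(1-4)] deg_closed[OF assms(3)]] M_eq_zero_iff[OF assms(1-4)] assms(5) by blast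
qed

lemma graded_domain_sec:
  assumes U: "openin (Spec A) U" "U \<noteq> {}"
  shows "graded_domain K (sec F U) (hcomp F U)"
proof -
  interpret FU: graded K "sec F U" "hcomp F U" by (rule graded_sec[OF U(1)])
  have one: "\<one>\<^bsub>FA\<^esub> \<in> Gam U 0" using one_QZ by (intro GamI) (auto simp: val_one)
  show ?thesis
  proof (rule FU.integral_if_homog)
    have "M U 0 \<one>\<^bsub>FA\<^esub> \<noteq> \<zero>\<^bsub>sec F U\<^esub>" using M_eq_zero_iff[OF U W_zero one] one_QZ by simp
    then show "\<one>\<^bsub>sec F U\<^esub> \<noteq> \<zero>\<^bsub>sec F U\<^esub>" using M_one[OF U] by simp
    fix a b assume ab: "a \<in> homog K (sec F U) (hcomp F U)" "b \<in> homog K (sec F U) (hcomp F U)"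
    obtain D x where D: "D \<in> W" "x \<in> Gam U D" "x \<noteq> \<zero>\<^bsub>FA\<^esub>" "a = M U D x" using homog_sec_cases[OF U ab(1)] .
    obtain E y where E: "E \<in> W" "y \<in> Gam U E" "y \<noteq> \<zero>\<^bsub>FA\<^esub>" "b = M U E y" using homog_sec_cases[OF U ab(2)] .
    have "x \<otimes>\<^bsub>FA\<^esub> y \<noteq> \<zero>\<^bsub>FA\<^esub>" using QZ_mult[OF Gam_QZ[OF D(2,3)] Gam_QZ[OF E(2,3)]] by simp
    then show "a \<otimes>\<^bsub>sec F U\<^esub> b \<noteq> \<zero>\<^bsub>sec F U\<^esub>"
      using M_mult[OF U D(1) E(1) D(2) E(2)] M_eq_zero_iff[OF U W_add[OF D(1) E(1)] Gam_mult[OF D(2) E(2)]] D(4) E(4) by simp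
  qed
qed

sublocale R: graded_domain K RX GX
  by (rule graded_domain_sec[OF open_X X_nonempty])

lemma one_Gam: "(\<And>Y. 0 \<le> Poly_Mapping.lookup D Y) \<Longrightarrow> \<one>\<^bsub>FA\<^esub> \<in> Gam U D"
  using one_QZ by (intro GamI) (auto simp: val_one)

lemmas XX = open_X X_nonempty

text \<open>Equal non-zero sections have equal degrees, so \<open>D - E\<close> is the divisor of
  some \<open>h\<close>. The section \<open>M X (E - D) h\<close> is invertible of neutral degree
  and hence given by some \<open>c\<close> in \<open>Gam X 0\<close>. Comparison in degree
  \<open>E\<close> yields \<open>x h = c y\<close>, and \<open>c\<close> has value 0.\<close>

lemma M_eq_imp_val:
  assumes D: "D \<in> W" "x \<in> Gam X D" "x \<noteq> \<zero>\<^bsub>FA\<^esub>" and E: "E \<in> W" "y \<in> Gam X E"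
    and eq: "M X D x = M X E y" and Y: "min_prime Y"
  shows "val Y x + Poly_Mapping.lookup D Y = val Y y + Poly_Mapping.lookup E Y"
proof -
  have nz: "M X D x \<noteq> \<zero>\<^bsub>RX\<^esub>" using M_eq_zero_iff[OF XX D(1,2)] D(3) by simp
  have deg: "\<delta> D = \<delta> E"
    using R.degree_unique[OF M_comp[OF XX D(1,2)] _ deg_closed[OF D(1)] deg_closed[OF E(1)] nz] M_comp[OF XX E] eq by simp
  obtain h where h: "h \<in> QZ" "pdiv h = D - E" using deg_eqD[OF D(1) E(1) deg] .
  obtain h' where h': "h' \<in> QZ" "h \<otimes>\<^bsub>FA\<^esub> h' = \<one>\<^bsub>FA\<^esub>" using QZ_inv[OF h(1)] .
  have vh: "val Y h = Poly_Mapping.lookup D Y - Poly_Mapping.lookup E Y" if "min_prime Y" for Y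
    using lookup_pdiv[OF h(1), of Y] that h(2) by (simp add: lookup_minus)
  have hG: "h \<in> Gam X (E - D)" using h(1) vh by (intro GamI) (auto simp: lookup_minus)
  have hG': "h' \<in> Gam X (D - E)" using h'(1) vh val_inv[OF _ h(1) h'] by (intro GamI) (auto simp: lookup_minus)
  have ED: "E - D \<in> W" "D - E \<in> W" using W_diff D(1) E(1) by blast+
  have "\<delta> (D - E) = \<one>\<^bsub>K\<^esub>" using deg_one_iff[OF ED(2)] h by (metis imageI)
  moreover have "\<delta> (D - E) \<otimes>\<^bsub>K\<^esub> \<delta> (E - D) = \<delta> 0" using deg_add[OF ED(2,1)] by simp
  ultimately have d1: "\<delta> (E - D) = \<delta> 0" "\<delta> (D - E) = \<delta> 0" using deg_zero deg_closed[OF ED(1)] by simp_all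
  obtain c where c: "c \<in> Gam X 0" "M X (E - D) h = M X 0 c"
    using M_surj[OF XX W_zero, of "M X (E - D) h"] M_comp[OF XX ED(1) hG] d1(1) by metis
  obtain c' where c': "c' \<in> Gam X 0" "M X (D - E) h' = M X 0 c'"
    using M_surj[OF XX W_zero, of "M X (D - E) h'"] M_comp[OF XX ED(2) hG'] d1(2) by metis
  have one0: "\<one>\<^bsub>FA\<^esub> \<in> Gam X 0" by (rule one_Gam) simp
  have "M X 0 (c \<otimes>\<^bsub>FA\<^esub> c') = M X 0 c \<otimes>\<^bsub>RX\<^esub> M X 0 c'" using M_mult[OF XX W_zero W_zero c(1) c'(1)] by simp
  also have "\<dots> = M X 0 \<one>\<^bsub>FA\<^esub>" using M_mult[OF XX ED hG hG'] h'(2) c(2) c'(2) by simp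
  finally have cc: "c \<otimes>\<^bsub>FA\<^esub> c' = \<one>\<^bsub>FA\<^esub>"
    using M_inj[OF XX W_zero _ one0] Gam_mult[OF c(1) c'(1)] by simp
  have cz: "c \<noteq> \<zero>\<^bsub>FA\<^esub>" "c' \<noteq> \<zero>\<^bsub>FA\<^esub>"
    using cc one_QZ FA.l_null[OF Gam_closed[OF c'(1)]] FA.r_null[OF Gam_closed[OF c(1)]] by (metis DiffD2 singletonI)+
  note cQ = Gam_QZ[OF c(1) cz(1)] and cQ' = Gam_QZ[OF c'(1) cz(2)]
  \<comment> \<open>Both \<open>c\<close> and its inverse are regular, so their values are opposite
    and non-negative.\<close>
  have vc: "val Y c = 0"
    using val_inv[OF Y cQ cQ' cc] GamD[OF c(1) cz(1) Y min_prime_in_X[OF Y]] GamD[OF c'(1) cz(2) Y min_prime_in_X[OF Y]] by simp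
  have xE: "x \<otimes>\<^bsub>FA\<^esub> h \<in> Gam X E" using Gam_mult[OF D(2) hG] by simp
  have yE: "c \<otimes>\<^bsub>FA\<^esub> y \<in> Gam X E" using Gam_mult[OF c(1) E(2)] by simp
  have cl: "M X D x \<in> carrier RX" "M X 0 c \<in> carrier RX"
    using M_closed[OF XX D(1,2)] M_closed[OF XX W_zero c(1)] by auto
  have "M X E (x \<otimes>\<^bsub>FA\<^esub> h) = M X D x \<otimes>\<^bsub>RX\<^esub> M X 0 c"
    using M_mult[OF XX D(1) ED(1) D(2) hG] c(2) by simp
  also have "\<dots> = M X 0 c \<otimes>\<^bsub>RX\<^esub> M X E y" using eq cl R.m_comm by simp
  also have "\<dots> = M X E (c \<otimes>\<^bsub>FA\<^esub> y)" using M_mult[OF XX W_zero E(1) c(1) E(2)] by simp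
  finally have xh: "x \<otimes>\<^bsub>FA\<^esub> h = c \<otimes>\<^bsub>FA\<^esub> y" using M_inj[OF XX E(1) xE yE] by blast
  have yz: "y \<noteq> \<zero>\<^bsub>FA\<^esub>" using M_eq_zero_iff[OF XX E] nz eq by simp
  have "val Y x + val Y h = val Y c + val Y y"
    using val_mult[OF Y Gam_QZ[OF D(2,3)] h(1)] val_mult[OF Y cQ Gam_QZ[OF E(2) yz]] xh by simp
  then show ?thesis using vh[OF Y] vc by simp
qed

text \<open>The order of vanishing of \<open>s\<close> along \<open>Y\<close>; for non-zero
  homogeneous \<open>s\<close>, \<open>M_eq_imp_val\<close> makes the choice of a representation
  irrelevant.\<close>

definition dv :: "'s \<Rightarrow> 'a set \<Rightarrow> int" where
  "dv s Y = (SOME n. \<exists>D\<in>W. \<exists>x\<in>Gam X D. x \<noteq> \<zero>\<^bsub>FA\<^esub> \<and> s = M X D x \<and> n = val Y x + Poly_Mapping.lookup D Y)"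

lemma dv_M:
  assumes "D \<in> W" "x \<in> Gam X D" "x \<noteq> \<zero>\<^bsub>FA\<^esub>" "min_prime Y"
  shows "dv (M X D x) Y = val Y x + Poly_Mapping.lookup D Y"
  unfolding dv_def
proof (rule some_equality)
  fix n assume "\<exists>E\<in>W. \<exists>y\<in>Gam X E. y \<noteq> \<zero>\<^bsub>FA\<^esub> \<and> M X D x = M X E y \<and> n = val Y y + Poly_Mapping.lookup E Y"
  then show "n = val Y x + Poly_Mapping.lookup D Y" using M_eq_imp_val[OF assms(1-3) _ _ _ assms(4)] by metis
qed (use assms in blast)

lemma dv_mult:
  assumes "s \<in> R.H" "t \<in> R.H" "min_prime Y"
  shows "dv (s \<otimes>\<^bsub>RX\<^esub> t) Y = dv s Y + dv t Y"
proof -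
  obtain D x where D: "D \<in> W" "x \<in> Gam X D" "x \<noteq> \<zero>\<^bsub>FA\<^esub>" "s = M X D x" using homog_sec_cases[OF XX assms(1)] .
  obtain E y where E: "E \<in> W" "y \<in> Gam X E" "y \<noteq> \<zero>\<^bsub>FA\<^esub>" "t = M X E y" using homog_sec_cases[OF XX assms(2)] .
  note xQ = Gam_QZ[OF D(2,3)] and yQ = Gam_QZ[OF E(2,3)]
  have "s \<otimes>\<^bsub>RX\<^esub> t = M X (D + E) (x \<otimes>\<^bsub>FA\<^esub> y)" using M_mult[OF XX D(1) E(1) D(2) E(2)] D(4) E(4) by simp
  then show ?thesis
    using dv_M[OF D(1-3) assms(3)] dv_M[OF E(1-3) assms(3)] D(4) E(4) val_mult[OF assms(3) xQ yQ]
      dv_M[OF W_add[OF D(1) E(1)] Gam_mult[OF D(2) E(2)] _ assms(3)] QZ_mult[OF xQ yQ] by (simp add: lookup_add)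
qed

lemma dv_nonneg: "\<lbrakk>s \<in> R.H; min_prime Y\<rbrakk> \<Longrightarrow> 0 \<le> dv s Y"
proof -
  assume s: "s \<in> R.H" and Y: "min_prime Y"
  obtain D x where D: "D \<in> W" "x \<in> Gam X D" "x \<noteq> \<zero>\<^bsub>FA\<^esub>" "s = M X D x" using homog_sec_cases[OF XX s] .
  show "0 \<le> dv s Y" using dv_M[OF D(1-3) Y] GamD[OF D(2,3) Y min_prime_in_X[OF Y]] D(4) by simp
qed

lemma finite_dv:
  assumes "s \<in> R.H"
  shows "finite {Y. min_prime Y \<and> dv s Y \<noteq> 0}"
proof -
  obtain D x where D: "D \<in> W" "x \<in> Gam X D" "x \<noteq> \<zero>\<^bsub>FA\<^esub>" "s = M X D x" using homog_sec_cases[OF XX assms] .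
  have "{Y. min_prime Y \<and> dv s Y \<noteq> 0} \<subseteq> {Y. min_prime Y \<and> val Y x \<noteq> 0} \<union> {Y. Poly_Mapping.lookup D Y \<noteq> 0}"
    using dv_M[OF D(1-3)] D(4) by auto
  then show ?thesis using finite_val[OF Gam_QZ[OF D(2,3)]] finite_lookup finite_subset by blast
qed

text \<open>If \<open>s\<close> and \<open>t\<close> come from \<open>x\<close> and
  \<open>y\<close>, the inequalities between the values say that \<open>y / x\<close> gives a
  section for the divisor \<open>E - D\<close>.\<close>

lemma dv_divides:
  assumes "s \<in> R.H" "t \<in> R.H" and le: "\<And>Y. min_prime Y \<Longrightarrow> dv s Y \<le> dv t Y"
  shows "\<exists>c\<in>R.H. t = s \<otimes>\<^bsub>RX\<^esub> c"
proof -
  obtain D x where D: "D \<in> W" "x \<in> Gam X D" "x \<noteq> \<zero>\<^bsub>FA\<^esub>" "s = M X D x" using homog_sec_cases[OF XX assms(1)] .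
  obtain E y where E: "E \<in> W" "y \<in> Gam X E" "y \<noteq> \<zero>\<^bsub>FA\<^esub>" "t = M X E y" using homog_sec_cases[OF XX assms(2)] .
  note xQ = Gam_QZ[OF D(2,3)] and yQ = Gam_QZ[OF E(2,3)]
  obtain x' where x': "x' \<in> QZ" "x \<otimes>\<^bsub>FA\<^esub> x' = \<one>\<^bsub>FA\<^esub>" using QZ_inv[OF xQ] .
  let ?z = "y \<otimes>\<^bsub>FA\<^esub> x'"
  have zQ: "?z \<in> QZ" using QZ_mult[OF yQ x'(1)] .
  have zG: "?z \<in> Gam X (E - D)"
  proof (rule GamI)
    show "0 \<le> val Y ?z + Poly_Mapping.lookup (E - D) Y" if "min_prime Y" for Y
      using le[OF that] dv_M[OF D(1-3) that] dv_M[OF E(1-3) that] D(4) E(4) val_mult[OF that yQ x'(1)]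
        val_inv[OF that xQ x'] by (simp add: lookup_minus)
  qed (use zQ in simp)
  have "x \<otimes>\<^bsub>FA\<^esub> ?z = y" using xQ yQ x' by (simp add: FA.m_lcomm[of x y x'])
  then have "t = s \<otimes>\<^bsub>RX\<^esub> M X (E - D) ?z"
    using M_mult[OF XX D(1) W_diff[OF E(1) D(1)] D(2) zG] D(4) E(4) by simp
  moreover have "M X (E - D) ?z \<in> R.H" using M_homog[OF XX W_diff[OF E(1) D(1)] zG] zQ by simp
  ultimately show ?thesis by blast
qed

lemma dv_one: "min_prime Y \<Longrightarrow> dv \<one>\<^bsub>RX\<^esub> Y = 0"
  using dv_mult[OF R.one_homog R.one_homog] by simp

section \<open>Factoriality of the ring of global sections\<close>

definition xe :: "'a set \<Rightarrow> 's" where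
  "xe Y = M X (Poly_Mapping.single Y 1) \<one>\<^bsub>FA\<^esub>"

lemma single_W: "min_prime Y \<Longrightarrow> Poly_Mapping.single Y (1::int) \<in> W"
  by simp

lemma dv_xe: "\<lbrakk>min_prime Y; min_prime Y'\<rbrakk> \<Longrightarrow> dv (xe Y) Y' = (if Y' = Y then 1 else 0)"
  using dv_M[OF single_W one_Gam] one_QZ by (auto simp: xe_def lookup_single when_def val_one)

lemma xe_homog: "min_prime Y \<Longrightarrow> xe Y \<in> R.H"
  unfolding xe_def using one_QZ by (intro M_homog[OF XX single_W one_Gam]) (auto simp: lookup_single when_def)

lemma M_divides_iff: "a divides\<^bsub>R.M\<^esub> b \<longleftrightarrow> (\<exists>c\<in>R.H. b = a \<otimes>\<^bsub>RX\<^esub> c)"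
  by (simp add: factor_def)

lemma dv_divides_iff:
  assumes "s \<in> R.H" "t \<in> R.H"
  shows "s divides\<^bsub>R.M\<^esub> t \<longleftrightarrow> (\<forall>Y. min_prime Y \<longrightarrow> dv s Y \<le> dv t Y)"
proof
  assume "s divides\<^bsub>R.M\<^esub> t"
  then obtain c where c: "c \<in> R.H" "t = s \<otimes>\<^bsub>RX\<^esub> c" by (auto simp: M_divides_iff)
  then show "\<forall>Y. min_prime Y \<longrightarrow> dv s Y \<le> dv t Y" using dv_mult[OF assms(1) c(1)] dv_nonneg[OF c(1)] by simp
qed (use dv_divides[OF assms] M_divides_iff in blast)

lemma xe_divides_iff:
  assumes Y: "min_prime Y" and s: "s \<in> R.H"
  shows "xe Y divides\<^bsub>R.M\<^esub> s \<longleftrightarrow> 0 < dv s Y"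
proof -
  have "(\<forall>Y'. min_prime Y' \<longrightarrow> dv (xe Y) Y' \<le> dv s Y') \<longleftrightarrow> 0 < dv s Y"
    using dv_xe[OF Y] dv_nonneg[OF s] Y by force
  then show ?thesis using dv_divides_iff[OF xe_homog[OF Y] s] by simp
qed

lemma unit_iff_dv: "s \<in> R.H \<Longrightarrow> s \<in> Units R.M \<longleftrightarrow> (\<forall>Y. min_prime Y \<longrightarrow> dv s Y = 0)"
proof -
  assume s: "s \<in> R.H"
  interpret M: comm_monoid_cancel R.M by (rule R.comm_monoid_cancel_homog)
  have "s \<in> Units R.M \<longleftrightarrow> s divides\<^bsub>R.M\<^esub> \<one>\<^bsub>RX\<^esub>"
    using M.Unit_eq_dividesone[of s] s by simp
  also have "\<dots> \<longleftrightarrow> (\<forall>Y. min_prime Y \<longrightarrow> dv s Y = 0)"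
    unfolding dv_divides_iff[OF s R.one_homog] using dv_one dv_nonneg[OF s] by force
  finally show ?thesis .
qed

text \<open>The sum of all values; it measures proper divisibility and yields the divisor chain
  condition.\<close>

definition sz :: "'s \<Rightarrow> nat" where
  "sz s = (\<Sum>Y\<in>{Y. min_prime Y \<and> dv s Y \<noteq> 0}. nat (dv s Y))"

lemma sz_less:
  assumes s: "s \<in> R.H" and t: "t \<in> R.H" and pf: "properfactor R.M s t"
  shows "sz s < sz t"
proof -
  have le: "dv s Y \<le> dv t Y" if "min_prime Y" for Y
    using pf dv_divides_iff[OF s t] that by (auto simp: properfactor_def)
  obtain Y0 where Y0: "min_prime Y0" "dv s Y0 < dv t Y0"
    using pf dv_divides_iff[OF t s] by (auto simp: properfactor_def not_le)
  let ?S = "{Y. min_prime Y \<and> dv s Y \<noteq> 0}" and ?T = "{Y. min_prime Y \<and> dv t Y \<noteq> 0}"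
  have sub: "?S \<subseteq> ?T" using le dv_nonneg[OF s] dv_nonneg[OF t] by force
  have "sz s = (\<Sum>Y\<in>?T. nat (dv s Y))"
    unfolding sz_def using finite_dv[OF t] sub by (intro sum.mono_neutral_left) auto
  also have "\<dots> < sz t" unfolding sz_def
  proof (rule sum_strict_mono_ex1[OF finite_dv[OF t]])
    show "\<forall>Y\<in>?T. nat (dv s Y) \<le> nat (dv t Y)" using le by (auto intro: nat_mono)
    have "Y0 \<in> ?T" "nat (dv s Y0) < nat (dv t Y0)" using Y0 dv_nonneg[OF s Y0(1)] by auto
    then show "\<exists>Y\<in>?T. nat (dv s Y) < nat (dv t Y)" by blast
  qed
  finally show ?thesis .
qed

text \<open>An irreducible \<open>a\<close> has positive value at some \<open>Y\<close>, hence is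
  divisible by \<open>xe Y\<close> and, being irreducible, associated with it. Divisibility by
  \<open>a\<close> then means positive value at \<open>Y\<close>, and primality follows from
  additivity of the values.\<close>

theorem graded_factorial_RX: "graded_factorial K RX GX"
  unfolding graded_factorial_def
proof (intro conjI R.integral)
  interpret M: comm_monoid_cancel R.M by (rule R.comm_monoid_cancel_homog)
  have cM: "carrier R.M = R.H" by simp
  have "{(x, y). x \<in> carrier R.M \<and> y \<in> carrier R.M \<and> properfactor R.M x y} \<subseteq> measure sz"
    using sz_less by auto
  then have "wf {(x, y). x \<in> carrier R.M \<and> y \<in> carrier R.M \<and> properfactor R.M x y}"
    using wf_subset wf_measure by blast
  then have dcc: "divisor_chain_condition_monoid R.M" by unfold_locales
  have "prime R.M a" if a: "a \<in> R.H" and irr: "irreducible R.M a" for a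
  proof -
    have nu: "a \<notin> Units R.M" and ir: "\<And>b. \<lbrakk>b \<in> R.H; properfactor R.M b a\<rbrakk> \<Longrightarrow> b \<in> Units R.M"
      using irr by (auto simp: irreducible_def)
    obtain Y where Y: "min_prime Y" "dv a Y \<noteq> 0" using nu unit_iff_dv[OF a] by blast
    then have pos: "0 < dv a Y" using dv_nonneg[OF a Y(1)] by simp
    then have div: "xe Y divides\<^bsub>R.M\<^esub> a" using xe_divides_iff[OF Y(1) a] by simp
    have "xe Y \<notin> Units R.M" using unit_iff_dv[OF xe_homog[OF Y(1)]] dv_xe[OF Y(1) Y(1)] Y(1) by auto
    then have "a divides\<^bsub>R.M\<^esub> xe Y" using ir[OF xe_homog[OF Y(1)]] div by (auto simp: properfactor_def)
    then have le: "dv a Y' \<le> (if Y' = Y then 1 else 0)" if "min_prime Y'" for Y'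
      using dv_divides_iff[OF a xe_homog[OF Y(1)]] dv_xe[OF Y(1) that] that by metis
    have iff: "a divides\<^bsub>R.M\<^esub> s \<longleftrightarrow> 0 < dv s Y" if s: "s \<in> R.H" for s
    proof -
      have "(\<forall>Y'. min_prime Y' \<longrightarrow> dv a Y' \<le> dv s Y') \<longleftrightarrow> 0 < dv s Y"
      proof
        assume "\<forall>Y'. min_prime Y' \<longrightarrow> dv a Y' \<le> dv s Y'"
        then show "0 < dv s Y" using Y(1) pos by force
      next
        assume p: "0 < dv s Y"
        show "\<forall>Y'. min_prime Y' \<longrightarrow> dv a Y' \<le> dv s Y'"
        proof (intro allI impI)
          fix Y' assume Y': "min_prime Y'"
          show "dv a Y' \<le> dv s Y'" using le[OF Y'] p dv_nonneg[OF s Y'] by (cases "Y' = Y") auto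
        qed
      qed
      then show ?thesis using dv_divides_iff[OF a s] by simp
    qed
    show ?thesis unfolding prime_def cM
    proof (intro conjI ballI impI nu)
      fix b c assume bc: "b \<in> R.H" "c \<in> R.H" "a divides\<^bsub>R.M\<^esub> b \<otimes>\<^bsub>R.M\<^esub> c"
      then have "0 < dv b Y + dv c Y" using iff[OF R.homog_mult[OF bc(1,2)]] dv_mult[OF bc(1,2) Y(1)] by simp
      then show "a divides\<^bsub>R.M\<^esub> b \<or> a divides\<^bsub>R.M\<^esub> c" using iff[OF bc(1)] iff[OF bc(2)] by auto
    qed
  qed
  then have "primeness_condition_monoid R.M" by unfold_locales simp
  then show "factorial_monoid R.M" using dcc factorial_condition_one by blast
qed

sublocale R: graded_ufd K RX GX
  by unfold_locales (rule graded_factorial_RX)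

lemma xe_prime: "min_prime Y \<Longrightarrow> xe Y \<in> R.prime_elems"
proof -
  assume Y: "min_prime Y"
  have "xe Y \<notin> Units R.M" using unit_iff_dv[OF xe_homog[OF Y]] dv_xe[OF Y Y] Y by auto
  moreover have "xe Y divides\<^bsub>R.M\<^esub> b \<or> xe Y divides\<^bsub>R.M\<^esub> c"
    if bc: "b \<in> R.H" "c \<in> R.H" "xe Y divides\<^bsub>R.M\<^esub> b \<otimes>\<^bsub>RX\<^esub> c" for b c
    using xe_divides_iff[OF Y R.homog_mult[OF bc(1,2)]] xe_divides_iff[OF Y bc(1)] xe_divides_iff[OF Y bc(2)]
      dv_mult[OF bc(1,2) Y] bc(3) by auto
  ultimately show ?thesis using xe_homog[OF Y] by (auto simp: R.prime_elems_def prime_def)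
qed

lemma mlt_xe:
  assumes Y: "min_prime Y" and s: "s \<in> R.H"
  shows "int (R.mlt (xe Y) s) = dv s Y"
proof -
  let ?n = "R.mlt (xe Y) s"
  obtain b where b: "b \<in> R.H" "s = xe Y [^]\<^bsub>RX\<^esub> ?n \<otimes>\<^bsub>RX\<^esub> b" "\<not> xe Y divides\<^bsub>R.M\<^esub> b"
    using R.mlt_decomp[OF xe_prime[OF Y] s] .
  have pw: "dv (xe Y [^]\<^bsub>RX\<^esub> n) Y = int n" for n :: nat
    by (induction n) (simp_all add: dv_one[OF Y] dv_mult[OF R.homog_pow[OF xe_homog[OF Y]] xe_homog[OF Y] Y] dv_xe[OF Y Y])
  have "dv b Y = 0" using b(3) xe_divides_iff[OF Y b(1)] dv_nonneg[OF b(1) Y] by simp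
  then have "dv (xe Y [^]\<^bsub>RX\<^esub> ?n \<otimes>\<^bsub>RX\<^esub> b) Y = int ?n"
    using dv_mult[OF R.homog_pow[OF xe_homog[OF Y]] b(1) Y] pw by simp
  then show ?thesis using b(2) by simp
qed

text \<open>Every prime element has positive value at some \<open>Y\<close> and therefore is
  associated with \<open>xe Y\<close>, whose multiplicity is the value at \<open>Y\<close>.\<close>

lemma essential_valuations_RX:
  "essential_valuations K RX GX = (\<lambda>Y. frac_val K RX GX (\<lambda>s. dv s Y)) ` {Y. min_prime Y}"
proof -
  have eq: "frac_val K RX GX (\<lambda>a. int (R.mlt x a)) = frac_val K RX GX (\<lambda>s. dv s Y)"
    if x: "x \<in> R.prime_elems" and Y: "min_prime Y" and c: "cgenideal RX x = cgenideal RX (xe Y)" for x Y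
  proof (rule R.frac_val_eqI)
    show "frac_val K RX GX (\<lambda>s. dv s Y) \<in> extensional (homog K R.FR R.FG)" by (rule R.frac_val_ext)
    show "int (R.mlt x (a \<otimes>\<^bsub>RX\<^esub> b)) = int (R.mlt x a) + int (R.mlt x b)" if "a \<in> R.H" "b \<in> R.H" for a b
      using R.mlt_mult[OF x that] by simp
    have m: "int (R.mlt x a) = dv a Y" if "a \<in> R.H" for a
      using R.mlt_cong[OF x xe_prime[OF Y] c that] mlt_xe[OF Y that] by simp
    show "frac_val K RX GX (\<lambda>s. dv s Y) (R.fr a s) = int (R.mlt x a) - int (R.mlt x s)"
      if "a \<in> R.H" "s \<in> R.H" for a s
      using R.frac_val_fr[OF dv_mult[OF _ _ Y] that] m that by simp
  qed
  show ?thesis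
  proof (intro equalityI subsetI)
    fix \<nu> assume "\<nu> \<in> essential_valuations K RX GX"
    then obtain x where x: "x \<in> R.prime_elems" "\<nu> = frac_val K RX GX (\<lambda>a. int (R.mlt x a))"
      unfolding R.essential_valuations_ufd by blast
    note x' = R.prime_elemD(1,2)[OF x(1)]
    obtain Y where Y: "min_prime Y" "dv x Y \<noteq> 0" using x'(2) unit_iff_dv[OF x'(1)] by blast
    then have "xe Y divides\<^bsub>R.M\<^esub> x" using xe_divides_iff[OF Y(1) x'(1)] dv_nonneg[OF x'(1) Y(1)] by simp
    then have "cgenideal RX x = cgenideal RX (xe Y)" using R.prime_elem_associated[OF xe_prime[OF Y(1)] x(1)] by simp
    then show "\<nu> \<in> (\<lambda>Y. frac_val K RX GX (\<lambda>s. dv s Y)) ` {Y. min_prime Y}" using eq[OF x(1) Y(1)] x(2) Y(1) by blast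
  next
    fix \<nu> assume "\<nu> \<in> (\<lambda>Y. frac_val K RX GX (\<lambda>s. dv s Y)) ` {Y. min_prime Y}"
    then show "\<nu> \<in> essential_valuations K RX GX"
      unfolding R.essential_valuations_ufd using eq[OF xe_prime _ refl] xe_prime by (auto intro!: image_eqI)
  qed
qed

section \<open>Functions as sections of neutral degree\<close>

definition emb :: "'a \<Rightarrow> 's" where
  "emb a = M X 0 (q a \<one>)"

lemma q_Gam: "a \<in> carrier A \<Longrightarrow> q a \<one> \<in> Gam X 0"
  unfolding Gam_X0 by blast

lemma q_one_add: "\<lbrakk>a \<in> carrier A; b \<in> carrier A\<rbrakk> \<Longrightarrow> q a \<one> \<oplus>\<^bsub>FA\<^esub> q b \<one> = q (a \<oplus> b) \<one>"
  using D.fr_add_same[of a \<one> b] by simp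

lemma q_one_mult: "\<lbrakk>a \<in> carrier A; b \<in> carrier A\<rbrakk> \<Longrightarrow> q a \<one> \<otimes>\<^bsub>FA\<^esub> q b \<one> = q (a \<otimes> b) \<one>"
  using q_mult[of a \<one> b \<one>] by simp

lemma emb_hom: "emb \<in> ring_hom A RX"
proof (rule ring_hom_memI)
  fix a assume a: "a \<in> carrier A"
  show "emb a \<in> carrier RX" unfolding emb_def by (rule M_closed[OF XX W_zero q_Gam[OF a]])
  fix b assume b: "b \<in> carrier A"
  show "emb (a \<otimes> b) = emb a \<otimes>\<^bsub>RX\<^esub> emb b"
    using M_mult[OF XX W_zero W_zero q_Gam[OF a] q_Gam[OF b]] q_one_mult[OF a b] by (simp add: emb_def)
  show "emb (a \<oplus> b) = emb a \<oplus>\<^bsub>RX\<^esub> emb b"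
    using M_add[OF XX W_zero q_Gam[OF a] q_Gam[OF b]] q_one_add[OF a b] by (simp add: emb_def)
qed (use M_one[OF XX] in \<open>simp add: emb_def q_one\<close>)

lemma emb_bij: "bij_betw emb (carrier A) (GX \<one>\<^bsub>K\<^esub>)"
proof -
  have "inj_on (\<lambda>a. q a \<one>) (carrier A)" by (auto simp: inj_on_def q_eq_iff)
  then have "bij_betw (\<lambda>a. q a \<one>) (carrier A) (Gam X 0)" using Gam_X0 by (simp add: bij_betw_def)
  then have "bij_betw (M X 0 \<circ> (\<lambda>a. q a \<one>)) (carrier A) (hcomp F X (\<delta> 0))"
    using bij_betw_trans M_bij[OF XX W_zero] by blast
  then show ?thesis by (simp add: deg_zero emb_def[abs_def] comp_def)
qed

sublocale L: graded_alg A V K RX GX emb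
  using emb_hom emb_bij by unfold_locales (auto simp: bij_betw_def)

lemma dv_emb: "\<lbrakk>min_prime Y; a \<in> Z\<rbrakk> \<Longrightarrow> dv (emb a) Y = ord Y a"
proof -
  assume Y: "min_prime Y" and a: "a \<in> Z"
  have "q a \<one> \<noteq> \<zero>\<^bsub>FA\<^esub>" using q_in_QZ[OF a, of \<one>] by simp
  then show "dv (emb a) Y = ord Y a"
    using dv_M[OF W_zero q_Gam _ Y, of a] val_q[OF Y a, of \<one>] ord_one[OF Y] a by (simp add: emb_def)
qed

text \<open>If all values of \<open>M X D x\<close> vanish, then \<open>D\<close> is the divisor of
  the inverse of \<open>x\<close>, so it is principal and its degree is neutral.\<close>

lemma units_RX: "homog_units K RX GX = Units (degree_zero_ring K RX GX)"
proof (intro equalityI subsetI)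
  have deg1: "s \<in> GX \<one>\<^bsub>K\<^esub>" if s: "s \<in> Units R.M" for s
  proof -
    have sH: "s \<in> R.H" using R.M.Units_closed[OF s] by simp
    obtain D x where D: "D \<in> W" "x \<in> Gam X D" "x \<noteq> \<zero>\<^bsub>FA\<^esub>" "s = M X D x" using homog_sec_cases[OF XX sH] .
    obtain x' where x': "x' \<in> QZ" "x \<otimes>\<^bsub>FA\<^esub> x' = \<one>\<^bsub>FA\<^esub>" using QZ_inv[OF Gam_QZ[OF D(2,3)]] .
    have "D = pdiv x'"
    proof (rule poly_mapping_eqI)
      fix Y show "Poly_Mapping.lookup D Y = Poly_Mapping.lookup (pdiv x') Y"
      proof (cases "min_prime Y")
        case True
        then have "val Y x + Poly_Mapping.lookup D Y = 0" using dv_M[OF D(1-3) True] D(4) s unit_iff_dv[OF sH] by simp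
        then show ?thesis using lookup_pdiv[OF x'(1), of Y] val_inv[OF True Gam_QZ[OF D(2,3)] x'] True by simp
      qed (use lookup_pdiv[OF x'(1), of Y] W_lookup[OF D(1)] in simp)
    qed
    then have "\<delta> D = \<one>\<^bsub>K\<^esub>" using deg_one_iff[OF D(1)] x'(1) by blast
    then show ?thesis using M_comp[OF XX D(1,2)] D(4) by simp
  qed
  fix u assume "u \<in> homog_units K RX GX"
  then have u: "u \<in> Units R.M" using R.Units_homog by simp
  then obtain v where v: "v \<in> R.H" "u \<otimes>\<^bsub>RX\<^esub> v = \<one>\<^bsub>RX\<^esub>" "v \<otimes>\<^bsub>RX\<^esub> u = \<one>\<^bsub>RX\<^esub>"
    unfolding Units_def by auto
  then have "v \<in> Units R.M" using u unfolding Units_def by auto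
  then show "u \<in> Units (degree_zero_ring K RX GX)"
    using deg1[OF u] deg1[of v] v unfolding Units_def degree_zero_ring_def by auto
next
  fix u assume "u \<in> Units (degree_zero_ring K RX GX)"
  then obtain v where v: "u \<in> GX \<one>\<^bsub>K\<^esub>" "v \<in> GX \<one>\<^bsub>K\<^esub>" "u \<otimes>\<^bsub>RX\<^esub> v = \<one>\<^bsub>RX\<^esub>" "v \<otimes>\<^bsub>RX\<^esub> u = \<one>\<^bsub>RX\<^esub>"
    unfolding Units_def degree_zero_ring_def by auto
  have c: "u \<in> carrier RX" "v \<in> carrier RX" using v(1,2) R.comp_closed by blast+
  have "u \<noteq> \<zero>\<^bsub>RX\<^esub>" using v(3) c R.one_not_zero by auto
  then have "u \<in> R.H" using R.homogI[OF v(1)] by simp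
  then show "u \<in> homog_units K RX GX" using v c unfolding homog_units_def Units_def by blast
qed

end

section \<open>The ring of degree zero\<close>

context graded_domain
begin

abbreviation R0 where "R0 \<equiv> degree_zero_ring K R G"

lemma R0_simps [simp]: "carrier R0 = G \<one>\<^bsub>K\<^esub>" "mult R0 = mult R" "one R0 = one R" "zero R0 = zero R" "add R0 = add R"
  by (simp_all add: degree_zero_ring_def)

lemma domain_R0: "domain R0"
proof -
  have "subring (G \<one>\<^bsub>K\<^esub>) R"
  proof (rule subringI)
    show "G \<one>\<^bsub>K\<^esub> \<subseteq> carrier R" using comp_closed by blast
    show "\<one> \<in> G \<one>\<^bsub>K\<^esub>" by (rule one_comp)
    show "\<ominus> a \<in> G \<one>\<^bsub>K\<^esub>" if "a \<in> G \<one>\<^bsub>K\<^esub>" for a using comp_minus that by simp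
    show "a \<otimes> b \<in> G \<one>\<^bsub>K\<^esub>" if "a \<in> G \<one>\<^bsub>K\<^esub>" "b \<in> G \<one>\<^bsub>K\<^esub>" for a b
      using comp_mult[OF K.one_closed K.one_closed that] by simp
    show "a \<oplus> b \<in> G \<one>\<^bsub>K\<^esub>" if "a \<in> G \<one>\<^bsub>K\<^esub>" "b \<in> G \<one>\<^bsub>K\<^esub>" for a b using comp_add that by simp
  qed
  then have "subcring (G \<one>\<^bsub>K\<^esub>) R" by (rule subcringI')
  then have cr: "cring R0" using subcring_iff comp_closed unfolding degree_zero_ring_def by blast
  show ?thesis
  proof (rule domainI[OF cr])
    show "\<one>\<^bsub>R0\<^esub> \<noteq> \<zero>\<^bsub>R0\<^esub>" using one_not_zero by simp
    fix a b assume ab: "a \<otimes>\<^bsub>R0\<^esub> b = \<zero>\<^bsub>R0\<^esub>" "a \<in> carrier R0" "b \<in> carrier R0"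
    then have "b = \<zero>" if "a \<noteq> \<zero>"
      using homog_integral[OF homogI[of a "\<one>\<^bsub>K\<^esub>"], of b] that comp_closed by simp
    then show "a = \<zero>\<^bsub>R0\<^esub> \<or> b = \<zero>\<^bsub>R0\<^esub>" by auto
  qed
qed

lemma degree_zero_frac_fraction:
  assumes a: "a \<in> G \<one>\<^bsub>K\<^esub>" and s: "s \<in> G \<one>\<^bsub>K\<^esub>" "s \<noteq> \<zero>"
  shows "degree_zero_frac K R G (fraction R0 (homog zero_group R0 (trivial_grading R0)) a s) = fr a s"
proof -
  interpret R0: graded_domain zero_group R0 "trivial_grading R0"
    by (rule domain.graded_domain_trivial[OF domain_R0])
  have mem: "x \<in> homog zero_group R0 (trivial_grading R0) \<longleftrightarrow> x \<in> G \<one>\<^bsub>K\<^esub> \<and> x \<noteq> \<zero>" for x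
    by (simp add: homog_trivial)
  have iff: "(b, t) \<in> fraction R0 (homog zero_group R0 (trivial_grading R0)) a s \<longleftrightarrow>
      b \<in> G \<one>\<^bsub>K\<^esub> \<and> t \<in> G \<one>\<^bsub>K\<^esub> \<and> t \<noteq> \<zero> \<and> a \<otimes> t = b \<otimes> s" for b t
    using R0.Q.mem_fraction_iff[of a s b t] a s mem by auto
  have "fr b t = fr a s" if "(b, t) \<in> fraction R0 (homog zero_group R0 (trivial_grading R0)) a s" for b t
    using that a s homogI[of t "\<one>\<^bsub>K\<^esub>"] homogI[of s "\<one>\<^bsub>K\<^esub>"] comp_closed unfolding iff
    by (intro fr_eqI) auto
  note eq = this
  show ?thesis
    unfolding degree_zero_frac_def
  proof (rule UN_constant_eq)
    show "(a, s) \<in> fraction R0 (homog zero_group R0 (trivial_grading R0)) a s"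
      unfolding iff using a s by blast
  qed (auto simp: eq)
qed

end

locale graded_alg_iso = graded_alg +
  assumes \<phi>_bij: "bij_betw \<phi> (carrier A) (G \<one>\<^bsub>K\<^esub>)"
begin

sublocale I: domain_iso A V R0 \<phi>
proof (intro domain_iso.intro domain_iso_axioms.intro)
  show "weighted_domain A V" by (rule A.weighted_domain_axioms)
  show "cring R0" using domain_R0 by (simp add: domain_def)
  show "\<phi> \<in> ring_hom A R0" using \<phi>_hom \<phi>_comp by (auto simp: ring_hom_def)
  show "bij_betw \<phi> (carrier A) (carrier R0)" using \<phi>_bij by simp
qed

lemma R0_cases:
  assumes "b \<in> G \<one>\<^bsub>K\<^esub>"
  obtains a where "a \<in> carrier A" "b = \<phi> a"
  using assms \<phi>_bij by (auto simp: bij_betw_def)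

lemma degree_zero_frac_image:
  "degree_zero_frac K R G ` carrier (fraction_field R0) =
     {fr (\<phi> a) (\<phi> f) | a f. a \<in> carrier A \<and> f \<in> carrier A \<and> f \<noteq> \<zero>\<^bsub>A\<^esub>}"
proof (intro equalityI subsetI)
  fix z assume "z \<in> degree_zero_frac K R G ` carrier (fraction_field R0)"
  then obtain x where x: "x \<in> carrier (fraction_field R0)" "z = degree_zero_frac K R G x" by blast
  obtain b t where bt: "b \<in> carrier R0" "t \<in> I.B.D.H" "x = I.B.q b t"
    using I.B.D.fr_cases[OF x(1)] .
  then have t: "t \<in> G \<one>\<^bsub>K\<^esub>" "t \<noteq> \<zero>" by (auto simp: homog_trivial)
  obtain a where a: "a \<in> carrier A" "b = \<phi> a" using R0_cases[of b] bt(1) by auto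
  obtain f where f: "f \<in> carrier A" "t = \<phi> f" using R0_cases[OF t(1)] .
  have "z = fr (\<phi> a) (\<phi> f)" using x(2) bt degree_zero_frac_fraction[OF _ t, of b] a(2) f(2) by simp
  moreover have "f \<noteq> \<zero>\<^bsub>A\<^esub>" using t(2) f by auto
  ultimately show "z \<in> {fr (\<phi> a) (\<phi> f) | a f. a \<in> carrier A \<and> f \<in> carrier A \<and> f \<noteq> \<zero>\<^bsub>A\<^esub>}" using a f by blast
next
  fix z assume "z \<in> {fr (\<phi> a) (\<phi> f) | a f. a \<in> carrier A \<and> f \<in> carrier A \<and> f \<noteq> \<zero>\<^bsub>A\<^esub>}"
  then obtain a f where h: "a \<in> carrier A" "f \<in> carrier A" "f \<noteq> \<zero>\<^bsub>A\<^esub>" "z = fr (\<phi> a) (\<phi> f)" by blast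
  have f0: "\<phi> f \<noteq> \<zero>" using \<phi>_eq_zero_iff h by simp
  have "I.B.q (\<phi> a) (\<phi> f) \<in> carrier (fraction_field R0)"
    using \<phi>_comp h f0 by (intro I.B.D.fr_closed) (auto simp: homog_trivial)
  moreover have "z = degree_zero_frac K R G (I.B.q (\<phi> a) (\<phi> f))"
    using degree_zero_frac_fraction[OF \<phi>_comp[OF h(1)] \<phi>_comp[OF h(2)] f0] h(4) by simp
  ultimately show "z \<in> degree_zero_frac K R G ` carrier (fraction_field R0)" by blast
qed

text \<open>Formulated for any additive \<open>v\<close>, as it is applied to the values
  \<open>dv\<close> of a Cox sheaf as well as to multiplicities of prime elements.\<close>

lemma restrict_frac_val:
  assumes Y: "A.min_prime Y" and v: "\<And>a b. \<lbrakk>a \<in> H; b \<in> H\<rbrakk> \<Longrightarrow> v (a \<otimes> b) = v a + v b"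
    and v\<phi>: "\<And>a. \<lbrakk>a \<in> carrier A; a \<noteq> \<zero>\<^bsub>A\<^esub>\<rbrakk> \<Longrightarrow> v (\<phi> a) = A.ord Y a"
  shows "restrict_valuation K R G (frac_val K R G v)
      = I.eB Y"
proof (rule I.B.D.frac_val_eqI[symmetric])
  note go = I.graded_ord_image[OF Y]
  show "A.ord Y (I.k (a \<otimes>\<^bsub>R0\<^esub> b)) = A.ord Y (I.k a) + A.ord Y (I.k b)"
    if "a \<in> I.B.D.H" "b \<in> I.B.D.H" for a b
    by (rule I.B.D.graded_ordD(1)[OF go that])
  have QZ: "homog zero_group I.B.FA (frac_grading zero_group R0 (trivial_grading R0)) = I.B.QZ"
  proof (intro equalityI subsetI)
    fix x assume "x \<in> homog zero_group I.B.FA (frac_grading zero_group R0 (trivial_grading R0))"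
    then obtain a s where "a \<in> I.B.D.H" "s \<in> I.B.D.H" "x = I.B.q a s"
      unfolding I.B.D.homog_FR by blast
    then show "x \<in> I.B.QZ" using I.B.q_in_QZ[of a s] by (auto simp: homog_trivial)
  next
    fix x assume "x \<in> I.B.QZ"
    then obtain a s where "a \<in> I.B.Z" "s \<in> I.B.Z" "x = I.B.q a s" by (rule I.B.QZ_cases)
    then show "x \<in> homog zero_group I.B.FA (frac_grading zero_group R0 (trivial_grading R0))"
      unfolding I.B.D.homog_FR by (auto simp: homog_trivial)
  qed
  show "restrict_valuation K R G (frac_val K R G v) \<in>
      extensional (homog zero_group I.B.FA (frac_grading zero_group R0 (trivial_grading R0)))"
    unfolding QZ restrict_valuation_def by simp
  fix b t assume bt: "b \<in> I.B.D.H" "t \<in> I.B.D.H"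
  then have b: "b \<in> G \<one>\<^bsub>K\<^esub>" "b \<noteq> \<zero>" and t: "t \<in> G \<one>\<^bsub>K\<^esub>" "t \<noteq> \<zero>" by (auto simp: homog_trivial)
  have bH: "b \<in> H" "t \<in> H" using homogI[OF b(1) _ b(2)] homogI[OF t(1) _ t(2)] by auto
  have val: "v c = A.ord Y (I.k c)" if c: "c \<in> G \<one>\<^bsub>K\<^esub>" "c \<noteq> \<zero>" for c
  proof -
    obtain a where a: "a \<in> carrier A" "c = \<phi> a" using R0_cases[OF c(1)] .
    then have "a \<noteq> \<zero>\<^bsub>A\<^esub>" using c(2) by auto
    then show ?thesis using v\<phi>[OF a(1)] I.kh[OF a(1)] a(2) by simp
  qed
  have "I.B.q b t \<in> I.B.QZ" using b t by (intro I.B.q_in_QZ) auto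
  then show "restrict_valuation K R G (frac_val K R G v) (I.B.q b t) = A.ord Y (I.k b) - A.ord Y (I.k t)"
    using degree_zero_frac_fraction[OF b(1) t] frac_val_fr[OF v bH] val[OF b] val[OF t]
    by (simp add: restrict_valuation_def)
qed

text \<open>The valuations at fractions with denominator \<open>\<one>\<close> return the orders of
  elements of \<open>A\<close>, and these determine the prime by
  \<open>graded_ord_inj\<close>.\<close>

lemma ord_valuation_inj:
  assumes Y: "A.min_prime Y" "A.min_prime Y'"
    and eq: "I.eB Y =
      I.eB Y'"
  shows "Y = Y'"
proof -
  have "A.ord Y a = A.ord Y' a" if a: "a \<in> A.Z" for a
  proof -
    have h: "\<phi> a \<in> carrier R0 - {\<zero>\<^bsub>R0\<^esub>}" "\<one> \<in> carrier R0 - {\<zero>\<^bsub>R0\<^esub>}"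
      using \<phi>_comp \<phi>_eq_zero_iff a one_comp one_not_zero by auto
    have k1: "I.k \<one> = \<one>\<^bsub>A\<^esub>" using I.k.hom_one by simp
    have o1: "A.ord Y \<one>\<^bsub>A\<^esub> = 0" if "A.min_prime Y" for Y using A.ord_mult[OF that, of "\<one>\<^bsub>A\<^esub>" "\<one>\<^bsub>A\<^esub>"] by simp
    show ?thesis
      using I.frac_val_B[OF Y(1) h] I.frac_val_B[OF Y(2) h] eq I.kh[of a] a k1 o1[OF Y(1)] o1[OF Y(2)] by simp
  qed
  then show ?thesis
    using A.D.graded_ord_inj[OF A.graded_ord_ord[OF Y(1)] A.min_prime_graded[OF Y(1)]
        A.graded_ord_ord[OF Y(2)] A.min_prime_graded[OF Y(2)]] by (simp add: homog_trivial)
qed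

end

context cox
begin

section \<open>Fractions of global sections: conditions (ii) and (iii)\<close>

sublocale L: graded_alg_iso A V K RX GX emb
  using emb_bij by unfold_locales

text \<open>Numerator and denominator of a fraction of neutral degree have the same degree, so they
  are the sections of functions \<open>x\<close> and \<open>y\<close> for one divisor
  \<open>D\<close>. The fraction then equals \<open>x / y\<close>, a quotient of elements of
  \<open>A\<close>.\<close>

lemma degree_zero_RX:
  "degree_zero_frac K RX GX ` carrier (fraction_field (degree_zero_ring K RX GX)) = frac_grading K RX GX \<one>\<^bsub>K\<^esub>"
  unfolding L.degree_zero_frac_image
proof (intro equalityI subsetI)
  fix z assume "z \<in> {R.fr (emb a) (emb f) | a f. a \<in> carrier A \<and> f \<in> carrier A \<and> f \<noteq> \<zero>}"
  then obtain a f where h: "a \<in> carrier A" "f \<in> carrier A" "f \<noteq> \<zero>" "z = R.fr (emb a) (emb f)" by blast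
  show "z \<in> frac_grading K RX GX \<one>\<^bsub>K\<^esub>"
    unfolding h(4) using R.fr_mem_FG_iff[OF _ L.\<phi>_homog[OF h(2,3)] L.\<phi>_comp[OF h(2)] K.one_closed K.one_closed, of "emb a"]
      L.\<phi>_comp[OF h(1)] R.comp_closed by simp
next
  fix z assume z: "z \<in> frac_grading K RX GX \<one>\<^bsub>K\<^esub>"
  obtain a s u where h: "s \<in> R.H" "u \<in> carrier K" "s \<in> GX u" "a \<in> GX (\<one>\<^bsub>K\<^esub> \<otimes>\<^bsub>K\<^esub> u)" "a \<in> carrier RX" "z = R.fr a s"
    using R.FG_cases[OF z K.one_closed] .
  obtain D where D: "D \<in> W" "\<delta> D = u" using deg_surj[OF h(2)] by blast
  obtain y where y: "y \<in> Gam X D" "s = M X D y" using M_surj[OF XX D(1), of s] h(3) D(2) by metis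
  obtain x where x: "x \<in> Gam X D" "a = M X D x" using M_surj[OF XX D(1), of a] h(2,4) D(2) by (metis K.l_one)
  have yQ: "y \<in> QZ" using Gam_QZ[OF y(1)] M_zero[OF XX D(1)] y(2) h(1) R.homog_zero by metis
  obtain b g where bg: "b \<in> Z" "g \<in> Z" "y = q b g" using QZ_cases[OF yQ] .
  have "\<exists>c e. c \<in> carrier A \<and> e \<in> Z \<and> x = q c e"
  proof (cases "x = \<zero>\<^bsub>FA\<^esub>")
    case True
    then show ?thesis using D.fr_zero by (intro exI[of _ \<zero>] exI[of _ \<one>]) auto
  next
    case False
    obtain c e where "c \<in> Z" "e \<in> Z" "x = q c e" using QZ_cases[OF Gam_QZ[OF x(1) False]] .
    then show ?thesis by blast
  qed
  then obtain c e where ce: "c \<in> carrier A" "e \<in> Z" "x = q c e" by blast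
  have zz: "c \<otimes> g \<in> carrier A" "b \<otimes> e \<in> Z" using ce bg Z_mult[OF bg(1) ce(2)] by auto
  \<comment> \<open>\<open>x/y = cg/be\<close>\<close>
  have eq: "x \<otimes>\<^bsub>FA\<^esub> q (b \<otimes> e) \<one> = y \<otimes>\<^bsub>FA\<^esub> q (c \<otimes> g) \<one>"
  proof -
    have "x \<otimes>\<^bsub>FA\<^esub> q (b \<otimes> e) \<one> = q (c \<otimes> (b \<otimes> e)) (e \<otimes> \<one>)" using ce zz by (simp add: q_mult)
    also have "\<dots> = q (b \<otimes> (c \<otimes> g)) (g \<otimes> \<one>)"
      using ce bg zz by (intro iffD2[OF q_eq_iff] Z_mult) (simp_all, simp add: m_ac)
    also have "\<dots> = y \<otimes>\<^bsub>FA\<^esub> q (c \<otimes> g) \<one>" using bg zz by (simp add: q_mult)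
    finally show ?thesis .
  qed
  have "a \<otimes>\<^bsub>RX\<^esub> emb (b \<otimes> e) = emb (c \<otimes> g) \<otimes>\<^bsub>RX\<^esub> s"
  proof -
    have "a \<otimes>\<^bsub>RX\<^esub> emb (b \<otimes> e) = M X D (x \<otimes>\<^bsub>FA\<^esub> q (b \<otimes> e) \<one>)"
      using M_mult[OF XX D(1) W_zero x(1) q_Gam[of "b \<otimes> e"]] zz x(2) by (simp add: emb_def)
    also have "\<dots> = s \<otimes>\<^bsub>RX\<^esub> emb (c \<otimes> g)"
      using M_mult[OF XX D(1) W_zero y(1) q_Gam[of "c \<otimes> g"]] zz y(2) eq by (simp add: emb_def)
    also have "\<dots> = emb (c \<otimes> g) \<otimes>\<^bsub>RX\<^esub> s" using R.m_comm[of s "emb (c \<otimes> g)"] h(1) zz R.homog_closed by simp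
    finally show ?thesis .
  qed
  then have "z = R.fr (emb (c \<otimes> g)) (emb (b \<otimes> e))"
    unfolding h(6) using h(1,5) zz L.\<phi>_homog[of "b \<otimes> e"] by (intro R.fr_eqI) auto
  then show "z \<in> {R.fr (emb a) (emb f) | a f. a \<in> carrier A \<and> f \<in> carrier A \<and> f \<noteq> \<zero>}" using zz by blast
qed

lemma W_pos_neg:
  assumes D: "D \<in> W"
  obtains P N where "P \<in> W" "N \<in> W" "D = P - N" "\<forall>Y. 0 \<le> Poly_Mapping.lookup P Y" "\<forall>Y. 0 \<le> Poly_Mapping.lookup N Y"
proof -
  define P where "P = Abs_poly_mapping (\<lambda>Y. max 0 (Poly_Mapping.lookup D Y))"
  have "finite {Y. max 0 (Poly_Mapping.lookup D Y) \<noteq> 0}"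
    by (rule finite_subset[OF _ finite_lookup[of D]]) auto
  then have lP: "Poly_Mapping.lookup P Y = max 0 (Poly_Mapping.lookup D Y)" for Y by (simp add: P_def)
  have PW: "P \<in> W" using W_lookup[OF D] lP by (auto simp: in_keys_iff) (metis max.idem)
  have "D = P - (P - D)" "\<forall>Y. 0 \<le> Poly_Mapping.lookup P Y" "\<forall>Y. 0 \<le> Poly_Mapping.lookup (P - D) Y"
    by (simp_all add: lP lookup_minus)
  then show thesis by (rule that[OF PW W_diff[OF PW D]])
qed

text \<open>The function 1 is a section for every effective divisor. Writing \<open>D\<close> as a
  difference of effective divisors therefore exhibits a homogeneous fraction in each degree.\<close>

lemma degrees_RX: "degrees K R.FR R.FG = carrier K"
proof
  show "degrees K R.FR R.FG \<subseteq> carrier K" by (auto simp: degrees_def)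
  show "carrier K \<subseteq> degrees K R.FR R.FG"
  proof
    fix w assume w: "w \<in> carrier K"
    obtain D where D: "D \<in> W" "\<delta> D = w" using deg_surj[OF w] by blast
    obtain P N where PN: "P \<in> W" "N \<in> W" "D = P - N" "\<forall>Y. 0 \<le> Poly_Mapping.lookup P Y" "\<forall>Y. 0 \<le> Poly_Mapping.lookup N Y"
      using W_pos_neg[OF D(1)] .
    note oP = one_Gam[OF spec[OF PN(4)], of X] and oN = one_Gam[OF spec[OF PN(5)], of X]
    have one0: "\<one>\<^bsub>FA\<^esub> \<noteq> \<zero>\<^bsub>FA\<^esub>" using one_QZ by simp
    have H: "M X P \<one>\<^bsub>FA\<^esub> \<in> R.H" "M X N \<one>\<^bsub>FA\<^esub> \<in> R.H"
      using M_homog[OF XX PN(1) oP one0] M_homog[OF XX PN(2) oN one0] by auto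
    have "\<delta> P = w \<otimes>\<^bsub>K\<^esub> \<delta> N" using deg_add[OF D(1) PN(2)] PN(3) D(2) by simp
    then have "R.fr (M X P \<one>\<^bsub>FA\<^esub>) (M X N \<one>\<^bsub>FA\<^esub>) \<in> R.FG w"
      using R.fr_mem_FG_iff[OF _ H(2) M_comp[OF XX PN(2) oN] deg_closed[OF PN(2)] w] M_comp[OF XX PN(1) oP] R.homog_closed[OF H(1)] by simp
    moreover have "R.fr (M X P \<one>\<^bsub>FA\<^esub>) (M X N \<one>\<^bsub>FA\<^esub>) \<in> homog K R.FR R.FG"
      using R.fr_mem_homog_iff[OF _ H(2)] H(1) R.homog_closed by blast
    ultimately show "w \<in> degrees K R.FR R.FG" using w unfolding degrees_def by blast
  qed
qed

lemma bij_restrict_RX: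
  "bij_betw (restrict_valuation K RX GX) (essential_valuations K RX GX)
     (essential_valuations zero_group (degree_zero_ring K RX GX) (trivial_grading (degree_zero_ring K RX GX)))"
proof -
  let ?f = "\<lambda>Y. frac_val K RX GX (\<lambda>s. dv s Y)"
  have fg: "restrict_valuation K RX GX (?f Y) = L.I.eB Y" if Y: "min_prime Y" for Y
    using L.restrict_frac_val[OF Y dv_mult[OF _ _ Y]] dv_emb[OF Y] by simp
  have inj: "inj_on L.I.eB {Y. min_prime Y}" by (rule inj_onI) (use L.ord_valuation_inj in blast)
  show ?thesis
    unfolding essential_valuations_RX L.I.essential_valuations_B bij_betw_def image_image
  proof
    show "inj_on (restrict_valuation K RX GX) (?f ` {Y. min_prime Y})"
    proof (rule inj_onI)
      fix x y assume "x \<in> ?f ` {Y. min_prime Y}" "y \<in> ?f ` {Y. min_prime Y}"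
        and eq: "restrict_valuation K RX GX x = restrict_valuation K RX GX y"
      then obtain Y Y' where Y: "min_prime Y" "x = ?f Y" "min_prime Y'" "y = ?f Y'" by blast
      then have "L.I.eB Y = L.I.eB Y'" using fg eq by simp
      then have "Y = Y'" using L.ord_valuation_inj[OF Y(1,3)] by blast
      then show "x = y" using Y by simp
    qed
    show "(\<lambda>Y. restrict_valuation K RX GX (?f Y)) ` {Y. min_prime Y} = L.I.eB ` {Y. min_prime Y}"
      by (rule image_cong[OF refl]) (use fg in simp)
  qed
qed

lemma graded_algebra_RX: "graded_algebra A K RX GX emb"
  using R.graded_ring L.\<phi>_hom L.\<phi>_deg by (simp add: graded_algebra_def)

subsection \<open>The sheaf is associated to its global sections\<close>

lemma res_hom: "\<lbrakk>openin (Spec A) U; openin (Spec A) U'; U' \<subseteq> U\<rbrakk> \<Longrightarrow> ring_hom_cring (sec F U) (sec F U') (res F U U')"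
  using graded_sheafD(2)[OF F] graded_sec
  by (simp add: ring_hom_cring_def ring_hom_cring_axioms_def graded_def graded_ring_def)

text \<open>Restriction of a homogeneous section does not change the function representing it;
  \<open>graded_hom_inj\<close> extends injectivity to all sections.\<close>

lemma res_inj:
  assumes U: "openin (Spec A) U" "U \<noteq> {}" and U': "openin (Spec A) U'" "U' \<noteq> {}" "U' \<subseteq> U"
  shows "inj_on (res F U U') (carrier (sec F U))"
proof (rule graded.graded_hom_inj[OF graded_sec[OF U(1)] graded_sec[OF U'(1)] graded_sheafD(2)[OF F U(1) U'(1,3)]])
  show "res F U U' a \<in> hcomp F U' w" if "w \<in> carrier K" "a \<in> hcomp F U w" for w a
    by (rule graded_sheafD(3)[OF F U(1) U'(1,3) that])
  fix w a assume w: "w \<in> carrier K" and a: "a \<in> hcomp F U w" and z: "res F U U' a = \<zero>\<^bsub>sec F U'\<^esub>"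
  obtain D where D: "D \<in> W" "\<delta> D = w" using deg_surj[OF w] by blast
  obtain x where x: "x \<in> Gam U D" "a = M U D x" using M_surj[OF U D(1), of a] a D(2) by metis
  have "M U' D x = \<zero>\<^bsub>sec F U'\<^esub>" using M_res[OF U U' D(1) x(1)] z x(2) by simp
  then have "x = \<zero>\<^bsub>FA\<^esub>" using M_eq_zero_iff[OF U'(1,2) D(1) Gam_mono[OF x(1) U'(3)]] by simp
  then show "a = \<zero>\<^bsub>sec F U\<^esub>" using M_zero[OF U D(1)] x(2) by simp
qed

lemma res_emb:
  assumes U: "openin (Spec A) U" "U \<noteq> {}" and a: "a \<in> carrier A"
  shows "res F X U (emb a) = M U 0 (q a \<one>)" "q a \<one> \<in> Gam U 0"
proof -
  have "U \<subseteq> X" using U(1) by (rule openin_subset)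
  then show "res F X U (emb a) = M U 0 (q a \<one>)" "q a \<one> \<in> Gam U 0"
    unfolding emb_def using M_res[OF XX U _ W_zero q_Gam[OF a]] Gam_mono[OF q_Gam[OF a]] by auto
qed

lemma res_emb_homog:
  assumes U: "openin (Spec A) U" "U \<noteq> {}" and a: "a \<in> Z"
  shows "res F X U (emb a) \<in> homog K (sec F U) (hcomp F U)"
  using res_emb[OF U, of a] M_homog[OF U W_zero, of "q a \<one>"] q_in_QZ[OF a, of \<one>] a by simp

text \<open>If \<open>s\<close> comes from the function \<open>x\<close> for the divisor
  \<open>D\<close>, then \<open>clear_denominators\<close> gives \<open>f\<close> outside
  \<open>p\<close> such that \<open>f x\<close> is a global section for \<open>D\<close>.\<close>

lemma local_fraction:
  assumes U: "openin (Spec A) U" and p: "p \<in> U" and w: "w \<in> carrier K" and s: "s \<in> hcomp F U w"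
  shows "\<exists>a\<in>GX w. \<exists>f\<in>carrier A - p. res F X U a = res F X U (emb f) \<otimes>\<^bsub>sec F U\<^esub> s"
proof -
  have ne: "U \<noteq> {}" using p by blast
  have UX: "U \<subseteq> X" using U by (rule openin_subset)
  obtain D where D: "D \<in> W" "\<delta> D = w" using deg_surj[OF w] by blast
  obtain x where x: "x \<in> Gam U D" "s = M U D x" using M_surj[OF U ne D(1), of s] s D(2) by metis
  have "\<exists>f\<in>carrier A - p. q f \<one> \<otimes>\<^bsub>FA\<^esub> x \<in> Gam X D"
  proof (cases "x = \<zero>\<^bsub>FA\<^esub>")
    case True
    interpret p: primeideal p A using open_primeideal[OF U p] .
    have "\<one> \<in> carrier A - p" using p.one_imp_carrier p.I_notcarr by auto
    moreover have "q \<one> \<one> \<in> carrier FA" using q_Gam[of \<one>] Gam_closed by blast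
    ultimately show ?thesis using True Gam_zero by (intro bexI[of _ \<one>]) auto
  next
    case False
    note xQ = Gam_QZ[OF x(1) False]
    let ?m = "\<lambda>Y. val Y x + Poly_Mapping.lookup D Y"
    have "finite {Y. min_prime Y \<and> ?m Y < 0}"
    proof (rule finite_subset)
      show "{Y. min_prime Y \<and> ?m Y < 0} \<subseteq> {Y. min_prime Y \<and> val Y x \<noteq> 0} \<union> {Y. Poly_Mapping.lookup D Y \<noteq> 0}" by auto
      show "finite ({Y. min_prime Y \<and> val Y x \<noteq> 0} \<union> {Y. Poly_Mapping.lookup D Y \<noteq> 0})"
        using finite_val[OF xQ] by simp
    qed
    moreover have "0 \<le> ?m Y" if "min_prime Y" "Y \<in> U" for Y using GamD[OF x(1) False that] .
    ultimately obtain f where f: "f \<in> carrier A - p" "\<And>Y. min_prime Y \<Longrightarrow> 0 \<le> ord Y f + ?m Y"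
      using clear_denominators[OF U p, of ?m] by blast
    have fZ: "f \<in> Z" using L.prime_outside(1)[OF open_primeideal[OF U p] f(1)] f(1) by blast
    have fQ: "q f \<one> \<in> QZ" using q_in_QZ[OF fZ] by simp
    have "q f \<one> \<otimes>\<^bsub>FA\<^esub> x \<in> Gam X D"
    proof (rule GamI)
      show "q f \<one> \<otimes>\<^bsub>FA\<^esub> x \<in> carrier FA" using fQ xQ by simp
      show "0 \<le> val Y (q f \<one> \<otimes>\<^bsub>FA\<^esub> x) + Poly_Mapping.lookup D Y" if "min_prime Y" for Y
        using f(2)[OF that] val_mult[OF that fQ xQ] val_q[OF that fZ, of \<one>] ord_one[OF that] by simp
    qed
    then show ?thesis using f(1) by blast
  qed
  then obtain f where f: "f \<in> carrier A - p" "q f \<one> \<otimes>\<^bsub>FA\<^esub> x \<in> Gam X D" by blast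
  have fA: "f \<in> carrier A" using f(1) by blast
  let ?a = "M X D (q f \<one> \<otimes>\<^bsub>FA\<^esub> x)"
  have "res F X U ?a = M U D (q f \<one> \<otimes>\<^bsub>FA\<^esub> x)" by (rule M_res[OF XX U ne UX D(1) f(2)])
  also have "\<dots> = res F X U (emb f) \<otimes>\<^bsub>sec F U\<^esub> s"
    using M_mult[OF U ne W_zero D(1) res_emb(2)[OF U ne fA] x(1)] res_emb(1)[OF U ne fA] x(2) by simp
  finally show ?thesis using M_comp[OF XX D(1) f(2)] D(2) f(1) by blast
qed

text \<open>The sum of two local fractions with denominators \<open>f\<close> and \<open>g\<close>
  has denominator \<open>f g\<close>, which is again outside the prime \<open>p\<close>.\<close>

lemma local_fraction_all:
  assumes U: "openin (Spec A) U" and p: "p \<in> U" and s: "s \<in> carrier (sec F U)"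
  shows "\<exists>a\<in>carrier RX. \<exists>f\<in>carrier A - p. res F X U a = res F X U (emb f) \<otimes>\<^bsub>sec F U\<^esub> s"
proof -
  interpret FU: graded K "sec F U" "hcomp F U" by (rule graded_sec[OF U])
  interpret r: ring_hom_cring RX "sec F U" "res F X U" using res_hom[OF open_X U openin_subset[OF U]] .
  interpret p: primeideal p A using open_primeideal[OF U p] .
  show ?thesis using s
  proof (induction s rule: FU.homog_induct)
    case (homog a w)
    then show ?case using local_fraction[OF U p homog] R.comp_closed[OF _ homog(1)] by blast
  next
    case (add s t)
    then obtain a f b g where h: "a \<in> carrier RX" "f \<in> carrier A - p" "res F X U a = res F X U (emb f) \<otimes>\<^bsub>sec F U\<^esub> s"
      "b \<in> carrier RX" "g \<in> carrier A - p" "res F X U b = res F X U (emb g) \<otimes>\<^bsub>sec F U\<^esub> t" by blast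
    have e: "emb f \<in> carrier RX" "emb g \<in> carrier RX" "emb (f \<otimes> g) = emb f \<otimes>\<^bsub>RX\<^esub> emb g" using h(2,5) by simp_all
    let ?F = "res F X U (emb f)" and ?G = "res F X U (emb g)"
    have c: "?F \<in> carrier (sec F U)" "?G \<in> carrier (sec F U)" using e by simp_all
    have dist: "(f \<otimes>\<^bsub>sec F U\<^esub> s) \<otimes>\<^bsub>sec F U\<^esub> g \<oplus>\<^bsub>sec F U\<^esub> (g \<otimes>\<^bsub>sec F U\<^esub> t) \<otimes>\<^bsub>sec F U\<^esub> f
        = f \<otimes>\<^bsub>sec F U\<^esub> g \<otimes>\<^bsub>sec F U\<^esub> (s \<oplus>\<^bsub>sec F U\<^esub> t)"
      if "f \<in> carrier (sec F U)" "g \<in> carrier (sec F U)" for f g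
      using add(1,2) that by algebra
    have "res F X U (a \<otimes>\<^bsub>RX\<^esub> emb g \<oplus>\<^bsub>RX\<^esub> b \<otimes>\<^bsub>RX\<^esub> emb f)
        = (?F \<otimes>\<^bsub>sec F U\<^esub> s) \<otimes>\<^bsub>sec F U\<^esub> ?G \<oplus>\<^bsub>sec F U\<^esub> (?G \<otimes>\<^bsub>sec F U\<^esub> t) \<otimes>\<^bsub>sec F U\<^esub> ?F"
      unfolding h(3)[symmetric] h(6)[symmetric] using h(1,4) e(1,2) by simp
    also have "\<dots> = ?F \<otimes>\<^bsub>sec F U\<^esub> ?G \<otimes>\<^bsub>sec F U\<^esub> (s \<oplus>\<^bsub>sec F U\<^esub> t)"
      by (rule dist[OF c])
    also have "\<dots> = res F X U (emb (f \<otimes> g)) \<otimes>\<^bsub>sec F U\<^esub> (s \<oplus>\<^bsub>sec F U\<^esub> t)" using e by simp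
    finally have "res F X U (a \<otimes>\<^bsub>RX\<^esub> emb g \<oplus>\<^bsub>RX\<^esub> b \<otimes>\<^bsub>RX\<^esub> emb f) = res F X U (emb (f \<otimes> g)) \<otimes>\<^bsub>sec F U\<^esub> (s \<oplus>\<^bsub>sec F U\<^esub> t)" .
    moreover have "f \<otimes> g \<in> carrier A - p" using h(2,5) p.I_prime by auto
    moreover have "a \<otimes>\<^bsub>RX\<^esub> emb g \<oplus>\<^bsub>RX\<^esub> b \<otimes>\<^bsub>RX\<^esub> emb f \<in> carrier RX" using h e by simp
    ultimately show ?case by blast
  qed
qed

text \<open>The element of \<open>Q\<^sup>+(F(X))\<close> corresponding to a section \<open>s\<close>, which is \<open>b/t\<close> if \<open>b = t s\<close> on \<open>U\<close>.\<close>

definition Zfr :: "'a set set \<Rightarrow> 's \<Rightarrow> ('s \<times> 's) set" where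
  "Zfr U s = {(b, t). b \<in> carrier RX \<and> t \<in> R.H \<and> res F X U b = res F X U t \<otimes>\<^bsub>sec F U\<^esub> s}"

lemma res_X_inj: "\<lbrakk>openin (Spec A) U; U \<noteq> {}; a \<in> carrier RX; b \<in> carrier RX; res F X U a = res F X U b\<rbrakk> \<Longrightarrow> a = b"
  using res_inj[OF XX _ _ openin_subset] by (meson inj_onD)

text \<open>Cancellation of \<open>emb f\<close> over \<open>U\<close> and injectivity of the
  restriction from \<open>X\<close> turn the condition in \<open>Zfr\<close> into cross
  multiplication.\<close>

lemma Zfr_eq:
  assumes U: "openin (Spec A) U" "U \<noteq> {}" and s: "s \<in> carrier (sec F U)"
    and a: "a \<in> carrier RX" and f: "f \<in> Z" and eq: "res F X U a = res F X U (emb f) \<otimes>\<^bsub>sec F U\<^esub> s"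
  shows "Zfr U s = R.fr a (emb f)"
proof -
  interpret FU: graded_domain K "sec F U" "hcomp F U" by (rule graded_domain_sec[OF U])
  interpret r: ring_hom_cring RX "sec F U" "res F X U" using res_hom[OF open_X U(1) openin_subset[OF U(1)]] .
  have fH: "emb f \<in> R.H" using L.\<phi>_homog f by blast
  have fc: "emb f \<in> carrier RX" using f by simp
  have "res F X U b = res F X U t \<otimes>\<^bsub>sec F U\<^esub> s \<longleftrightarrow> a \<otimes>\<^bsub>RX\<^esub> t = b \<otimes>\<^bsub>RX\<^esub> emb f"
    if b: "b \<in> carrier RX" and t: "t \<in> R.H" for b t
  proof -
    have tc: "t \<in> carrier RX" using t by (rule R.homog_closed)
    have "res F X U (emb f) \<otimes>\<^bsub>sec F U\<^esub> res F X U b = res F X U (emb f) \<otimes>\<^bsub>sec F U\<^esub> (res F X U t \<otimes>\<^bsub>sec F U\<^esub> s) \<longleftrightarrow>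
        res F X U b = res F X U t \<otimes>\<^bsub>sec F U\<^esub> s"
      using FU.homog_cancel[OF res_emb_homog[OF U f]] b tc s by simp
    moreover have "res F X U (emb f) \<otimes>\<^bsub>sec F U\<^esub> (res F X U t \<otimes>\<^bsub>sec F U\<^esub> s) = res F X U (a \<otimes>\<^bsub>RX\<^esub> t)"
      using tc s a fc eq by (simp add: FU.m_lcomm FU.m_comm)
    moreover have "res F X U (emb f) \<otimes>\<^bsub>sec F U\<^esub> res F X U b = res F X U (b \<otimes>\<^bsub>RX\<^esub> emb f)"
      using b fc by (simp add: FU.m_comm)
    moreover have "res F X U (b \<otimes>\<^bsub>RX\<^esub> emb f) = res F X U (a \<otimes>\<^bsub>RX\<^esub> t) \<longleftrightarrow> b \<otimes>\<^bsub>RX\<^esub> emb f = a \<otimes>\<^bsub>RX\<^esub> t"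
      using res_X_inj[OF U] b fc a tc by (metis R.m_closed)
    ultimately show ?thesis by auto
  qed
  then show ?thesis unfolding Zfr_def using R.Q.mem_fraction_iff[OF a fH] by auto
qed

lemma Zfr_reg:
  assumes U: "openin (Spec A) U" "U \<noteq> {}" and s: "s \<in> carrier (sec F U)"
  shows "Zfr U s \<in> L.reg (carrier RX) U"
proof -
  have "\<exists>a\<in>carrier RX. \<exists>f\<in>carrier A - p. Zfr U s = R.fr a (emb f)" if p: "p \<in> U" for p
  proof -
    obtain a f where h: "a \<in> carrier RX" "f \<in> carrier A - p" "res F X U a = res F X U (emb f) \<otimes>\<^bsub>sec F U\<^esub> s"
      using local_fraction_all[OF U(1) p s] by blast
    have "f \<in> Z" using L.prime_outside(1)[OF open_primeideal[OF U(1) p] h(2)] h(2) by blast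
    then show ?thesis using Zfr_eq[OF U s h(1) _ h(3)] h(1,2) by blast
  qed
  then show ?thesis unfolding L.reg_def by blast
qed

lemma Zfr_reg_comp:
  assumes U: "openin (Spec A) U" "U \<noteq> {}" and w: "w \<in> carrier K" and s: "s \<in> hcomp F U w"
  shows "Zfr U s \<in> L.reg (GX w) U"
proof -
  have sc: "s \<in> carrier (sec F U)" using graded.comp_closed[OF graded_sec[OF U(1)] s w] .
  have "\<exists>a\<in>GX w. \<exists>f\<in>carrier A - p. Zfr U s = R.fr a (emb f)" if p: "p \<in> U" for p
  proof -
    obtain a f where h: "a \<in> GX w" "f \<in> carrier A - p" "res F X U a = res F X U (emb f) \<otimes>\<^bsub>sec F U\<^esub> s"
      using local_fraction[OF U(1) p w s] by blast
    have "f \<in> Z" using L.prime_outside(1)[OF open_primeideal[OF U(1) p] h(2)] h(2) by blast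
    then show ?thesis using Zfr_eq[OF U sc R.comp_closed[OF h(1) w] _ h(3)] h(1,2) by blast
  qed
  then show ?thesis unfolding L.reg_def by blast
qed

lemma Zfr_rep:
  assumes U: "openin (Spec A) U" "U \<noteq> {}" and s: "s \<in> carrier (sec F U)"
  obtains a f where "a \<in> carrier RX" "f \<in> Z" "res F X U a = res F X U (emb f) \<otimes>\<^bsub>sec F U\<^esub> s" "Zfr U s = R.fr a (emb f)"
proof -
  have p: "{\<zero>} \<in> U" using open_generic[OF U] .
  obtain a f where h: "a \<in> carrier RX" "f \<in> carrier A - {\<zero>}" "res F X U a = res F X U (emb f) \<otimes>\<^bsub>sec F U\<^esub> s"
    using local_fraction_all[OF U(1) p s] by blast
  then show thesis using that[OF h(1) _ h(3)] Zfr_eq[OF U s h(1) _ h(3)] by blast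
qed

lemma Zfr_ops:
  assumes U: "openin (Spec A) U" "U \<noteq> {}" and s: "s \<in> carrier (sec F U)" and t: "t \<in> carrier (sec F U)"
  shows "Zfr U (s \<otimes>\<^bsub>sec F U\<^esub> t) = Zfr U s \<otimes>\<^bsub>R.FR\<^esub> Zfr U t"
    and "Zfr U (s \<oplus>\<^bsub>sec F U\<^esub> t) = Zfr U s \<oplus>\<^bsub>R.FR\<^esub> Zfr U t"
proof -
  interpret FU: graded_domain K "sec F U" "hcomp F U" by (rule graded_domain_sec[OF U])
  interpret r: ring_hom_cring RX "sec F U" "res F X U" using res_hom[OF open_X U(1) openin_subset[OF U(1)]] .
  obtain a f where h: "a \<in> carrier RX" "f \<in> Z" "res F X U a = res F X U (emb f) \<otimes>\<^bsub>sec F U\<^esub> s" "Zfr U s = R.fr a (emb f)"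
    using Zfr_rep[OF U s] .
  obtain b g where k: "b \<in> carrier RX" "g \<in> Z" "res F X U b = res F X U (emb g) \<otimes>\<^bsub>sec F U\<^esub> t" "Zfr U t = R.fr b (emb g)"
    using Zfr_rep[OF U t] .
  have fH: "emb f \<in> R.H" "emb g \<in> R.H" using L.\<phi>_homog h(2) k(2) by blast+
  have e: "emb f \<in> carrier RX" "emb g \<in> carrier RX" "emb (f \<otimes> g) = emb f \<otimes>\<^bsub>RX\<^esub> emb g" using h(2) k(2) by simp_all
  let ?F = "res F X U (emb f)" and ?G = "res F X U (emb g)"
  have c: "?F \<in> carrier (sec F U)" "?G \<in> carrier (sec F U)" using e by simp_all
  have "res F X U (a \<otimes>\<^bsub>RX\<^esub> b) = (?F \<otimes>\<^bsub>sec F U\<^esub> s) \<otimes>\<^bsub>sec F U\<^esub> (?G \<otimes>\<^bsub>sec F U\<^esub> t)"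
    unfolding h(3)[symmetric] k(3)[symmetric] using h(1) k(1) by simp
  also have "\<dots> = res F X U (emb (f \<otimes> g)) \<otimes>\<^bsub>sec F U\<^esub> (s \<otimes>\<^bsub>sec F U\<^esub> t)"
    unfolding e(3) r.hom_mult[OF e(1,2)] using s t c by algebra
  finally have "Zfr U (s \<otimes>\<^bsub>sec F U\<^esub> t) = R.fr (a \<otimes>\<^bsub>RX\<^esub> b) (emb (f \<otimes> g))"
    using Zfr_eq[OF U _ _ Z_mult[OF h(2) k(2)]] h(1) k(1) s t by simp
  then show "Zfr U (s \<otimes>\<^bsub>sec F U\<^esub> t) = Zfr U s \<otimes>\<^bsub>R.FR\<^esub> Zfr U t"
    unfolding h(4) k(4) R.fr_mult[OF h(1) fH(1) k(1) fH(2)] e(3) .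
  have "res F X U (a \<otimes>\<^bsub>RX\<^esub> emb g \<oplus>\<^bsub>RX\<^esub> b \<otimes>\<^bsub>RX\<^esub> emb f)
      = (?F \<otimes>\<^bsub>sec F U\<^esub> s) \<otimes>\<^bsub>sec F U\<^esub> ?G \<oplus>\<^bsub>sec F U\<^esub> (?G \<otimes>\<^bsub>sec F U\<^esub> t) \<otimes>\<^bsub>sec F U\<^esub> ?F"
    unfolding h(3)[symmetric] k(3)[symmetric] using h(1) k(1) e(1,2) by simp
  also have "\<dots> = res F X U (emb (f \<otimes> g)) \<otimes>\<^bsub>sec F U\<^esub> (s \<oplus>\<^bsub>sec F U\<^esub> t)"
    unfolding e(3) r.hom_mult[OF e(1,2)] using s t c by algebra
  finally have "Zfr U (s \<oplus>\<^bsub>sec F U\<^esub> t) = R.fr (a \<otimes>\<^bsub>RX\<^esub> emb g \<oplus>\<^bsub>RX\<^esub> b \<otimes>\<^bsub>RX\<^esub> emb f) (emb (f \<otimes> g))"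
    using Zfr_eq[OF U _ _ Z_mult[OF h(2) k(2)]] h(1) k(1) s t e(1,2) by simp
  then show "Zfr U (s \<oplus>\<^bsub>sec F U\<^esub> t) = Zfr U s \<oplus>\<^bsub>R.FR\<^esub> Zfr U t"
    unfolding h(4) k(4) R.fr_add[OF h(1) fH(1) k(1) fH(2)] e(3) .
qed

lemma Zfr_inj:
  assumes U: "openin (Spec A) U" "U \<noteq> {}" and s: "s \<in> carrier (sec F U)" "t \<in> carrier (sec F U)" and eq: "Zfr U s = Zfr U t"
  shows "s = t"
proof -
  interpret FU: graded_domain K "sec F U" "hcomp F U" by (rule graded_domain_sec[OF U])
  obtain a f where h: "a \<in> carrier RX" "f \<in> Z" "res F X U a = res F X U (emb f) \<otimes>\<^bsub>sec F U\<^esub> s" "Zfr U s = R.fr a (emb f)"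
    using Zfr_rep[OF U s(1)] .
  have "(a, emb f) \<in> Zfr U s" using R.Q.self_mem_fraction[OF h(1) L.\<phi>_homog[of f]] h(2,4) by simp
  then have "res F X U (emb f) \<otimes>\<^bsub>sec F U\<^esub> s = res F X U (emb f) \<otimes>\<^bsub>sec F U\<^esub> t"
    unfolding eq using h(3) by (simp add: Zfr_def)
  then show ?thesis using FU.homog_cancel[OF res_emb_homog[OF U h(2)] s] by simp
qed

lemma Zfr_res:
  assumes U: "openin (Spec A) U" "U \<noteq> {}" and U': "openin (Spec A) U'" "U' \<noteq> {}" "U' \<subseteq> U" and s: "s \<in> carrier (sec F U)"
  shows "Zfr U' (res F U U' s) = Zfr U s"
proof -
  interpret r: ring_hom_cring "sec F U" "sec F U'" "res F U U'" using res_hom[OF U(1) U'(1,3)] .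
  interpret rX: ring_hom_cring RX "sec F U" "res F X U" using res_hom[OF open_X U(1) openin_subset[OF U(1)]] .
  obtain a f where h: "a \<in> carrier RX" "f \<in> Z" "res F X U a = res F X U (emb f) \<otimes>\<^bsub>sec F U\<^esub> s" "Zfr U s = R.fr a (emb f)"
    using Zfr_rep[OF U s] .
  have rr: "res F U U' (res F X U b) = res F X U' b" if "b \<in> carrier RX" for b
    by (rule graded_sheafD(5)[OF F open_X U(1) U'(1,3) openin_subset[OF U(1)] that])
  have "res F X U' a = res F X U' (emb f) \<otimes>\<^bsub>sec F U'\<^esub> res F U U' s"
    using arg_cong[OF h(3), of "res F U U'"] rr[OF h(1)] rr[of "emb f"] h(2) s by simp
  then show ?thesis using Zfr_eq[OF U'(1,2) _ h(1,2)] r.hom_closed[OF s] h(4) by simp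
qed

text \<open>Where \<open>f\<close> does not vanish, \<open>1 / f\<close> is a section of the
  structure sheaf, and its product with \<open>a\<close> is the desired section.\<close>

lemma Zfr_local:
  assumes p: "primeideal p A" and a: "a \<in> carrier RX" and f: "f \<in> carrier A - p"
    and U: "openin (Spec A) U" "p \<in> U" "\<And>q. q \<in> U \<Longrightarrow> f \<notin> q"
  shows "\<exists>t\<in>carrier (sec F U). Zfr U t = R.fr a (emb f)"
proof -
  have ne: "U \<noteq> {}" using U(2) by blast
  interpret FU: graded_domain K "sec F U" "hcomp F U" by (rule graded_domain_sec[OF U(1) ne])
  interpret r: ring_hom_cring RX "sec F U" "res F X U" using res_hom[OF open_X U(1) openin_subset[OF U(1)]] .
  have fZ: "f \<in> Z" using L.prime_outside(1)[OF p f] f by blast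
  have iG: "q \<one> f \<in> Gam U 0"
  proof (rule GamI)
    show "q \<one> f \<in> carrier FA" using q_in_QZ[of \<one> f] fZ by simp
    fix Y assume Y: "min_prime Y" "Y \<in> U"
    have "\<not> 0 < ord Y f" using U(3)[OF Y(2)] ord_pos_iff[OF Y(1) fZ] by simp
    then show "0 \<le> val Y (q \<one> f) + Poly_Mapping.lookup 0 Y"
      using val_q[OF Y(1) _ fZ, of \<one>] ord_one[OF Y(1)] by simp
  qed
  let ?i = "M U 0 (q \<one> f)"
  have fA: "f \<in> carrier A" using fZ by simp
  have ic: "?i \<in> carrier (sec F U)" by (rule M_closed[OF U(1) ne W_zero iG])
  have "q f \<one> \<otimes>\<^bsub>FA\<^esub> q \<one> f = \<one>\<^bsub>FA\<^esub>" using D.fr_inverse[of f \<one>] fZ by simp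
  then have inv: "res F X U (emb f) \<otimes>\<^bsub>sec F U\<^esub> ?i = \<one>\<^bsub>sec F U\<^esub>"
    using M_mult[OF U(1) ne W_zero W_zero res_emb(2)[OF U(1) ne fA] iG] res_emb(1)[OF U(1) ne fA] M_one[OF U(1) ne] by simp
  have rc: "res F X U a \<in> carrier (sec F U)" "res F X U (emb f) \<in> carrier (sec F U)" using a fA by simp_all
  have "res F X U (emb f) \<otimes>\<^bsub>sec F U\<^esub> (res F X U a \<otimes>\<^bsub>sec F U\<^esub> ?i) = res F X U a \<otimes>\<^bsub>sec F U\<^esub> (res F X U (emb f) \<otimes>\<^bsub>sec F U\<^esub> ?i)"
    using rc ic by (simp add: FU.m_lcomm)
  then have "res F X U a = res F X U (emb f) \<otimes>\<^bsub>sec F U\<^esub> (res F X U a \<otimes>\<^bsub>sec F U\<^esub> ?i)" using inv rc by simp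
  then have "Zfr U (res F X U a \<otimes>\<^bsub>sec F U\<^esub> ?i) = R.fr a (emb f)"
    using Zfr_eq[OF U(1) ne _ a fZ] rc ic by simp
  then show ?thesis using rc ic by blast
qed

text \<open>By \<open>Zfr_local\<close> the fraction comes from sections over small open sets. These
  agree on overlaps because \<open>Zfr\<close> is injective there, and the sheaf property glues
  them.\<close>

lemma Zfr_surj:
  assumes U: "openin (Spec A) U" "U \<noteq> {}" and z: "z \<in> L.reg (carrier RX) U"
  shows "\<exists>s\<in>carrier (sec F U). Zfr U s = z"
proof -
  define \<U> where "\<U> = {U'. openin (Spec A) U' \<and> U' \<noteq> {} \<and> U' \<subseteq> U \<and> (\<exists>t\<in>carrier (sec F U'). Zfr U' t = z)}"
  define g where "g = (\<lambda>U'. SOME t. t \<in> carrier (sec F U') \<and> Zfr U' t = z)"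
  have g: "g U' \<in> carrier (sec F U')" "Zfr U' (g U') = z" if "U' \<in> \<U>" for U'
    using someI_ex[of "\<lambda>t. t \<in> carrier (sec F U') \<and> Zfr U' t = z"] that unfolding \<U>_def g_def by blast+
  have "p \<in> \<Union>\<U>" if p: "p \<in> U" for p
  proof -
    note pp = open_primeideal[OF U(1) p]
    obtain a f where h: "a \<in> carrier RX" "f \<in> carrier A - p" "z = R.fr a (emb f)" using L.regD[OF z p] by blast
    let ?U = "U \<inter> {q. primeideal q A \<and> f \<notin> q}"
    have o: "openin (Spec A) ?U" "p \<in> ?U" using U(1) open_basic[of f] h(2) p pp by auto
    have "\<exists>t\<in>carrier (sec F ?U). Zfr ?U t = z" unfolding h(3) by (rule Zfr_local[OF pp h(1,2) o]) simp
    then have "?U \<in> \<U>" using o unfolding \<U>_def by blast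
    then show ?thesis using o(2) by blast
  qed
  then have cover: "\<Union>\<U> = U" unfolding \<U>_def by blast
  have compat: "res F U1 (U1 \<inter> U2) (g U1) = res F U2 (U1 \<inter> U2) (g U2)" if "U1 \<in> \<U>" "U2 \<in> \<U>" for U1 U2
  proof -
    have o: "openin (Spec A) U1" "U1 \<noteq> {}" "openin (Spec A) U2" "U2 \<noteq> {}" using that unfolding \<U>_def by blast+
    have o12: "openin (Spec A) (U1 \<inter> U2)" "U1 \<inter> U2 \<noteq> {}" using o open_generic[OF o(1,2)] open_generic[OF o(3,4)] by blast+
    interpret r1: ring_hom_cring "sec F U1" "sec F (U1 \<inter> U2)" "res F U1 (U1 \<inter> U2)" by (rule res_hom[OF o(1) o12(1)]) blast
    interpret r2: ring_hom_cring "sec F U2" "sec F (U1 \<inter> U2)" "res F U2 (U1 \<inter> U2)" by (rule res_hom[OF o(3) o12(1)]) blast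
    show ?thesis
      using Zfr_inj[OF o12 r1.hom_closed[OF g(1)[OF that(1)]] r2.hom_closed[OF g(1)[OF that(2)]]]
        Zfr_res[OF o(1,2) o12 _ g(1)[OF that(1)]] Zfr_res[OF o(3,4) o12 _ g(1)[OF that(2)]] g(2)[OF that(1)] g(2)[OF that(2)] by simp
  qed
  have "\<exists>!s. s \<in> carrier (sec F (\<Union>\<U>)) \<and> (\<forall>U'\<in>\<U>. res F (\<Union>\<U>) U' s = g U')"
    by (rule graded_sheafD(6)[OF F]) (use compat g(1) in \<open>auto simp: \<U>_def\<close>)
  then obtain s where s: "s \<in> carrier (sec F U)" "\<And>U'. U' \<in> \<U> \<Longrightarrow> res F U U' s = g U'" unfolding cover by blast
  obtain U' where U': "U' \<in> \<U>" using cover U(2) by blast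
  then have "openin (Spec A) U'" "U' \<noteq> {}" "U' \<subseteq> U" unfolding \<U>_def by blast+
  then have "Zfr U s = Zfr U' (g U')" using Zfr_res[OF U _ _ _ s(1), of U'] s(2)[OF U'] by simp
  then show ?thesis using g(2)[OF U'] s(1) by metis
qed

text \<open>The section belonging to \<open>a / f\<close> inherits the degree of \<open>a\<close>,
  since the homogeneous factor \<open>emb f\<close> of neutral degree can be cancelled.\<close>

lemma Zfr_surj_comp:
  assumes U: "openin (Spec A) U" "U \<noteq> {}" and w: "w \<in> carrier K" and z: "z \<in> L.reg (GX w) U"
  shows "\<exists>s\<in>hcomp F U w. Zfr U s = z"
proof -
  interpret FU: graded_domain K "sec F U" "hcomp F U" by (rule graded_domain_sec[OF U])
  have sub: "GX w \<subseteq> carrier RX" using R.comp_closed w by blast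
  obtain s where s: "s \<in> carrier (sec F U)" "Zfr U s = z" using Zfr_surj[OF U L.reg_mono[OF z sub order_refl]] by blast
  have p: "{\<zero>} \<in> U" using open_generic[OF U] .
  obtain a f where h: "a \<in> GX w" "f \<in> carrier A - {\<zero>}" "z = R.fr a (emb f)" using L.regD[OF z p] by blast
  have fZ: "f \<in> Z" using h(2) by blast
  have "(a, emb f) \<in> Zfr U s" using R.Q.self_mem_fraction[OF subsetD[OF sub h(1)] L.\<phi>_homog[of f]] fZ h(3) s(2) by simp
  then have eq: "res F X U (emb f) \<otimes>\<^bsub>sec F U\<^esub> s = res F X U a" by (simp add: Zfr_def)
  have rc: "res F X U a \<in> hcomp F U w" "res F X U (emb f) \<in> hcomp F U \<one>\<^bsub>K\<^esub>"
    using graded_sheafD(3)[OF F open_X U(1) openin_subset[OF U(1)]] w h(1) L.\<phi>_comp[of f] fZ by auto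
  have "res F X U (emb f) \<noteq> \<zero>\<^bsub>sec F U\<^esub>" using res_emb_homog[OF U fZ] FU.homog_zero by metis
  then have "s \<in> hcomp F U (inv\<^bsub>K\<^esub> \<one>\<^bsub>K\<^esub> \<otimes>\<^bsub>K\<^esub> w)"
    using FU.cofactor_comp[OF rc(2) _ K.one_closed s(1) _ w] eq rc(1) by simp
  then show ?thesis using s(2) w by auto
qed

definition psi :: "'a set set \<Rightarrow> 's \<Rightarrow> 'a set \<Rightarrow> ('s \<times> 's) set" where
  "psi U s = L.sect U (Zfr U s)"

theorem sheaf_iso_assoc: "graded_sheaf_iso K K (Spec A) F (assoc_sheaf A RX GX emb) id psi"
proof -
  have empty: "psi {} s = (\<lambda>_. undefined)" for s by (simp add: psi_def L.sect_def restrict_def)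
  have Fempty: "carrier (sec F {}) = {\<zero>\<^bsub>sec F {}\<^esub>}" "w \<in> carrier K \<Longrightarrow> hcomp F {} w = {\<zero>\<^bsub>sec F {}\<^esub>}" for w
  proof -
    have o: "openin (Spec A) {}" by simp
    interpret FU: graded K "sec F {}" "hcomp F {}" by (rule graded_sec[OF o])
    have z: "x = \<zero>\<^bsub>sec F {}\<^esub>" if "x \<in> carrier (sec F {})" for x
      using graded_sheaf_empty[OF F that] FU.zero_closed by blast
    then show "carrier (sec F {}) = {\<zero>\<^bsub>sec F {}\<^esub>}" using FU.zero_closed by blast
    show "w \<in> carrier K \<Longrightarrow> hcomp F {} w = {\<zero>\<^bsub>sec F {}\<^esub>}" using z FU.comp_closed FU.comp_zero by blast
  qed
  have bij: "bij_betw (psi U) (carrier (sec F U)) (carrier (sec L.AS U))" if U: "openin (Spec A) U" for U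
  proof (cases "U = {}")
    case True
    then show ?thesis using empty Fempty(1) L.assoc_sections_empty by (simp add: L.AS_simps bij_betw_def)
  next
    case ne: False
    show ?thesis unfolding L.AS_simps L.assoc_sections_eq[OF U ne order_refl] psi_def[abs_def]
    proof (rule bij_betwI')
      fix s t assume s: "s \<in> carrier (sec F U)" and t: "t \<in> carrier (sec F U)"
      show "L.sect U (Zfr U s) = L.sect U (Zfr U t) \<longleftrightarrow> s = t"
        using L.sect_inj[OF U ne Zfr_reg[OF U ne s] Zfr_reg[OF U ne t]] Zfr_inj[OF U ne s t] by blast
    qed (use Zfr_reg[OF U ne] Zfr_surj[OF U ne] in blast)+
  qed
  have comp: "psi U ` hcomp F U w = hcomp L.AS U w" if U: "openin (Spec A) U" and w: "w \<in> carrier K" for U w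
  proof (cases "U = {}")
    case True
    then show ?thesis using empty Fempty(2)[OF w] L.assoc_sections_empty by (simp add: L.AS_simps)
  next
    case ne: False
    have sub: "GX w \<subseteq> carrier RX" using R.comp_closed w by blast
    show ?thesis unfolding L.AS_simps L.assoc_sections_eq[OF U ne sub] psi_def[abs_def]
    proof (intro equalityI subsetI)
      fix x assume "x \<in> (\<lambda>s. L.sect U (Zfr U s)) ` hcomp F U w"
      then show "x \<in> L.sect U ` L.reg (GX w) U" using Zfr_reg_comp[OF U ne w] by blast
    next
      fix x assume "x \<in> L.sect U ` L.reg (GX w) U"
      then obtain z where z: "z \<in> L.reg (GX w) U" "x = L.sect U z" by blast
      obtain s where "s \<in> hcomp F U w" "Zfr U s = z" using Zfr_surj_comp[OF U ne w z(1)] by blast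
      then show "x \<in> (\<lambda>s. L.sect U (Zfr U s)) ` hcomp F U w" using z(2) by blast
    qed
  qed
  have "graded_sheaf_hom K K (Spec A) F L.AS id psi"
  proof (rule graded_sheaf_homI)
    show "id \<in> hom K K" by (simp add: hom_def)
    fix U assume U: "openin (Spec A) U"
    show "psi U s \<in> hcomp L.AS U (id w)" if "w \<in> carrier K" "s \<in> hcomp F U w" for w s
      using comp[OF U that(1)] that(2) by auto
    show "psi U \<in> ring_hom (sec F U) (sec L.AS U)"
    proof (rule ring_hom_memI)
      fix s assume s: "s \<in> carrier (sec F U)"
      show "psi U s \<in> carrier (sec L.AS U)" using bij[OF U] s by (auto simp: bij_betw_def)
      fix t assume t: "t \<in> carrier (sec F U)"
      show "psi U (s \<otimes>\<^bsub>sec F U\<^esub> t) = psi U s \<otimes>\<^bsub>sec L.AS U\<^esub> psi U t"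
      proof (cases "U = {}")
        case True
        then show ?thesis by (simp add: empty L.AS_simps restrict_def)
      next
        case ne: False
        show ?thesis unfolding psi_def L.reg_ops(3)[OF U Zfr_reg[OF U ne s] Zfr_reg[OF U ne t]] Zfr_ops(1)[OF U ne s t] ..
      qed
      show "psi U (s \<oplus>\<^bsub>sec F U\<^esub> t) = psi U s \<oplus>\<^bsub>sec L.AS U\<^esub> psi U t"
      proof (cases "U = {}")
        case True
        then show ?thesis by (simp add: empty L.AS_simps restrict_def)
      next
        case ne: False
        show ?thesis unfolding psi_def L.reg_ops(4)[OF U Zfr_reg[OF U ne s] Zfr_reg[OF U ne t]] Zfr_ops(2)[OF U ne s t] ..
      qed
    next
      show "psi U \<one>\<^bsub>sec F U\<^esub> = \<one>\<^bsub>sec L.AS U\<^esub>"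
      proof (cases "U = {}")
        case True
        then show ?thesis by (simp add: empty L.AS_simps restrict_def)
      next
        case ne: False
        interpret FU: graded K "sec F U" "hcomp F U" by (rule graded_sec[OF U])
        interpret r: ring_hom_cring RX "sec F U" "res F X U" using res_hom[OF open_X U openin_subset[OF U]] .
        have "Zfr U \<one>\<^bsub>sec F U\<^esub> = R.fr \<one>\<^bsub>RX\<^esub> (emb \<one>)"
          by (rule Zfr_eq[OF U ne]) simp_all
        then have "Zfr U \<one>\<^bsub>sec F U\<^esub> = \<one>\<^bsub>R.FR\<^esub>" by (simp add: R.fr_one)
        then show ?thesis using L.sect_one(1)[OF U] by (simp add: psi_def)
      qed
    qed
    fix U' s assume U': "openin (Spec A) U'" "U' \<subseteq> U" and s: "s \<in> carrier (sec F U)"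
    show "psi U' (res F U U' s) = res L.AS U U' (psi U s)"
    proof (cases "U' = {}")
      case True
      then show ?thesis by (simp add: empty L.AS_simps restrict_def)
    next
      case ne': False
      then have ne: "U \<noteq> {}" using U'(2) by blast
      show ?thesis unfolding psi_def L.AS_simps L.restrict_sect[OF U'(2)] Zfr_res[OF U ne U'(1) ne' U'(2) s] ..
    qed
  qed
  moreover have "id \<in> iso K K" by (simp add: iso_def hom_def)
  ultimately show ?thesis unfolding graded_sheaf_iso_def using bij comp by simp
qed

end

section \<open>Cox sheaves from graded factorial algebras\<close>

locale cox_alg = graded_alg_iso A V K R G \<phi> + graded_ufd K R G
  for A :: "('a, 'm) ring_scheme" and V
    and K :: "('k, 'n) monoid_scheme" and R :: "('r, 'l) ring_scheme" (structure) and G and \<phi> +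
  assumes units: "homog_units K R G = Units R0"
    and fracs: "degree_zero_frac K R G ` carrier (fraction_field R0) = FG \<one>\<^bsub>K\<^esub>"
    and degs: "degrees K FR FG = carrier K"
    and vals: "bij_betw (restrict_valuation K R G) (essential_valuations K R G)
      (essential_valuations zero_group R0 (trivial_grading R0))"
begin

section \<open>Prime elements correspond to prime divisors\<close>

lemma restrict_valuation_q:
  assumes "b \<in> G \<one>\<^bsub>K\<^esub>" "b \<noteq> \<zero>" "t \<in> G \<one>\<^bsub>K\<^esub>" "t \<noteq> \<zero>"
  shows "restrict_valuation K R G \<nu> (I.B.q b t) = \<nu> (fr b t)"
proof -
  have "I.B.q b t \<in> I.B.QZ" using assms by (intro I.B.q_in_QZ) auto
  then show ?thesis using degree_zero_frac_fraction[of b t] assms by (simp add: restrict_valuation_def)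
qed

lemma val_mlt:
  assumes "x \<in> prime_elems" "a \<in> H" "s \<in> H"
  shows "pval x (fr a s) = int (mlt x a) - int (mlt x s)"
  using frac_val_fr[of "\<lambda>a. int (mlt x a)" a s] mlt_mult[OF assms(1)] assms(2,3) by simp

lemma mlt_one: "x \<in> prime_elems \<Longrightarrow> mlt x \<one> = 0"
  using mlt_mult[of x \<one> \<one>] one_homog by simp

text \<open>By surjectivity in (iii) the valuation at \<open>Y\<close> is the restriction of an
  essential valuation of \<open>R\<close>, and those belong to prime elements.\<close>

lemma ex_prime_elem:
  assumes Y: "A.min_prime Y"
  shows "\<exists>x\<in>prime_elems. \<forall>a\<in>A.Z. int (mlt x (\<phi> a)) = A.ord Y a"
proof -
  have "I.eB Y \<in> restrict_valuation K R G ` essential_valuations K R G"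
    using vals Y unfolding bij_betw_def I.essential_valuations_B by blast
  then obtain x where x: "x \<in> prime_elems" "I.eB Y = restrict_valuation K R G (pval x)"
    unfolding essential_valuations_ufd by blast
  have "int (mlt x (\<phi> a)) = A.ord Y a" if a: "a \<in> A.Z" for a
  proof -
    have aA: "a \<in> carrier A" "a \<noteq> \<zero>\<^bsub>A\<^esub>" using a by auto
    have h: "\<phi> a \<in> G \<one>\<^bsub>K\<^esub>" "\<phi> a \<noteq> \<zero>" using \<phi>_comp[OF aA(1)] \<phi>_eq_zero_iff[OF aA(1)] aA(2) by auto
    have B: "\<phi> a \<in> carrier R0 - {\<zero>\<^bsub>R0\<^esub>}" "\<one> \<in> carrier R0 - {\<zero>\<^bsub>R0\<^esub>}" using h one_comp one_not_zero by auto
    have k1: "I.k \<one> = \<one>\<^bsub>A\<^esub>" using I.k.hom_one by simp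
    have "A.ord Y \<one>\<^bsub>A\<^esub> = 0" using A.ord_mult[OF Y, of "\<one>\<^bsub>A\<^esub>" "\<one>\<^bsub>A\<^esub>"] by simp
    then have "I.eB Y (I.B.q (\<phi> a) \<one>) = A.ord Y a" using I.frac_val_B[OF Y B] k1 I.kh[OF aA(1)] by simp
    moreover have "I.eB Y (I.B.q (\<phi> a) \<one>) = int (mlt x (\<phi> a))"
      unfolding x(2) restrict_valuation_q[OF h one_comp one_not_zero]
      using val_mlt[OF x(1) \<phi>_homog[OF aA] one_homog] mlt_one[OF x(1)] by simp
    ultimately show ?thesis by simp
  qed
  then show ?thesis using x(1) by blast
qed

definition pe :: "'a set \<Rightarrow> 'r" where
  "pe Y = (SOME x. x \<in> prime_elems \<and> (\<forall>a\<in>A.Z. int (mlt x (\<phi> a)) = A.ord Y a))"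

lemma pe: "A.min_prime Y \<Longrightarrow> pe Y \<in> prime_elems"
  and mlt_pe: "\<lbrakk>A.min_prime Y; a \<in> A.Z\<rbrakk> \<Longrightarrow> int (mlt (pe Y) (\<phi> a)) = A.ord Y a"
  using someI_ex[of "\<lambda>x. x \<in> prime_elems \<and> (\<forall>a\<in>A.Z. int (mlt x (\<phi> a)) = A.ord Y a)"] ex_prime_elem[of Y]
  unfolding pe_def by blast+

text \<open>By injectivity in (iii), \<open>x\<close> and \<open>pe Y\<close> define the same
  essential valuation as soon as the restrictions agree, and the valuation determines the
  ideal.\<close>

lemma ex_pe:
  assumes x: "x \<in> prime_elems"
  obtains Y where "A.min_prime Y" "PIdl x = PIdl (pe Y)"
proof -
  have ess: "pval y \<in> essential_valuations K R G" if "y \<in> prime_elems" for y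
    unfolding essential_valuations_ufd using that by blast
  have "restrict_valuation K R G (pval x) \<in> essential_valuations zero_group R0 (trivial_grading R0)"
    using vals ess[OF x] unfolding bij_betw_def by blast
  then obtain Y where Y: "A.min_prime Y"
    "restrict_valuation K R G (pval x) = I.eB Y"
    unfolding I.essential_valuations_B by blast
  have "restrict_valuation K R G (pval (pe Y)) = I.eB Y"
    by (rule restrict_frac_val[OF Y(1)]) (simp_all add: mlt_mult[OF pe[OF Y(1)]] mlt_pe[OF Y(1)])
  then have eq: "pval x = pval (pe Y)"
    using vals ess[OF x] ess[OF pe[OF Y(1)]] Y(2) unfolding bij_betw_def by (metis inj_onD)
  have "int (mlt x a) = int (mlt (pe Y) a)" if a: "a \<in> H" for a
    using val_mlt[OF x a one_homog] val_mlt[OF pe[OF Y(1)] a one_homog] mlt_one[OF x] mlt_one[OF pe[OF Y(1)]] eq by simp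
  then have "PIdl x = PIdl (pe Y)"
    by (rule graded_ord_inj[OF graded_ord_mlt[OF x] graded_prime_cgenideal[OF x]
        graded_ord_mlt[OF pe[OF Y(1)]] graded_prime_cgenideal[OF pe[OF Y(1)]]])
  then show thesis using that Y(1) by blast
qed

lemma pe_inj:
  assumes Y: "A.min_prime Y" "A.min_prime Y'" and eq: "PIdl (pe Y) = PIdl (pe Y')"
  shows "Y = Y'"
proof (rule A.D.graded_ord_inj[OF A.graded_ord_ord[OF Y(1)] A.min_prime_graded[OF Y(1)]
      A.graded_ord_ord[OF Y(2)] A.min_prime_graded[OF Y(2)]])
  fix a assume "a \<in> homog zero_group A (trivial_grading A)"
  then have a: "a \<in> A.Z" by (simp add: homog_trivial)
  then show "A.ord Y a = A.ord Y' a"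
    using mlt_cong[OF pe[OF Y(1)] pe[OF Y(2)] eq \<phi>_homog[of a]] mlt_pe[OF Y(1) a] mlt_pe[OF Y(2) a] by simp
qed

lemma mlt_pe_pe:
  assumes Y: "A.min_prime Y" "A.min_prime Y'"
  shows "mlt (pe Y) (pe Y') = (if Y = Y' then 1 else 0)"
proof (cases "Y = Y'")
  case True
  then show ?thesis using mlt_self[OF pe[OF Y(2)]] by simp
next
  case False
  then have "\<not> pe Y divides\<^bsub>M\<^esub> pe Y'" using prime_elem_associated[OF pe[OF Y(1)] pe[OF Y(2)]] pe_inj[OF Y] by blast
  then show ?thesis using False mlt_zero_iff[OF pe[OF Y(1)] prime_elemD(1)[OF pe[OF Y(2)]]] by simp
qed

lemma finite_mlt_pe:
  assumes a: "a \<in> H"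
  shows "finite {Y. A.min_prime Y \<and> mlt (pe Y) a \<noteq> 0}"
proof (rule finite_imageD)
  show "finite ((\<lambda>Y. PIdl (pe Y)) ` {Y. A.min_prime Y \<and> mlt (pe Y) a \<noteq> 0})"
    by (rule finite_subset[OF _ finite_mlt_nonzero[OF a]]) (use pe in auto)
  show "inj_on (\<lambda>Y. PIdl (pe Y)) {Y. A.min_prime Y \<and> mlt (pe Y) a \<noteq> 0}"
    by (rule inj_onI) (use pe_inj in blast)
qed

text \<open>As \<open>Q\<^sup>+(R)\<close> is graded simple, it is graded integral itself; the
  results on homogeneous elements and degrees thus apply to fractions too.\<close>

sublocale L: graded_domain K FR FG
proof
  have unit: "b = \<zero>\<^bsub>FR\<^esub>" if ab: "a \<in> homog K FR FG" "b \<in> carrier FR" "a \<otimes>\<^bsub>FR\<^esub> b = \<zero>\<^bsub>FR\<^esub>" for a b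
  proof -
    interpret FR: cring FR by (rule cring_FR)
    have "a \<in> Units FR" using graded_simple_FR ab(1) by (auto simp: graded_simple_def)
    then have "a \<otimes>\<^bsub>FR\<^esub> b = a \<otimes>\<^bsub>FR\<^esub> \<zero>\<^bsub>FR\<^esub> \<longleftrightarrow> b = \<zero>\<^bsub>FR\<^esub>" "a \<in> carrier FR"
      using FR.Units_l_cancel[of a b "\<zero>\<^bsub>FR\<^esub>"] ab(2) by auto
    then show ?thesis using ab(3) FR.r_null[of a] by metis
  qed
  then show "graded_integral K FR FG"
    using graded_ring_FR one_FR_not_zero by (simp add: graded_integral_def)
qed

section \<open>Homogeneous fractions and their values\<close>

abbreviation HQ where "HQ \<equiv> homog K FR FG"

lemma HQ_cases:
  assumes "z \<in> HQ"
  obtains a s where "a \<in> H" "s \<in> H" "z = fr a s"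
  using assms unfolding homog_FR by blast

lemma fr_HQ: "\<lbrakk>a \<in> H; s \<in> H\<rbrakk> \<Longrightarrow> fr a s \<in> HQ"
  unfolding homog_FR by blast

abbreviation QM where "QM \<equiv> FR\<lparr>carrier := HQ\<rparr>"

sublocale QM: comm_group QM
proof (rule comm_groupI)
  fix x assume x: "x \<in> carrier QM"
  then obtain a s where h: "a \<in> H" "s \<in> H" "x = fr a s" using HQ_cases[of x] by auto
  then show "\<exists>y\<in>carrier QM. y \<otimes>\<^bsub>QM\<^esub> x = \<one>\<^bsub>QM\<^esub>"
    using fr_HQ[OF h(2,1)] fr_inverse[OF h(2,1)] by (intro bexI[of _ "fr s a"]) auto
qed (simp_all add: L.m_ac L.homog_closed L.homog_mult L.one_homog)

definition vl :: "'a set \<Rightarrow> ('r \<times> 'r) set \<Rightarrow> int" where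
  "vl Y = pval (pe Y)"

lemma vl_fr: "\<lbrakk>A.min_prime Y; a \<in> H; s \<in> H\<rbrakk> \<Longrightarrow> vl Y (fr a s) = int (mlt (pe Y) a) - int (mlt (pe Y) s)"
  unfolding vl_def by (rule val_mlt[OF pe])

lemma vl_mult:
  assumes Y: "A.min_prime Y" and z: "z \<in> HQ" "w \<in> HQ"
  shows "vl Y (z \<otimes>\<^bsub>FR\<^esub> w) = vl Y z + vl Y w"
proof -
  obtain a s where h: "a \<in> H" "s \<in> H" "z = fr a s" using HQ_cases[OF z(1)] .
  obtain b t where k: "b \<in> H" "t \<in> H" "w = fr b t" using HQ_cases[OF z(2)] .
  have "z \<otimes>\<^bsub>FR\<^esub> w = fr (a \<otimes> b) (s \<otimes> t)" using h k fr_mult[of a s b t] homog_closed by simp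
  then show ?thesis
    using h k vl_fr[OF Y] homog_mult mlt_mult[OF pe[OF Y]] by simp
qed

lemma finite_vl:
  assumes "z \<in> HQ"
  shows "finite {Y. A.min_prime Y \<and> vl Y z \<noteq> 0}"
proof -
  obtain a s where h: "a \<in> H" "s \<in> H" "z = fr a s" using HQ_cases[OF assms] .
  have "{Y. A.min_prime Y \<and> vl Y z \<noteq> 0} \<subseteq>
      {Y. A.min_prime Y \<and> mlt (pe Y) a \<noteq> 0} \<union> {Y. A.min_prime Y \<and> mlt (pe Y) s \<noteq> 0}"
    using vl_fr h by auto
  then show ?thesis using finite_mlt_pe[OF h(1)] finite_mlt_pe[OF h(2)] finite_subset by blast
qed

text \<open>By \<open>ex_pe\<close> the elements \<open>pe Y\<close> represent all prime elements up
  to associates, so they suffice to test divisibility.\<close>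

lemma mlt_le_if_pe:
  assumes ab: "a \<in> H" "b \<in> H" and le: "\<And>Y. A.min_prime Y \<Longrightarrow> mlt (pe Y) b \<le> mlt (pe Y) a"
  shows "b divides\<^bsub>M\<^esub> a"
proof (rule divides_if_mlt_le[OF ab(2,1)])
  fix x assume x: "x \<in> prime_elems"
  obtain Y where Y: "A.min_prime Y" "PIdl x = PIdl (pe Y)" using ex_pe[OF x] .
  show "mlt x b \<le> mlt x a" using mlt_cong[OF x pe[OF Y(1)] Y(2)] ab le[OF Y(1)] by simp
qed

lemma vl_nonneg_integral:
  assumes z: "z \<in> HQ" and nn: "\<And>Y. A.min_prime Y \<Longrightarrow> 0 \<le> vl Y z"
  obtains a where "a \<in> H" "z = fr a \<one>"
proof -
  obtain a s where h: "a \<in> H" "s \<in> H" "z = fr a s" using HQ_cases[OF z] .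
  have "s divides\<^bsub>M\<^esub> a"
    using nn vl_fr[OF _ h(1,2)] unfolding h(3) by (intro mlt_le_if_pe[OF h(1,2)]) fastforce
  then obtain c where c: "c \<in> H" "a = s \<otimes> c" by (rule homog_dividesE)
  have "z = fr c \<one>" unfolding h(3)
    using h c one_homog homog_closed m_comm[of s c] by (intro fr_eqI) auto
  then show thesis using that c(1) by blast
qed

text \<open>The condition on units in (i) enters here: the fraction is an element of
  \<open>R\<close> that divides \<open>\<one>\<close>, so it has neutral degree.\<close>

lemma vl_zero_degree:
  assumes z: "z \<in> HQ" and nn: "\<And>Y. A.min_prime Y \<Longrightarrow> vl Y z = 0"
  shows "z \<in> FG \<one>\<^bsub>K\<^esub>"
proof -
  obtain a where a: "a \<in> H" "z = fr a \<one>" using vl_nonneg_integral[OF z] nn by (metis order_refl)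
  have "a divides\<^bsub>M\<^esub> \<one>"
  proof (rule mlt_le_if_pe[OF one_homog a(1)])
    fix Y assume Y: "A.min_prime Y"
    show "mlt (pe Y) a \<le> mlt (pe Y) \<one>" using nn[OF Y] vl_fr[OF Y a(1) one_homog] a(2) by simp
  qed
  then obtain b where b: "b \<in> H" "\<one> = a \<otimes> b" by (rule homog_dividesE)
  have "a \<in> Units R" unfolding Units_def
    using a(1) b homog_closed m_comm[of a b] by (auto intro!: bexI[of _ b])
  then have "a \<in> Units R0" using a(1) unfolding units[symmetric] by (simp add: homog_units_def)
  then have "a \<in> G \<one>\<^bsub>K\<^esub>" by (simp add: Units_def)
  then show ?thesis unfolding a(2)
    using fr_mem_FG_iff[OF homog_closed[OF a(1)] one_homog one_comp K.one_closed K.one_closed] by simp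
qed

text \<open>The universal property of the free abelian group on the prime divisors, applied to the
  group \<open>QM\<close> of non-zero homogeneous fractions.\<close>

lemma ex_divisor_hom:
  "\<exists>h. h \<in> hom A.WD QM \<and> (\<forall>Y. A.min_prime Y \<longrightarrow> h (frag_of Y) = fr (pe Y) \<one>)"
proof -
  have "(\<lambda>Y. fr (pe Y) \<one>) ` {Y. A.min_prime Y} \<subseteq> carrier QM"
    using fr_HQ one_homog prime_elemD(1)[OF pe] by auto
  then obtain h where "h \<in> hom (free_Abelian_group {Y. A.min_prime Y}) QM"
    "\<And>Y. Y \<in> {Y. A.min_prime Y} \<Longrightarrow> h (frag_of Y) = fr (pe Y) \<one>"
    using QM.free_Abelian_group_universal[of "\<lambda>Y. fr (pe Y) \<one>" "{Y. A.min_prime Y}"] by blast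
  then show ?thesis unfolding A.WDiv_eq by blast
qed

section \<open>From divisors to homogeneous fractions and degrees\<close>

definition h :: "'a divisor \<Rightarrow> ('r \<times> 'r) set" where
  "h = (SOME h. h \<in> hom A.WD QM \<and> (\<forall>Y. A.min_prime Y \<longrightarrow> h (frag_of Y) = fr (pe Y) \<one>))"

lemma h_hom: "h \<in> hom A.WD QM" and h_frag: "A.min_prime Y \<Longrightarrow> h (frag_of Y) = fr (pe Y) \<one>"
  using someI_ex[OF ex_divisor_hom] unfolding h_def by blast+

lemma h_HQ: "D \<in> A.W \<Longrightarrow> h D \<in> HQ"
  using hom_in_carrier[OF h_hom, of D] by (simp add: A.WD_simps)

lemma h_add: "\<lbrakk>D \<in> A.W; E \<in> A.W\<rbrakk> \<Longrightarrow> h (D + E) = h D \<otimes>\<^bsub>FR\<^esub> h E"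
  using hom_mult[OF h_hom, of D E] by (simp add: A.WD_simps)

lemma vl_h:
  assumes "D \<in> A.W" "A.min_prime Y"
  shows "vl Y (h D) = Poly_Mapping.lookup D Y"
proof -
  \<comment> \<open>Membership in \<open>A.W\<close> is part of the induction hypothesis because the
    difference step does not provide it.\<close>
  have "D \<in> A.W \<and> vl Y (h D) = Poly_Mapping.lookup D Y"
    using assms(1)[unfolded mem_Collect_eq]
  proof (induction D rule: frag_induction)
    case zero
    have "h 0 = h 0 \<otimes>\<^bsub>FR\<^esub> h 0" using h_add[OF A.W_zero A.W_zero] by simp
    then have "vl Y (h 0) = vl Y (h 0) + vl Y (h 0)" using vl_mult[OF assms(2) h_HQ[OF A.W_zero] h_HQ[OF A.W_zero]] by simp
    then show ?case by simp
  next
    case (one Y')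
    then have Y': "A.min_prime Y'" by simp
    have "vl Y (h (frag_of Y')) = (if Y = Y' then 1 else 0)"
      unfolding h_frag[OF Y'] vl_fr[OF assms(2) prime_elemD(1)[OF pe[OF Y']] one_homog]
        mlt_pe_pe[OF assms(2) Y'] mlt_one[OF pe[OF assms(2)]] by simp
    then show ?case using Y' by (auto simp: lookup_frag_of)
  next
    case (diff D E)
    then have DE: "D - E \<in> A.W" using A.W_diff by blast
    have "h D = h (D - E) \<otimes>\<^bsub>FR\<^esub> h E" using h_add[OF DE, of E] diff by simp
    then have "vl Y (h D) = vl Y (h (D - E)) + vl Y (h E)" using vl_mult[OF assms(2) h_HQ[OF DE] h_HQ[of E]] diff by simp
    then show ?case using diff DE by (simp add: lookup_minus)
  qed
  then show ?thesis by blast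
qed

definition dg :: "'a divisor \<Rightarrow> 'k" where
  "dg D = (SOME w. w \<in> carrier K \<and> h D \<in> FG w)"

lemma dg: "D \<in> A.W \<Longrightarrow> dg D \<in> carrier K" "D \<in> A.W \<Longrightarrow> h D \<in> FG (dg D)"
proof -
  assume "D \<in> A.W"
  then have "\<exists>w. w \<in> carrier K \<and> h D \<in> FG w" using h_HQ[of D] by (auto simp: homog_def)
  from someI_ex[OF this] show "dg D \<in> carrier K" "h D \<in> FG (dg D)" unfolding dg_def by auto
qed

lemma QM_inv:
  assumes "z \<in> HQ"
  obtains y where "y \<in> HQ" "y \<otimes>\<^bsub>FR\<^esub> z = \<one>\<^bsub>FR\<^esub>"
  using QM.l_inv_ex[of z] assms by auto

lemma HQ_quotient:
  assumes z: "z \<in> HQ" and w: "w \<in> HQ"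
  obtains u where "u \<in> HQ" "z = u \<otimes>\<^bsub>FR\<^esub> w" "\<forall>Y. A.min_prime Y \<longrightarrow> vl Y u = vl Y z - vl Y w"
proof -
  obtain y where y: "y \<in> HQ" "y \<otimes>\<^bsub>FR\<^esub> w = \<one>\<^bsub>FR\<^esub>" using QM_inv[OF w] .
  let ?u = "z \<otimes>\<^bsub>FR\<^esub> y"
  have u: "?u \<in> HQ" by (rule L.homog_mult[OF z y(1)])
  have eq: "z = ?u \<otimes>\<^bsub>FR\<^esub> w" using y z w by (simp add: L.m_assoc L.homog_closed)
  have "vl Y ?u = vl Y z - vl Y w" if "A.min_prime Y" for Y
  proof -
    have "vl Y z = vl Y ?u + vl Y w" by (subst eq) (rule vl_mult[OF that u w])
    then show ?thesis by simp
  qed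
  then show thesis using that[OF u eq] by blast
qed

text \<open>Two homogeneous fractions with the same values differ by a factor all of whose values
  are 0, and this factor has neutral degree.\<close>

lemma degree_eqI:
  assumes D: "D \<in> A.W" and z: "z \<in> HQ" "z \<in> FG w" "w \<in> carrier K"
    and vl: "\<And>Y. A.min_prime Y \<Longrightarrow> vl Y z = Poly_Mapping.lookup D Y"
  shows "dg D = w"
proof -
  obtain u where u: "u \<in> HQ" "z = u \<otimes>\<^bsub>FR\<^esub> h D" "\<forall>Y. A.min_prime Y \<longrightarrow> vl Y u = vl Y z - vl Y (h D)"
    using HQ_quotient[OF z(1) h_HQ[OF D]] .
  have "u \<in> FG \<one>\<^bsub>K\<^esub>" using vl_zero_degree[OF u(1)] u(3) vl vl_h[OF D] by simp
  then have "z \<in> FG (dg D)" unfolding u(2) using L.comp_mult[OF K.one_closed dg(1)[OF D] _ dg(2)[OF D], of u] dg(1)[OF D] by simp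
  then show ?thesis using L.degree_unique[OF _ z(2) dg(1)[OF D] z(3)] z(1) L.homog_zero by blast
qed

lemma dg_add:
  assumes D: "D \<in> A.W" "E \<in> A.W"
  shows "dg (D + E) = dg D \<otimes>\<^bsub>K\<^esub> dg E"
proof (rule degree_eqI[OF A.W_add[OF D]])
  show "h (D + E) \<in> HQ" by (rule h_HQ[OF A.W_add[OF D]])
  show "h (D + E) \<in> FG (dg D \<otimes>\<^bsub>K\<^esub> dg E)"
    unfolding h_add[OF D] by (rule L.comp_mult[OF dg(1)[OF D(1)] dg(1)[OF D(2)] dg(2)[OF D(1)] dg(2)[OF D(2)]])
  show "dg D \<otimes>\<^bsub>K\<^esub> dg E \<in> carrier K" using dg(1) D by simp
qed (rule vl_h[OF A.W_add[OF D]])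

text \<open>By (ii) there is a homogeneous fraction of degree \<open>w\<close>; the divisor
  \<open>D\<close> collects its values.\<close>

lemma dg_surj:
  assumes w: "w \<in> carrier K"
  shows "\<exists>D\<in>A.W. dg D = w"
proof -
  have "w \<in> degrees K FR FG" using w degs by simp
  then obtain z where z: "z \<in> HQ" "z \<in> FG w" by (auto simp: degrees_def)
  define D where "D = Abs_poly_mapping (\<lambda>Y. if A.min_prime Y then vl Y z else 0)"
  have "finite {Y. (if A.min_prime Y then vl Y z else 0) \<noteq> 0}"
    by (rule finite_subset[OF _ finite_vl[OF z(1)]]) (auto split: if_splits)
  then have lD: "Poly_Mapping.lookup D Y = (if A.min_prime Y then vl Y z else 0)" for Y by (simp add: D_def)
  then have "D \<in> A.W" by (auto simp: in_keys_iff split: if_splits)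
  then show ?thesis using degree_eqI[OF _ z w] lD by auto
qed

section \<open>The function field inside the graded fraction ring\<close>

definition em :: "('a \<times> 'a) set \<Rightarrow> ('r \<times> 'r) set" where
  "em x = (\<Union>(a, s)\<in>x. fr (\<phi> a) (\<phi> s))"

lemma em_q:
  assumes a: "a \<in> carrier A" and s: "s \<in> A.Z"
  shows "em (A.q a s) = fr (\<phi> a) (\<phi> s)"
  unfolding em_def
proof (rule UN_constant_eq)
  have sH: "s \<in> homog zero_group A (trivial_grading A)" using s by simp
  show "(a, s) \<in> A.q a s" by (rule A.D.Q.self_mem_fraction[OF a sH])
  show "\<forall>p\<in>A.q a s. (case p of (a, s) \<Rightarrow> fr (\<phi> a) (\<phi> s)) = fr (\<phi> a) (\<phi> s)"
  proof
  fix p assume "p \<in> A.q a s"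
  then obtain b t where p: "p = (b, t)" "(b, t) \<in> A.q a s" by (cases p) auto
  then have bt: "b \<in> carrier A" "t \<in> A.Z" "a \<otimes>\<^bsub>A\<^esub> t = b \<otimes>\<^bsub>A\<^esub> s" using A.D.Q.mem_fraction_iff[OF a sH] by auto
  have "\<phi> b \<otimes> \<phi> s = \<phi> a \<otimes> \<phi> t" using arg_cong[OF bt(3), of \<phi>] a s bt(1,2) by simp
  then have "fr (\<phi> b) (\<phi> t) = fr (\<phi> a) (\<phi> s)" using a s bt(1,2) \<phi>_homog[of s] \<phi>_homog[of t] by (intro fr_eqI) auto
  then show "(case p of (a, s) \<Rightarrow> fr (\<phi> a) (\<phi> s)) = fr (\<phi> a) (\<phi> s)" using p(1) by simp
  qed
qed

lemma FA_cases:
  assumes "x \<in> carrier A.FA"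
  obtains a s where "a \<in> carrier A" "s \<in> A.Z" "x = A.q a s"
  using A.D.fr_cases[OF assms] by auto

lemma em_ops:
  assumes "x \<in> carrier A.FA" "y \<in> carrier A.FA"
  shows "em (x \<otimes>\<^bsub>A.FA\<^esub> y) = em x \<otimes>\<^bsub>FR\<^esub> em y" "em (x \<oplus>\<^bsub>A.FA\<^esub> y) = em x \<oplus>\<^bsub>FR\<^esub> em y"
proof -
  obtain a s where x: "a \<in> carrier A" "s \<in> A.Z" "x = A.q a s" using FA_cases[OF assms(1)] .
  obtain b t where y: "b \<in> carrier A" "t \<in> A.Z" "y = A.q b t" using FA_cases[OF assms(2)] .
  have sH: "s \<in> homog zero_group A (trivial_grading A)" "t \<in> homog zero_group A (trivial_grading A)" using x y by simp_all
  have c: "s \<in> carrier A" "t \<in> carrier A" using x y by auto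
  have H: "\<phi> s \<in> H" "\<phi> t \<in> H" using x y \<phi>_homog by auto
  note st = A.Z_mult[OF x(2) y(2)]
  have e: "em (A.q c (s \<otimes>\<^bsub>A\<^esub> t)) = fr (\<phi> c) (\<phi> s \<otimes> \<phi> t)" if "c \<in> carrier A" for c
    using em_q[OF that st] c by simp
  show "em (x \<otimes>\<^bsub>A.FA\<^esub> y) = em x \<otimes>\<^bsub>FR\<^esub> em y"
    unfolding x(3) y(3) A.q_mult[OF x(1,2) y(1,2)] em_q[OF x(1,2)] em_q[OF y(1,2)]
      fr_mult[OF \<phi>.hom_closed[OF x(1)] H(1) \<phi>.hom_closed[OF y(1)] H(2)]
    using e[of "a \<otimes>\<^bsub>A\<^esub> b"] x(1) y(1) by simp
  show "em (x \<oplus>\<^bsub>A.FA\<^esub> y) = em x \<oplus>\<^bsub>FR\<^esub> em y"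
    unfolding x(3) y(3) A.D.fr_add[OF x(1) sH(1) y(1) sH(2)] em_q[OF x(1,2)] em_q[OF y(1,2)]
      fr_add[OF \<phi>.hom_closed[OF x(1)] H(1) \<phi>.hom_closed[OF y(1)] H(2)]
    using e[of "a \<otimes>\<^bsub>A\<^esub> t \<oplus>\<^bsub>A\<^esub> b \<otimes>\<^bsub>A\<^esub> s"] x(1) y(1) c by simp
qed

lemma em_closed: "x \<in> carrier A.FA \<Longrightarrow> em x \<in> carrier FR"
  using em_q \<phi>_homog by (elim FA_cases) auto

lemma em_zero: "em \<zero>\<^bsub>A.FA\<^esub> = \<zero>\<^bsub>FR\<^esub>" and em_one: "em \<one>\<^bsub>A.FA\<^esub> = \<one>\<^bsub>FR\<^esub>"
  using em_q[of "\<zero>\<^bsub>A\<^esub>" "\<one>\<^bsub>A\<^esub>"] em_q[of "\<one>\<^bsub>A\<^esub>" "\<one>\<^bsub>A\<^esub>"] by (simp_all add: A.D.fr_zero A.D.fr_one fr_zero fr_one)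

lemma em_inj:
  assumes "x \<in> carrier A.FA" "y \<in> carrier A.FA" "em x = em y"
  shows "x = y"
proof -
  obtain a s where x: "a \<in> carrier A" "s \<in> A.Z" "x = A.q a s" using FA_cases[OF assms(1)] .
  obtain b t where y: "b \<in> carrier A" "t \<in> A.Z" "y = A.q b t" using FA_cases[OF assms(2)] .
  have H: "\<phi> s \<in> H" "\<phi> t \<in> H" using x y \<phi>_homog by auto
  have c: "s \<in> carrier A" "t \<in> carrier A" using x y by auto
  have "\<phi> a \<otimes> \<phi> t = \<phi> b \<otimes> \<phi> s"
    using assms(3) fr_eq_iff[OF \<phi>.hom_closed[OF x(1)] H(1) \<phi>.hom_closed[OF y(1)] H(2)]
    unfolding x(3) y(3) em_q[OF x(1,2)] em_q[OF y(1,2)] by blast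
  then have "\<phi> (a \<otimes>\<^bsub>A\<^esub> t) = \<phi> (b \<otimes>\<^bsub>A\<^esub> s)" using x(1) y(1) c by simp
  then have "a \<otimes>\<^bsub>A\<^esub> t = b \<otimes>\<^bsub>A\<^esub> s" using \<phi>_inj x(1) y(1) c by (meson A.m_closed inj_onD)
  then show ?thesis unfolding x(3) y(3) using A.q_eq_iff[OF x(1,2) y(1,2)] by blast
qed

lemma em_QZ:
  assumes "x \<in> A.QZ"
  shows "em x \<in> HQ" "em x \<in> FG \<one>\<^bsub>K\<^esub>" "A.min_prime Y \<Longrightarrow> vl Y (em x) = A.val Y x"
proof -
  obtain a s where x: "a \<in> A.Z" "s \<in> A.Z" "x = A.q a s" using A.QZ_cases[OF assms] .
  have H: "\<phi> a \<in> H" "\<phi> s \<in> H" using x \<phi>_homog by auto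
  have e: "em x = fr (\<phi> a) (\<phi> s)" unfolding x(3) using em_q[of a s] x by blast
  show "em x \<in> HQ" unfolding e by (rule fr_HQ[OF H])
  show "em x \<in> FG \<one>\<^bsub>K\<^esub>" unfolding e
    using fr_mem_FG_iff[OF homog_closed[OF H(1)] H(2) \<phi>_comp[of s] K.one_closed K.one_closed] \<phi>_comp[of a] x by simp
  assume Y: "A.min_prime Y"
  show "vl Y (em x) = A.val Y x"
    unfolding e vl_fr[OF Y H] mlt_pe[OF Y x(1)] mlt_pe[OF Y x(2)] using A.val_q[OF Y x(1,2)] x(3) by metis
qed

lemma em_surj:
  assumes z: "z \<in> FG \<one>\<^bsub>K\<^esub>" "z \<noteq> \<zero>\<^bsub>FR\<^esub>"
  obtains x where "x \<in> A.QZ" "z = em x"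
proof -
  obtain a f where h: "a \<in> carrier A" "f \<in> carrier A" "f \<noteq> \<zero>\<^bsub>A\<^esub>" "z = fr (\<phi> a) (\<phi> f)"
    using z(1) unfolding fracs[symmetric] degree_zero_frac_image by blast
  have "a \<noteq> \<zero>\<^bsub>A\<^esub>" using z(2) h fr_eq_zero_iff[OF _ \<phi>_homog[OF h(2,3)], of "\<phi> a"] by auto
  then have "A.q a f \<in> A.QZ" using h by (intro A.q_in_QZ) auto
  moreover have "z = em (A.q a f)" using em_q[of a f] h by simp
  ultimately show thesis by (rule that)
qed

text \<open>By (ii) the fractions of neutral degree come from the function field, and
  \<open>h D = em x\<close> says that \<open>D\<close> is the divisor of \<open>x\<close>.
  Conversely, \<open>em x\<close> has neutral degree, and the degree depends on the values
  only.\<close>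

lemma dg_trivial_iff:
  assumes D: "D \<in> A.W"
  shows "dg D = \<one>\<^bsub>K\<^esub> \<longleftrightarrow> D \<in> A.pdiv ` A.QZ"
proof
  assume "dg D = \<one>\<^bsub>K\<^esub>"
  then have "h D \<in> FG \<one>\<^bsub>K\<^esub>" using dg(2)[OF D] by simp
  moreover have "h D \<noteq> \<zero>\<^bsub>FR\<^esub>" using h_HQ[OF D] L.homog_zero by metis
  ultimately obtain x where x: "x \<in> A.QZ" "h D = em x" by (rule em_surj)
  have "D = A.pdiv x"
  proof (rule poly_mapping_eqI)
    show "Poly_Mapping.lookup D Y = Poly_Mapping.lookup (A.pdiv x) Y" for Y
      using A.lookup_pdiv[OF x(1), of Y] A.W_lookup[OF D, of Y] vl_h[OF D, of Y] em_QZ(3)[OF x(1), of Y] x(2) by auto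
  qed
  then show "D \<in> A.pdiv ` A.QZ" using x(1) by blast
next
  assume "D \<in> A.pdiv ` A.QZ"
  then obtain x where x: "x \<in> A.QZ" "D = A.pdiv x" by blast
  show "dg D = \<one>\<^bsub>K\<^esub>"
    by (rule degree_eqI[OF D em_QZ(1,2)[OF x(1)] K.one_closed]) (simp add: em_QZ(3)[OF x(1)] A.lookup_pdiv[OF x(1)] x(2))
qed

section \<open>Sections of divisors as homogeneous fractions\<close>

definition sc :: "'a divisor \<Rightarrow> ('a \<times> 'a) set \<Rightarrow> ('r \<times> 'r) set" where
  "sc D x = em x \<otimes>\<^bsub>FR\<^esub> h D"

lemma sc_HQ:
  assumes D: "D \<in> A.W" and x: "x \<in> A.QZ"
  shows "sc D x \<in> HQ" "sc D x \<in> FG (dg D)"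
    and "A.min_prime Y \<Longrightarrow> vl Y (sc D x) = A.val Y x + Poly_Mapping.lookup D Y"
  unfolding sc_def
  using L.homog_mult[OF em_QZ(1)[OF x] h_HQ[OF D]] L.comp_mult[OF K.one_closed dg(1)[OF D] em_QZ(2)[OF x] dg(2)[OF D]]
    dg(1)[OF D] vl_mult[OF _ em_QZ(1)[OF x] h_HQ[OF D]] em_QZ(3)[OF x] vl_h[OF D] by simp_all

lemma sc_zero: "D \<in> A.W \<Longrightarrow> sc D \<zero>\<^bsub>A.FA\<^esub> = \<zero>\<^bsub>FR\<^esub>"
  using h_HQ[of D] L.homog_closed by (simp add: sc_def em_zero)

text \<open>The fraction \<open>sc D x\<close> has non-negative values over \<open>U\<close>. By
  \<open>clear_denominators\<close> some \<open>f\<close> outside \<open>p\<close> makes all values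
  of the product with \<open>f\<close> non-negative, so that this product is an element
  \<open>a\<close> of \<open>R\<close>.\<close>

lemma sc_reg:
  assumes U: "openin (Spec A) U" and D: "D \<in> A.W" and x: "x \<in> A.Gam U D"
  shows "sc D x \<in> reg (G (dg D)) U"
  unfolding reg_def
proof (intro CollectI ballI)
  fix p assume p: "p \<in> U"
  note pp = A.open_primeideal[OF U p]
  show "\<exists>a\<in>G (dg D). \<exists>f\<in>carrier A - p. sc D x = fr a (\<phi> f)"
  proof (cases "x = \<zero>\<^bsub>A.FA\<^esub>")
    case True
    interpret p: primeideal p A by (rule pp)
    have "\<one>\<^bsub>A\<^esub> \<in> carrier A - p" using p.one_imp_carrier p.I_notcarr by auto
    moreover have "sc D x = fr \<zero> (\<phi> \<one>\<^bsub>A\<^esub>)" using True sc_zero[OF D] by (simp add: fr_zero)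
    ultimately show ?thesis using comp_zero[OF dg(1)[OF D]] by blast
  next
    case False
    then have xQ: "x \<in> A.QZ" using A.Gam_closed[OF x] by blast
    let ?z = "sc D x"
    note z = sc_HQ[OF D xQ]
    have fin: "finite {Y. A.min_prime Y \<and> vl Y ?z < 0}"
      by (rule finite_subset[OF _ finite_vl[OF z(1)]]) auto
    have nn: "0 \<le> vl Y ?z" if "A.min_prime Y" "Y \<in> U" for Y
      using A.GamD[OF x False that] z(3)[OF that(1)] by simp
    obtain f where f: "f \<in> carrier A - p" "\<And>Y. A.min_prime Y \<Longrightarrow> 0 \<le> A.ord Y f + vl Y ?z"
      using A.clear_denominators[OF U p fin nn] by blast
    note f' = prime_outside[OF pp f(1)]
    have fH: "fr (\<phi> f) \<one> \<in> HQ" by (rule fr_HQ[OF f'(3) one_homog])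
    have "0 \<le> vl Y (?z \<otimes>\<^bsub>FR\<^esub> fr (\<phi> f) \<one>)" if Y: "A.min_prime Y" for Y
      using f(2)[OF Y] vl_mult[OF Y z(1) fH] vl_fr[OF Y f'(3) one_homog] mlt_one[OF pe[OF Y]] mlt_pe[OF Y, of f] f'(1,2) by simp
    then obtain a where a: "a \<in> H" "?z \<otimes>\<^bsub>FR\<^esub> fr (\<phi> f) \<one> = fr a \<one>"
      using vl_nonneg_integral[OF L.homog_mult[OF z(1) fH]] by blast
    obtain b t where bt: "b \<in> H" "t \<in> H" "?z = fr b t" using HQ_cases[OF z(1)] .
    have "fr (b \<otimes> \<phi> f) (t \<otimes> \<one>) = fr a \<one>"
      using a(2) bt f' fr_mult[of b t "\<phi> f" \<one>] one_homog homog_closed by simp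
    then have "b \<otimes> \<phi> f \<otimes> \<one> = a \<otimes> (t \<otimes> \<one>)"
      using fr_eq_iff[of "b \<otimes> \<phi> f" "t \<otimes> \<one>" a \<one>] a(1) bt f' one_homog homog_closed homog_mult by simp
    then have "b \<otimes> \<phi> f = a \<otimes> t" using a(1) bt f' homog_closed by simp
    then have eq: "?z = fr a (\<phi> f)" unfolding bt(3) using a(1) bt(1,2) f' homog_closed by (intro fr_eqI) auto
    have "a \<in> G (dg D \<otimes>\<^bsub>K\<^esub> \<one>\<^bsub>K\<^esub>)"
      using z(2) fr_mem_FG_iff[OF homog_closed[OF a(1)] f'(3) \<phi>_comp[OF f'(2)] K.one_closed dg(1)[OF D]] unfolding eq by simp
    then show ?thesis using eq f(1) dg(1)[OF D] by auto
  qed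
qed

text \<open>Dividing \<open>z\<close> by \<open>h D\<close> leaves a fraction of neutral degree,
  which is \<open>em x\<close> for a function \<open>x\<close>. For \<open>Y\<close> in
  \<open>U\<close> its order is controlled by a representation of \<open>z\<close> with denominator
  outside \<open>Y\<close>, hence of order 0 there.\<close>

lemma reg_sc:
  assumes U: "openin (Spec A) U" "U \<noteq> {}" and D: "D \<in> A.W" and z: "z \<in> reg (G (dg D)) U"
  obtains x where "x \<in> A.Gam U D" "z = sc D x"
proof (cases "z = \<zero>\<^bsub>FR\<^esub>")
  case True
  then show thesis using that[OF A.Gam_zero] sc_zero[OF D] by simp
next
  case False
  have loc: "\<exists>a f. a \<in> H \<and> a \<in> G (dg D) \<and> f \<in> carrier A - p \<and> \<phi> f \<in> H \<and> z = fr a (\<phi> f)" if p: "p \<in> U" for p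
  proof -
    obtain a f where h: "a \<in> G (dg D)" "f \<in> carrier A - p" "z = fr a (\<phi> f)" using regD[OF z p] by blast
    note f' = prime_outside[OF A.open_primeideal[OF U(1) p] h(2)]
    have "a \<noteq> \<zero>" using False fr_eq_zero_iff[OF comp_closed[OF h(1) dg(1)[OF D]] f'(3)] h(3) by simp
    then show ?thesis using homogI[OF h(1) dg(1)[OF D]] h f'(3) by blast
  qed
  have "{\<zero>\<^bsub>A\<^esub>} \<in> U" by (rule A.open_generic[OF U])
  then obtain a f where h: "a \<in> H" "a \<in> G (dg D)" "f \<in> carrier A" "\<phi> f \<in> H" "z = fr a (\<phi> f)" using loc by blast
  have zH: "z \<in> HQ" unfolding h(5) by (rule fr_HQ[OF h(1,4)])
  have zD: "z \<in> FG (dg D)" unfolding h(5)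
    using fr_mem_FG_iff[OF homog_closed[OF h(1)] h(4) \<phi>_comp[OF h(3)] K.one_closed dg(1)[OF D]] h(2) dg(1)[OF D] by simp
  obtain u where u: "u \<in> HQ" "z = u \<otimes>\<^bsub>FR\<^esub> local.h D" "\<forall>Y. A.min_prime Y \<longrightarrow> vl Y u = vl Y z - vl Y (local.h D)"
    using HQ_quotient[OF zH h_HQ[OF D]] .
  have "local.h D \<otimes>\<^bsub>FR\<^esub> u = z" using u(1,2) h_HQ[OF D] L.m_comm L.homog_closed by simp
  then have "u \<in> FG (inv\<^bsub>K\<^esub> dg D \<otimes>\<^bsub>K\<^esub> dg D)"
    using L.cofactor_comp[OF dg(2)[OF D] _ dg(1)[OF D] L.homog_closed[OF u(1)] _ dg(1)[OF D]] zD h_HQ[OF D] L.homog_zero by metis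
  then have "u \<in> FG \<one>\<^bsub>K\<^esub>" using dg(1)[OF D] by simp
  then obtain x where x: "x \<in> A.QZ" "u = em x" using em_surj u(1) L.homog_zero by metis
  have zx: "z = sc D x" using u(2) x(2) by (simp add: sc_def)
  have "x \<in> A.Gam U D"
  proof (rule A.GamI)
    show "x \<in> carrier A.FA" using x(1) by blast
    fix Y assume Y: "A.min_prime Y" "Y \<in> U"
    obtain b g where k: "b \<in> H" "g \<in> carrier A - Y" "\<phi> g \<in> H" "z = fr b (\<phi> g)" using loc[OF Y(2)] by blast
    have gZ: "g \<in> A.Z" using prime_outside(1)[OF A.open_primeideal[OF U(1) Y(2)] k(2)] k(2) by blast
    have "A.ord Y g = 0" using A.ord_pos_iff[OF Y(1) gZ] A.ord_nonneg[OF Y(1) gZ] k(2) by auto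
    then have "0 \<le> vl Y z" unfolding k(4) using vl_fr[OF Y(1) k(1,3)] mlt_pe[OF Y(1) gZ] by simp
    then show "0 \<le> A.val Y x + Poly_Mapping.lookup D Y" using sc_HQ(3)[OF D x(1) Y(1)] zx by simp
  qed
  then show thesis using that zx by blast
qed

lemma sc_add:
  assumes "D \<in> A.W" "x \<in> carrier A.FA" "y \<in> carrier A.FA"
  shows "sc D (x \<oplus>\<^bsub>A.FA\<^esub> y) = sc D x \<oplus>\<^bsub>FR\<^esub> sc D y"
  using assms em_closed h_HQ[of D] L.homog_closed by (simp add: sc_def em_ops L.l_distr)

lemma sc_mult:
  assumes "D \<in> A.W" "E \<in> A.W" "x \<in> carrier A.FA" "y \<in> carrier A.FA"
  shows "sc (D + E) (x \<otimes>\<^bsub>A.FA\<^esub> y) = sc D x \<otimes>\<^bsub>FR\<^esub> sc E y"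
proof -
  have c: "em x \<in> carrier FR" "em y \<in> carrier FR" "h D \<in> carrier FR" "h E \<in> carrier FR"
    using assms em_closed h_HQ L.homog_closed by blast+
  have "(em x \<otimes>\<^bsub>FR\<^esub> em y) \<otimes>\<^bsub>FR\<^esub> (h D \<otimes>\<^bsub>FR\<^esub> h E) = (em x \<otimes>\<^bsub>FR\<^esub> h D) \<otimes>\<^bsub>FR\<^esub> (em y \<otimes>\<^bsub>FR\<^esub> h E)"
    using c by (simp add: L.m_ac)
  then show ?thesis unfolding sc_def em_ops(1)[OF assms(3,4)] h_add[OF assms(1,2)] .
qed

lemma sc_one: "sc 0 \<one>\<^bsub>A.FA\<^esub> = \<one>\<^bsub>FR\<^esub>"
proof -
  have "h 0 \<otimes>\<^bsub>FR\<^esub> h 0 = h 0 \<otimes>\<^bsub>FR\<^esub> \<one>\<^bsub>FR\<^esub>" using h_add[OF A.W_zero A.W_zero] h_HQ[OF A.W_zero] L.homog_closed by simp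
  then have "h 0 = \<one>\<^bsub>FR\<^esub>" using L.homog_cancel[OF h_HQ[OF A.W_zero]] h_HQ[OF A.W_zero] L.homog_closed by blast
  then show ?thesis by (simp add: sc_def em_one)
qed

lemma sc_inj:
  assumes D: "D \<in> A.W" and x: "x \<in> carrier A.FA" "y \<in> carrier A.FA" "sc D x = sc D y"
  shows "x = y"
proof -
  have c: "em x \<in> carrier FR" "em y \<in> carrier FR" "h D \<in> carrier FR" using em_closed x h_HQ[OF D] L.homog_closed by auto
  have "h D \<otimes>\<^bsub>FR\<^esub> em x = h D \<otimes>\<^bsub>FR\<^esub> em y" using x(3) c by (simp add: sc_def L.m_comm)
  then show ?thesis using L.homog_cancel[OF h_HQ[OF D] c(1,2)] em_inj x by blast
qed

text \<open>\<open>M\<close> sends a function \<open>x\<close> to the section of \<open>F\<close>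
  that corresponds to the germs of \<open>sc D x\<close>. As \<open>\<psi>\<close> is injective on
  sections, the laws for \<open>M\<close> reduce to those for \<open>sc\<close>.\<close>

theorem cox_if_iso:
  assumes F: "graded_sheaf K (Spec A) F" and iso: "graded_sheaf_iso K K (Spec A) F AS id \<psi>"
  shows "\<exists>M. cox A V K F dg M"
proof -
  define t where "t = (\<lambda>U D x. sect U (sc D x))"
  define M where "M = (\<lambda>U D x. inv_into (carrier (sec F U)) (\<psi> U) (t U D x))"
  note d = graded_sheaf_isoD[OF iso]
  note bij = d(3) and comp = d(4)[unfolded id_apply]
    and \<psi>_hom = graded_sheaf_homD(2)[OF d(1)] and \<psi>_res = graded_sheaf_homD(4)[OF d(1)]
  have sub: "G w \<subseteq> carrier R" if "w \<in> carrier K" for w using comp_closed that by blast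
  have treg: "sc D x \<in> reg (carrier R) U" if "openin (Spec A) U" "D \<in> A.W" "x \<in> A.Gam U D" for U D x
    using reg_mono[OF sc_reg[OF that] sub[OF dg(1)[OF that(2)]] order_refl] .
  have tc: "t U D x \<in> carrier (sec AS U)" "t U D x \<in> hcomp AS U (dg D)"
    if U: "openin (Spec A) U" "U \<noteq> {}" and D: "D \<in> A.W" and x: "x \<in> A.Gam U D" for U D x
    unfolding t_def AS_simps assoc_sections_eq[OF U order_refl] assoc_sections_eq[OF U sub[OF dg(1)[OF D]]]
    using treg[OF U(1) D x] sc_reg[OF U(1) D x] by blast+
  have M: "M U D x \<in> carrier (sec F U)" "\<psi> U (M U D x) = t U D x"
    if U: "openin (Spec A) U" "U \<noteq> {}" and D: "D \<in> A.W" and x: "x \<in> A.Gam U D" for U D x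
  proof -
    have "t U D x \<in> \<psi> U ` carrier (sec F U)" using tc(1)[OF that] bij[OF U(1)] by (simp add: bij_betw_def)
    then show "M U D x \<in> carrier (sec F U)" "\<psi> U (M U D x) = t U D x"
      unfolding M_def by (auto intro: inv_into_into f_inv_into_f)
  qed
  have inj: "s = s'" if "openin (Spec A) U" "s \<in> carrier (sec F U)" "s' \<in> carrier (sec F U)" "\<psi> U s = \<psi> U s'" for U s s'
    using bij[OF that(1)] that(2-4) by (meson bij_betw_def inj_onD)
  have gr: "graded K (sec F U) (hcomp F U)" if "openin (Spec A) U" for U
    using graded_sheafD(1)[OF F that] by (simp add: graded_def)
  have Fc: "hcomp F U w \<subseteq> carrier (sec F U)" if "openin (Spec A) U" "w \<in> carrier K" for U w
    using graded.comp_closed[OF gr[OF that(1)] _ that(2)] by blast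
  have Mbij: "bij_betw (M U D) (A.Gam U D) (hcomp F U (dg D))"
    if U: "openin (Spec A) U" "U \<noteq> {}" and D: "D \<in> A.W" for U D
  proof (rule bij_betwI')
    fix x y assume x: "x \<in> A.Gam U D" and y: "y \<in> A.Gam U D"
    show "M U D x = M U D y \<longleftrightarrow> x = y"
    proof
      assume "M U D x = M U D y"
      then have "sect U (sc D x) = sect U (sc D y)" using M(2)[OF U D x] M(2)[OF U D y] by (simp add: t_def)
      then have "sc D x = sc D y" by (rule sect_inj[OF U treg[OF U(1) D x] treg[OF U(1) D y]])
      then show "x = y" by (rule sc_inj[OF D A.Gam_closed[OF x] A.Gam_closed[OF y]])
    qed simp
  next
    fix x assume x: "x \<in> A.Gam U D"
    have "t U D x \<in> \<psi> U ` hcomp F U (dg D)" using tc(2)[OF U D x] comp[OF U(1) dg(1)[OF D]] by simp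
    then obtain s where s: "s \<in> hcomp F U (dg D)" "t U D x = \<psi> U s" by blast
    then have "M U D x = s" using inj[OF U(1) M(1)[OF U D x], of s] M(2)[OF U D x] Fc[OF U(1) dg(1)[OF D]] by auto
    then show "M U D x \<in> hcomp F U (dg D)" using s(1) by simp
  next
    fix s assume s: "s \<in> hcomp F U (dg D)"
    then have "\<psi> U s \<in> hcomp AS U (dg D)" using comp[OF U(1) dg(1)[OF D]] by blast
    then have "\<psi> U s \<in> sect U ` reg (G (dg D)) U" unfolding AS_simps assoc_sections_eq[OF U sub[OF dg(1)[OF D]]] .
    then obtain z where z: "z \<in> reg (G (dg D)) U" "\<psi> U s = sect U z" by blast
    obtain x where x: "x \<in> A.Gam U D" "z = sc D x" using reg_sc[OF U D z(1)] .
    have "M U D x = s" using inj[OF U(1) M(1)[OF U D x(1)], of s] M(2)[OF U D x(1)] Fc[OF U(1) dg(1)[OF D]] s z(2) x(2) by (auto simp: t_def)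
    then show "\<exists>x\<in>A.Gam U D. s = M U D x" using x(1) by blast
  qed
  have Madd: "M U D (x \<oplus>\<^bsub>A.FA\<^esub> y) = M U D x \<oplus>\<^bsub>sec F U\<^esub> M U D y"
    if U: "openin (Spec A) U" "U \<noteq> {}" and D: "D \<in> A.W" and x: "x \<in> A.Gam U D" and y: "y \<in> A.Gam U D" for U D x y
  proof (rule inj[OF U(1)])
    interpret FU: graded K "sec F U" "hcomp F U" by (rule gr[OF U(1)])
    show "M U D (x \<oplus>\<^bsub>A.FA\<^esub> y) \<in> carrier (sec F U)" by (rule M(1)[OF U D A.Gam_add[OF x y]])
    show "M U D x \<oplus>\<^bsub>sec F U\<^esub> M U D y \<in> carrier (sec F U)" using M(1)[OF U D x] M(1)[OF U D y] by simp
    show "\<psi> U (M U D (x \<oplus>\<^bsub>A.FA\<^esub> y)) = \<psi> U (M U D x \<oplus>\<^bsub>sec F U\<^esub> M U D y)"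
      unfolding M(2)[OF U D A.Gam_add[OF x y]] ring_hom_add[OF \<psi>_hom[OF U(1)] M(1)[OF U D x] M(1)[OF U D y]]
        M(2)[OF U D x] M(2)[OF U D y] t_def reg_ops(4)[OF U(1) treg[OF U(1) D x] treg[OF U(1) D y]]
        sc_add[OF D A.Gam_closed[OF x] A.Gam_closed[OF y]] ..
  qed
  have Mmult: "M U (D + E) (x \<otimes>\<^bsub>A.FA\<^esub> y) = M U D x \<otimes>\<^bsub>sec F U\<^esub> M U E y"
    if U: "openin (Spec A) U" "U \<noteq> {}" and D: "D \<in> A.W" and E: "E \<in> A.W" and x: "x \<in> A.Gam U D" and y: "y \<in> A.Gam U E" for U D E x y
  proof (rule inj[OF U(1)])
    interpret FU: graded K "sec F U" "hcomp F U" by (rule gr[OF U(1)])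
    show "M U (D + E) (x \<otimes>\<^bsub>A.FA\<^esub> y) \<in> carrier (sec F U)" by (rule M(1)[OF U A.W_add[OF D E] A.Gam_mult[OF x y]])
    show "M U D x \<otimes>\<^bsub>sec F U\<^esub> M U E y \<in> carrier (sec F U)" using M(1)[OF U D x] M(1)[OF U E y] by simp
    show "\<psi> U (M U (D + E) (x \<otimes>\<^bsub>A.FA\<^esub> y)) = \<psi> U (M U D x \<otimes>\<^bsub>sec F U\<^esub> M U E y)"
      unfolding M(2)[OF U A.W_add[OF D E] A.Gam_mult[OF x y]] ring_hom_mult[OF \<psi>_hom[OF U(1)] M(1)[OF U D x] M(1)[OF U E y]]
        M(2)[OF U D x] M(2)[OF U E y] t_def reg_ops(3)[OF U(1) treg[OF U(1) D x] treg[OF U(1) E y]]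
        sc_mult[OF D E A.Gam_closed[OF x] A.Gam_closed[OF y]] ..
  qed
  have Mone: "M U 0 \<one>\<^bsub>A.FA\<^esub> = \<one>\<^bsub>sec F U\<^esub>" if U: "openin (Spec A) U" "U \<noteq> {}" for U
  proof (rule inj[OF U(1)])
    interpret FU: graded K "sec F U" "hcomp F U" by (rule gr[OF U(1)])
    have o: "\<one>\<^bsub>A.FA\<^esub> \<in> A.Gam U 0"
      using A.one_QZ A.val_one by (intro A.GamI) auto
    show "M U 0 \<one>\<^bsub>A.FA\<^esub> \<in> carrier (sec F U)" by (rule M(1)[OF U A.W_zero o])
    show "\<one>\<^bsub>sec F U\<^esub> \<in> carrier (sec F U)" by simp
    show "\<psi> U (M U 0 \<one>\<^bsub>A.FA\<^esub>) = \<psi> U \<one>\<^bsub>sec F U\<^esub>"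
      unfolding M(2)[OF U A.W_zero o] ring_hom_one[OF \<psi>_hom[OF U(1)]] t_def sc_one sect_one(1)[OF U(1)] ..
  qed
  have Mres: "res F U U' (M U D x) = M U' D x"
    if U: "openin (Spec A) U" "U \<noteq> {}" and U': "openin (Spec A) U'" "U' \<noteq> {}" "U' \<subseteq> U"
      and D: "D \<in> A.W" and x: "x \<in> A.Gam U D" for U U' D x
  proof (rule inj[OF U'(1)])
    note x' = A.Gam_mono[OF x U'(3)]
    show "res F U U' (M U D x) \<in> carrier (sec F U')"
      by (rule ring_hom_closed[OF graded_sheafD(2)[OF F U(1) U'(1,3)] M(1)[OF U D x]])
    show "M U' D x \<in> carrier (sec F U')" by (rule M(1)[OF U'(1,2) D x'])
    show "\<psi> U' (res F U U' (M U D x)) = \<psi> U' (M U' D x)"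
      unfolding \<psi>_res[OF U(1) U'(1,3) M(1)[OF U D x]] M(2)[OF U D x] M(2)[OF U'(1,2) D x'] AS_simps t_def
        restrict_sect[OF U'(3)] ..
  qed
  have "cox A V K F dg M"
    by (intro cox.intro cox_axioms.intro;
        fact A.weighted_domain_axioms K.comm_group_axioms F dg dg_add dg_surj dg_trivial_iff Mbij Madd Mmult Mone Mres)
  then show ?thesis by blast
qed

end

text \<open>That \<open>R\<^sub>0\<close> is the ring of global functions is expressed by
  bijectivity of the structure map \<open>\<phi>\<close> onto the component of neutral degree. The
  algebra may be sought on the type of sections of \<open>F\<close>, since for a Cox sheaf it is the
  ring of global sections. The last conjunct is the addition to (i) that \<open>R\<close> is a
  graded Krull ring.\<close>

theorem corollary3:
  fixes A :: "'a ring" and K :: "'k monoid"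
    and F :: "('a set, 's, 'k) graded_presheaf"
  assumes "Krull_ring A" and "comm_group K" and "graded_sheaf K (Spec A) F"
  shows "(Cox_sheaf A K F \<longleftrightarrow>
      (\<exists>(R :: 's ring) G \<phi>.
         graded_algebra A K R G \<phi> \<and>
         (\<exists>\<psi>. graded_sheaf_iso K K (Spec A) F (assoc_sheaf A R G \<phi>) id \<psi>) \<and>
         graded_factorial K R G \<and>
         homog_units K R G = Units (degree_zero_ring K R G) \<and>
         bij_betw \<phi> (carrier A) (G \<one>\<^bsub>K\<^esub>) \<and>
         degree_zero_frac K R G ` carrier (fraction_field (degree_zero_ring K R G))
           = frac_grading K R G \<one>\<^bsub>K\<^esub> \<and>
         degrees K (frac_ring K R G) (frac_grading K R G) = carrier K \<and>
         bij_betw (restrict_valuation K R G)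
           (essential_valuations K R G)
           (essential_valuations zero_group (degree_zero_ring K R G)
              (trivial_grading (degree_zero_ring K R G))))) \<and>
    (\<forall>(R :: 's ring) G. graded_factorial K R G \<longrightarrow> graded_Krull K R G)"
  (is "(_ \<longleftrightarrow> ?R) \<and> _")
proof (intro conjI iffI allI impI)
  obtain V where V: "weighted_domain A V" using Krull_ring_imp_weighted_domain[OF assms(1)] by blast
  interpret A: weighted_domain A V by (rule V)
  show ?R if cs: "Cox_sheaf A K F"
  proof -
    obtain \<delta> M where "cox A V K F \<delta> M" using A.Cox_sheaf_imp_cox[OF assms(2,3) cs] by blast
    then interpret C: cox A V K F \<delta> M .
    show ?thesis
      using C.graded_algebra_RX C.sheaf_iso_assoc C.graded_factorial_RX C.units_RX C.emb_bij
        C.degree_zero_RX C.degrees_RX C.bij_restrict_RX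
      by (intro exI[of _ C.RX] exI[of _ C.GX] exI[of _ C.emb]) blast
  qed
  show "Cox_sheaf A K F" if h: ?R
  proof -
    obtain R :: "'s ring" and G \<phi> \<psi> where
      alg: "graded_algebra A K R G \<phi>" and iso: "graded_sheaf_iso K K (Spec A) F (assoc_sheaf A R G \<phi>) id \<psi>"
      and fac: "graded_factorial K R G" and units: "homog_units K R G = Units (degree_zero_ring K R G)"
      and bij: "bij_betw \<phi> (carrier A) (G \<one>\<^bsub>K\<^esub>)"
      and fracs: "degree_zero_frac K R G ` carrier (fraction_field (degree_zero_ring K R G)) = frac_grading K R G \<one>\<^bsub>K\<^esub>"
      and degs: "degrees K (frac_ring K R G) (frac_grading K R G) = carrier K"
      and vals: "bij_betw (restrict_valuation K R G) (essential_valuations K R G)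
           (essential_valuations zero_group (degree_zero_ring K R G) (trivial_grading (degree_zero_ring K R G)))"
      using h by (elim exE conjE)
    have dom: "graded_domain K R G" using fac by (simp add: graded_domain_def graded_factorial_def)
    interpret C: cox_alg A V K R G \<phi>
    proof (intro cox_alg.intro graded_alg_iso.intro graded_alg.intro graded_ufd.intro V dom
        graded_alg_axioms.intro graded_alg_iso_axioms.intro graded_ufd_axioms.intro cox_alg_axioms.intro
        fac units bij fracs degs vals)
      show "\<phi> \<in> ring_hom A R" "\<phi> ` carrier A \<subseteq> G \<one>\<^bsub>K\<^esub>" using alg by (simp_all add: graded_algebra_def)
      show "inj_on \<phi> (carrier A)" using bij by (rule bij_betw_imp_inj_on)
    qed
    obtain M where "cox A V K F C.dg M" using C.cox_if_iso[OF assms(3) iso] by blast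
    then interpret X: cox A V K F C.dg M .
    show ?thesis by (rule X.Cox_sheaf)
  qed
  fix R :: "'s ring" and G assume fac: "graded_factorial K R G"
  have dom: "graded_domain K R G" using fac by (simp add: graded_domain_def graded_factorial_def)
  interpret graded_ufd K R G by (intro graded_ufd.intro dom graded_ufd_axioms.intro fac)
  show "graded_Krull K R G" by (rule graded_Krull)
qed

end
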